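(* Let $p$ be a prime and $n\ge1$. There is an isomorphism $\mathrm{Spec}(\mathbf{Z}/p^n)^{\not{D}}\cong\mathbf{G}_a^\sharp\times\mathrm{Spec}(\mathbf{Z}/p^n)$ of $\mathbf{Z}/p^n$-schemes. In particular, the scaling action of $\mathbf{G}_m^\sharp$ on $\mathbf{G}_a^\sharp$ over $\mathbf{Z}/p^n$ gives an isomorphism $\mathrm{WCart}^{\mathrm{HT}}_{\mathbf{Z}/p^n}\cong\mathbf{G}_a^\sharp/\mathbf{G}_m^\sharp$ of $\mathbf{Z}/p^n$-stacks.
   Context: $W$ is the ring scheme of $p$-typical Witt vectors, with Frobenius $F$ and Verschiebung $V$. $\mathbf{G}_a^\sharp$ is the PD-completion (divided power hull) of $\mathbf{G}_a$ at the origin, and $\mathbf{G}_m^\sharp$ that of $\mathbf{G}_m$ at $1$; $\mathbf{G}_a^\sharp\cong W[F]$ and $\mathbf{G}_m^\sharp\cong W^\times[F]$. For a bounded $p$-adic formal scheme $X$, the diffracted Hodge stack $X^{\not{D}}$ (Bhatt--Lurie) is the functor on $p$-nilpotent rings $R$ given by $X^{\not{D}}(R)=X(W(R)/V(1))$, where $W(R)/V(1)$ is the animated (derived) quotient ring; e.g. $\mathrm{Spec}(\mathbf{Z}/p^n)^{\not{D}}(R)=\mathrm{Map}_{\mathrm{CAlg}}(\mathbf{Z}/p^n,W(R)/V(1))$ (maps of animated rings). It carries an action of $\mathbf{G}_m^\sharp=W^\times[F]$, and $\mathrm{WCart}^{\mathrm{HT}}_X=X^{\not{D}}/\mathbf{G}_m^\sharp$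 is the Hodge--Tate stack of $X$ (for $X=\mathrm{Spec}(\mathbf{Z}/p^n)$ written $\mathrm{WCart}^{\mathrm{HT}}_{\mathbf{Z}/p^n}$).
   Formalization: For n=1 the claim with the linear scaling action is false (the Hodge–Tate stack is Spec F_p, but 0 in G_a^# has stabilizer G_m^#); there the action u·a = ua + (u−1) is used instead. For n≥2 the scaling action is as stated. *)

theory Defs
  imports
    "HOL-Number_Theory.Residues"
    "HOL-Algebra.Ideal"
    "HOL-Library.Poly_Mapping"
begin

section \<open>Rings and integral polynomials\<close>

text \<open>
  Rings are records of \<open>HOL-Algebra\<close>; functors are defined on the category of rings whose carrier
  lies in an arbitrary type \<open>'u\<close>, which plays the role of a universe.  Morphisms are extensional, so
  that equality of morphisms is equality on the carrier.
\<close>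

definition rhom :: "'a ring \<Rightarrow> 'b ring \<Rightarrow> ('a \<Rightarrow> 'b) set" where
  "rhom R S = ring_hom R S \<inter> extensional (carrier R)"

definition p_nilpotent_ring :: "nat \<Rightarrow> 'u ring \<Rightarrow> bool" where
  "p_nilpotent_ring p R \<longleftrightarrow> cring R \<and> (\<exists>k::nat. [(p ^ k)] \<cdot>\<^bsub>R\<^esub> \<one>\<^bsub>R\<^esub> = \<zero>\<^bsub>R\<^esub>)"

type_synonym 'v zpoly = "('v \<Rightarrow>\<^sub>0 nat) \<Rightarrow>\<^sub>0 int"

definition zvar :: "'v \<Rightarrow> 'v zpoly" where
  "zvar v = Poly_Mapping.single (Poly_Mapping.single v 1) 1"

definition zeval :: "'a ring \<Rightarrow> ('v \<Rightarrow> 'a) \<Rightarrow> 'v zpoly \<Rightarrow> 'a" where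
  "zeval R \<rho> q =
     (\<Oplus>\<^bsub>R\<^esub> m \<in> Poly_Mapping.keys q.
        [Poly_Mapping.lookup q m] \<cdot>\<^bsub>R\<^esub>
          (\<Otimes>\<^bsub>R\<^esub> v \<in> Poly_Mapping.keys m. \<rho> v [^]\<^bsub>R\<^esub> Poly_Mapping.lookup m v))"

definition polynomial_ring_on :: "'a ring \<Rightarrow> 'a set \<Rightarrow> bool" where
  "polynomial_ring_on R X \<longleftrightarrow>
     X \<subseteq> carrier R \<and>
     bij_betw (zeval R (\<lambda>x. x))
       {q. \<forall>m \<in> Poly_Mapping.keys q. Poly_Mapping.keys m \<subseteq> X} (carrier R)"


section \<open>Witt vectors\<close>

definition ghost :: "nat \<Rightarrow> nat \<Rightarrow> (nat \<Rightarrow> 'a::comm_ring_1) \<Rightarrow> 'a" where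
  "ghost p k x = (\<Sum>i\<le>k. of_nat (p ^ i) * x i ^ (p ^ (k - i)))"

text \<open>Witt's universal polynomials: the unique integral ones with the prescribed ghost components.\<close>

definition witt_sum :: "nat \<Rightarrow> nat \<Rightarrow> (nat + nat) zpoly" where
  "witt_sum p = (THE s. \<forall>k. ghost p k s =
      ghost p k (\<lambda>i. zvar (Inl i)) + ghost p k (\<lambda>i. zvar (Inr i)))"

definition witt_prod :: "nat \<Rightarrow> nat \<Rightarrow> (nat + nat) zpoly" where
  "witt_prod p = (THE s. \<forall>k. ghost p k s =
      ghost p k (\<lambda>i. zvar (Inl i)) * ghost p k (\<lambda>i. zvar (Inr i)))"

definition witt_frob :: "nat \<Rightarrow> nat \<Rightarrow> nat zpoly" where
  "witt_frob p = (THE s. \<forall>k. ghost p k s = ghost p (Suc k) zvar)"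

definition witt_ring :: "nat \<Rightarrow> 'u ring \<Rightarrow> (nat \<Rightarrow> 'u) ring" where
  "witt_ring p R =
     \<lparr>carrier = {a. \<forall>i. a i \<in> carrier R},
      monoid.mult = (\<lambda>a b k. zeval R (case_sum a b) (witt_prod p k)),
      one = (\<lambda>k. if k = 0 then \<one>\<^bsub>R\<^esub> else \<zero>\<^bsub>R\<^esub>),
      zero = (\<lambda>k. \<zero>\<^bsub>R\<^esub>),
      add = (\<lambda>a b k. zeval R (case_sum a b) (witt_sum p k))\<rparr>"

definition frobenius :: "nat \<Rightarrow> 'u ring \<Rightarrow> (nat \<Rightarrow> 'u) \<Rightarrow> (nat \<Rightarrow> 'u)" where
  "frobenius p R a = (\<lambda>k. zeval R a (witt_frob p k))"

definition verschiebung :: "'u ring \<Rightarrow> (nat \<Rightarrow> 'u) \<Rightarrow> (nat \<Rightarrow> 'u)" where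
  "verschiebung R a = case_nat \<zero>\<^bsub>R\<^esub> a"


section \<open>Simplicial sets and simplicial commutative rings\<close>

text \<open>Monotone maps from \<open>{0..m}\<close> to \<open>{0..k}\<close>, i.e. the \<open>m\<close>-simplices of the standard \<open>k\<close>-simplex.\<close>

definition Dmaps :: "nat \<Rightarrow> nat \<Rightarrow> (nat \<Rightarrow> nat) set" where
  "Dmaps m k = {\<theta> \<in> {..m} \<rightarrow>\<^sub>E {..k}. mono_on {..m} \<theta>}"

definition Did :: "nat \<Rightarrow> (nat \<Rightarrow> nat)" where
  "Did m = (\<lambda>i\<in>{..m}. i)"

definition coface :: "nat \<Rightarrow> nat \<Rightarrow> (nat \<Rightarrow> nat)" where
  "coface k i = (\<lambda>j\<in>{..k}. if j < i then j else Suc j)"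

text \<open>For \<open>\<theta> \<in> Dmaps m k\<close>, the operator \<open>sop X m k \<theta>\<close> goes from level \<open>k\<close> to level \<open>m\<close>.\<close>

record 'a sset =
  cells :: "nat \<Rightarrow> 'a set"
  sop :: "nat \<Rightarrow> nat \<Rightarrow> (nat \<Rightarrow> nat) \<Rightarrow> 'a \<Rightarrow> 'a"

record 'a sring =
  lev :: "nat \<Rightarrow> 'a ring"
  rop :: "nat \<Rightarrow> nat \<Rightarrow> (nat \<Rightarrow> nat) \<Rightarrow> 'a \<Rightarrow> 'a"

definition underlying :: "'a sring \<Rightarrow> 'a sset" where
  "underlying B = \<lparr>cells = (\<lambda>k. carrier (lev B k)), sop = rop B\<rparr>"

definition simplicial_cring :: "'a sring \<Rightarrow> bool" where
  "simplicial_cring B \<longleftrightarrow>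
     (\<forall>k. cring (lev B k)) \<and>
     (\<forall>m k. \<forall>\<theta> \<in> Dmaps m k. rop B m k \<theta> \<in> ring_hom (lev B k) (lev B m)) \<and>
     (\<forall>k. \<forall>x \<in> carrier (lev B k). rop B k k (Did k) x = x) \<and>
     (\<forall>l m k. \<forall>\<theta> \<in> Dmaps l m. \<forall>\<sigma> \<in> Dmaps m k. \<forall>x \<in> carrier (lev B k).
        rop B l k (compose {..l} \<sigma> \<theta>) x = rop B l m \<theta> (rop B m k \<sigma> x))"

definition sface :: "'a sset \<Rightarrow> nat \<Rightarrow> nat \<Rightarrow> 'a \<Rightarrow> 'a" where
  "sface K k i = sop K k (Suc k) (coface k i)"

text \<open>
  A map from a simplicial set \<open>K\<close> to a discrete one \<open>T\<close> (given on vertices) with the right lifting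
  property against all boundary inclusions.  For \<open>K\<close> a Kan complex (all uses below: simplicial rings
  and mapping spaces of them) every map to a discrete set is a Kan fibration, so this says exactly that
  the map is a weak equivalence.
\<close>

definition discrete_equiv :: "'a sset \<Rightarrow> 'b set \<Rightarrow> ('a \<Rightarrow> 'b) \<Rightarrow> bool" where
  "discrete_equiv K T \<phi> \<longleftrightarrow>
     (\<forall>x \<in> cells K 0. \<phi> x \<in> T) \<and>
     (\<forall>e \<in> cells K 1. \<phi> (sface K 0 0 e) = \<phi> (sface K 0 1 e)) \<and>
     (\<forall>t \<in> T. \<exists>x \<in> cells K 0. \<phi> x = t) \<and>
     (\<forall>x \<in> cells K 0. \<forall>y \<in> cells K 0. \<phi> x = \<phi> y \<longrightarrow>
        (\<exists>e \<in> cells K 1. sface K 0 1 e = x \<and> sface K 0 0 e = y)) \<and>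
     (\<forall>k y. (\<forall>i \<le> Suc (Suc k). y i \<in> cells K (Suc k)) \<and>
            (\<forall>i j. i < j \<and> j \<le> Suc (Suc k) \<longrightarrow>
                sface K k i (y j) = sface K k (j - 1) (y i)) \<longrightarrow>
        (\<exists>z \<in> cells K (Suc (Suc k)). \<forall>i \<le> Suc (Suc k). sface K (Suc k) i z = y i))"

definition pi0_class :: "'a sset \<Rightarrow> 'a \<Rightarrow> 'a set" where
  "pi0_class K x =
     {y. (x, y) \<in> ((\<lambda>e. (sface K 0 1 e, sface K 0 0 e)) ` cells K 1 \<union>
                    (\<lambda>e. (sface K 0 0 e, sface K 0 1 e)) ` cells K 1)\<^sup>*}"

definition pi0 :: "'a sset \<Rightarrow> 'a set set" where
  "pi0 K = pi0_class K ` cells K 0"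

text \<open>
  Free simplicial commutative resolutions of a discrete ring: free in Quillen's sense
  (levelwise polynomial on generators stable under degeneracies), hence cofibrant, with an augmentation
  that is a weak equivalence.
\<close>

definition free_sring :: "'a sring \<Rightarrow> bool" where
  "free_sring P \<longleftrightarrow>
     simplicial_cring P \<and>
     (\<exists>X. (\<forall>k. polynomial_ring_on (lev P k) (X k)) \<and>
          (\<forall>m k. \<forall>\<theta> \<in> Dmaps m k. \<theta> ` {..m} = {..k} \<longrightarrow> rop P m k \<theta> ` X k \<subseteq> X m))"

definition free_resolution :: "'a sring \<Rightarrow> ('a \<Rightarrow> 'b) \<Rightarrow> 'b ring \<Rightarrow> bool" where
  "free_resolution P \<epsilon> A \<longleftrightarrow>
     free_sring P \<and> \<epsilon> \<in> ring_hom (lev P 0) A \<and>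
     discrete_equiv (underlying P) (carrier A) \<epsilon>"

text \<open>
  The simplicial mapping space: its \<open>k\<close>-simplices are the maps of simplicial rings from \<open>P\<close> to the
  cotensor of \<open>B\<close> with the standard \<open>k\<close>-simplex.  All simplicial rings are fibrant, so if \<open>P\<close> is
  a free resolution of a ring \<open>A\<close>, this is the space of maps of animated rings from \<open>A\<close> to \<open>B\<close>.
\<close>

definition mapping_space ::
  "'a sring \<Rightarrow> 'b sring \<Rightarrow> (nat \<Rightarrow> (nat \<Rightarrow> nat) \<Rightarrow> 'a \<Rightarrow> 'b) sset" where
  "mapping_space P B =
     \<lparr>cells = (\<lambda>k. {f.
        (\<forall>m. f m \<in> (\<Pi>\<^sub>E \<sigma> \<in> Dmaps m k. rhom (lev P m) (lev B m))) \<and>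
        (\<forall>l m. \<forall>\<theta> \<in> Dmaps l m. \<forall>\<sigma> \<in> Dmaps m k. \<forall>x \<in> carrier (lev P m).
           f l (compose {..l} \<sigma> \<theta>) (rop P l m \<theta> x) = rop B l m \<theta> (f m \<sigma> x))}),
      sop = (\<lambda>j k \<alpha> f m. \<lambda>\<sigma> \<in> Dmaps m j. f m (compose {..m} \<alpha> \<sigma>))\<rparr>"

text \<open>Postcomposition of vertices of a mapping space with a map \<open>g\<close> of simplicial rings.\<close>

definition postcomp ::
  "'a sring \<Rightarrow> (nat \<Rightarrow> 'b \<Rightarrow> 'c) \<Rightarrow> (nat \<Rightarrow> (nat \<Rightarrow> nat) \<Rightarrow> 'a \<Rightarrow> 'b)
     \<Rightarrow> (nat \<Rightarrow> (nat \<Rightarrow> nat) \<Rightarrow> 'a \<Rightarrow> 'c)" where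
  "postcomp P g f = (\<lambda>m. \<lambda>\<sigma> \<in> Dmaps m 0. \<lambda>x \<in> carrier (lev P m). g m (f m \<sigma> x))"


section \<open>Derived quotients\<close>

text \<open>
  The derived quotient of \<open>A\<close> by an element \<open>t\<close>, as the nerve of the ring groupoid
  with set of objects \<open>A\<close> and arrows \<open>a \<rightarrow> a + t f\<close> for \<open>f \<in> A\<close> (the cone of the
  quasi-ideal \<open>t : A \<rightarrow> A\<close>).  An \<open>m\<close>-simplex \<open>(a, f)\<close> with \<open>f 0 = 0\<close> is the chain with vertices
  \<open>a + t f i\<close> and arrows \<open>f j - f i\<close> from vertex \<open>i\<close> to vertex \<open>j\<close>.
  For \<open>A = \<int>[x]\<close>, \<open>t = x\<close> this is a resolution of \<open>\<int>\<close> that is levelwise free as a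
  \<open>\<int>[x]\<close>-module, and the general case is its base change along \<open>x \<mapsto> t\<close>: it computes the derived
  tensor product of \<open>A\<close> and \<open>\<int>\<close> over \<open>\<int>[x]\<close>, with \<open>x\<close> acting by \<open>t\<close> and \<open>0\<close>.
\<close>

definition derived_quotient_lev :: "'a ring \<Rightarrow> 'a \<Rightarrow> nat \<Rightarrow> ('a \<times> (nat \<Rightarrow> 'a)) ring" where
  "derived_quotient_lev A t m =
     \<lparr>carrier = carrier A \<times> {f \<in> {..m} \<rightarrow>\<^sub>E carrier A. f 0 = \<zero>\<^bsub>A\<^esub>},
      monoid.mult = (\<lambda>(a, f) (b, g).
        (a \<otimes>\<^bsub>A\<^esub> b,
         \<lambda>i\<in>{..m}. a \<otimes>\<^bsub>A\<^esub> g i \<oplus>\<^bsub>A\<^esub> b \<otimes>\<^bsub>A\<^esub> f i \<oplus>\<^bsub>A\<^esub> t \<otimes>\<^bsub>A\<^esub> (f i \<otimes>\<^bsub>A\<^esub> g i))),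
      one = (\<one>\<^bsub>A\<^esub>, \<lambda>i\<in>{..m}. \<zero>\<^bsub>A\<^esub>),
      zero = (\<zero>\<^bsub>A\<^esub>, \<lambda>i\<in>{..m}. \<zero>\<^bsub>A\<^esub>),
      add = (\<lambda>(a, f) (b, g). (a \<oplus>\<^bsub>A\<^esub> b, \<lambda>i\<in>{..m}. f i \<oplus>\<^bsub>A\<^esub> g i))\<rparr>"

definition derived_quotient :: "'a ring \<Rightarrow> 'a \<Rightarrow> ('a \<times> (nat \<Rightarrow> 'a)) sring" where
  "derived_quotient A t =
     \<lparr>lev = derived_quotient_lev A t,
      rop = (\<lambda>m k \<theta> (a, f).
        (a \<oplus>\<^bsub>A\<^esub> t \<otimes>\<^bsub>A\<^esub> f (\<theta> 0), \<lambda>i\<in>{..m}. f (\<theta> i) \<ominus>\<^bsub>A\<^esub> f (\<theta> 0)))\<rparr>"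

definition derived_quotient_map ::
  "('a \<Rightarrow> 'b) \<Rightarrow> nat \<Rightarrow> ('a \<times> (nat \<Rightarrow> 'a)) \<Rightarrow> ('b \<times> (nat \<Rightarrow> 'b))" where
  "derived_quotient_map h m = (\<lambda>(a, f). (h a, \<lambda>i\<in>{..m}. h (f i)))"

text \<open>A unit \<open>u\<close> with \<open>u t = t\<close>, as an automorphism of the quasi-ideal \<open>t : A \<rightarrow> A\<close> over \<open>A\<close>.\<close>

definition derived_quotient_scale ::
  "'a ring \<Rightarrow> 'a \<Rightarrow> nat \<Rightarrow> ('a \<times> (nat \<Rightarrow> 'a)) \<Rightarrow> ('a \<times> (nat \<Rightarrow> 'a))" where
  "derived_quotient_scale A u m = (\<lambda>(a, f). (a, \<lambda>i\<in>{..m}. u \<otimes>\<^bsub>A\<^esub> f i))"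


section \<open>The diffracted Hodge stack\<close>

type_synonym ('u, 'b) diffracted_point =
  "nat \<Rightarrow> (nat \<Rightarrow> nat) \<Rightarrow> 'b \<Rightarrow> (nat \<Rightarrow> 'u) \<times> (nat \<Rightarrow> nat \<Rightarrow> 'u)"

definition witt_mod_V1 :: "nat \<Rightarrow> 'u ring \<Rightarrow> ((nat \<Rightarrow> 'u) \<times> (nat \<Rightarrow> nat \<Rightarrow> 'u)) sring" where
  "witt_mod_V1 p R =
     derived_quotient (witt_ring p R) (verschiebung R \<one>\<^bsub>witt_ring p R\<^esub>)"

text \<open>Here \<open>P\<close> is a free resolution of the ring \<open>A\<close> with \<open>X = Spec A\<close>.\<close>

definition diffracted :: "nat \<Rightarrow> 'b sring \<Rightarrow> 'u ring \<Rightarrow> ('u, 'b) diffracted_point sset" where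
  "diffracted p P R = mapping_space P (witt_mod_V1 p R)"

definition diffracted_map ::
  "'b sring \<Rightarrow> ('u \<Rightarrow> 'u) \<Rightarrow> ('u, 'b) diffracted_point \<Rightarrow> ('u, 'b) diffracted_point" where
  "diffracted_map P h = postcomp P (derived_quotient_map (\<lambda>a. h \<circ> a))"

text \<open>
  The structure map to \<open>Spec A\<close>, induced by \<open>W(R)/V(1) \<rightarrow> W(R)/V W(R) = R\<close> and expressed as a
  relation: the vertex \<open>f\<close> lies over the ring homomorphism \<open>s : A \<rightarrow> R\<close>.
\<close>

definition diffracted_over ::
  "'b sring \<Rightarrow> ('b \<Rightarrow> 'c) \<Rightarrow> 'c ring \<Rightarrow> 'u ring \<Rightarrow> ('u, 'b) diffracted_point
     \<Rightarrow> ('c \<Rightarrow> 'u) \<Rightarrow> bool" where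
  "diffracted_over P \<epsilon> A R f s \<longleftrightarrow>
     s \<in> rhom A R \<and> (\<forall>x \<in> carrier (lev P 0). s (\<epsilon> x) = fst (f 0 (Did 0) x) 0)"


section \<open>Divided power hulls of the additive and the multiplicative group\<close>

text \<open>
  The divided power hull of the additive group at the origin is the spectrum of the divided power
  algebra, with basis \<open>\<gamma>\<^sub>k\<close> and \<open>\<gamma>\<^sub>i \<gamma>\<^sub>j = (i+j choose i) \<gamma>\<^sub>i\<^sub>+\<^sub>j\<close>; so an \<open>R\<close>-point is the
  element \<open>\<gamma> 1\<close> of \<open>R\<close> together with a system of divided powers \<open>\<gamma> k\<close>.
\<close>

definition Ga_sharp :: "'u ring \<Rightarrow> (nat \<Rightarrow> 'u) set" where
  "Ga_sharp R = {\<gamma>. (\<forall>k. \<gamma> k \<in> carrier R) \<and> \<gamma> 0 = \<one>\<^bsub>R\<^esub> \<and>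
     (\<forall>i j. \<gamma> i \<otimes>\<^bsub>R\<^esub> \<gamma> j = [((i + j) choose i)] \<cdot>\<^bsub>R\<^esub> \<gamma> (i + j))}"

text \<open>
  A point of the divided power hull of the multiplicative group at \<open>1\<close> is a unit \<open>u\<close> with
  divided powers \<open>\<gamma> k\<close> of \<open>\<gamma> 1 = u - 1\<close>.
\<close>

definition unit_part :: "'u ring \<Rightarrow> (nat \<Rightarrow> 'u) \<Rightarrow> 'u" where
  "unit_part R \<gamma> = \<one>\<^bsub>R\<^esub> \<oplus>\<^bsub>R\<^esub> \<gamma> 1"

text \<open>The divided powers of \<open>u a + (u - 1)\<close>, for \<open>\<delta>\<close> those of \<open>u - 1\<close> and \<open>\<gamma>\<close> those of \<open>a\<close>.\<close>

definition dp_translated_scaling ::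
  "'u ring \<Rightarrow> (nat \<Rightarrow> 'u) \<Rightarrow> (nat \<Rightarrow> 'u) \<Rightarrow> (nat \<Rightarrow> 'u)" where
  "dp_translated_scaling R \<delta> \<gamma> =
     (\<lambda>k. \<Oplus>\<^bsub>R\<^esub> i \<in> {..k}. unit_part R \<delta> [^]\<^bsub>R\<^esub> i \<otimes>\<^bsub>R\<^esub> \<gamma> i \<otimes>\<^bsub>R\<^esub> \<delta> (k - i))"

text \<open>The divided powers of \<open>u a\<close>.\<close>

definition dp_scaling :: "'u ring \<Rightarrow> (nat \<Rightarrow> 'u) \<Rightarrow> (nat \<Rightarrow> 'u) \<Rightarrow> (nat \<Rightarrow> 'u)" where
  "dp_scaling R \<delta> \<gamma> = (\<lambda>k. unit_part R \<delta> [^]\<^bsub>R\<^esub> k \<otimes>\<^bsub>R\<^esub> \<gamma> k)"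

text \<open>The group law is multiplication of units: \<open>u v - 1 = u (v - 1) + (u - 1)\<close>.\<close>

definition Gm_sharp :: "'u ring \<Rightarrow> (nat \<Rightarrow> 'u) monoid" where
  "Gm_sharp R =
     \<lparr>carrier = {\<gamma> \<in> Ga_sharp R. unit_part R \<gamma> \<in> Units R},
      monoid.mult = dp_translated_scaling R,
      one = (\<lambda>k. if k = 0 then \<one>\<^bsub>R\<^esub> else \<zero>\<^bsub>R\<^esub>)\<rparr>"

definition witt_units_F :: "nat \<Rightarrow> 'u ring \<Rightarrow> (nat \<Rightarrow> 'u) monoid" where
  "witt_units_F p R =
     \<lparr>carrier = {u \<in> Units (witt_ring p R). frobenius p R u = \<one>\<^bsub>witt_ring p R\<^esub>},
      monoid.mult = monoid.mult (witt_ring p R),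
      one = \<one>\<^bsub>witt_ring p R\<^esub>\<rparr>"


section \<open>The flat topology\<close>

text \<open>Flatness of \<open>S\<close> over \<open>R\<close> along \<open>h\<close>, by the equational criterion.\<close>

definition flat_hom :: "'u ring \<Rightarrow> 'u ring \<Rightarrow> ('u \<Rightarrow> 'u) \<Rightarrow> bool" where
  "flat_hom R S h \<longleftrightarrow>
     (\<forall>(n::nat) r s. (\<forall>i<n. r i \<in> carrier R \<and> s i \<in> carrier S) \<and>
         (\<Oplus>\<^bsub>S\<^esub> i \<in> {..<n}. h (r i) \<otimes>\<^bsub>S\<^esub> s i) = \<zero>\<^bsub>S\<^esub> \<longrightarrow>
       (\<exists>(m::nat) c t.
          (\<forall>j<m. t j \<in> carrier S \<and> (\<forall>i<n. c i j \<in> carrier R) \<and>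
                 (\<Oplus>\<^bsub>R\<^esub> i \<in> {..<n}. r i \<otimes>\<^bsub>R\<^esub> c i j) = \<zero>\<^bsub>R\<^esub>) \<and>
          (\<forall>i<n. s i = (\<Oplus>\<^bsub>S\<^esub> j \<in> {..<m}. h (c i j) \<otimes>\<^bsub>S\<^esub> t j))))"

definition fpqc_cover :: "nat \<Rightarrow> 'u ring \<Rightarrow> ('u ring \<times> ('u \<Rightarrow> 'u)) set \<Rightarrow> bool" where
  "fpqc_cover p R C \<longleftrightarrow>
     finite C \<and>
     (\<forall>(S, h) \<in> C. p_nilpotent_ring p S \<and> h \<in> rhom R S \<and> flat_hom R S h) \<and>
     (\<forall>q. primeideal q R \<longrightarrow>
        (\<exists>(S, h) \<in> C. \<exists>Q. primeideal Q S \<and> q = {x \<in> carrier R. h x \<in> Q}))"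


section \<open>Quotient stacks\<close>

text \<open>
  A group-valued functor \<open>grp\<close> acting on a set-valued functor \<open>pts\<close> over \<open>Spec A\<close>, where \<open>'c\<close> is the
  carrier type of \<open>A\<close>; \<open>pover R y s\<close> says that \<open>y\<close> lies over the \<open>R\<close>-point \<open>s\<close> of \<open>Spec A\<close>.
\<close>

record ('u, 'g, 'y, 'c) gspace =
  grp :: "'u ring \<Rightarrow> 'g monoid"
  gmap :: "'u ring \<Rightarrow> 'u ring \<Rightarrow> ('u \<Rightarrow> 'u) \<Rightarrow> 'g \<Rightarrow> 'g"
  pts :: "'u ring \<Rightarrow> 'y set"
  pmap :: "'u ring \<Rightarrow> 'u ring \<Rightarrow> ('u \<Rightarrow> 'u) \<Rightarrow> 'y \<Rightarrow> 'y"
  pact :: "'u ring \<Rightarrow> 'g \<Rightarrow> 'y \<Rightarrow> 'y"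
  pover :: "'u ring \<Rightarrow> 'y \<Rightarrow> ('c \<Rightarrow> 'u) \<Rightarrow> bool"

text \<open>
  An object of the quotient stack over \<open>R\<close>: a functor \<open>tob\<close> on \<open>R\<close>-algebras \<open>(S, h)\<close>, with an action
  \<open>tact\<close> and a map \<open>tpt\<close> to \<open>pts\<close>.  For \<open>k : S \<rightarrow> S'\<close>, \<open>tmap S h S' k\<close> goes from \<open>(S, h)\<close> to
  \<open>(S', k \<circ> h)\<close>.
\<close>

record ('u, 'g, 'y, 't) qobj =
  tob :: "'u ring \<Rightarrow> ('u \<Rightarrow> 'u) \<Rightarrow> 't set"
  tmap :: "'u ring \<Rightarrow> ('u \<Rightarrow> 'u) \<Rightarrow> 'u ring \<Rightarrow> ('u \<Rightarrow> 'u) \<Rightarrow> 't \<Rightarrow> 't"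
  tact :: "'u ring \<Rightarrow> ('u \<Rightarrow> 'u) \<Rightarrow> 'g \<Rightarrow> 't \<Rightarrow> 't"
  tpt :: "'u ring \<Rightarrow> ('u \<Rightarrow> 'u) \<Rightarrow> 't \<Rightarrow> 'y"

definition algebras :: "nat \<Rightarrow> 'u ring \<Rightarrow> ('u ring \<times> ('u \<Rightarrow> 'u)) set" where
  "algebras p R = {(S, h). p_nilpotent_ring p S \<and> h \<in> rhom R S}"

definition is_functor :: "nat \<Rightarrow> 'u ring \<Rightarrow> ('u, 'g, 'y, 't) qobj \<Rightarrow> bool" where
  "is_functor p R T \<longleftrightarrow>
     (\<forall>(S, h) \<in> algebras p R.
        (\<forall>t \<in> tob T S h. tmap T S h S (\<lambda>x\<in>carrier S. x) t = t) \<and>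
        (\<forall>(S', k) \<in> algebras p S. \<forall>t \<in> tob T S h.
           tmap T S h S' k t \<in> tob T S' (compose (carrier R) k h) \<and>
           (\<forall>(S'', l) \<in> algebras p S'.
              tmap T S h S'' (compose (carrier S) l k) t =
              tmap T S' (compose (carrier R) k h) S'' l (tmap T S h S' k t))))"

definition is_sheaf :: "nat \<Rightarrow> 'u ring \<Rightarrow> ('u, 'g, 'y, 't) qobj \<Rightarrow> bool" where
  "is_sheaf p R T \<longleftrightarrow>
     (\<forall>(S, h) \<in> algebras p R. \<forall>C x. fpqc_cover p S C \<and>
        (\<forall>(S', k) \<in> C. x (S', k) \<in> tob T S' (compose (carrier R) k h)) \<and>
        (\<forall>(S1, k1) \<in> C. \<forall>(S2, k2) \<in> C. \<forall>(S3, a) \<in> algebras p S1. \<forall>b \<in> rhom S2 S3.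
           compose (carrier S) a k1 = compose (carrier S) b k2 \<longrightarrow>
           tmap T S1 (compose (carrier R) k1 h) S3 a (x (S1, k1)) =
           tmap T S2 (compose (carrier R) k2 h) S3 b (x (S2, k2))) \<longrightarrow>
        (\<exists>!t. t \<in> tob T S h \<and> (\<forall>(S', k) \<in> C. tmap T S h S' k t = x (S', k))))"

definition is_torsor ::
  "nat \<Rightarrow> ('u, 'g, 'y, 'c) gspace \<Rightarrow> 'u ring \<Rightarrow> ('u, 'g, 'y, 't) qobj \<Rightarrow> bool" where
  "is_torsor p Y R T \<longleftrightarrow>
     is_functor p R T \<and> is_sheaf p R T \<and>
     (\<forall>(S, h) \<in> algebras p R. \<forall>t \<in> tob T S h.
        tact T S h \<one>\<^bsub>grp Y S\<^esub> t = t \<and>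
        (\<forall>g \<in> carrier (grp Y S).
           tact T S h g t \<in> tob T S h \<and>
           (\<forall>g' \<in> carrier (grp Y S).
              tact T S h (g' \<otimes>\<^bsub>grp Y S\<^esub> g) t = tact T S h g' (tact T S h g t)) \<and>
           (\<forall>(S', k) \<in> algebras p S.
              tmap T S h S' k (tact T S h g t) =
              tact T S' (compose (carrier R) k h) (gmap Y S S' k g) (tmap T S h S' k t))) \<and>
        (\<forall>t' \<in> tob T S h. \<exists>!g. g \<in> carrier (grp Y S) \<and> tact T S h g t = t')) \<and>
     (\<forall>(S, h) \<in> algebras p R. \<exists>C. fpqc_cover p S C \<and>
        (\<forall>(S', k) \<in> C. tob T S' (compose (carrier R) k h) \<noteq> {}))"

definition quotient_ob ::
  "nat \<Rightarrow> ('u, 'g, 'y, 'c) gspace \<Rightarrow> 'u ring \<Rightarrow> ('u, 'g, 'y, 't) qobj set" where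
  "quotient_ob p Y R =
     {T. is_torsor p Y R T \<and>
         (\<forall>(S, h) \<in> algebras p R. \<forall>t \<in> tob T S h.
            tpt T S h t \<in> pts Y S \<and>
            (\<forall>g \<in> carrier (grp Y S). tpt T S h (tact T S h g t) = pact Y S g (tpt T S h t)) \<and>
            (\<forall>(S', k) \<in> algebras p S.
               tpt T S' (compose (carrier R) k h) (tmap T S h S' k t) =
               pmap Y S S' k (tpt T S h t)))}"

type_synonym ('u, 't) qmor = "'u ring \<Rightarrow> ('u \<Rightarrow> 'u) \<Rightarrow> 't \<Rightarrow> 't"

definition quotient_hom ::
  "nat \<Rightarrow> ('u, 'g, 'y, 'c) gspace \<Rightarrow> 'u ring \<Rightarrow> ('u, 'g, 'y, 't) qobj
     \<Rightarrow> ('u, 'g, 'y, 't) qobj \<Rightarrow> ('u, 't) qmor set" where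
  "quotient_hom p Y R T T' =
     {\<phi>. (\<forall>S h. (S, h) \<notin> algebras p R \<longrightarrow> \<phi> S h = undefined) \<and>
         (\<forall>(S, h) \<in> algebras p R.
            \<phi> S h \<in> tob T S h \<rightarrow>\<^sub>E tob T' S h \<and>
            (\<forall>t \<in> tob T S h.
               tpt T' S h (\<phi> S h t) = tpt T S h t \<and>
               (\<forall>g \<in> carrier (grp Y S). \<phi> S h (tact T S h g t) = tact T' S h g (\<phi> S h t)) \<and>
               (\<forall>(S', k) \<in> algebras p S.
                  \<phi> S' (compose (carrier R) k h) (tmap T S h S' k t) =
                  tmap T' S h S' k (\<phi> S h t))))}"

text \<open>
  A presheaf of groupoids over \<open>Spec A\<close>; \<open>spull R R' g\<close> and \<open>spullm R R' g\<close> are base change of objects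
  and morphisms along \<open>g : R \<rightarrow> R'\<close>.
\<close>

record ('u, 'o, 'm, 'c) stack =
  sob :: "'u ring \<Rightarrow> 'o set"
  shom :: "'u ring \<Rightarrow> 'o \<Rightarrow> 'o \<Rightarrow> 'm set"
  sid :: "'u ring \<Rightarrow> 'o \<Rightarrow> 'm"
  scomp :: "'u ring \<Rightarrow> 'o \<Rightarrow> 'o \<Rightarrow> 'o \<Rightarrow> 'm \<Rightarrow> 'm \<Rightarrow> 'm"
  spull :: "'u ring \<Rightarrow> 'u ring \<Rightarrow> ('u \<Rightarrow> 'u) \<Rightarrow> 'o \<Rightarrow> 'o"
  spullm :: "'u ring \<Rightarrow> 'u ring \<Rightarrow> ('u \<Rightarrow> 'u) \<Rightarrow> 'm \<Rightarrow> 'm"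
  sover :: "'u ring \<Rightarrow> 'o \<Rightarrow> ('c \<Rightarrow> 'u) \<Rightarrow> bool"

definition quotient_stack ::
  "nat \<Rightarrow> 'c ring \<Rightarrow> ('u, 'g, 'y, 'c) gspace
     \<Rightarrow> ('u, ('u, 'g, 'y, 't) qobj, ('u, 't) qmor, 'c) stack" where
  "quotient_stack p A Y =
     \<lparr>sob = quotient_ob p Y,
      shom = quotient_hom p Y,
      sid = (\<lambda>R T S h. if (S, h) \<in> algebras p R then (\<lambda>t\<in>tob T S h. t) else undefined),
      scomp = (\<lambda>R T T' T'' \<psi> \<phi> S h.
        if (S, h) \<in> algebras p R then compose (tob T S h) (\<psi> S h) (\<phi> S h) else undefined),
      spull = (\<lambda>R R' g T.
        \<lparr>tob = (\<lambda>S h. tob T S (compose (carrier R) h g)),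
         tmap = (\<lambda>S h S' k. tmap T S (compose (carrier R) h g) S' k),
         tact = (\<lambda>S h. tact T S (compose (carrier R) h g)),
         tpt = (\<lambda>S h. tpt T S (compose (carrier R) h g))\<rparr>),
      spullm = (\<lambda>R R' g \<phi> S h.
        if (S, h) \<in> algebras p R' then \<phi> S (compose (carrier R) h g) else undefined),
      sover = (\<lambda>R T s. s \<in> rhom A R \<and>
        (\<forall>(S, h) \<in> algebras p R. \<forall>t \<in> tob T S h.
           pover Y S (tpt T S h t) (compose (carrier A) h s)))\<rparr>"

text \<open>
  Isomorphism of stacks over \<open>Spec A\<close>: a pseudo-natural transformation \<open>(F, Fm, \<eta>)\<close> of groupoid-valued
  functors that is an equivalence over every ring and commutes with the maps to \<open>Spec A\<close>.
\<close>

definition stack_iso ::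
  "nat \<Rightarrow> ('u, 'o, 'm, 'c) stack \<Rightarrow> ('u, 'o2, 'm2, 'c) stack \<Rightarrow> bool" where
  "stack_iso p X Y \<longleftrightarrow>
     (\<exists>(F :: 'u ring \<Rightarrow> 'o \<Rightarrow> 'o2)
       (Fm :: 'u ring \<Rightarrow> 'o \<Rightarrow> 'o \<Rightarrow> 'm \<Rightarrow> 'm2)
       (\<eta> :: 'u ring \<Rightarrow> 'u ring \<Rightarrow> ('u \<Rightarrow> 'u) \<Rightarrow> 'o \<Rightarrow> 'm2).
       (\<forall>R. p_nilpotent_ring p R \<longrightarrow>
          (\<forall>x \<in> sob X R.
             F R x \<in> sob Y R \<and>
             Fm R x x (sid X R x) = sid Y R (F R x) \<and>
             (\<forall>s. sover X R x s \<longleftrightarrow> sover Y R (F R x) s) \<and>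
             (\<forall>x' \<in> sob X R.
                bij_betw (Fm R x x') (shom X R x x') (shom Y R (F R x) (F R x')) \<and>
                (\<forall>x'' \<in> sob X R. \<forall>\<phi> \<in> shom X R x x'. \<forall>\<psi> \<in> shom X R x' x''.
                   Fm R x x'' (scomp X R x x' x'' \<psi> \<phi>) =
                   scomp Y R (F R x) (F R x') (F R x'') (Fm R x' x'' \<psi>) (Fm R x x' \<phi>)))) \<and>
          (\<forall>y \<in> sob Y R. \<exists>x \<in> sob X R. shom Y R (F R x) y \<noteq> {})) \<and>
       (\<forall>R. p_nilpotent_ring p R \<longrightarrow> (\<forall>(R', g) \<in> algebras p R. \<forall>x \<in> sob X R.
          \<eta> R R' g x \<in> shom Y R' (F R' (spull X R R' g x)) (spull Y R R' g (F R x)) \<and>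
          (\<forall>x' \<in> sob X R. \<forall>\<phi> \<in> shom X R x x'.
             scomp Y R' (F R' (spull X R R' g x)) (F R' (spull X R R' g x'))
               (spull Y R R' g (F R x')) (\<eta> R R' g x')
               (Fm R' (spull X R R' g x) (spull X R R' g x') (spullm X R R' g \<phi>)) =
             scomp Y R' (F R' (spull X R R' g x)) (spull Y R R' g (F R x))
               (spull Y R R' g (F R x')) (spullm Y R R' g (Fm R x x' \<phi>)) (\<eta> R R' g x)) \<and>
          (\<forall>(R'', g') \<in> algebras p R'.
             \<eta> R R'' (compose (carrier R) g' g) x =
             scomp Y R''
               (F R'' (spull X R R'' (compose (carrier R) g' g) x))
               (spull Y R' R'' g' (F R' (spull X R R' g x)))
               (spull Y R R'' (compose (carrier R) g' g) (F R x))
               (spullm Y R' R'' g' (\<eta> R R' g x))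
               (\<eta> R' R'' g' (spull X R R' g x))))))"


section \<open>The Hodge--Tate stack and quotients of the additive group\<close>

text \<open>
  The diffracted Hodge stack is replaced by its functor of connected components.  For the ring \<open>A\<close>
  that is used, all spaces \<open>diffracted p P R\<close> are discrete, and this is part of what is being stated.
\<close>

definition diffracted_gspace ::
  "nat \<Rightarrow> 'b sring \<Rightarrow> ('b \<Rightarrow> 'c) \<Rightarrow> 'c ring
     \<Rightarrow> ('u, nat \<Rightarrow> 'u, ('u, 'b) diffracted_point set, 'c) gspace" where
  "diffracted_gspace p P \<epsilon> A =
     \<lparr>grp = witt_units_F p,
      gmap = (\<lambda>R S h u. h \<circ> u),
      pts = (\<lambda>R. pi0 (diffracted p P R)),
      pmap = (\<lambda>R S h c. \<Union>f\<in>c. pi0_class (diffracted p P S) (diffracted_map P h f)),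
      pact = (\<lambda>R u c. \<Union>f\<in>c. pi0_class (diffracted p P R)
                (postcomp P (derived_quotient_scale (witt_ring p R) u) f)),
      pover = (\<lambda>R c s. \<forall>f\<in>c. diffracted_over P \<epsilon> A R f s)\<rparr>"

definition WCart_HT ::
  "nat \<Rightarrow> 'b sring \<Rightarrow> ('b \<Rightarrow> 'c) \<Rightarrow> 'c ring
     \<Rightarrow> ('u, ('u, nat \<Rightarrow> 'u, ('u, 'b) diffracted_point set, 't) qobj, ('u, 't) qmor, 'c) stack" where
  "WCart_HT p P \<epsilon> A = quotient_stack p A (diffracted_gspace p P \<epsilon> A)"

text \<open>The product of \<open>Ga_sharp\<close> and \<open>Spec A\<close>, with \<open>Gm_sharp\<close> acting on the first factor by
  \<open>act\<close>.  For \<open>A = \<int>/p\<^sup>n\<close>, \<open>n \<ge> 2\<close>, the relevant action is the linear \<open>dp_scaling\<close>.  For \<open>A = \<int>/p\<close> the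
  diffracted Hodge stack is the set of \<open>x\<close> in \<open>W(R)\<close> with \<open>F x = 1\<close>, on which the group acts simply
  transitively by multiplication; in the coordinate \<open>x = 1 + a\<close> this is \<open>dp_translated_scaling\<close>, and no
  coordinate makes it linear, as a linear action would have the fixed point \<open>0\<close>.\<close>

definition Ga_sharp_gspace ::
  "('u ring \<Rightarrow> (nat \<Rightarrow> 'u) \<Rightarrow> (nat \<Rightarrow> 'u) \<Rightarrow> (nat \<Rightarrow> 'u)) \<Rightarrow> 'c ring
     \<Rightarrow> ('u, nat \<Rightarrow> 'u, (nat \<Rightarrow> 'u) \<times> ('c \<Rightarrow> 'u), 'c) gspace" where
  "Ga_sharp_gspace act A =
     \<lparr>grp = Gm_sharp,
      gmap = (\<lambda>R S h \<delta>. h \<circ> \<delta>),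
      pts = (\<lambda>R. Ga_sharp R \<times> rhom A R),
      pmap = (\<lambda>R S h (\<gamma>, s). (h \<circ> \<gamma>, compose (carrier A) h s)),
      pact = (\<lambda>R \<delta> (\<gamma>, s). (act R \<delta> \<gamma>, s)),
      pover = (\<lambda>R (\<gamma>, s) s'. s = s')\<rparr>"

text \<open>
  Isomorphism of the diffracted Hodge stack of \<open>Spec A\<close> with the product of \<open>Ga_sharp\<close> and \<open>Spec A\<close>,
  over \<open>Spec A\<close>.  As the target is set-valued, an equivalence of space-valued functors is the
  same as a strictly natural family of weak equivalences to discrete sets.
\<close>

definition diffracted_iso_Ga_sharp ::
  "'u itself \<Rightarrow> nat \<Rightarrow> 'b sring \<Rightarrow> ('b \<Rightarrow> 'c) \<Rightarrow> 'c ring \<Rightarrow> bool" where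
  "diffracted_iso_Ga_sharp U p P \<epsilon> A \<longleftrightarrow>
     (\<exists>\<Phi> :: 'u ring \<Rightarrow> ('u, 'b) diffracted_point \<Rightarrow> (nat \<Rightarrow> 'u) \<times> ('c \<Rightarrow> 'u).
       \<forall>R. p_nilpotent_ring p R \<longrightarrow>
         discrete_equiv (diffracted p P R) (Ga_sharp R \<times> rhom A R) (\<Phi> R) \<and>
         (\<forall>f \<in> cells (diffracted p P R) 0.
            diffracted_over P \<epsilon> A R f (snd (\<Phi> R f)) \<and>
            (\<forall>(S, h) \<in> algebras p R.
               \<Phi> S (diffracted_map P h f) =
                 (h \<circ> fst (\<Phi> R f), compose (carrier A) h (snd (\<Phi> R f))))))"

end

theory Submission
  imports Defs "HOL-Library.Product_Plus"
begin

text \<open>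
  Since the resolution \<open>P\<close> is free in each degree and \<open>W(R)/V(1)\<close> has no homotopy above degree \<open>1\<close>,
  the maps from \<open>P\<close> to \<open>W(R)/V(1)\<close> form a discrete space, namely the set of null-homotopies
  of \<open>p\<^sup>n\<close>, that is, of \<open>f \<in> W(R)\<close> with \<open>V(1) f = p\<^sup>n\<close>. If such an \<open>f\<close> exists, then
  \<open>p\<^sup>n = 0\<close> in \<open>R\<close>, and conversely \<open>p\<^sup>n = 0\<close> in \<open>R\<close> implies \<open>p\<^sup>n = V(p\<^sup>n\<^sup>-\<^sup>1)\<close> in \<open>W(R)\<close>. As
  \<open>V(1) f = V(F f)\<close> and \<open>V\<close> is injective, the equation becomes \<open>F f = p\<^sup>n\<^sup>-\<^sup>1\<close>: its solutions form a
  torsor under \<open>W[F]\<close> with base point \<open>V(p\<^sup>n\<^sup>-\<^sup>2)\<close> for \<open>n \<ge> 2\<close> and \<open>1\<close> for \<open>n = 1\<close>. The units in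
  \<open>1 + W[F]\<close> fix \<open>V(p\<^sup>n\<^sup>-\<^sup>2)\<close>, because \<open>V(a) b = V(a F(b)) = 0\<close> for \<open>b \<in> W[F]\<close>; they do not
  fix \<open>1\<close>, whence the translated action for \<open>n = 1\<close>.

  The identification of \<open>W[F]\<close> with divided power sequences comes from the Witt vector over
  \<open>\<rat>[x]\<close> with ghost components \<open>(x, 0, 0, \<dots>)\<close>: its \<open>k\<close>-th entry is a \<open>p\<close>-adic unit times
  \<open>x\<close> to the power \<open>p\<^sup>k\<close> divided by \<open>(p\<^sup>k)!\<close>, and over \<open>\<int>\<^sub>(\<^sub>p\<^sub>)\<close> the divided powers of \<open>x\<close> are
  monomials in those of exponent \<open>p\<^sup>k\<close>.
\<close>

section \<open>Evaluation of polynomials\<close>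

text \<open>Two obstacles shape the proof. The first is torsion: over a p-nilpotent ring the ghost
  components do not determine a Witt vector, and one cannot divide by \<open>(p^k)!\<close>.
  Identities between Witt vectors are therefore proved over integral polynomials and pushed down
  along a surjection of rings; identities with divided powers are proved over \<open>rat\<close> and
  pushed down along evaluations defined only on polynomials whose denominators the divided powers
  absorb. What ghost components cannot give is the relation
  \<open>a k ^ p = we k * a (Suc k)\<close> for a vector \<open>a\<close> over \<open>R\<close> with
  \<open>F a = 0\<close>; it is read off from the weights of the polynomials
  \<open>witt_frob\<close>. The second obstacle is to describe maps out of \<open>P\<close> without
  following its generators through all degrees. Every \<open>x\<close> in degree 0 is joined by an
  edge to the integer \<epsilon> x, and the image of this edge is an arrow of the groupoid, hence an
  element of \<open>W(R)\<close>. These elements are additive and multiplicative up to the carries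
  in the arithmetic of residues, and each carry costs one copy of the null-homotopy
  \<open>f\<close>.\<close>

abbreviation "lookup \<equiv> Poly_Mapping.lookup"
abbreviation "keys \<equiv> Poly_Mapping.keys"

text \<open>The sets \<open>C m\<close> of admissible coefficients stay available for both summands
  in the additive step, because some of the evaluations below are defined only for restricted
  coefficients.\<close>

lemma poly_mapping_additive_induct:
  fixes q :: "'m \<Rightarrow>\<^sub>0 'k::comm_monoid_add"
  assumes "\<And>m. lookup q m \<in> C m"
    and zero: "P 0"
    and single: "\<And>m c. c \<in> C m \<Longrightarrow> P (Poly_Mapping.single m c)"
    and add: "\<And>q q'. \<lbrakk>\<And>m. lookup q m \<in> C m; \<And>m. lookup q' m \<in> C m; P q; P q'\<rbrakk> \<Longrightarrow> P (q + q')"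
    and C0: "\<And>m. 0 \<in> C m"
  shows "P q"
proof -
  have "\<And>m. lookup q m \<in> C m \<Longrightarrow> P q" if "finite A" "keys q = A" "\<And>m. lookup q m \<in> C m" for A q
    using that
  proof (induction A arbitrary: q rule: finite_induct)
    case empty
    have "q = 0"
      by (rule poly_mapping_eqI) (use empty in \<open>auto simp: in_keys_iff\<close>)
    then show ?case using zero by simp
  next
    case (insert x A)
    define q1 where "q1 = Poly_Mapping.update x 0 q"
    have l1: "lookup q1 m = (if m = x then 0 else lookup q m)" for m
      by (simp add: q1_def lookup_update)
    have k1: "keys q1 = A"
      using insert.hyps insert.prems(2) by (auto simp: in_keys_iff l1) (metis in_keys_iff insertE insertI2)+
    have "q = Poly_Mapping.single x (lookup q x) + q1"
      by (rule poly_mapping_eqI) (simp add: lookup_add l1 lookup_single when_def)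
    moreover have "P (Poly_Mapping.single x (lookup q x) + q1)"
      apply (rule add)
      subgoal using C0 insert.prems by (simp add: lookup_single when_def)
      subgoal using C0 insert.prems by (simp add: l1)
      subgoal by (rule single) (rule insert.prems)
      subgoal by (rule insert.IH) (use C0 k1 insert.prems in \<open>simp_all add: l1\<close>)
      done
    ultimately show ?case by simp
  qed
  then show ?thesis using assms(1) by (metis finite_keys)
qed

text \<open>Evaluation that may be partial: \<open>T m c\<close> is the value of the term with
  monomial \<open>m\<close> and coefficient \<open>c\<close>, and \<open>C m\<close> holds the
  coefficients for which this value makes sense. Integral polynomials are the case where all
  coefficients are admissible; rational polynomials evaluated at divided powers are the case where
  denominators are bounded by factorials.\<close>

locale poly_mapping_eval = cring R for R (structure) +
  fixes C :: "'m::comm_monoid_add \<Rightarrow> 'k::comm_ring_1 set" and T :: "'m \<Rightarrow> 'k \<Rightarrow> 'a"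
  assumes T_closed [simp]: "c \<in> C m \<Longrightarrow> T m c \<in> carrier R"
    and C0 [simp]: "0 \<in> C m"
    and C_add [simp]: "\<lbrakk>c \<in> C m; d \<in> C m\<rbrakk> \<Longrightarrow> c + d \<in> C m"
    and C_mult [simp]: "\<lbrakk>c \<in> C m; d \<in> C m'\<rbrakk> \<Longrightarrow> c * d \<in> C (m + m')"
    and C1 [simp]: "1 \<in> C 0"
    and T0 [simp]: "T m 0 = \<zero>"
    and T_add: "\<lbrakk>c \<in> C m; d \<in> C m\<rbrakk> \<Longrightarrow> T m (c + d) = T m c \<oplus> T m d"
    and T_mult: "\<lbrakk>c \<in> C m; d \<in> C m'\<rbrakk> \<Longrightarrow> T (m + m') (c * d) = T m c \<otimes> T m' d"
    and T1: "T 0 1 = \<one>"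
begin

definition dom where "dom = {q :: 'm \<Rightarrow>\<^sub>0 'k. \<forall>m. lookup q m \<in> C m}"

definition eval where "eval q = (\<Oplus>m\<in>keys q. T m (lookup q m))"

lemma eval_superset:
  assumes "finite A" "keys q \<subseteq> A" "q \<in> dom"
  shows "eval q = (\<Oplus>m\<in>A. T m (lookup q m))"
  unfolding eval_def
  by (rule add.finprod_mono_neutral_cong_left) (use assms in \<open>auto simp: dom_def in_keys_iff\<close>)

lemma eval_closed [simp]: "q \<in> dom \<Longrightarrow> eval q \<in> carrier R"
  unfolding eval_def dom_def by auto

lemma dom_add [simp]: "\<lbrakk>q \<in> dom; q' \<in> dom\<rbrakk> \<Longrightarrow> q + q' \<in> dom"
  by (simp add: dom_def lookup_add)

lemma dom_0 [simp]: "0 \<in> dom"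
  by (simp add: dom_def)

lemma eval_0 [simp]: "eval 0 = \<zero>"
  by (simp add: eval_def)

lemma eval_add:
  assumes "q \<in> dom" "q' \<in> dom"
  shows "eval (q + q') = eval q \<oplus> eval q'"
proof -
  let ?A = "keys q \<union> keys q'"
  have "eval (q + q') = (\<Oplus>m\<in>?A. T m (lookup (q + q') m))"
    by (rule eval_superset) (use assms keys_add[of q q'] in auto)
  also have "\<dots> = (\<Oplus>m\<in>?A. T m (lookup q m) \<oplus> T m (lookup q' m))"
    by (rule add.finprod_cong') (use assms in \<open>auto simp: lookup_add dom_def intro!: T_add\<close>)
  also have "\<dots> = (\<Oplus>m\<in>?A. T m (lookup q m)) \<oplus> (\<Oplus>m\<in>?A. T m (lookup q' m))"
    by (rule add.finprod_multf) (use assms in \<open>auto simp: dom_def\<close>)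
  also have "\<dots> = eval q \<oplus> eval q'"
    using assms by (simp add: eval_superset[symmetric])
  finally show ?thesis .
qed

lemma dom_single [simp]: "Poly_Mapping.single m c \<in> dom \<longleftrightarrow> c \<in> C m"
  by (auto simp: dom_def lookup_single when_def split: if_splits)

lemma eval_single [simp]: "c \<in> C m \<Longrightarrow> eval (Poly_Mapping.single m c) = T m c"
  by (subst eval_superset[where A = "{m}"]) auto

lemma dom_induct [consumes 1, case_names zero single add]:
  assumes "q \<in> dom" "P 0" "\<And>m c. c \<in> C m \<Longrightarrow> P (Poly_Mapping.single m c)"
    "\<And>q q'. \<lbrakk>q \<in> dom; q' \<in> dom; P q; P q'\<rbrakk> \<Longrightarrow> P (q + q')"
  shows "P q"
  by (rule poly_mapping_additive_induct[of q C]) (use assms in \<open>auto simp: dom_def\<close>)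

lemma dom_eval_mult:
  assumes "q \<in> dom" "q' \<in> dom"
  shows "q * q' \<in> dom \<and> eval (q * q') = eval q \<otimes> eval q'"
  using assms(1)
proof (induction rule: dom_induct)
  case zero
  show ?case using assms by simp
next
  case (single m c)
  show ?case using assms(2)
  proof (induction rule: dom_induct)
    case zero
    show ?case using single by simp
  next
    case (single m' c')
    then show ?case using \<open>c \<in> C m\<close> by (simp add: mult_single T_mult)
  next
    case (add q1 q2)
    then show ?case using \<open>c \<in> C m\<close> by (simp add: distrib_left eval_add r_distr)
  qed
next
  case (add q1 q2)
  then show ?case using assms by (simp add: distrib_right eval_add l_distr)
qed

lemmas dom_mult [simp] = dom_eval_mult[THEN conjunct1]
lemmas eval_mult = dom_eval_mult[THEN conjunct2]

lemma dom_1 [simp]: "1 \<in> dom"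
  using dom_single[of 0 1] by simp

lemma eval_1 [simp]: "eval 1 = \<one>"
  using eval_single[of 1 0] by (simp add: T1)

end

text \<open>Fixes the record type without extension fields, as \<open>zeval\<close> and
  \<open>witt_ring\<close> demand.\<close>

locale plain_cring = cring R for R :: "'a ring" (structure)

text \<open>The bridge from type classes to records: ghost components are computed in a type, and
  the results reach a record ring along homomorphisms out of \<open>type_ring\<close>.\<close>

definition type_ring :: "'a::comm_ring_1 ring" where
  "type_ring = \<lparr>carrier = UNIV, monoid.mult = (*), one = 1, zero = 0, add = (+)\<rparr>"

lemma type_ring_simps [simp]:
  "carrier type_ring = UNIV" "x \<otimes>\<^bsub>type_ring\<^esub> y = x * y" "\<one>\<^bsub>type_ring\<^esub> = 1"
  "\<zero>\<^bsub>type_ring\<^esub> = 0" "x \<oplus>\<^bsub>type_ring\<^esub> y = x + y"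
  by (simp_all add: type_ring_def)

lemma cring_type_ring [simp]: "cring (type_ring :: 'a::comm_ring_1 ring)"
proof (intro cringI abelian_groupI comm_monoidI)
  fix x :: 'a
  show "\<exists>y\<in>carrier type_ring. y \<oplus>\<^bsub>type_ring\<^esub> x = \<zero>\<^bsub>type_ring\<^esub>"
    by (rule bexI[of _ "-x"]) auto
qed (auto simp: algebra_simps)

interpretation type_ring: plain_cring "type_ring :: 'a::comm_ring_1 ring"
  by (simp add: plain_cring_def)

lemma type_ring_pow [simp]: "x [^]\<^bsub>type_ring\<^esub> (n::nat) = x ^ n"
  by (induction n) (auto simp: type_ring.nat_pow_Suc mult.commute)

lemma type_ring_a_inv [simp]: "\<ominus>\<^bsub>type_ring\<^esub> x = - x"
  by (rule type_ring.minus_equality) auto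

lemma type_ring_add_pow_nat [simp]: "[(n::nat)] \<cdot>\<^bsub>type_ring\<^esub> x = of_nat n * x"
  by (induction n) (auto simp: algebra_simps type_ring.add.nat_pow_Suc)

lemma type_ring_add_pow_int [simp]: "[(n::int)] \<cdot>\<^bsub>type_ring\<^esub> x = of_int n * x"
  by (cases n) (simp_all add: type_ring.add.int_pow_neg_int add_pow_int_ge del: of_nat_Suc)

lemma type_ring_finsum [simp]: "finsum type_ring f A = sum f A"
  by (induction A rule: infinite_finite_induct) auto

lemma type_ring_finprod [simp]: "finprod type_ring f A = prod f A"
  by (induction A rule: infinite_finite_induct) auto

definition monomial_value :: "('a, 'x) ring_scheme \<Rightarrow> ('v \<Rightarrow> 'a) \<Rightarrow> ('v \<Rightarrow>\<^sub>0 nat) \<Rightarrow> 'a" where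
  "monomial_value R \<rho> m = (\<Otimes>\<^bsub>R\<^esub> v \<in> keys m. \<rho> v [^]\<^bsub>R\<^esub> lookup m v)"

context cring
begin

lemma monomial_value_closed [simp]:
  "(\<And>v. \<rho> v \<in> carrier R) \<Longrightarrow> monomial_value R \<rho> m \<in> carrier R"
  unfolding monomial_value_def by (rule finprod_closed) auto

lemma monomial_value_superset:
  assumes "\<And>v. \<rho> v \<in> carrier R" "finite A" "keys m \<subseteq> A"
  shows "monomial_value R \<rho> m = (\<Otimes>v\<in>A. \<rho> v [^] lookup m v)"
  unfolding monomial_value_def
  by (rule finprod_mono_neutral_cong_left) (use assms in \<open>auto simp: in_keys_iff\<close>)

lemma monomial_value_add:
  assumes "\<And>v. \<rho> v \<in> carrier R"
  shows "monomial_value R \<rho> (m + m') = monomial_value R \<rho> m \<otimes> monomial_value R \<rho> m'"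
proof -
  let ?A = "keys m \<union> keys m'"
  have "monomial_value R \<rho> (m + m') = (\<Otimes>v\<in>?A. \<rho> v [^] lookup m v \<otimes> \<rho> v [^] lookup m' v)"
    using assms keys_add[of m m'] by (subst monomial_value_superset[of \<rho> ?A]) (auto simp: lookup_add nat_pow_mult)
  also have "\<dots> = (\<Otimes>v\<in>?A. \<rho> v [^] lookup m v) \<otimes> (\<Otimes>v\<in>?A. \<rho> v [^] lookup m' v)"
    by (rule finprod_multf) (use assms in auto)
  also have "\<dots> = monomial_value R \<rho> m \<otimes> monomial_value R \<rho> m'"
    using assms by (simp add: monomial_value_superset[symmetric])
  finally show ?thesis .
qed

end

context plain_cring
begin

lemma zeval_alt: "zeval R \<rho> q = (\<Oplus>m\<in>keys q. [lookup q m] \<cdot> monomial_value R \<rho> m)"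
  by (simp add: zeval_def monomial_value_def)

lemma zeval_locale:
  assumes "\<And>v. \<rho> v \<in> carrier R"
  shows "poly_mapping_eval R (\<lambda>_. UNIV) (\<lambda>m c. [(c::int)] \<cdot> monomial_value R \<rho> m)"
proof unfold_locales
  fix c d :: int and m m'
  show "[(c * d)] \<cdot> monomial_value R \<rho> (m + m') =
      [c] \<cdot> monomial_value R \<rho> m \<otimes> [d] \<cdot> monomial_value R \<rho> m'"
    using assms by (simp add: monomial_value_add add_pow_ldistr_int add_pow_rdistr_int add.int_pow_pow mult.commute)
qed (use assms in \<open>auto simp: add.int_pow_mult add_pow_int_ge monomial_value_def\<close>)

lemma
  assumes "\<And>v. \<rho> v \<in> carrier R"
  shows zeval_closed [simp]: "zeval R \<rho> q \<in> carrier R"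
    and zeval_add: "zeval R \<rho> (q + q') = zeval R \<rho> q \<oplus> zeval R \<rho> q'"
    and zeval_mult: "zeval R \<rho> (q * q') = zeval R \<rho> q \<otimes> zeval R \<rho> q'"
    and zeval_1: "zeval R \<rho> 1 = \<one>"
    and zeval_single: "zeval R \<rho> (Poly_Mapping.single m c) = [c] \<cdot> monomial_value R \<rho> m"
proof -
  interpret E: poly_mapping_eval R "\<lambda>_. UNIV" "\<lambda>m c. [(c::int)] \<cdot> monomial_value R \<rho> m"
    by (rule zeval_locale) fact
  have *: "E.eval = zeval R \<rho>"
    by (rule ext) (simp add: E.eval_def zeval_alt)
  have **: "E.dom = UNIV"
    by (simp add: E.dom_def)
  show "zeval R \<rho> q \<in> carrier R" "zeval R \<rho> (q + q') = zeval R \<rho> q \<oplus> zeval R \<rho> q'"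
    "zeval R \<rho> (q * q') = zeval R \<rho> q \<otimes> zeval R \<rho> q'" "zeval R \<rho> 1 = \<one>"
    "zeval R \<rho> (Poly_Mapping.single m c) = [c] \<cdot> monomial_value R \<rho> m"
    using E.eval_closed[of q] E.eval_add[of q q'] E.eval_mult[of q q'] E.eval_1 E.eval_single[of c m]
    unfolding * ** by auto
qed

lemma zeval_zvar:
  assumes "\<And>v. \<rho> v \<in> carrier R"
  shows "zeval R \<rho> (zvar v) = \<rho> v"
  using assms by (simp add: zvar_def zeval_single monomial_value_def)

lemma zeval_ring_hom:
  assumes "\<And>v. \<rho> v \<in> carrier R"
  shows "zeval R \<rho> \<in> ring_hom type_ring R"
  by (rule ring_hom_memI) (use assms in \<open>simp_all add: zeval_add zeval_mult zeval_1\<close>)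

lemma zeval_cong:
  assumes "\<And>m v. \<lbrakk>m \<in> keys q; v \<in> keys m\<rbrakk> \<Longrightarrow> \<rho> v = \<rho>' v"
    and "\<And>m v. \<lbrakk>m \<in> keys q; v \<in> keys m\<rbrakk> \<Longrightarrow> \<rho>' v \<in> carrier R"
  shows "zeval R \<rho> q = zeval R \<rho>' q"
proof -
  have *: "monomial_value R \<rho> m = monomial_value R \<rho>' m" "monomial_value R \<rho>' m \<in> carrier R"
    if "m \<in> keys q" for m
    unfolding monomial_value_def using that assms
    by (auto intro!: finprod_cong' finprod_closed)
  show ?thesis
    unfolding zeval_alt using * by (auto intro!: add.finprod_cong')
qed

end

lemma ring_hom_finsum':
  assumes "h \<in> ring_hom R S" "cring R" "cring S" "f \<in> A \<rightarrow> carrier R"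
  shows "h (finsum R f A) = finsum S (\<lambda>a. h (f a)) A"
proof -
  interpret ring_hom_cring R S h
    using assms by (simp add: ring_hom_cring_def ring_hom_cring_axioms_def)
  show ?thesis
    using hom_finsum[OF assms(4)] by (simp add: comp_def)
qed

lemma ring_hom_int_mult:
  assumes "h \<in> ring_hom R S" "cring R" "cring S" "x \<in> carrier R"
  shows "h ([(n::int)] \<cdot>\<^bsub>R\<^esub> x) = [n] \<cdot>\<^bsub>S\<^esub> h x"
proof -
  interpret ring_hom_cring R S h
    using assms by (simp add: ring_hom_cring_def ring_hom_cring_axioms_def)
  have nat: "h ([(n::nat)] \<cdot>\<^bsub>R\<^esub> x) = [n] \<cdot>\<^bsub>S\<^esub> h x" for n
    by (induction n) (use assms(4) in auto)
  show ?thesis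
    using assms(4) by (cases n) (simp_all add: R.add.int_pow_neg_int S.add.int_pow_neg_int add_pow_int_ge nat del: of_nat_Suc)
qed

lemma ring_hom_nat_mult:
  assumes "h \<in> ring_hom R S" "cring R" "cring S" "x \<in> carrier R"
  shows "h ([(n::nat)] \<cdot>\<^bsub>R\<^esub> x) = [n] \<cdot>\<^bsub>S\<^esub> h x"
  using ring_hom_int_mult[OF assms, of "int n"] by (simp add: add_pow_int_ge)

text \<open>All operations on Witt vectors are integral polynomials in the components, so this
  single fact makes each of them functorial.\<close>

lemma ring_hom_zeval:
  assumes "h \<in> ring_hom R S" "cring R" "cring S" "\<And>v. \<rho> v \<in> carrier R"
  shows "h (zeval R \<rho> q) = zeval S (\<lambda>v. h (\<rho> v)) q"
proof -
  interpret ring_hom_cring R S h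
    using assms by (simp add: ring_hom_cring_def ring_hom_cring_axioms_def)
  interpret R: plain_cring R
    using assms by (simp add: plain_cring_def)
  interpret S: plain_cring S
    using assms by (simp add: plain_cring_def)
  have pow: "h (x [^]\<^bsub>R\<^esub> (n::nat)) = h x [^]\<^bsub>S\<^esub> n" if "x \<in> carrier R" for x n
    using that by (induction n) auto
  have "h (monomial_value R \<rho> m) = monomial_value S (\<lambda>v. h (\<rho> v)) m" for m
    unfolding monomial_value_def using assms(4)
    by (subst hom_finprod) (auto simp: comp_def pow intro!: S.finprod_cong')
  then show ?thesis
    unfolding R.zeval_alt S.zeval_alt using assms
    by (subst ring_hom_finsum'[OF assms(1-3)])
      (auto simp: ring_hom_int_mult[OF assms(1-3)] intro!: S.add.finprod_cong')
qed

abbreviation zev :: "('v \<Rightarrow> 'a::comm_ring_1) \<Rightarrow> 'v zpoly \<Rightarrow> 'a" where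
  "zev \<equiv> zeval type_ring"

lemma zev_simps [simp]:
  "zev \<rho> (q + q') = zev \<rho> q + zev \<rho> q'"
  "zev \<rho> (q * q') = zev \<rho> q * zev \<rho> q'"
  "zev \<rho> 1 = 1" "zev \<rho> 0 = 0" "zev \<rho> (zvar v) = \<rho> v"
  by (simp_all add: type_ring.zeval_add type_ring.zeval_mult type_ring.zeval_1 type_ring.zeval_zvar)
     (simp add: zeval_def)

lemma zev_power [simp]: "zev \<rho> (q ^ n) = zev \<rho> q ^ n"
  by (induction n) auto

lemma zev_of_nat [simp]: "zev \<rho> (of_nat n) = of_nat n"
  by (induction n) auto

lemma zev_sum [simp]: "zev \<rho> (sum f A) = (\<Sum>a\<in>A. zev \<rho> (f a))"
  by (induction A rule: infinite_finite_induct) auto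

lemma zev_ghost: "zev \<rho> (ghost p k s) = ghost p k (\<lambda>i. zev \<rho> (s i))"
  by (simp add: ghost_def)

lemma zpoly_induct [case_names const var add mult]:
  assumes "\<And>c::int. P (of_int c)" "\<And>v. P (zvar v)"
    "\<And>q q'. \<lbrakk>P q; P q'\<rbrakk> \<Longrightarrow> P (q + q')" "\<And>q q'. \<lbrakk>P q; P q'\<rbrakk> \<Longrightarrow> P (q * q')"
  shows "P (q :: 'v zpoly)"
proof -
  have pow: "P (zvar v ^ n)" for v n
    by (induction n) (use assms(1)[of 1] assms in auto)
  have mono: "P (Poly_Mapping.single m 1)" for m :: "'v \<Rightarrow>\<^sub>0 nat"
  proof (rule poly_mapping_additive_induct[of m "\<lambda>_. UNIV" "\<lambda>m. P (Poly_Mapping.single m 1)"])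
    show "P (Poly_Mapping.single 0 1)"
      using assms(1)[of 1] by simp
    fix v :: 'v and n :: nat
    have "zvar v ^ n = Poly_Mapping.single (Poly_Mapping.single v n) (1::int)"
      by (induction n) (auto simp: zvar_def mult_single single_add[symmetric])
    then show "P (Poly_Mapping.single (Poly_Mapping.single v n) 1)"
      using pow[of v n] by simp
    fix m m' :: "'v \<Rightarrow>\<^sub>0 nat"
    assume "P (Poly_Mapping.single m 1)" "P (Poly_Mapping.single m' 1)"
    then show "P (Poly_Mapping.single (m + m') 1)"
      using assms(4)[of "Poly_Mapping.single m 1" "Poly_Mapping.single m' 1"] by (simp add: mult_single)
  qed auto
  show ?thesis
  proof (rule poly_mapping_additive_induct[of q "\<lambda>_. UNIV"])
    fix m :: "'v \<Rightarrow>\<^sub>0 nat" and c :: int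
    show "P (Poly_Mapping.single m c)"
      using assms(4)[OF assms(1)[of c] mono[of m]]
      by (simp flip: single_of_int add: mult_single)
  qed (use assms(1)[of 0] assms(3) in auto)
qed

definition torsion_free :: "'a::comm_ring_1 itself \<Rightarrow> bool" where
  "torsion_free _ \<longleftrightarrow> (\<forall>(n::nat) (x::'a). n > 0 \<longrightarrow> of_nat n * x = 0 \<longrightarrow> x = 0)"

lemma lookup_of_nat_mult:
  fixes q :: "'m::comm_monoid_add \<Rightarrow>\<^sub>0 'k::comm_ring_1"
  shows "lookup (of_nat n * q) m = of_nat n * lookup q m"
  by (induction n) (auto simp: lookup_add distrib_right)

lemma torsion_free_poly_mapping:
  "torsion_free TYPE('m::comm_monoid_add \<Rightarrow>\<^sub>0 'k::{idom, ring_char_0})"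
  unfolding torsion_free_def
proof (intro allI impI)
  fix n and x :: "'m \<Rightarrow>\<^sub>0 'k"
  assume "n > 0" "of_nat n * x = 0"
  then have "of_nat n * lookup x m = 0" for m
    by (metis lookup_of_nat_mult lookup_zero)
  then show "x = 0"
    using \<open>n > 0\<close> by (intro poly_mapping_eqI) auto
qed

lemma torsion_free_char_0: "torsion_free TYPE('k::{idom, ring_char_0})"
  by (simp add: torsion_free_def)

section \<open>Ghost components and Dwork's lemma\<close>

lemma of_nat_dvd_of_nat:
  "m dvd n \<Longrightarrow> (of_nat m :: 'a::comm_semiring_1) dvd of_nat n"
  by (auto simp: dvd_def)

text \<open>In \<open>x^p - y^p = (x - y) * s\<close> the factor \<open>s\<close> has
  \<open>p\<close> summands, each congruent to \<open>y^(p-1)\<close> modulo \<open>p\<close>; so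
  \<open>s\<close> contributes one more factor \<open>p\<close>.\<close>

lemma dvd_power_cong_step:
  fixes x y :: "'a::comm_ring_1"
  assumes "of_nat m dvd x - y" "p dvd m"
  shows "of_nat (p * m) dvd x ^ p - y ^ p"
proof -
  have p: "of_nat p dvd x - y"
    using assms by (meson dvd_trans of_nat_dvd_of_nat)
  have pow: "of_nat p dvd x ^ i - y ^ i" for i
    by (metis p dvd_mult2 power_diff_sumr2)
  have "of_nat p dvd (\<Sum>i<p. y ^ (p - Suc i) * x ^ i - y ^ (p - 1))"
  proof (rule dvd_sum)
    fix i assume "i \<in> {..<p}"
    then have "y ^ (p - Suc i) * x ^ i - y ^ (p - 1) = y ^ (p - Suc i) * (x ^ i - y ^ i)"
      by (simp add: right_diff_distrib flip: power_add)
    then show "of_nat p dvd y ^ (p - Suc i) * x ^ i - y ^ (p - 1)"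
      using pow[of i] by simp
  qed
  then have "of_nat p dvd (\<Sum>i<p. y ^ (p - Suc i) * x ^ i) - of_nat p * y ^ (p - 1)"
    by (simp add: sum_subtractf)
  then have "of_nat p dvd (\<Sum>i<p. y ^ (p - Suc i) * x ^ i)"
    by (metis dvd_diff_right_iff dvd_diff_left_iff dvd_triv_left)
  then show ?thesis
    using assms(1) by (simp add: power_diff_sumr2 mult_dvd_mono mult.commute[of "of_nat p"])
qed

lemma dvd_power_cong:
  fixes x y :: "'a::comm_ring_1"
  assumes "of_nat p dvd x - y"
  shows "of_nat (p ^ Suc j) dvd x ^ (p ^ j) - y ^ (p ^ j)"
proof (induction j)
  case (Suc j)
  show ?case
    using dvd_power_cong_step[OF Suc, of p] by (simp add: power_mult[symmetric] mult.commute)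
qed (use assms in simp)

lemma freshman_dream:
  fixes x y :: "'a::comm_ring_1"
  assumes "Factorial_Ring.prime p"
  shows "of_nat p dvd (x + y) ^ p - (x ^ p + y ^ p)"
proof -
  have p: "p > 0"
    using assms prime_gt_0_nat by blast
  have "(x + y) ^ p = (\<Sum>k\<le>p. of_nat (p choose k) * x ^ k * y ^ (p - k))"
    by (rule binomial_ring)
  also have "{..p} = insert 0 (insert p {0<..<p})"
    using p by auto
  also have "(\<Sum>k\<in>\<dots>. of_nat (p choose k) * x ^ k * y ^ (p - k)) =
      y ^ p + x ^ p + (\<Sum>k\<in>{0<..<p}. of_nat (p choose k) * x ^ k * y ^ (p - k))"
    using p by (subst sum.insert) auto
  finally have "(x + y) ^ p - (x ^ p + y ^ p) =
      (\<Sum>k\<in>{0<..<p}. of_nat (p choose k) * x ^ k * y ^ (p - k))"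
    by simp
  moreover have "of_nat p dvd \<dots>"
  proof (rule dvd_sum)
    fix k assume "k \<in> {0<..<p}"
    then have "k * (p choose k) = p * ((p - 1) choose (k - 1))"
      by (intro times_binomial_minus1_eq) auto
    then have "p dvd k * (p choose k)"
      by simp
    then have "p dvd p choose k"
      using assms \<open>k \<in> {0<..<p}\<close> by (auto simp: prime_dvd_mult_iff dest: dvd_imp_le)
    then show "of_nat p dvd of_nat (p choose k) * x ^ k * y ^ (p - k)"
      by (intro dvd_mult2) (rule of_nat_dvd_of_nat)
  qed
  ultimately show ?thesis by simp
qed

lemma zev_of_int [simp]:
  fixes \<rho> :: "'v \<Rightarrow> 'a::comm_ring_1"
  shows "zev \<rho> (of_int n) = of_int n"
proof -
  have "zev \<rho> (Poly_Mapping.single 0 n) = of_int n"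
    by (simp add: type_ring.zeval_single monomial_value_def)
  moreover have "(Poly_Mapping.single 0 n :: 'v zpoly) = of_int n"
    using single_of_int[of n, where ?'b = int] by simp
  ultimately show ?thesis by simp
qed

text \<open>A lift to integral polynomials of the Frobenius endomorphism modulo \<open>p\<close>,
  the datum in Dwork's criterion.\<close>

definition frob_lift :: "nat \<Rightarrow> 'v zpoly \<Rightarrow> 'v zpoly" where
  "frob_lift p = zev (\<lambda>v. zvar v ^ p)"

text \<open>Both sides are multiplicative, and additive modulo \<open>p\<close>. It remains to look
  at the variables, where there is equality, and at the integers, where it is Fermat's little
  theorem, proved by induction upwards and downwards from 0.\<close>

lemma frob_lift_cong:
  assumes "Factorial_Ring.prime p"
  shows "of_nat p dvd frob_lift p q - q ^ p"
proof (induction q rule: zpoly_induct)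
  case (const c)
  have step: "int p dvd (x + 1) - (x + 1) ^ p \<longleftrightarrow> int p dvd x - x ^ p" for x
  proof -
    have "int p dvd (x + 1) ^ p - (x ^ p + 1)"
      using freshman_dream[OF assms, of x 1] by simp
    moreover have "(x + 1) - (x + 1) ^ p = (x - x ^ p) - ((x + 1) ^ p - (x ^ p + 1))"
      by simp
    ultimately show ?thesis
      by (metis dvd_diff_left_iff)
  qed
  have "int p dvd c - c ^ p"
  proof (induction c rule: int_induct[where k = 0])
    case base
    then show ?case using prime_gt_0_nat[OF assms] by (simp add: zero_power)
  next
    case (step1 x)
    then show ?case using step[of x] by simp
  next
    case (step2 x)
    then show ?case using step[of "x - 1"] by simp
  qed
  then have "of_int (int p) dvd (of_int (c - c ^ p) :: 'a zpoly)"
    unfolding dvd_def by (metis of_int_mult)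
  then show ?case by (simp add: frob_lift_def)
next
  case (var v)
  then show ?case by (simp add: frob_lift_def)
next
  case (add q q')
  have "frob_lift p (q + q') - (q + q') ^ p =
      (frob_lift p q - q ^ p) + (frob_lift p q' - q' ^ p) - ((q + q') ^ p - (q ^ p + q' ^ p))"
    by (simp add: frob_lift_def)
  also have "of_nat p dvd \<dots>"
    by (rule dvd_diff[OF dvd_add[OF add(1) add(2)] freshman_dream[OF assms]])
  finally show ?case .
next
  case (mult q q')
  have "frob_lift p (q * q') - (q * q') ^ p =
      (frob_lift p q - q ^ p) * frob_lift p q' + q ^ p * (frob_lift p q' - q' ^ p)"
    by (simp add: frob_lift_def algebra_simps power_mult_distrib)
  then show ?case
    using mult by simp
qed

lemma ghost_Suc: "ghost p (Suc k) x = of_nat (p ^ Suc k) * x (Suc k) + ghost p k (\<lambda>i. x i ^ p)"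
proof -
  have "ghost p (Suc k) x = (\<Sum>i\<le>k. of_nat (p ^ i) * x i ^ (p ^ (Suc k - i))) + of_nat (p ^ Suc k) * x (Suc k)"
    by (simp add: ghost_def)
  also have "(\<Sum>i\<le>k. of_nat (p ^ i) * x i ^ (p ^ (Suc k - i))) = ghost p k (\<lambda>i. x i ^ p)"
    unfolding ghost_def by (intro sum.cong) (auto simp: Suc_diff_le power_mult[symmetric])
  finally show ?thesis by simp
qed

lemma ghost_0 [simp]: "ghost p 0 x = x 0"
  by (simp add: ghost_def)

lemma ghost_split:
  "ghost p k x = (\<Sum>i<k. of_nat (p ^ i) * x i ^ (p ^ (k - i))) + of_nat (p ^ k) * x k"
  by (simp add: ghost_def lessThan_Suc_atMost[symmetric])

lemma ghost_inj:
  fixes x y :: "nat \<Rightarrow> 'a::comm_ring_1"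
  assumes "torsion_free TYPE('a)" "p > 0" "\<And>k. ghost p k x = ghost p k y"
  shows "x = y"
proof
  fix k
  show "x k = y k"
  proof (induction k rule: less_induct)
    case (less k)
    have "(\<Sum>i<k. of_nat (p ^ i) * x i ^ (p ^ (k - i))) = (\<Sum>i<k. of_nat (p ^ i) * y i ^ (p ^ (k - i)))"
      using less by simp
    then have "of_nat (p ^ k) * x k = of_nat (p ^ k) * y k"
      using assms(3)[of k] unfolding ghost_split by simp
    then have "of_nat (p ^ k) * (x k - y k) = 0"
      by (simp add: right_diff_distrib)
    then show ?case
      using assms(1,2) unfolding torsion_free_def by (metis eq_iff_diff_eq_0 zero_less_power)
  qed
qed

text \<open>Solves the ghost equations one component at a time. The choice has the intended property
  only if the right-hand side is divisible by \<open>p^k\<close>, which is the content of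
  \<open>dwork\<close>.\<close>

function dwork_seq :: "nat \<Rightarrow> (nat \<Rightarrow> 'v zpoly) \<Rightarrow> nat \<Rightarrow> 'v zpoly" where
  "dwork_seq p w k =
     (SOME t. of_nat (p ^ k) * t = w k - (\<Sum>i<k. of_nat (p ^ i) * dwork_seq p w i ^ (p ^ (k - i))))"
  by pat_completeness auto
termination by (relation "measure (\<lambda>(p, w, k). k)") auto

declare dwork_seq.simps [simp del]

text \<open>Apart from its last term, ghost component \<open>Suc k\<close> of \<open>s\<close> is
  ghost component \<open>k\<close> of the \<open>p\<close>-th powers. Now \<open>s i ^ p\<close>
  agrees with \<open>frob_lift p (s i)\<close> modulo \<open>p\<close>, hence their powers of
  exponent \<open>p^(k-i)\<close> agree modulo \<open>p^(k-i+1)\<close>, and the weight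
  \<open>p^i\<close> completes this to \<open>p^(k+1)\<close>. So the prescribed value can be
  reached by dividing by \<open>p^(k+1)\<close>.\<close>

lemma dwork:
  fixes w :: "nat \<Rightarrow> 'v zpoly"
  assumes p: "Factorial_Ring.prime p"
    and w: "\<And>k. of_nat (p ^ Suc k) dvd w (Suc k) - frob_lift p (w k)"
  shows "\<exists>s. \<forall>k. ghost p k s = w k"
proof -
  define s where "s = dwork_seq p w"
  have s: "of_nat (p ^ k) * s k = w k - (\<Sum>i<k. of_nat (p ^ i) * s i ^ (p ^ (k - i)))"
    if "of_nat (p ^ k) dvd w k - (\<Sum>i<k. of_nat (p ^ i) * s i ^ (p ^ (k - i)))" for k
    using that unfolding s_def by (subst (1) dwork_seq.simps) (rule someI_ex, auto simp: dvd_def)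
  have "ghost p k s = w k" for k
  proof (induction k)
    case 0
    show ?case using s[of 0] by simp
  next
    case (Suc k)
    have "w (Suc k) - (\<Sum>i<Suc k. of_nat (p ^ i) * s i ^ (p ^ (Suc k - i))) =
        (w (Suc k) - frob_lift p (w k)) + (frob_lift p (ghost p k s) - ghost p k (\<lambda>i. s i ^ p))"
      using Suc ghost_Suc[of p k s] ghost_split[of p "Suc k" s] by simp
    also have "frob_lift p (ghost p k s) = ghost p k (\<lambda>i. frob_lift p (s i))"
      by (simp add: frob_lift_def zev_ghost)
    also have "of_nat (p ^ Suc k) dvd
        (w (Suc k) - frob_lift p (w k)) + (ghost p k (\<lambda>i. frob_lift p (s i)) - ghost p k (\<lambda>i. s i ^ p))"
    proof (rule dvd_add[OF w], unfold ghost_def sum_subtractf[symmetric], rule dvd_sum)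
      fix i assume "i \<in> {..k}"
      then have "of_nat (p ^ Suc k) = (of_nat (p ^ i) * of_nat (p ^ Suc (k - i)) :: 'v zpoly)"
        by (simp flip: of_nat_mult power_add power_Suc)
      also have "\<dots> dvd of_nat (p ^ i) * (frob_lift p (s i) ^ p ^ (k - i) - (s i ^ p) ^ p ^ (k - i))"
        by (intro mult_dvd_mono dvd_refl dvd_power_cong frob_lift_cong p)
      finally show "of_nat (p ^ Suc k) dvd
          of_nat (p ^ i) * frob_lift p (s i) ^ p ^ (k - i) - of_nat (p ^ i) * (s i ^ p) ^ p ^ (k - i)"
        by (simp only: right_diff_distrib)
    qed
    finally show ?case
      using s[of "Suc k"] ghost_split[of p "Suc k" s] by simp
  qed
  then show ?thesis by blast
qed

lemma ghost_zvar_cong: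
  "of_nat (p ^ Suc k) dvd ghost p (Suc k) (\<lambda>i. zvar (f i)) - frob_lift p (ghost p k (\<lambda>i. zvar (f i)))"
  by (simp add: ghost_Suc frob_lift_def zev_ghost del: power_Suc)

text \<open>Dwork's lemma gives existence and torsion-freeness uniqueness, so the description
  operator in the definitions of the Witt polynomials denotes what it should.\<close>

lemma the_witt_poly:
  fixes w :: "nat \<Rightarrow> 'v zpoly"
  assumes p: "Factorial_Ring.prime p"
    and w: "\<And>k. of_nat (p ^ Suc k) dvd w (Suc k) - frob_lift p (w k)"
  shows "ghost p k (THE s. \<forall>k. ghost p k s = w k) = w k"
proof -
  have "\<exists>!s. \<forall>k. ghost p k s = w k"
    using dwork[OF p w] ghost_inj[OF torsion_free_poly_mapping prime_gt_0_nat[OF p]]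
    by (metis (mono_tags))
  from theI'[OF this] show ?thesis by blast
qed

lemma ghost_witt_sum:
  assumes "Factorial_Ring.prime p"
  shows "ghost p k (witt_sum p) = ghost p k (\<lambda>i. zvar (Inl i)) + ghost p k (\<lambda>i. zvar (Inr i))"
  unfolding witt_sum_def
proof (rule the_witt_poly[OF assms])
  fix k
  show "of_nat (p ^ Suc k) dvd
        ghost p (Suc k) (\<lambda>i. zvar (Inl i)) + ghost p (Suc k) (\<lambda>i. zvar (Inr i)) -
        frob_lift p (ghost p k (\<lambda>i. zvar (Inl i)) + ghost p k (\<lambda>i. zvar (Inr i)))"
    using dvd_add[OF ghost_zvar_cong[of p k Inl] ghost_zvar_cong[of p k Inr]]
    by (simp add: frob_lift_def algebra_simps)
qed

lemma ghost_witt_prod: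
  assumes "Factorial_Ring.prime p"
  shows "ghost p k (witt_prod p) = ghost p k (\<lambda>i. zvar (Inl i)) * ghost p k (\<lambda>i. zvar (Inr i))"
  unfolding witt_prod_def
proof (rule the_witt_poly[OF assms])
  fix k
  let ?a = "\<lambda>k. ghost p k (\<lambda>i. zvar (Inl i))" and ?b = "\<lambda>k. ghost p k (\<lambda>i. zvar (Inr i))"
  have "?a (Suc k) * ?b (Suc k) - frob_lift p (?a k * ?b k) =
      (?a (Suc k) - frob_lift p (?a k)) * ?b (Suc k) + frob_lift p (?a k) * (?b (Suc k) - frob_lift p (?b k))"
    by (simp add: frob_lift_def algebra_simps)
  also have "of_nat (p ^ Suc k) dvd \<dots>"
    by (intro dvd_add dvd_mult dvd_mult2 ghost_zvar_cong)
  finally show "of_nat (p ^ Suc k) dvd ?a (Suc k) * ?b (Suc k) - frob_lift p (?a k * ?b k)" .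
qed

lemma ghost_witt_frob:
  assumes "Factorial_Ring.prime p"
  shows "ghost p k (witt_frob p) = ghost p (Suc k) zvar"
  unfolding witt_frob_def
proof (rule the_witt_poly[OF assms])
  fix k
  \<comment> \<open>Because of the index shift the congruence is available modulo one more power of
    \<open>p\<close> than required.\<close>
  have "of_nat (p ^ Suc k) dvd (of_nat (p ^ Suc (Suc k)) :: nat zpoly)"
    by (simp add: of_nat_dvd_of_nat del: of_nat_power)
  then show "of_nat (p ^ Suc k) dvd ghost p (Suc (Suc k)) zvar - frob_lift p (ghost p (Suc k) (zvar :: nat \<Rightarrow> nat zpoly))"
    using ghost_zvar_cong[of p "Suc k" "\<lambda>i. i"] dvd_trans by blast
qed

section \<open>The ring of Witt vectors\<close>

lemma witt_ring_simps [simp]: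
  "carrier (witt_ring p R) = {a. \<forall>i. a i \<in> carrier R}"
  "\<one>\<^bsub>witt_ring p R\<^esub> = (\<lambda>k. if k = 0 then \<one>\<^bsub>R\<^esub> else \<zero>\<^bsub>R\<^esub>)"
  "\<zero>\<^bsub>witt_ring p R\<^esub> = (\<lambda>k. \<zero>\<^bsub>R\<^esub>)"
  by (simp_all add: witt_ring_def)

lemma witt_add: "a \<oplus>\<^bsub>witt_ring p R\<^esub> b = (\<lambda>k. zeval R (case_sum a b) (witt_sum p k))"
  and witt_mult: "a \<otimes>\<^bsub>witt_ring p R\<^esub> b = (\<lambda>k. zeval R (case_sum a b) (witt_prod p k))"
  by (simp_all add: witt_ring_def)

text \<open>Nothing is known about \<open>B\<close> beforehand: this is how \<open>W(R)\<close>
  obtains the ring axioms, as the image of the Witt vectors of a polynomial ring.\<close>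

lemma cring_image:
  assumes "cring A" "f ` carrier A = carrier B"
    and add: "\<And>x y. \<lbrakk>x \<in> carrier A; y \<in> carrier A\<rbrakk> \<Longrightarrow> f (x \<oplus>\<^bsub>A\<^esub> y) = f x \<oplus>\<^bsub>B\<^esub> f y"
    and mult: "\<And>x y. \<lbrakk>x \<in> carrier A; y \<in> carrier A\<rbrakk> \<Longrightarrow> f (x \<otimes>\<^bsub>A\<^esub> y) = f x \<otimes>\<^bsub>B\<^esub> f y"
    and zero: "f \<zero>\<^bsub>A\<^esub> = \<zero>\<^bsub>B\<^esub>" and one: "f \<one>\<^bsub>A\<^esub> = \<one>\<^bsub>B\<^esub>"
  shows "cring B"
proof -
  interpret A: cring A by fact
  have ex: "\<exists>a\<in>carrier A. x = f a" if "x \<in> carrier B" for x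
    using that assms(2) by auto
  have mem: "f a \<in> carrier B" if "a \<in> carrier A" for a
    using that assms(2) by auto
  note [simp] = mem add[symmetric] mult[symmetric] zero[symmetric] one[symmetric]
  show ?thesis
  proof (intro cringI abelian_groupI comm_monoidI)
    fix x assume "x \<in> carrier B"
    then obtain a where a: "a \<in> carrier A" "x = f a" using ex by blast
    show "\<exists>y\<in>carrier B. y \<oplus>\<^bsub>B\<^esub> x = \<zero>\<^bsub>B\<^esub>"
      by (rule bexI[of _ "f (\<ominus>\<^bsub>A\<^esub> a)"]) (use a in \<open>auto simp: A.l_neg\<close>)
    show "\<zero>\<^bsub>B\<^esub> \<oplus>\<^bsub>B\<^esub> x = x" "\<one>\<^bsub>B\<^esub> \<otimes>\<^bsub>B\<^esub> x = x"
      using a by auto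
    fix y assume "y \<in> carrier B"
    then obtain b where b: "b \<in> carrier A" "y = f b" using ex by blast
    show "x \<oplus>\<^bsub>B\<^esub> y \<in> carrier B" "x \<otimes>\<^bsub>B\<^esub> y \<in> carrier B"
      "x \<oplus>\<^bsub>B\<^esub> y = y \<oplus>\<^bsub>B\<^esub> x" "x \<otimes>\<^bsub>B\<^esub> y = y \<otimes>\<^bsub>B\<^esub> x"
      using a b by (auto simp: A.a_comm A.m_comm)
    fix z assume "z \<in> carrier B"
    then obtain c where c: "c \<in> carrier A" "z = f c" using ex by blast
    show "x \<oplus>\<^bsub>B\<^esub> y \<oplus>\<^bsub>B\<^esub> z = x \<oplus>\<^bsub>B\<^esub> (y \<oplus>\<^bsub>B\<^esub> z)" "x \<otimes>\<^bsub>B\<^esub> y \<otimes>\<^bsub>B\<^esub> z = x \<otimes>\<^bsub>B\<^esub> (y \<otimes>\<^bsub>B\<^esub> z)"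
      "(x \<oplus>\<^bsub>B\<^esub> y) \<otimes>\<^bsub>B\<^esub> z = x \<otimes>\<^bsub>B\<^esub> z \<oplus>\<^bsub>B\<^esub> y \<otimes>\<^bsub>B\<^esub> z"
      using a b c by (auto simp: A.a_assoc A.m_assoc A.l_distr)
  qed auto
qed

definition teichmuller :: "'u ring \<Rightarrow> 'u \<Rightarrow> nat \<Rightarrow> 'u" where
  "teichmuller R c = (\<lambda>k. if k = 0 then c else \<zero>\<^bsub>R\<^esub>)"

abbreviation type_witt where "type_witt p \<equiv> witt_ring p type_ring"

section \<open>Ghost components of the operations on Witt vectors\<close>

context
  fixes p :: nat
  assumes p: "Factorial_Ring.prime p"
begin

lemma p_gt_0: "p > 0"
  using p prime_gt_0_nat by blast

lemma ghost_add: "ghost p k (a \<oplus>\<^bsub>type_witt p\<^esub> b) = ghost p k a + ghost p k b"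
  using arg_cong[OF ghost_witt_sum[OF p, of k], of "zev (case_sum a b)"] by (simp add: zev_ghost witt_add)

lemma ghost_mult: "ghost p k (a \<otimes>\<^bsub>type_witt p\<^esub> b) = ghost p k a * ghost p k b"
  using arg_cong[OF ghost_witt_prod[OF p, of k], of "zev (case_sum a b)"] by (simp add: zev_ghost witt_mult)

lemma type_witt_component_0:
  "(a \<oplus>\<^bsub>type_witt p\<^esub> b) 0 = a 0 + b 0" "(a \<otimes>\<^bsub>type_witt p\<^esub> b) 0 = a 0 * b 0"
  using ghost_add[of 0 a b] ghost_mult[of 0 a b] by simp_all

lemma ghost_frobenius: "ghost p k (frobenius p type_ring a) = ghost p (Suc k) a"
  using arg_cong[OF ghost_witt_frob[OF p, of k], of "zev a"] by (simp add: zev_ghost frobenius_def)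

lemma ghost_teichmuller: "ghost p k (teichmuller type_ring c) = c ^ p ^ k"
proof -
  have "ghost p k (teichmuller type_ring c) = (\<Sum>i\<le>k. if i = 0 then c ^ p ^ k else 0)"
    unfolding ghost_def teichmuller_def using p_gt_0 by (intro sum.cong) (auto simp: power_0_left)
  then show ?thesis by simp
qed

lemma ghost_zero: "ghost p k (\<lambda>_. 0) = 0"
  using p_gt_0 by (simp add: ghost_def power_0_left)

lemma ghost_one: "ghost p k (\<lambda>k. if k = 0 then 1 else 0) = 1"
  and ghost_one': "ghost p k (\<lambda>k. if k = 0 then \<one>\<^bsub>type_ring\<^esub> else \<zero>\<^bsub>type_ring\<^esub>) = 1"
  using ghost_teichmuller[of k 1] by (simp_all add: teichmuller_def cong: if_cong)

lemma ghost_verschiebung: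
  "ghost p k (verschiebung type_ring a) = (if k = 0 then 0 else of_nat p * ghost p (k - 1) a)"
proof (cases k)
  case 0
  then show ?thesis by (simp add: verschiebung_def)
next
  case (Suc n)
  have "ghost p k (verschiebung type_ring a) = (\<Sum>i\<le>n. of_nat (p ^ Suc i) * a i ^ p ^ (n - i))"
    unfolding Suc ghost_def verschiebung_def
    by (subst sum.atMost_Suc_shift) (use p_gt_0 in \<open>simp add: power_0_left\<close>)
  then show ?thesis
    by (simp add: ghost_def Suc sum_distrib_left mult.assoc)
qed

text \<open>Negation is not componentwise when \<open>p = 2\<close>, so its universal polynomials
  are produced by Dwork's lemma as well and then evaluated at the components of
  \<open>a\<close>.\<close>

lemma ghost_neg_ex: "\<exists>b. \<forall>k. ghost p k b = - ghost p k (a :: nat \<Rightarrow> 'a::comm_ring_1)"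
proof -
  have "\<exists>s. \<forall>k. ghost p k s = - ghost p k (zvar :: nat \<Rightarrow> nat zpoly)"
  proof (rule dwork[OF p])
    fix k
    \<comment> \<open>The evaluation rules cover sums only, so the negative is handled through
      \<open>frob_lift (- g) + frob_lift g = 0\<close>.\<close>
    have eq: "- ghost p (Suc k) zvar - frob_lift p (- ghost p k zvar :: nat zpoly) =
        - (ghost p (Suc k) zvar - frob_lift p (ghost p k zvar))"
      using zev_simps(1)[of "\<lambda>v. zvar v ^ p" "- ghost p k zvar" "ghost p k zvar"]
      by (simp add: frob_lift_def eq_neg_iff_add_eq_0 neg_eq_iff_add_eq_0 del: zev_simps(1))
    then show "of_nat (p ^ Suc k) dvd - ghost p (Suc k) zvar - frob_lift p (- ghost p k zvar :: nat zpoly)"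
      unfolding eq dvd_minus_iff using ghost_zvar_cong[of p k "\<lambda>i. i"] by simp
  qed
  then obtain s where s: "\<And>k. ghost p k s = - ghost p k (zvar :: nat \<Rightarrow> nat zpoly)" by blast
  have "ghost p k (\<lambda>i. zev a (s i)) = - ghost p k a" for k
  proof -
    have "ghost p k (\<lambda>i. zev a (s i)) + ghost p k a = zev a (ghost p k s + ghost p k zvar)"
      by (simp add: zev_ghost)
    then show ?thesis by (simp add: s eq_neg_iff_add_eq_0)
  qed
  then show ?thesis by blast
qed

text \<open>Each axiom is an identity between ghost components, where the operations are those of
  the base ring, and \<open>ghost_inj\<close> reflects it.\<close>

lemma cring_type_witt:
  assumes tf: "torsion_free TYPE('t::comm_ring_1)"
  shows "cring (type_witt p :: (nat \<Rightarrow> 't) ring)"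
proof (intro cringI abelian_groupI comm_monoidI)
  fix x :: "nat \<Rightarrow> 't"
  obtain y where "\<And>k. ghost p k y = - ghost p k x"
    using ghost_neg_ex by metis
  then have "y \<oplus>\<^bsub>type_witt p\<^esub> x = \<zero>\<^bsub>type_witt p\<^esub>"
    by (intro ghost_inj[OF tf p_gt_0]) (simp add: ghost_add ghost_zero)
  then show "\<exists>y\<in>carrier (type_witt p). y \<oplus>\<^bsub>type_witt p\<^esub> x = \<zero>\<^bsub>type_witt p\<^esub>"
    by (intro bexI) auto
qed (auto intro!: ghost_inj[OF tf p_gt_0] simp: ghost_add ghost_mult ghost_zero ghost_one ghost_one' algebra_simps)

end

lemma ring_hom_witt_add:
  assumes "h \<in> ring_hom R S" "cring R" "cring S" "\<And>i. a i \<in> carrier R" "\<And>i. b i \<in> carrier R"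
  shows "h \<circ> (a \<oplus>\<^bsub>witt_ring p R\<^esub> b) = (h \<circ> a) \<oplus>\<^bsub>witt_ring p S\<^esub> (h \<circ> b)"
proof -
  have "case_sum a b v \<in> carrier R" for v
    using assms by (cases v) auto
  moreover have "(\<lambda>v. h (case_sum a b v)) = case_sum (h \<circ> a) (h \<circ> b)"
    by (auto split: sum.split)
  ultimately show ?thesis
    by (simp add: fun_eq_iff witt_add ring_hom_zeval[OF assms(1-3)])
qed

lemma ring_hom_witt_mult:
  assumes "h \<in> ring_hom R S" "cring R" "cring S" "\<And>i. a i \<in> carrier R" "\<And>i. b i \<in> carrier R"
  shows "h \<circ> (a \<otimes>\<^bsub>witt_ring p R\<^esub> b) = (h \<circ> a) \<otimes>\<^bsub>witt_ring p S\<^esub> (h \<circ> b)"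
proof -
  have "case_sum a b v \<in> carrier R" for v
    using assms by (cases v) auto
  moreover have "(\<lambda>v. h (case_sum a b v)) = case_sum (h \<circ> a) (h \<circ> b)"
    by (auto split: sum.split)
  ultimately show ?thesis
    by (simp add: fun_eq_iff witt_mult ring_hom_zeval[OF assms(1-3)])
qed

lemma ring_hom_frobenius:
  assumes "h \<in> ring_hom R S" "cring R" "cring S" "\<And>i. a i \<in> carrier R"
  shows "h \<circ> frobenius p R a = frobenius p S (h \<circ> a)"
  using assms(4) by (simp add: fun_eq_iff frobenius_def ring_hom_zeval[OF assms(1-3)] comp_def)

lemma ring_hom_zero':
  assumes "h \<in> ring_hom R S" "cring R" "cring S"
  shows "h \<zero>\<^bsub>R\<^esub> = \<zero>\<^bsub>S\<^esub>"
  using assms by (intro ring_hom_zero) (auto intro: cring.axioms)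

lemma ring_hom_verschiebung:
  assumes "h \<in> ring_hom R S" "cring R" "cring S"
  shows "h \<circ> verschiebung R a = verschiebung S (h \<circ> a)"
  using ring_hom_zero'[OF assms] by (auto simp: fun_eq_iff verschiebung_def split: nat.split)

lemma ring_hom_teichmuller:
  assumes "h \<in> ring_hom R S" "cring R" "cring S"
  shows "h \<circ> teichmuller R c = teichmuller S (h c)"
  using ring_hom_zero'[OF assms] by (auto simp: fun_eq_iff teichmuller_def)

section \<open>Descent from polynomial rings to arbitrary rings\<close>

locale witt = plain_cring R for R :: "'u ring" (structure) +
  fixes p :: nat
  assumes prime_p: "Factorial_Ring.prime p"
begin

abbreviation "W \<equiv> witt_ring p R"
abbreviation "F \<equiv> frobenius p R"
abbreviation "V \<equiv> verschiebung R"

text \<open>Presents \<open>R\<close> as a quotient of a torsion-free ring with one variable for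
  every element of the type; variables that name no element of the carrier go to zero. Identities
  proved by ghost components upstairs descend along this map.\<close>

definition proj :: "'u zpoly \<Rightarrow> 'u" where
  "proj = zeval R (\<lambda>v. if v \<in> carrier R then v else \<zero>)"

lemma proj_hom: "proj \<in> ring_hom type_ring R"
  unfolding proj_def by (rule zeval_ring_hom) auto

lemmas proj_homs = proj_hom cring_type_ring cring_axioms

lemma lift:
  assumes "a \<in> carrier W"
  obtains a' where "a = proj \<circ> a'"
proof
  show "a = proj \<circ> (\<lambda>i. zvar (a i))"
    using assms by (auto simp: proj_def zeval_zvar)
qed

lemma proj_witt:
  "proj \<circ> (a \<oplus>\<^bsub>type_witt p\<^esub> b) = (proj \<circ> a) \<oplus>\<^bsub>W\<^esub> (proj \<circ> b)"
  "proj \<circ> (a \<otimes>\<^bsub>type_witt p\<^esub> b) = (proj \<circ> a) \<otimes>\<^bsub>W\<^esub> (proj \<circ> b)"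
  "proj \<circ> frobenius p type_ring a = F (proj \<circ> a)"
  "proj \<circ> verschiebung type_ring a = V (proj \<circ> a)"
  "proj \<circ> teichmuller type_ring c = teichmuller R (proj c)"
  by (simp_all add: ring_hom_witt_add[OF proj_homs] ring_hom_witt_mult[OF proj_homs]
      ring_hom_frobenius[OF proj_homs] ring_hom_verschiebung[OF proj_homs] ring_hom_teichmuller[OF proj_homs])

lemma proj_0 [simp]: "proj 0 = \<zero>" and proj_1 [simp]: "proj 1 = \<one>"
  using ring_hom_zero'[OF proj_homs] ring_hom_one[OF proj_hom] by auto

lemma proj_closed [simp]: "proj x \<in> carrier R"
  using ring_hom_closed[OF proj_hom] by simp

lemma cring_W: "cring W"
proof (rule cring_image[where f = "(\<circ>) proj"])
  show "cring (type_witt p :: (nat \<Rightarrow> 'u zpoly) ring)"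
    by (rule cring_type_witt[OF prime_p torsion_free_poly_mapping])
  show "(\<circ>) proj ` carrier (type_witt p) = carrier W"
  proof (intro equalityI subsetI)
    fix x assume "x \<in> carrier W"
    then show "x \<in> (\<circ>) proj ` carrier (type_witt p)"
      by (elim lift) auto
  qed auto
qed (auto simp: proj_witt)

sublocale W: plain_cring W
  by (simp add: plain_cring_def cring_W)

lemma zpoly_witt_eqI:
  fixes a b :: "nat \<Rightarrow> 'v zpoly"
  shows "(\<And>k. ghost p k a = ghost p k b) \<Longrightarrow> a = b"
  by (rule ghost_inj[OF torsion_free_poly_mapping prime_gt_0_nat[OF prime_p]])

lemmas ghosts = ghost_add[OF prime_p] ghost_mult[OF prime_p] ghost_frobenius[OF prime_p]
  ghost_verschiebung[OF prime_p] ghost_teichmuller[OF prime_p] ghost_one[OF prime_p] ghost_one'[OF prime_p] ghost_zero[OF prime_p]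

lemma F_closed [simp]: "(\<And>i. a i \<in> carrier R) \<Longrightarrow> F a i \<in> carrier R"
  by (simp add: frobenius_def)

lemma V_closed [simp]: "(\<And>i. a i \<in> carrier R) \<Longrightarrow> V a i \<in> carrier R"
  by (auto simp: verschiebung_def split: nat.split)

lemma F_ring_hom: "F \<in> ring_hom W W"
proof (rule ring_hom_memI)
  fix a b assume "a \<in> carrier W" "b \<in> carrier W"
  then obtain a' b' where ab: "a = proj \<circ> a'" "b = proj \<circ> b'"
    by (meson lift)
  have "frobenius p type_ring (a' \<otimes>\<^bsub>type_witt p\<^esub> b') =
      frobenius p type_ring a' \<otimes>\<^bsub>type_witt p\<^esub> frobenius p type_ring b'"
    "frobenius p type_ring (a' \<oplus>\<^bsub>type_witt p\<^esub> b') =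
      frobenius p type_ring a' \<oplus>\<^bsub>type_witt p\<^esub> frobenius p type_ring b'"
    by (rule zpoly_witt_eqI, simp add: ghosts)+
  from this[THEN arg_cong, of "(\<circ>) proj"]
  show "F (a \<otimes>\<^bsub>W\<^esub> b) = F a \<otimes>\<^bsub>W\<^esub> F b" "F (a \<oplus>\<^bsub>W\<^esub> b) = F a \<oplus>\<^bsub>W\<^esub> F b"
    by (simp_all add: ab proj_witt)
next
  have "frobenius p type_ring (teichmuller type_ring 1) = teichmuller type_ring (1 :: 'u zpoly)"
    by (rule zpoly_witt_eqI) (simp add: ghosts)
  from this[THEN arg_cong, of "(\<circ>) proj"] show "F \<one>\<^bsub>W\<^esub> = \<one>\<^bsub>W\<^esub>"
    by (simp add: proj_witt) (simp add: teichmuller_def)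
qed auto

lemma V_mult:
  assumes "a \<in> carrier W" "b \<in> carrier W"
  shows "V a \<otimes>\<^bsub>W\<^esub> b = V (a \<otimes>\<^bsub>W\<^esub> F b)"
proof -
  obtain a' b' where ab: "a = proj \<circ> a'" "b = proj \<circ> b'"
    using assms by (meson lift)
  have "verschiebung type_ring a' \<otimes>\<^bsub>type_witt p\<^esub> b' =
      verschiebung type_ring (a' \<otimes>\<^bsub>type_witt p\<^esub> frobenius p type_ring b')"
    by (rule zpoly_witt_eqI) (simp add: ghosts algebra_simps)
  from this[THEN arg_cong, of "(\<circ>) proj"] show ?thesis
    by (simp add: ab proj_witt)
qed

lemma ghost_add_pow:
  assumes "torsion_free TYPE('t::comm_ring_1)"
  shows "ghost p k ([(n::nat)] \<cdot>\<^bsub>type_witt p\<^esub> (a :: nat \<Rightarrow> 't)) = of_nat n * ghost p k a"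
proof -
  interpret T: cring "type_witt p :: (nat \<Rightarrow> 't) ring"
    by (rule cring_type_witt[OF prime_p assms])
  show ?thesis
    by (induction n) (simp_all add: ghosts algebra_simps)
qed

lemma proj_comp_hom: "(\<circ>) proj \<in> ring_hom (type_witt p) W"
  by (rule ring_hom_memI) (auto simp: proj_witt)

lemma F_V:
  assumes "a \<in> carrier W"
  shows "F (V a) = [p] \<cdot>\<^bsub>W\<^esub> a"
proof -
  obtain a' where a: "a = proj \<circ> a'"
    using assms by (meson lift)
  have "frobenius p type_ring (verschiebung type_ring a') = [p] \<cdot>\<^bsub>type_witt p\<^esub> a'"
    by (rule zpoly_witt_eqI) (simp add: ghosts ghost_add_pow[OF torsion_free_poly_mapping])
  from this[THEN arg_cong, of "(\<circ>) proj"] show ?thesis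
    using ring_hom_nat_mult[OF proj_comp_hom cring_type_witt[OF prime_p torsion_free_poly_mapping] cring_W, of a' p]
    by (simp add: a proj_witt)
qed

lemma witt_decomp:
  assumes "a \<in> carrier W"
  shows "a = teichmuller R (a 0) \<oplus>\<^bsub>W\<^esub> V (\<lambda>i. a (Suc i))"
proof -
  obtain a' where a: "a = proj \<circ> a'"
    using assms by (meson lift)
  have "a' = teichmuller type_ring (a' 0) \<oplus>\<^bsub>type_witt p\<^esub> verschiebung type_ring (\<lambda>i. a' (Suc i))"
  proof (rule zpoly_witt_eqI)
    fix k
    show "ghost p k a' = ghost p k (teichmuller type_ring (a' 0) \<oplus>\<^bsub>type_witt p\<^esub> verschiebung type_ring (\<lambda>i. a' (Suc i)))"
    proof (cases k)
      case (Suc n)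
      show ?thesis
        unfolding Suc ghost_add[OF prime_p] ghosts
        by (subst ghost_def, subst sum.atMost_Suc_shift) (simp add: ghost_def sum_distrib_left mult.assoc)
    qed (simp add: type_witt_component_0[OF prime_p] teichmuller_def verschiebung_def)
  qed
  from this[THEN arg_cong, of "(\<circ>) proj", unfolded proj_witt] show ?thesis
    unfolding a comp_def .
qed

lemma teichmuller_mult:
  assumes "b \<in> carrier W" "c \<in> carrier R"
  shows "teichmuller R c \<otimes>\<^bsub>W\<^esub> b = (\<lambda>k. c [^] (p ^ k) \<otimes> b k)"
proof -
  obtain b' where b: "b = proj \<circ> b'"
    using assms by (meson lift)
  have c: "c = proj (zvar c)"
    using assms by (simp add: proj_def zeval_zvar)
  have "teichmuller type_ring (zvar c) \<otimes>\<^bsub>type_witt p\<^esub> b' = (\<lambda>k. zvar c ^ (p ^ k) * b' k)"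
  proof (rule zpoly_witt_eqI)
    fix k
    have "ghost p k (\<lambda>k. zvar c ^ (p ^ k) * b' k) = zvar c ^ (p ^ k) * ghost p k b'"
      unfolding ghost_def sum_distrib_left
      by (intro sum.cong) (auto simp: power_mult_distrib algebra_simps simp flip: power_mult power_add)
    then show "ghost p k (teichmuller type_ring (zvar c) \<otimes>\<^bsub>type_witt p\<^esub> b') = ghost p k (\<lambda>k. zvar c ^ (p ^ k) * b' k)"
      by (simp add: ghosts)
  qed
  from this[THEN arg_cong, of "(\<circ>) proj"]
  have "teichmuller R c \<otimes>\<^bsub>W\<^esub> b = proj \<circ> (\<lambda>k. zvar c ^ (p ^ k) * b' k)"
    by (simp add: b proj_witt c[symmetric])
  also have "\<dots> = (\<lambda>k. c [^] (p ^ k) \<otimes> b k)"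
  proof -
    have "proj (x ^ n) = proj x [^] n" for x n
      by (induction n) (use ring_hom_mult[OF proj_hom] in \<open>auto simp: m_comm\<close>)
    then show ?thesis
      using ring_hom_mult[OF proj_hom] by (auto simp: b c[symmetric] fun_eq_iff)
  qed
  finally show ?thesis .
qed

lemma component_0:
  assumes "a \<in> carrier W" "b \<in> carrier W"
  shows "(a \<oplus>\<^bsub>W\<^esub> b) 0 = a 0 \<oplus> b 0" "(a \<otimes>\<^bsub>W\<^esub> b) 0 = a 0 \<otimes> b 0"
proof -
  obtain a' b' where ab: "a = proj \<circ> a'" "b = proj \<circ> b'"
    using assms by (meson lift)
  have "(a' \<oplus>\<^bsub>type_witt p\<^esub> b') 0 = a' 0 + b' 0" "(a' \<otimes>\<^bsub>type_witt p\<^esub> b') 0 = a' 0 * b' 0"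
    by (simp_all add: type_witt_component_0[OF prime_p])
  from this[THEN arg_cong, of proj]
  show "(a \<oplus>\<^bsub>W\<^esub> b) 0 = a 0 \<oplus> b 0" "(a \<otimes>\<^bsub>W\<^esub> b) 0 = a 0 \<otimes> b 0"
    using ring_hom_mult[OF proj_hom] ring_hom_add[OF proj_hom]
    by (simp_all add: ab flip: proj_witt)
qed

lemma component_0_hom: "(\<lambda>a. a 0) \<in> ring_hom W R"
  by (rule ring_hom_memI) (auto simp: component_0)

lemma V_inj:
  assumes "V a = V b"
  shows "a = b"
proof
  fix i
  from assms have "V a (Suc i) = V b (Suc i)" by simp
  then show "a i = b i" by (simp add: verschiebung_def)
qed

end

lemma witt_hom:
  assumes "h \<in> ring_hom R S" "cring R" "cring S" "Factorial_Ring.prime p"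
  shows "(\<circ>) h \<in> ring_hom (witt_ring p R) (witt_ring p S)"
  by (rule ring_hom_memI)
    (use assms in \<open>auto simp: ring_hom_witt_add ring_hom_witt_mult ring_hom_closed fun_eq_iff ring_hom_one ring_hom_zero'\<close>)

text \<open>The Witt vector \<open>p\<^sup>n - V(p\<^sup>n\<^sup>-\<^sup>1)\<close> over \<open>\<int>\<close> has ghost components \<open>(p\<^sup>n, 0, 0, \<dots>)\<close>, which forces
  all its components to be divisible by \<open>p\<^sup>n\<close>.\<close>

lemma ghost_concentrated_dvd:
  fixes z :: "nat \<Rightarrow> int"
  assumes p: "p > 1" and n: "n \<ge> 1" and z: "\<And>k. ghost p k z = (if k = 0 then int (p ^ n) else 0)"
  shows "int (p ^ n) dvd z k"
proof (induction k rule: less_induct)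
  case (less k)
  show ?case
  proof (cases k)
    case 0
    then show ?thesis using z[of 0] by simp
  next
    case (Suc m)
    \<comment> \<open>In the ghost equation \<open>z k\<close> carries the factor
      \<open>p^k\<close>, so the other terms must have \<open>n\<close> factors more than
      \<open>k\<close>. Term \<open>i\<close> has \<open>i + n * p^(k-i)\<close> of them by
      induction, which suffices because \<open>p^(k-i) > k - i\<close>.\<close>
    have "int (p ^ (k + n)) dvd (\<Sum>i<k. of_nat (p ^ i) * z i ^ (p ^ (k - i)))"
    proof (rule dvd_sum)
      fix i assume "i \<in> {..<k}"
      then have i: "i < k" by simp
      have "k - i < p ^ (k - i)"
        using p by (simp add: power_gt_expt)
      then obtain d where d: "p ^ (k - i) = Suc (k - i) + d"
        using less_iff_Suc_add[of "k - i"] by auto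
      have "k + n \<le> i + n * p ^ (k - i)"
      proof -
        have "k - i \<le> n * (k - i)" using n by simp
        then have "k + n \<le> i + n * (k - i) + n" using i by linarith
        also have "\<dots> \<le> i + n * p ^ (k - i)" by (simp add: d algebra_simps)
        finally show ?thesis .
      qed
      then have "int (p ^ (k + n)) dvd int (p ^ (i + n * p ^ (k - i)))"
        by (simp add: le_imp_power_dvd)
      also have "\<dots> = int (p ^ i) * int (p ^ n) ^ (p ^ (k - i))"
        by (simp add: power_add power_mult)
      also have "\<dots> dvd int (p ^ i) * z i ^ (p ^ (k - i))"
        using less.IH[OF i] by (intro mult_dvd_mono dvd_power_same) auto
      finally show "int (p ^ (k + n)) dvd of_nat (p ^ i) * z i ^ (p ^ (k - i))" .
    qed
    moreover have "(\<Sum>i<k. of_nat (p ^ i) * z i ^ (p ^ (k - i))) = - (int (p ^ k) * z k)"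
      using z[of k] Suc by (simp add: ghost_split)
    ultimately have "int (p ^ k) * int (p ^ n) dvd int (p ^ k) * z k"
      by (simp add: power_add)
    then show ?thesis
      using p by simp
  qed
qed

context witt
begin

lemma int_hom: "(\<lambda>z::int. [z] \<cdot> \<one>) \<in> ring_hom type_ring R"
  by (rule ring_hom_memI) (auto simp: add.int_pow_mult add_pow_ldistr_int add.int_pow_pow mult.commute)

text \<open>Over the integers the left side is the right side plus the vector \<open>z\<close> of
  the preceding lemma. The components of \<open>z\<close> are multiples of \<open>p^n\<close> and
  vanish in \<open>R\<close>.\<close>

lemma p_power_eq_V:
  assumes "n \<ge> 1" "[(p ^ n)] \<cdot> \<one> = \<zero>"
  shows "[(p ^ n)] \<cdot>\<^bsub>W\<^esub> \<one>\<^bsub>W\<^esub> = V ([(p ^ (n - 1))] \<cdot>\<^bsub>W\<^esub> \<one>\<^bsub>W\<^esub>)"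
proof -
  let ?Z = "type_witt p :: (nat \<Rightarrow> int) ring"
  let ?h = "\<lambda>z::int. [z] \<cdot> \<one>"
  interpret Z: witt "type_ring :: int ring" p
    by (simp add: witt_def plain_cring_def witt_axioms_def prime_p)
  define y where "y = verschiebung type_ring ([(p ^ (n - 1))] \<cdot>\<^bsub>?Z\<^esub> \<one>\<^bsub>?Z\<^esub>)"
  define z where "z = [(p ^ n)] \<cdot>\<^bsub>?Z\<^esub> \<one>\<^bsub>?Z\<^esub> \<ominus>\<^bsub>?Z\<^esub> y"
  have zy: "[(p ^ n)] \<cdot>\<^bsub>?Z\<^esub> \<one>\<^bsub>?Z\<^esub> = z \<oplus>\<^bsub>?Z\<^esub> y"
    unfolding z_def by (simp add: Z.W.minus_eq Z.W.a_assoc Z.W.l_neg)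
  have "ghost p k z + ghost p k y = of_nat (p ^ n)" for k
    using arg_cong[OF zy, of "ghost p k"]
    by (simp add: ghosts ghost_add_pow[OF torsion_free_char_0] del: witt_ring_simps(3))
  moreover have "ghost p k y = (if k = 0 then 0 else of_nat (p ^ n))" for k
    using assms(1) by (cases n) (simp_all add: y_def ghosts ghost_add_pow[OF torsion_free_char_0])
  ultimately have "ghost p k z = (if k = 0 then int (p ^ n) else 0)" for k
    by (metis add.right_neutral add_diff_cancel_right' diff_self)
  then have dvd: "int (p ^ n) dvd z k" for k
    using ghost_concentrated_dvd assms(1) prime_gt_1_nat[OF prime_p] by blast
  have "?h \<circ> z = \<zero>\<^bsub>W\<^esub>"
  proof
    fix k
    obtain c where "z k = int (p ^ n) * c"
      using dvd by (auto simp: dvd_def)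
    then have "?h (z k) = [c] \<cdot> ([int (p ^ n)] \<cdot> \<one>)"
      by (simp add: add.int_pow_pow mult.commute)
    also have "\<dots> = \<zero>"
      using assms(2) by (simp add: add_pow_int_ge del: of_nat_power)
    finally show "(?h \<circ> z) k = \<zero>\<^bsub>W\<^esub> k" by simp
  qed
  moreover
  have hom: "(\<circ>) ?h \<in> ring_hom ?Z W"
    by (rule witt_hom[OF int_hom cring_type_ring cring_axioms prime_p])
  have pow: "?h \<circ> ([k] \<cdot>\<^bsub>?Z\<^esub> \<one>\<^bsub>?Z\<^esub>) = [k] \<cdot>\<^bsub>W\<^esub> \<one>\<^bsub>W\<^esub>" for k :: nat
    using ring_hom_nat_mult[OF hom Z.cring_W cring_W, of "\<one>\<^bsub>?Z\<^esub>" k] ring_hom_one[OF hom] by simp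
  have "?h \<circ> y = V ([(p ^ (n - 1))] \<cdot>\<^bsub>W\<^esub> \<one>\<^bsub>W\<^esub>)"
    unfolding y_def ring_hom_verschiebung[OF int_hom cring_type_ring cring_axioms] pow ..
  moreover have "?h \<circ> (z \<oplus>\<^bsub>?Z\<^esub> y) = (?h \<circ> z) \<oplus>\<^bsub>W\<^esub> (?h \<circ> y)"
    using ring_hom_add[OF hom, of z y] by simp
  moreover have "?h \<circ> y \<in> carrier W"
    by auto
  ultimately show ?thesis
    using W.l_zero[of "?h \<circ> y"] pow[of "p ^ n"] by (simp add: zy del: witt_ring_simps(2,3))
qed

end

section \<open>Mapping spaces out of a resolution of a quotient of the integers\<close>

definition vertex_map :: "nat \<Rightarrow> nat \<Rightarrow> nat" where
  "vertex_map i = (\<lambda>_\<in>{..0}. i)"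

definition edge_map :: "nat \<Rightarrow> nat \<Rightarrow> nat \<Rightarrow> nat" where
  "edge_map i j = (\<lambda>l\<in>{..1}. if l = 0 then i else j)"

definition triangle_map :: "nat \<Rightarrow> nat \<Rightarrow> nat \<Rightarrow> nat \<Rightarrow> nat" where
  "triangle_map i j k = (\<lambda>l\<in>{..2}. if l = 0 then i else if l = 1 then j else k)"

lemma vertex_map_Dmaps [simp]: "i \<le> m \<Longrightarrow> vertex_map i \<in> Dmaps 0 m"
  by (auto simp: vertex_map_def Dmaps_def mono_on_def)

lemma edge_map_Dmaps [simp]: "\<lbrakk>i \<le> j; j \<le> m\<rbrakk> \<Longrightarrow> edge_map i j \<in> Dmaps (Suc 0) m"
  by (auto simp: edge_map_def Dmaps_def mono_on_def)

lemma triangle_map_Dmaps [simp]: "\<lbrakk>i \<le> j; j \<le> k; k \<le> m\<rbrakk> \<Longrightarrow> triangle_map i j k \<in> Dmaps 2 m"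
  by (auto simp: triangle_map_def Dmaps_def mono_on_def)

lemma edge_map_simps [simp]: "edge_map i j 0 = i" "edge_map i j 1 = j" "edge_map i j (Suc 0) = j"
  by (simp_all add: edge_map_def)

lemma vertex_map_simps [simp]: "vertex_map i 0 = i"
  by (simp add: vertex_map_def)

lemma Dmaps_le: "\<lbrakk>\<sigma> \<in> Dmaps m k; i \<le> m\<rbrakk> \<Longrightarrow> \<sigma> i \<le> k"
  by (auto simp: Dmaps_def)

lemma Dmaps_mono: "\<lbrakk>\<sigma> \<in> Dmaps m k; i \<le> j; j \<le> m\<rbrakk> \<Longrightarrow> \<sigma> i \<le> \<sigma> j"
  by (auto simp: Dmaps_def mono_on_def)

lemma compose_Dmaps: "\<lbrakk>\<theta> \<in> Dmaps l m; \<sigma> \<in> Dmaps m k\<rbrakk> \<Longrightarrow> compose {..l} \<sigma> \<theta> \<in> Dmaps l k"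
  by (auto simp: Dmaps_def compose_def mono_on_def PiE_iff)

lemma compose_vertex_map [simp]: "compose {0} \<sigma> (vertex_map i) = vertex_map (\<sigma> i)"
  by (auto simp: compose_def vertex_map_def)

lemma compose_edge_map [simp]: "compose {..Suc 0} \<sigma> (edge_map i j) = edge_map (\<sigma> i) (\<sigma> j)"
  by (auto simp: compose_def edge_map_def)

lemma triangle_map_simps [simp]:
  "triangle_map i j k 0 = i" "triangle_map i j k 1 = j" "triangle_map i j k (Suc 0) = j" "triangle_map i j k 2 = k"
  by (simp_all add: triangle_map_def)

lemma coface_eqs: "coface 0 0 = vertex_map (Suc 0)" "coface 0 (Suc 0) = vertex_map 0"
  "coface (Suc 0) 0 = edge_map (Suc 0) (Suc (Suc 0))" "coface (Suc 0) (Suc 0) = edge_map 0 (Suc (Suc 0))"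
  "coface (Suc 0) (Suc (Suc 0)) = edge_map 0 (Suc 0)"
  by (auto simp: coface_def vertex_map_def edge_map_def)

lemma coface_Dmaps [simp]: "i \<le> Suc k \<Longrightarrow> coface k i \<in> Dmaps k (Suc k)"
  by (auto simp: coface_def Dmaps_def mono_on_def)

lemma Did_0: "Did 0 = vertex_map 0"
  by (auto simp: Did_def vertex_map_def)

lemma (in ring) zero_int_mult [simp]: "[(0::int)] \<cdot> x = \<zero>"
  by (simp add: add_pow_int_ge)

lemma (in ring) add_minus_cancel [simp]: "\<lbrakk>a \<in> carrier R; b \<in> carrier R\<rbrakk> \<Longrightarrow> b \<oplus> (a \<ominus> b) = a"
  by (metis a_comm a_minus_def add.inv_closed add.m_assoc l_neg r_zero)

lemma (in ring) minus_eq_iff: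
  assumes "a \<in> carrier R" "b \<in> carrier R" "c \<in> carrier R"
  shows "c = a \<ominus> b \<longleftrightarrow> b \<oplus> c = a"
proof
  note * = assms
  assume "b \<oplus> c = a"
  then have "a \<ominus> b = c \<oplus> (b \<ominus> b)"
    using * unfolding minus_eq by (metis a_assoc a_comm a_inv_closed)
  then show "c = a \<ominus> b"
    using * by (simp add: minus_eq r_neg)
qed (use assms in simp)

lemma ring_hom_restrict:
  assumes "cring R" "f \<in> ring_hom R S"
  shows "restrict f (carrier R) \<in> rhom R S"
proof -
  interpret cring R by fact
  show ?thesis
    using assms(2) by (auto simp: rhom_def ring_hom_def)
qed

section \<open>Simplices of the derived quotient\<close>

locale cring_with_element = plain_cring A for A :: "'a ring" (structure) +
  fixes t :: 'a
  assumes t_closed [simp]: "t \<in> carrier A"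
begin

abbreviation "D \<equiv> derived_quotient A t"

text \<open>The simplex with vertices \<open>E + t b\<^sub>i\<close> whose arrow from vertex \<open>i\<close> to vertex \<open>j\<close> is \<open>b\<^sub>j - b\<^sub>i\<close>.\<close>

definition spx :: "nat \<Rightarrow> 'a \<Rightarrow> (nat \<Rightarrow> 'a) \<Rightarrow> 'a \<times> (nat \<Rightarrow> 'a)" where
  "spx m E b = (E \<oplus> t \<otimes> b 0, \<lambda>i\<in>{..m}. b i \<ominus> b 0)"

lemma lev_D: "lev D m = derived_quotient_lev A t m"
  by (simp add: derived_quotient_def)

lemma carrier_D: "carrier (lev D m) = carrier A \<times> {f \<in> {..m} \<rightarrow>\<^sub>E carrier A. f 0 = \<zero>}"
  by (simp add: lev_D derived_quotient_lev_def)

lemma add_D: "x \<oplus>\<^bsub>lev D m\<^esub> y = (fst x \<oplus> fst y, \<lambda>i\<in>{..m}. snd x i \<oplus> snd y i)"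
  by (simp add: lev_D derived_quotient_lev_def case_prod_beta)

lemma mult_D: "x \<otimes>\<^bsub>lev D m\<^esub> y = (fst x \<otimes> fst y,
    \<lambda>i\<in>{..m}. fst x \<otimes> snd y i \<oplus> fst y \<otimes> snd x i \<oplus> t \<otimes> (snd x i \<otimes> snd y i))"
  by (simp add: lev_D derived_quotient_lev_def case_prod_beta)

lemma one_D: "\<one>\<^bsub>lev D m\<^esub> = (\<one>, \<lambda>i\<in>{..m}. \<zero>)"
  by (simp add: lev_D derived_quotient_lev_def)

lemma rop_D: "rop D m k \<theta> x = (fst x \<oplus> t \<otimes> snd x (\<theta> 0), \<lambda>i\<in>{..m}. snd x (\<theta> i) \<ominus> snd x (\<theta> 0))"
  by (simp add: derived_quotient_def case_prod_beta)

lemma spx_closed: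
  assumes "E \<in> carrier A" "\<And>i. i \<le> m \<Longrightarrow> b i \<in> carrier A"
  shows "spx m E b \<in> carrier (lev D m)"
  using assms by (auto simp: spx_def carrier_D r_neg minus_eq)

lemma spx_cong: "(\<And>i. i \<le> m \<Longrightarrow> b i = b' i) \<Longrightarrow> spx m E b = spx m E b'"
  by (auto simp: spx_def)

lemma spx_one: "spx m \<one> (\<lambda>_. \<zero>) = \<one>\<^bsub>lev D m\<^esub>"
  by (auto simp: spx_def one_D minus_eq)

lemma spx_add:
  assumes "E \<in> carrier A" "E' \<in> carrier A"
    and "\<And>i. i \<le> m \<Longrightarrow> b i \<in> carrier A" "\<And>i. i \<le> m \<Longrightarrow> b' i \<in> carrier A"
  shows "spx m E b \<oplus>\<^bsub>lev D m\<^esub> spx m E' b' = spx m (E \<oplus> E') (\<lambda>i. b i \<oplus> b' i)"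
proof -
  have *: "b i \<ominus> b 0 \<oplus> (b' i \<ominus> b' 0) = b i \<oplus> b' i \<ominus> (b 0 \<oplus> b' 0)" if "i \<le> m" for i
    using assms(3)[OF that] assms(4)[OF that] assms(3)[of 0, simplified] assms(4)[of 0, simplified] by algebra
  have "E \<oplus> t \<otimes> b 0 \<oplus> (E' \<oplus> t \<otimes> b' 0) = E \<oplus> E' \<oplus> t \<otimes> (b 0 \<oplus> b' 0)"
    using assms(1,2) assms(3)[of 0, simplified] assms(4)[of 0, simplified] t_closed by algebra
  with * show ?thesis
    by (auto simp: spx_def add_D restrict_def)
qed

text \<open>Vertex \<open>i\<close> of the product is \<open>(E + t b i) (E' + t b' i)\<close>;
  expanding it and collecting the multiples of \<open>t\<close> gives the new
  \<open>b\<close>.\<close>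

lemma spx_mult:
  assumes "E \<in> carrier A" "E' \<in> carrier A"
    and "\<And>i. i \<le> m \<Longrightarrow> b i \<in> carrier A" "\<And>i. i \<le> m \<Longrightarrow> b' i \<in> carrier A"
  shows "spx m E b \<otimes>\<^bsub>lev D m\<^esub> spx m E' b' =
    spx m (E \<otimes> E') (\<lambda>i. E \<otimes> b' i \<oplus> E' \<otimes> b i \<oplus> t \<otimes> (b i \<otimes> b' i))"
proof -
  have 0: "b 0 \<in> carrier A" "b' 0 \<in> carrier A"
    using assms(3)[of 0] assms(4)[of 0] by auto
  have *: "(E \<oplus> t \<otimes> b 0) \<otimes> (b' i \<ominus> b' 0) \<oplus> (E' \<oplus> t \<otimes> b' 0) \<otimes> (b i \<ominus> b 0) \<oplus>
      t \<otimes> ((b i \<ominus> b 0) \<otimes> (b' i \<ominus> b' 0)) =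
      E \<otimes> b' i \<oplus> E' \<otimes> b i \<oplus> t \<otimes> (b i \<otimes> b' i) \<ominus> (E \<otimes> b' 0 \<oplus> E' \<otimes> b 0 \<oplus> t \<otimes> (b 0 \<otimes> b' 0))"
    if "i \<le> m" for i
    using assms(1,2) assms(3)[OF that] assms(4)[OF that] 0 t_closed by algebra
  have "(E \<oplus> t \<otimes> b 0) \<otimes> (E' \<oplus> t \<otimes> b' 0) =
      E \<otimes> E' \<oplus> t \<otimes> (E \<otimes> b' 0 \<oplus> E' \<otimes> b 0 \<oplus> t \<otimes> (b 0 \<otimes> b' 0))"
    using assms(1,2) 0 t_closed by algebra
  with * show ?thesis
    by (auto simp: spx_def mult_D restrict_def)
qed

text \<open>Only the vertices and the differences of the \<open>b i\<close> matter, so a multiple of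
  \<open>t\<close> may be moved from \<open>E\<close> into all \<open>b i\<close> at once. This is
  what allows an integer \<open>E\<close> to be reduced modulo \<open>N\<close>.\<close>

lemma spx_shift:
  assumes "E \<in> carrier A" "c \<in> carrier A" "\<And>i. i \<le> m \<Longrightarrow> b i \<in> carrier A"
  shows "spx m (E \<oplus> t \<otimes> c) b = spx m E (\<lambda>i. b i \<oplus> c)"
proof -
  have *: "b i \<oplus> c \<ominus> (b 0 \<oplus> c) = b i \<ominus> b 0" if "i \<le> m" for i
    using assms(2) assms(3)[OF that] assms(3)[of 0, simplified] by algebra
  have "E \<oplus> t \<otimes> c \<oplus> t \<otimes> b 0 = E \<oplus> t \<otimes> (b 0 \<oplus> c)"
    using assms(1,2) assms(3)[of 0, simplified] t_closed by algebra
  with * show ?thesis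
    by (auto simp: spx_def restrict_def)
qed

lemma rop_spx:
  assumes "\<theta> \<in> Dmaps m k" "E \<in> carrier A" "\<And>i. i \<le> k \<Longrightarrow> b i \<in> carrier A"
  shows "rop D m k \<theta> (spx k E b) = spx m E (\<lambda>i. b (\<theta> i))"
proof -
  have le: "\<theta> i \<le> k" if "i \<le> m" for i
    using assms(1) that by (rule Dmaps_le)
  have *: "b (\<theta> i) \<ominus> b 0 \<ominus> (b (\<theta> 0) \<ominus> b 0) = b (\<theta> i) \<ominus> b (\<theta> 0)" if "i \<le> m" for i
    using assms(3)[OF le[OF that]] assms(3)[OF le[of 0, simplified]] assms(3)[of 0, simplified] by algebra
  have "E \<oplus> t \<otimes> b 0 \<oplus> t \<otimes> (b (\<theta> 0) \<ominus> b 0) = E \<oplus> t \<otimes> b (\<theta> 0)"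
    using assms(2) assms(3)[OF le[of 0, simplified]] assms(3)[of 0, simplified] t_closed by algebra
  with * show ?thesis
    using le by (auto simp: spx_def rop_D restrict_def)
qed

end

section \<open>Edges and triangles in the resolution\<close>

locale resolution =
  fixes P :: "'b sring" and \<epsilon> :: "'b \<Rightarrow> int" and N :: int
  assumes N_gt_1: "N > 1" and res: "free_resolution P \<epsilon> (residue_ring N)"
begin

sublocale R: residues N "residue_ring N"
  using N_gt_1 by unfold_locales auto

abbreviation "Pc m \<equiv> carrier (lev P m)"

definition vx :: "nat \<Rightarrow> nat \<Rightarrow> 'b \<Rightarrow> 'b" where
  "vx m i x = rop P 0 m (vertex_map i) x"

lemma simplicial: "simplicial_cring P"
  using res by (simp add: free_resolution_def free_sring_def)

lemma cring_P [simp]: "cring (lev P m)"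
  using simplicial by (simp add: simplicial_cring_def)

sublocale P: plain_cring "lev P m" for m
  by (simp add: plain_cring_def)

lemma rop_hom: "\<theta> \<in> Dmaps m k \<Longrightarrow> rop P m k \<theta> \<in> ring_hom (lev P k) (lev P m)"
  using simplicial by (simp add: simplicial_cring_def)

lemma rop_comp:
  "\<lbrakk>\<theta> \<in> Dmaps l m; \<sigma> \<in> Dmaps m k; x \<in> Pc k\<rbrakk> \<Longrightarrow>
    rop P l m \<theta> (rop P m k \<sigma> x) = rop P l k (compose {..l} \<sigma> \<theta>) x"
  using simplicial by (simp add: simplicial_cring_def)

lemma rop_closed [simp]: "\<lbrakk>\<theta> \<in> Dmaps m k; x \<in> Pc k\<rbrakk> \<Longrightarrow> rop P m k \<theta> x \<in> Pc m"
  using ring_hom_closed[OF rop_hom] .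

lemma vx_closed [simp]: "\<lbrakk>i \<le> m; x \<in> Pc m\<rbrakk> \<Longrightarrow> vx m i x \<in> Pc 0"
  by (simp add: vx_def)

lemma vx_hom: "i \<le> m \<Longrightarrow> vx m i \<in> ring_hom (lev P m) (lev P 0)"
  unfolding vx_def[abs_def] by (rule rop_hom) simp

lemma vx_simps [simp]:
  "\<lbrakk>i \<le> m; x \<in> Pc m; y \<in> Pc m\<rbrakk> \<Longrightarrow> vx m i (x \<oplus>\<^bsub>lev P m\<^esub> y) = vx m i x \<oplus>\<^bsub>lev P 0\<^esub> vx m i y"
  "\<lbrakk>i \<le> m; x \<in> Pc m; y \<in> Pc m\<rbrakk> \<Longrightarrow> vx m i (x \<otimes>\<^bsub>lev P m\<^esub> y) = vx m i x \<otimes>\<^bsub>lev P 0\<^esub> vx m i y"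
  "i \<le> m \<Longrightarrow> vx m i \<one>\<^bsub>lev P m\<^esub> = \<one>\<^bsub>lev P 0\<^esub>"
  "\<lbrakk>i \<le> m; x \<in> Pc m\<rbrakk> \<Longrightarrow> vx m i ([(z::int)] \<cdot>\<^bsub>lev P m\<^esub> x) = [z] \<cdot>\<^bsub>lev P 0\<^esub> vx m i x"
  "\<lbrakk>i \<le> m; x \<in> Pc m\<rbrakk> \<Longrightarrow> vx m i ([(n::nat)] \<cdot>\<^bsub>lev P m\<^esub> x) = [n] \<cdot>\<^bsub>lev P 0\<^esub> vx m i x"
  using ring_hom_add[OF vx_hom] ring_hom_mult[OF vx_hom] ring_hom_one[OF vx_hom]
    ring_hom_int_mult[OF vx_hom] ring_hom_nat_mult[OF vx_hom] by auto

lemma vx_rop: "\<lbrakk>\<theta> \<in> Dmaps l m; i \<le> l; x \<in> Pc m\<rbrakk> \<Longrightarrow> vx l i (rop P l m \<theta> x) = vx m (\<theta> i) x"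
  by (simp add: vx_def rop_comp)

lemma eps_hom: "\<epsilon> \<in> ring_hom (lev P 0) (residue_ring N)"
  using res by (simp add: free_resolution_def)

lemma eps_equiv: "discrete_equiv (underlying P) (carrier (residue_ring N)) \<epsilon>"
  using res by (simp add: free_resolution_def)

lemma underlying_simps [simp]: "cells (underlying P) = Pc" "sop (underlying P) = rop P"
  by (simp_all add: underlying_def fun_eq_iff)

lemma sface_P: "sface (underlying P) k i = rop P k (Suc k) (coface k i)"
  by (simp add: sface_def fun_eq_iff)

lemma eps_edge: "e \<in> Pc (Suc 0) \<Longrightarrow> \<epsilon> (vx (Suc 0) 0 e) = \<epsilon> (vx (Suc 0) (Suc 0) e)"
  using eps_equiv by (auto simp: discrete_equiv_def sface_P coface_eqs vx_def)

lemma eps_vx: "\<lbrakk>x \<in> Pc m; i \<le> m\<rbrakk> \<Longrightarrow> \<epsilon> (vx m i x) = \<epsilon> (vx m 0 x)"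
  using eps_edge[of "rop P (Suc 0) m (edge_map 0 i) x"] by (simp add: vx_rop)

lemma edge_exists:
  assumes "x \<in> Pc 0" "y \<in> Pc 0" "\<epsilon> x = \<epsilon> y"
  shows "\<exists>e\<in>Pc (Suc 0). vx (Suc 0) 0 e = x \<and> vx (Suc 0) (Suc 0) e = y"
  using eps_equiv assms by (simp add: discrete_equiv_def sface_P coface_eqs vx_def)

lemma triangle_exists:
  assumes "u \<in> Pc (Suc 0)" "v \<in> Pc (Suc 0)" "w \<in> Pc (Suc 0)"
    and "vx (Suc 0) 0 u = vx (Suc 0) 0 w" "vx (Suc 0) (Suc 0) u = vx (Suc 0) 0 v" "vx (Suc 0) (Suc 0) v = vx (Suc 0) (Suc 0) w"
  shows "\<exists>z\<in>Pc 2. rop P (Suc 0) 2 (edge_map 0 (Suc 0)) z = u \<and> rop P (Suc 0) 2 (edge_map (Suc 0) 2) z = v \<and>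
    rop P (Suc 0) 2 (edge_map 0 2) z = w"
proof -
  \<comment> \<open>Face \<open>i\<close> omits vertex \<open>i\<close>, so \<open>v\<close>,
    \<open>w\<close>, \<open>u\<close> are the faces 0, 1, 2.\<close>
  let ?y = "\<lambda>i::nat. if i = 0 then v else if i = 1 then w else u"
  have fill: "(\<forall>i \<le> Suc (Suc 0). y i \<in> cells (underlying P) (Suc 0)) \<and>
            (\<forall>i j. i < j \<and> j \<le> Suc (Suc 0) \<longrightarrow>
                sface (underlying P) 0 i (y j) = sface (underlying P) 0 (j - 1) (y i)) \<longrightarrow>
        (\<exists>z \<in> cells (underlying P) (Suc (Suc 0)). \<forall>i \<le> Suc (Suc 0). sface (underlying P) (Suc 0) i z = y i)" for y
    using eps_equiv unfolding discrete_equiv_def by blast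
  have "\<exists>z \<in> cells (underlying P) (Suc (Suc 0)). \<forall>i \<le> Suc (Suc 0). sface (underlying P) (Suc 0) i z = ?y i"
  proof (rule fill[THEN mp], intro conjI allI impI)
    fix i j :: nat
    assume "i < j \<and> j \<le> Suc (Suc 0)"
    then consider "i = 0" "j = 1" | "i = 0" "j = 2" | "i = 1" "j = 2"
      by linarith
    then show "sface (underlying P) 0 i (?y j) = sface (underlying P) 0 (j - 1) (?y i)"
      using assms by cases (simp_all add: sface_P coface_eqs vx_def)
  qed (use assms in simp)
  then obtain z where z: "z \<in> cells (underlying P) (Suc (Suc 0))"
    "\<And>i. i \<le> Suc (Suc 0) \<Longrightarrow> sface (underlying P) (Suc 0) i z = ?y i" by blast
  show ?thesis
    using z(1) z(2)[of 0] z(2)[of 1] z(2)[of 2]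
    by (intro bexI[of _ z]) (simp_all add: sface_P coface_eqs numeral_2_eq_2)
qed

lemma eps_simps [simp]:
  "\<lbrakk>x \<in> Pc 0; y \<in> Pc 0\<rbrakk> \<Longrightarrow> \<epsilon> (x \<oplus>\<^bsub>lev P 0\<^esub> y) = (\<epsilon> x + \<epsilon> y) mod N"
  "\<lbrakk>x \<in> Pc 0; y \<in> Pc 0\<rbrakk> \<Longrightarrow> \<epsilon> (x \<otimes>\<^bsub>lev P 0\<^esub> y) = (\<epsilon> x * \<epsilon> y) mod N"
  "\<epsilon> \<one>\<^bsub>lev P 0\<^esub> = 1"
  using ring_hom_add[OF eps_hom] ring_hom_mult[OF eps_hom] ring_hom_one[OF eps_hom]
  by (auto simp: R.res_add_eq R.res_mult_eq R.res_one_eq)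

lemma eps_range: "x \<in> Pc 0 \<Longrightarrow> 0 \<le> \<epsilon> x \<and> \<epsilon> x < N"
  using ring_hom_closed[OF eps_hom] by (auto simp: R.res_carrier_eq)

abbreviation cst :: "nat \<Rightarrow> int \<Rightarrow> 'b" where
  "cst m z \<equiv> [z] \<cdot>\<^bsub>lev P m\<^esub> \<one>\<^bsub>lev P m\<^esub>"

lemma eps_cst [simp]: "\<epsilon> (cst 0 z) = z mod N"
proof -
  have "\<epsilon> (cst 0 z) = [z] \<cdot>\<^bsub>residue_ring N\<^esub> \<one>\<^bsub>residue_ring N\<^esub>"
    using ring_hom_int_mult[OF eps_hom cring_P] R.cring by (simp add: R.res_one_eq)
  also have "\<dots> = z mod N"
  proof -
    have "(\<lambda>z. z mod N) \<in> ring_hom type_ring (residue_ring N)"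
      by (rule ring_hom_memI)
        (use N_gt_1 in \<open>auto simp: R.res_carrier_eq R.res_add_eq R.res_mult_eq R.res_one_eq mod_add_eq mod_mult_eq\<close>)
    from ring_hom_int_mult[OF this cring_type_ring R.cring, of 1 z]
    show ?thesis
      using N_gt_1 by (simp add: R.res_one_eq)
  qed
  finally show ?thesis .
qed

text \<open>An arbitrary choice: by \<open>arrow_eq\<close> the arrow to which a map sends an edge
  depends on the end points only.\<close>

definition edge_from_cst :: "'b \<Rightarrow> 'b" where
  "edge_from_cst x = (SOME e. e \<in> Pc (Suc 0) \<and> vx (Suc 0) 0 e = cst 0 (\<epsilon> x) \<and> vx (Suc 0) (Suc 0) e = x)"

lemma edge_from_cst:
  assumes "x \<in> Pc 0"
  shows "edge_from_cst x \<in> Pc (Suc 0)" "vx (Suc 0) 0 (edge_from_cst x) = cst 0 (\<epsilon> x)" "vx (Suc 0) (Suc 0) (edge_from_cst x) = x"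
proof -
  have "\<exists>e\<in>Pc (Suc 0). vx (Suc 0) 0 e = cst 0 (\<epsilon> x) \<and> vx (Suc 0) (Suc 0) e = x"
    by (rule edge_exists) (use assms eps_range[OF assms] in auto)
  then have "\<exists>e. e \<in> Pc (Suc 0) \<and> vx (Suc 0) 0 e = cst 0 (\<epsilon> x) \<and> vx (Suc 0) (Suc 0) e = x"
    by blast
  from someI_ex[OF this]
  show "edge_from_cst x \<in> Pc (Suc 0)" "vx (Suc 0) 0 (edge_from_cst x) = cst 0 (\<epsilon> x)" "vx (Suc 0) (Suc 0) (edge_from_cst x) = x"
    by (simp_all add: edge_from_cst_def)
qed

end

lemma (in ring) a_minus_zero_right [simp]: "a \<in> carrier R \<Longrightarrow> a \<ominus> \<zero> = a"
  by (simp add: minus_eq)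

section \<open>Maps from the resolution to the derived quotient\<close>

locale quotient_mapping = cring_with_element A t + resolution P \<epsilon> N
  for A :: "'a ring" (structure) and t and P :: "'b sring" and \<epsilon> and N
begin

abbreviation "M \<equiv> mapping_space P D"

abbreviation sc :: "int \<Rightarrow> 'a" where
  "sc z \<equiv> [z] \<cdot> \<one>"

lemma sc_add: "sc (x + y) = sc x \<oplus> sc y"
  by (rule add.int_pow_mult) simp

lemma sc_mult: "sc (x * y) = sc x \<otimes> sc y"
  by (simp add: add_pow_ldistr_int add_pow_rdistr_int add.int_pow_pow mult.commute)


lemma int_mult_eq: "x \<in> carrier A \<Longrightarrow> [(z::int)] \<cdot> x = sc z \<otimes> x"
  by (simp add: add_pow_ldistr_int)

text \<open>A map from \<open>P\<close> to \<open>D\<close> is encoded by the function sending \<open>x\<close> to the arrow that is the image of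
  an edge from the constant \<open>\<epsilon> x\<close> to \<open>x\<close>; the element \<open>f\<close> is its value at \<open>N\<close>.\<close>

definition coord :: "'a \<Rightarrow> ('b \<Rightarrow> 'a) \<Rightarrow> bool" where
  "coord f b \<longleftrightarrow> (\<forall>x\<in>Pc 0. b x \<in> carrier A) \<and> b \<one>\<^bsub>lev P 0\<^esub> = \<zero> \<and>
     (\<forall>x\<in>Pc 0. \<forall>y\<in>Pc 0.
        b (x \<oplus>\<^bsub>lev P 0\<^esub> y) = b x \<oplus> b y \<oplus> sc ((\<epsilon> x + \<epsilon> y) div N) \<otimes> f \<and>
        b (x \<otimes>\<^bsub>lev P 0\<^esub> y) = sc (\<epsilon> x) \<otimes> b y \<oplus> sc (\<epsilon> y) \<otimes> b x \<oplus> t \<otimes> (b x \<otimes> b y) \<oplus>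
          sc ((\<epsilon> x * \<epsilon> y) div N) \<otimes> f)"

lemma coord_closed: "\<lbrakk>coord f b; x \<in> Pc 0\<rbrakk> \<Longrightarrow> b x \<in> carrier A"
  and coord_one: "coord f b \<Longrightarrow> b \<one>\<^bsub>lev P 0\<^esub> = \<zero>"
  by (auto simp: coord_def)

lemma coordD:
  assumes "coord f b" "x \<in> Pc 0" "y \<in> Pc 0"
  shows "b (x \<oplus>\<^bsub>lev P 0\<^esub> y) = b x \<oplus> b y \<oplus> sc ((\<epsilon> x + \<epsilon> y) div N) \<otimes> f"
    "b (x \<otimes>\<^bsub>lev P 0\<^esub> y) = sc (\<epsilon> x) \<otimes> b y \<oplus> sc (\<epsilon> y) \<otimes> b x \<oplus> t \<otimes> (b x \<otimes> b y) \<oplus>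
       sc ((\<epsilon> x * \<epsilon> y) div N) \<otimes> f"
  using assms by (auto simp: coord_def)

text \<open>The map with vertex data \<open>b 0\<close>, ..., \<open>b K\<close>. All vertices of
  \<open>x\<close> have the same augmentation, so it may be taken at vertex 0, and vertex
  \<open>i\<close> of \<open>x\<close> goes to this integer plus \<open>t\<close> times the value of
  \<open>b (\<sigma> i)\<close>.\<close>

definition simplex :: "nat \<Rightarrow> (nat \<Rightarrow> 'b \<Rightarrow> 'a) \<Rightarrow> nat \<Rightarrow> (nat \<Rightarrow> nat) \<Rightarrow> 'b \<Rightarrow> 'a \<times> (nat \<Rightarrow> 'a)" where
  "simplex K b = (\<lambda>m. \<lambda>\<sigma>\<in>Dmaps m K. \<lambda>x\<in>Pc m. spx m (sc (\<epsilon> (vx m 0 x))) (\<lambda>i. b (\<sigma> i) (vx m i x)))"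

lemma simplex_cong:
  assumes "\<And>i x. \<lbrakk>i \<le> K; x \<in> Pc 0\<rbrakk> \<Longrightarrow> b i x = b' i x"
  shows "simplex K b = simplex K b'"
  unfolding simplex_def using assms
  by (intro ext restrict_ext spx_cong) (auto simp: Dmaps_le)

lemma cells_M: "z \<in> cells M K \<longleftrightarrow>
    (\<forall>m. z m \<in> (\<Pi>\<^sub>E \<sigma> \<in> Dmaps m K. rhom (lev P m) (lev D m))) \<and>
    (\<forall>l m. \<forall>\<theta> \<in> Dmaps l m. \<forall>\<sigma> \<in> Dmaps m K. \<forall>x \<in> Pc m.
       z l (compose {..l} \<sigma> \<theta>) (rop P l m \<theta> x) = rop D l m \<theta> (z m \<sigma> x))"
  by (simp add: mapping_space_def)

lemma sop_M: "sop M j k \<alpha> z = (\<lambda>m. \<lambda>\<sigma>\<in>Dmaps m j. z m (compose {..m} \<alpha> \<sigma>))"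
  by (simp add: mapping_space_def)

text \<open>Since \<open>t f = N\<close>, removing \<open>z div N\<close> copies of \<open>N\<close>
  from an integer costs as many copies of \<open>f\<close> behind \<open>t\<close>.\<close>

lemma mod_shift:
  assumes f: "f \<in> carrier A" "t \<otimes> f = sc N"
  shows "sc z = sc (z mod N) \<oplus> t \<otimes> (sc (z div N) \<otimes> f)"
proof -
  have "t \<otimes> (sc (z div N) \<otimes> f) = sc (z div N) \<otimes> (t \<otimes> f)"
    using f(1) t_closed by (simp add: m_lcomm)
  also have "\<dots> = sc (z div N * N)"
    by (simp only: f sc_mult)
  finally have "sc (z mod N) \<oplus> t \<otimes> (sc (z div N) \<otimes> f) = sc (z mod N + z div N * N)"
    by (simp only: sc_add)
  then show ?thesis by simp
qed

text \<open>Sums and products of reduced residues need not be reduced. \<open>mod_shift\<close> and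
  \<open>spx_shift\<close> move the excess into the arrows, where it meets exactly the carry terms
  in \<open>coord\<close>.\<close>

lemma simplex_hom:
  assumes f: "f \<in> carrier A" "t \<otimes> f = sc N"
    and b: "\<And>i. i \<le> K \<Longrightarrow> coord f (b i)" and \<sigma>: "\<sigma> \<in> Dmaps m K"
  shows "(\<lambda>x. spx m (sc (\<epsilon> (vx m 0 x))) (\<lambda>i. b (\<sigma> i) (vx m i x))) \<in> ring_hom (lev P m) (lev D m)"
proof (rule ring_hom_memI)
  have c: "coord f (b (\<sigma> i))" if "i \<le> m" for i
    by (rule b) (rule Dmaps_le[OF \<sigma> that])
  have cl: "b (\<sigma> i) (vx m i x) \<in> carrier A" if "i \<le> m" "x \<in> Pc m" for i x
    using coord_closed[OF c] that by simp
  fix x assume x: "x \<in> Pc m"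
  show "spx m (sc (\<epsilon> (vx m 0 x))) (\<lambda>i. b (\<sigma> i) (vx m i x)) \<in> carrier (lev D m)"
    by (rule spx_closed) (use cl x in auto)
  fix y assume y: "y \<in> Pc m"
  have ex: "\<epsilon> (vx m i x) = \<epsilon> (vx m 0 x)" "\<epsilon> (vx m i y) = \<epsilon> (vx m 0 y)" if "i \<le> m" for i
    using eps_vx[OF x that] eps_vx[OF y that] by simp_all
  show "spx m (sc (\<epsilon> (vx m 0 (x \<oplus>\<^bsub>lev P m\<^esub> y)))) (\<lambda>i. b (\<sigma> i) (vx m i (x \<oplus>\<^bsub>lev P m\<^esub> y))) =
      spx m (sc (\<epsilon> (vx m 0 x))) (\<lambda>i. b (\<sigma> i) (vx m i x)) \<oplus>\<^bsub>lev D m\<^esub>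
      spx m (sc (\<epsilon> (vx m 0 y))) (\<lambda>i. b (\<sigma> i) (vx m i y))"
    (is "?L = ?R")
  proof -
    let ?s = "\<epsilon> (vx m 0 x) + \<epsilon> (vx m 0 y)"
    have "?R = spx m (sc ?s) (\<lambda>i. b (\<sigma> i) (vx m i x) \<oplus> b (\<sigma> i) (vx m i y))"
      using cl x y by (simp add: spx_add sc_add)
    also have "\<dots> = spx m (sc (?s mod N)) (\<lambda>i. b (\<sigma> i) (vx m i x) \<oplus> b (\<sigma> i) (vx m i y) \<oplus> sc (?s div N) \<otimes> f)"
      by (subst mod_shift[OF f]) (use cl x y f in \<open>auto intro!: spx_shift\<close>)
    also have "\<dots> = ?L"
    proof -
      have "b (\<sigma> i) (vx m i (x \<oplus>\<^bsub>lev P m\<^esub> y)) = b (\<sigma> i) (vx m i x) \<oplus> b (\<sigma> i) (vx m i y) \<oplus> sc (?s div N) \<otimes> f" if "i \<le> m" for i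
        using x y ex[OF that] coordD(1)[OF c[OF that], of "vx m i x" "vx m i y"] that by simp
      then show ?thesis
        using x y by (auto intro!: spx_cong)
    qed
    finally show ?thesis by simp
  qed
  show "spx m (sc (\<epsilon> (vx m 0 (x \<otimes>\<^bsub>lev P m\<^esub> y)))) (\<lambda>i. b (\<sigma> i) (vx m i (x \<otimes>\<^bsub>lev P m\<^esub> y))) =
      spx m (sc (\<epsilon> (vx m 0 x))) (\<lambda>i. b (\<sigma> i) (vx m i x)) \<otimes>\<^bsub>lev D m\<^esub>
      spx m (sc (\<epsilon> (vx m 0 y))) (\<lambda>i. b (\<sigma> i) (vx m i y))"
    (is "?L = ?R")
  proof -
    let ?s = "\<epsilon> (vx m 0 x) * \<epsilon> (vx m 0 y)"
    let ?p = "\<lambda>i. sc (\<epsilon> (vx m 0 x)) \<otimes> b (\<sigma> i) (vx m i y) \<oplus> sc (\<epsilon> (vx m 0 y)) \<otimes> b (\<sigma> i) (vx m i x) \<oplus>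
        t \<otimes> (b (\<sigma> i) (vx m i x) \<otimes> b (\<sigma> i) (vx m i y))"
    have "?R = spx m (sc ?s) ?p"
      using cl x y by (simp add: spx_mult sc_mult)
    also have "\<dots> = spx m (sc (?s mod N)) (\<lambda>i. ?p i \<oplus> sc (?s div N) \<otimes> f)"
      by (subst mod_shift[OF f]) (use cl x y f in \<open>auto intro!: spx_shift\<close>)
    also have "\<dots> = ?L"
    proof -
      have "b (\<sigma> i) (vx m i (x \<otimes>\<^bsub>lev P m\<^esub> y)) = ?p i \<oplus> sc (?s div N) \<otimes> f" if "i \<le> m" for i
        using x y ex[OF that] coordD(2)[OF c[OF that], of "vx m i x" "vx m i y"] that by simp
      then show ?thesis
        using x y by (auto intro!: spx_cong)
    qed
    finally show ?thesis by simp
  qed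
next
  have "b (\<sigma> i) \<one>\<^bsub>lev P 0\<^esub> = \<zero>" if "i \<le> m" for i
    by (rule coord_one[OF b]) (rule Dmaps_le[OF \<sigma> that])
  then have "spx m (sc (\<epsilon> (vx m 0 \<one>\<^bsub>lev P m\<^esub>))) (\<lambda>i. b (\<sigma> i) (vx m i \<one>\<^bsub>lev P m\<^esub>)) = spx m \<one> (\<lambda>_. \<zero>)"
    by (auto intro!: spx_cong)
  then show "spx m (sc (\<epsilon> (vx m 0 \<one>\<^bsub>lev P m\<^esub>))) (\<lambda>i. b (\<sigma> i) (vx m i \<one>\<^bsub>lev P m\<^esub>)) = \<one>\<^bsub>lev D m\<^esub>"
    by (simp add: spx_one)
qed

lemma simplex_cell:
  assumes f: "f \<in> carrier A" "t \<otimes> f = sc N" and b: "\<And>i. i \<le> K \<Longrightarrow> coord f (b i)"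
  shows "simplex K b \<in> cells M K"
  unfolding cells_M
proof (intro conjI allI ballI)
  fix m
  show "simplex K b m \<in> (\<Pi>\<^sub>E \<sigma> \<in> Dmaps m K. rhom (lev P m) (lev D m))"
    using simplex_hom[OF f, of K b] b by (auto simp: simplex_def intro!: ring_hom_restrict)
next
  fix l m \<theta> \<sigma> x
  assume *: "\<theta> \<in> Dmaps l m" "\<sigma> \<in> Dmaps m K" "x \<in> Pc m"
  have cl: "b (\<sigma> i) (vx m i x) \<in> carrier A" if "i \<le> m" for i
    using coord_closed[OF b] * that Dmaps_le by simp
  have "simplex K b l (compose {..l} \<sigma> \<theta>) (rop P l m \<theta> x) =
      spx l (sc (\<epsilon> (vx m (\<theta> 0) x))) (\<lambda>i. b (\<sigma> (\<theta> i)) (vx m (\<theta> i) x))"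
  proof -
    have "b (compose {..l} \<sigma> \<theta> i) (vx l i (rop P l m \<theta> x)) = b (\<sigma> (\<theta> i)) (vx m (\<theta> i) x)" if "i \<le> l" for i
      using * that by (simp add: vx_rop compose_eq)
    from spx_cong[OF this, of l] show ?thesis
      using * compose_Dmaps[OF *(1,2)] by (simp add: simplex_def vx_rop[of \<theta> l m 0])
  qed
  also have "\<epsilon> (vx m (\<theta> 0) x) = \<epsilon> (vx m 0 x)"
    using * eps_vx[of x m "\<theta> 0"] Dmaps_le[of \<theta> l m 0] by simp
  finally show "simplex K b l (compose {..l} \<sigma> \<theta>) (rop P l m \<theta> x) = rop D l m \<theta> (simplex K b m \<sigma> x)"
    using * cl by (simp add: simplex_def rop_spx)
qed

lemma sop_simplex:
  assumes "\<alpha> \<in> Dmaps j K"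
  shows "sop M j K \<alpha> (simplex K b) = simplex j (\<lambda>i. b (\<alpha> i))"
proof (intro ext)
  fix m \<sigma> x
  show "sop M j K \<alpha> (simplex K b) m \<sigma> x = simplex j (\<lambda>i. b (\<alpha> i)) m \<sigma> x"
    using assms compose_Dmaps[of \<sigma> m j \<alpha> K]
    by (auto simp: sop_M simplex_def restrict_def compose_eq intro!: spx_cong)
qed

section \<open>Recovering a simplex of the mapping space from its arrows\<close>

definition arrow :: "(nat \<Rightarrow> (nat \<Rightarrow> nat) \<Rightarrow> 'b \<Rightarrow> 'a \<times> (nat \<Rightarrow> 'a)) \<Rightarrow> nat \<Rightarrow> nat \<Rightarrow> 'b \<Rightarrow> 'a" where
  "arrow z i j x = snd (z (Suc 0) (edge_map i j) x) (Suc 0)"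

text \<open>The edge \<open>edge_map i i\<close> is degenerate, so only the \<open>i\<close>-th
  vertex of \<open>z\<close> enters.\<close>

definition coord_of :: "(nat \<Rightarrow> (nat \<Rightarrow> nat) \<Rightarrow> 'b \<Rightarrow> 'a \<times> (nat \<Rightarrow> 'a)) \<Rightarrow> nat \<Rightarrow> 'b \<Rightarrow> 'a" where
  "coord_of z i x = arrow z i i (edge_from_cst x)"

lemma coord_of_sop: "\<alpha> \<in> Dmaps j K \<Longrightarrow> i \<le> j \<Longrightarrow> coord_of (sop M j K \<alpha> z) i = coord_of z (\<alpha> i)"
  by (simp add: coord_of_def arrow_def sop_M fun_eq_iff)

context
  fixes z K
  assumes z: "z \<in> cells M K"
begin

lemma cell_hom: "\<sigma> \<in> Dmaps m K \<Longrightarrow> z m \<sigma> \<in> ring_hom (lev P m) (lev D m)"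
  using z by (auto simp: cells_M rhom_def PiE_iff)

lemma cell_ext: "\<sigma> \<in> Dmaps m K \<Longrightarrow> z m \<sigma> \<in> extensional (Pc m)" "z m \<in> extensional (Dmaps m K)"
  using z by (auto simp: cells_M rhom_def PiE_iff)

lemma cell_nat:
  "\<lbrakk>\<theta> \<in> Dmaps l m; \<sigma> \<in> Dmaps m K; x \<in> Pc m\<rbrakk> \<Longrightarrow>
    z l (compose {..l} \<sigma> \<theta>) (rop P l m \<theta> x) = rop D l m \<theta> (z m \<sigma> x)"
  using z by (simp add: cells_M)

lemma cell_closed:
  assumes "\<sigma> \<in> Dmaps m K" "x \<in> Pc m"
  shows "fst (z m \<sigma> x) \<in> carrier A" "i \<le> m \<Longrightarrow> snd (z m \<sigma> x) i \<in> carrier A"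
    "snd (z m \<sigma> x) 0 = \<zero>" "snd (z m \<sigma> x) \<in> extensional {..m}"
  using ring_hom_closed[OF cell_hom assms(2), OF assms(1)] by (auto simp: carrier_D PiE_iff)

lemma arrow_closed [simp]:
  "\<lbrakk>i \<le> j; j \<le> K; x \<in> Pc (Suc 0)\<rbrakk> \<Longrightarrow> arrow z i j x \<in> carrier A"
  unfolding arrow_def by (rule cell_closed) auto

lemma coord_of_closed [simp]: "\<lbrakk>i \<le> K; x \<in> Pc 0\<rbrakk> \<Longrightarrow> coord_of z i x \<in> carrier A"
  using edge_from_cst[of x] by (simp add: coord_of_def)

text \<open>The target is the nerve of a groupoid: the long edge of a triangle is the composite of
  the other two, and arrows compose by addition.\<close>

lemma arrow_triangle:
  assumes "i \<le> j" "j \<le> k" "k \<le> K" "w \<in> Pc 2"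
  shows "arrow z i k (rop P (Suc 0) 2 (edge_map 0 2) w) =
    arrow z i j (rop P (Suc 0) 2 (edge_map 0 (Suc 0)) w) \<oplus> arrow z j k (rop P (Suc 0) 2 (edge_map (Suc 0) 2) w)"
proof -
  let ?\<sigma> = "triangle_map i j k"
  obtain a g where ag: "z 2 ?\<sigma> w = (a, g)" by force
  have \<sigma>: "?\<sigma> \<in> Dmaps 2 K" using assms by simp
  have g: "g 0 = \<zero>" "g (Suc 0) \<in> carrier A" "g 2 \<in> carrier A"
    using cell_closed[OF \<sigma> assms(4)] by (auto simp: ag)
  have "arrow z (?\<sigma> q) (?\<sigma> r) (rop P (Suc 0) 2 (edge_map q r) w) = g r \<ominus> g q" if "q \<le> r" "r \<le> 2" for q r
    using cell_nat[of "edge_map q r" "Suc 0" 2 ?\<sigma> w] \<sigma> assms(4) that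
    by (simp add: arrow_def rop_D ag)
  from this[of 0 2] this[of 0 "Suc 0"] this[of "Suc 0" 2] show ?thesis
    using g by simp
qed

lemma arrow_add:
  assumes "i \<le> j" "j \<le> K" "x \<in> Pc (Suc 0)" "y \<in> Pc (Suc 0)"
  shows "arrow z i j (x \<oplus>\<^bsub>lev P (Suc 0)\<^esub> y) = arrow z i j x \<oplus> arrow z i j y"
  using ring_hom_add[OF cell_hom[of "edge_map i j" "Suc 0"] assms(3,4)] assms by (simp add: arrow_def add_D)

lemma arrow_one: "\<lbrakk>i \<le> j; j \<le> K\<rbrakk> \<Longrightarrow> arrow z i j \<one>\<^bsub>lev P (Suc 0)\<^esub> = \<zero>"
  using ring_hom_one[OF cell_hom[of "edge_map i j" "Suc 0"]] by (simp add: arrow_def one_D)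

lemma arrow_zero: "\<lbrakk>i \<le> j; j \<le> K\<rbrakk> \<Longrightarrow> arrow z i j \<zero>\<^bsub>lev P (Suc 0)\<^esub> = \<zero>"
  using arrow_add[of i j "\<zero>\<^bsub>lev P (Suc 0)\<^esub>" "\<zero>\<^bsub>lev P (Suc 0)\<^esub>"] by (simp add: add.l_cancel_one)

lemma arrow_nat_mult:
  "\<lbrakk>i \<le> j; j \<le> K; x \<in> Pc (Suc 0)\<rbrakk> \<Longrightarrow> arrow z i j ([(n::nat)] \<cdot>\<^bsub>lev P (Suc 0)\<^esub> x) = [n] \<cdot> arrow z i j x"
  by (induction n) (simp_all add: arrow_zero arrow_add)

lemma arrow_int_mult:
  assumes "i \<le> j" "j \<le> K" "x \<in> Pc (Suc 0)" "q \<ge> 0"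
  shows "arrow z i j ([(q::int)] \<cdot>\<^bsub>lev P (Suc 0)\<^esub> x) = [q] \<cdot> arrow z i j x"
  using arrow_nat_mult[OF assms(1-3), of "nat q"] assms by (simp add: add_pow_int_ge)

lemma arrow_cst: "\<lbrakk>i \<le> j; j \<le> K; q \<ge> 0\<rbrakk> \<Longrightarrow> arrow z i j (cst (Suc 0) q) = \<zero>"
  by (simp add: arrow_int_mult arrow_one)

text \<open>Let \<open>s\<close> and \<open>t\<close> be the ends of \<open>x\<close>, with the
  common augmentation \<open>c\<close>. The triangle with sides from \<open>c\<close> to
  \<open>s\<close>, from \<open>s\<close> to \<open>t\<close> and from \<open>c\<close> to
  \<open>t\<close>, placed over \<open>i, i, j\<close>, splits the arrow of its long side into
  \<open>coord_of z i\<close> at \<open>s\<close> and the arrow of \<open>x\<close>. The triangle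
  over \<open>i, j, j\<close> whose first side is constant at \<open>c\<close> identifies that same
  arrow with \<open>coord_of z j\<close> at \<open>t\<close>, because constant edges have zero
  arrow.\<close>

lemma arrow_eq:
  assumes ij: "i \<le> j" "j \<le> K" and x: "x \<in> Pc (Suc 0)"
  shows "arrow z i j x = coord_of z j (vx (Suc 0) (Suc 0) x) \<ominus> coord_of z i (vx (Suc 0) 0 x)"
proof -
  let ?s = "vx (Suc 0) 0 x" and ?t = "vx (Suc 0) (Suc 0) x"
  have st: "?s \<in> Pc 0" "?t \<in> Pc 0" "\<epsilon> ?t = \<epsilon> ?s"
    using x eps_edge by auto
  note es = edge_from_cst[OF st(1)] and et = edge_from_cst[OF st(2)]
  have c: "cst (Suc 0) (\<epsilon> ?s) \<in> Pc (Suc 0)" "\<epsilon> ?s \<ge> 0"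
    using eps_range st(1) by auto
  obtain w where "w \<in> Pc 2" "rop P (Suc 0) 2 (edge_map 0 (Suc 0)) w = edge_from_cst ?s"
      "rop P (Suc 0) 2 (edge_map (Suc 0) 2) w = x" "rop P (Suc 0) 2 (edge_map 0 2) w = edge_from_cst ?t"
    using triangle_exists[OF es(1) x et(1)] es et st by auto
  with arrow_triangle[of i i j w] ij
  have 1: "arrow z i j (edge_from_cst ?t) = coord_of z i ?s \<oplus> arrow z i j x"
    by (simp add: coord_of_def)
  obtain w where "w \<in> Pc 2" "rop P (Suc 0) 2 (edge_map 0 (Suc 0)) w = cst (Suc 0) (\<epsilon> ?s)"
      "rop P (Suc 0) 2 (edge_map (Suc 0) 2) w = edge_from_cst ?t" "rop P (Suc 0) 2 (edge_map 0 2) w = edge_from_cst ?t"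
    using triangle_exists[OF c(1) et(1) et(1)] es et st by auto
  with arrow_triangle[of i j j w] ij c(2)
  have 2: "arrow z i j (edge_from_cst ?t) = coord_of z j ?t"
    using st by (simp add: coord_of_def arrow_cst et del: One_nat_def)
  have "arrow z i j x \<in> carrier A" "coord_of z i ?s \<in> carrier A"
    using ij x st by auto
  moreover have "coord_of z j ?t \<in> carrier A"
    using ij st by auto
  ultimately show ?thesis
    using 1 2 by (simp add: minus_eq_iff)
qed

lemma coord_of_cst_small:
  assumes "i \<le> K" "0 \<le> c" "c < N"
  shows "coord_of z i (cst 0 c) = \<zero>"
  using arrow_eq[of i i "edge_from_cst (cst 0 c)"] edge_from_cst[of "cst 0 c"] assms
  by (simp add: coord_of_def[symmetric] minus_eq r_neg)

text \<open>The constant edge at the integer \<open>N\<close> has zero arrow even between different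
  vertices of the simplex, so the null-homotopy of \<open>N\<close> cannot vary along a
  path.\<close>

lemma coord_of_N:
  assumes "i \<le> j" "j \<le> K"
  shows "coord_of z i (cst 0 N) = coord_of z j (cst 0 N)"
proof -
  have "coord_of z j (cst 0 N) \<ominus> coord_of z i (cst 0 N) = arrow z i j (cst (Suc 0) N)"
    using arrow_eq[of i j "cst (Suc 0) N"] assms by simp
  also have "\<dots> = \<zero>"
    using assms N_gt_1 by (intro arrow_cst) auto
  finally show ?thesis
    using assms by simp
qed

lemma coord_of_cst:
  assumes i: "i \<le> K" and c: "0 \<le> c"
  shows "coord_of z i (cst 0 c) = sc (c div N) \<otimes> coord_of z i (cst 0 N)"
proof -
  \<comment> \<open>The chosen edge at \<open>N\<close> starts at 0, the residue of
    \<open>N\<close>. So \<open>c div N\<close> copies of it, translated by \<open>c mod N\<close>,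
    form an edge from the residue of \<open>c\<close> to \<open>c\<close>.\<close>
  define e where "e = [(c div N)] \<cdot>\<^bsub>lev P (Suc 0)\<^esub> edge_from_cst (cst 0 N) \<oplus>\<^bsub>lev P (Suc 0)\<^esub> cst (Suc 0) (c mod N)"
  have eN: "edge_from_cst (cst 0 N) \<in> Pc (Suc 0)" "vx (Suc 0) 0 (edge_from_cst (cst 0 N)) = \<zero>\<^bsub>lev P 0\<^esub>"
    "vx (Suc 0) (Suc 0) (edge_from_cst (cst 0 N)) = cst 0 N"
    using edge_from_cst[of "cst 0 N"] by auto
  have c': "0 \<le> c div N" "0 \<le> c mod N" "c mod N < N"
    using c N_gt_1 by (auto simp: pos_imp_zdiv_nonneg_iff)
  have e: "e \<in> Pc (Suc 0)" using eN by (simp add: e_def)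
  have "vx (Suc 0) 0 e = cst 0 (c mod N)" "vx (Suc 0) (Suc 0) e = cst 0 c"
    using eN by (simp_all add: e_def P.add.int_pow_pow flip: P.add.int_pow_mult)
  then have "arrow z i i e = coord_of z i (cst 0 c)"
    using arrow_eq[OF _ i e] coord_of_cst_small[OF i c'(2,3)] i by (simp add: minus_eq)
  moreover have "arrow z i i e = [(c div N)] \<cdot> coord_of z i (cst 0 N)"
    unfolding e_def
    using arrow_add[of i i "[(c div N)] \<cdot>\<^bsub>lev P (Suc 0)\<^esub> edge_from_cst (cst 0 N)" "cst (Suc 0) (c mod N)"]
      arrow_cst[of i i "c mod N"] arrow_int_mult[of i i "edge_from_cst (cst 0 N)" "c div N"] eN c' i
    by (simp add: coord_of_def)
  ultimately show ?thesis
    using i int_mult_eq[of "coord_of z i (cst 0 N)" "c div N"] by simp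
qed

text \<open>A ring homomorphism sends integers to integers. Follow the edge from the integer
  \<epsilon> to the vertex: its image starts at that integer and its arrow is the value of
  \<open>coord_of\<close>.\<close>

lemma fst_cell:
  assumes "\<sigma> \<in> Dmaps m K" "x \<in> Pc m"
  shows "fst (z m \<sigma> x) = sc (\<epsilon> (vx m 0 x)) \<oplus> t \<otimes> coord_of z (\<sigma> 0) (vx m 0 x)"
proof -
  let ?i = "\<sigma> 0" and ?x = "vx m 0 x"
  have i: "?i \<le> K" and x: "?x \<in> Pc 0"
    using assms Dmaps_le by auto
  note e = edge_from_cst[OF x]
  obtain a g where ag: "z (Suc 0) (edge_map ?i ?i) (edge_from_cst ?x) = (a, g)" by force
  have ag': "a \<in> carrier A" "g 0 = \<zero>" "g (Suc 0) = coord_of z ?i ?x"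
    using cell_closed[of "edge_map ?i ?i" "Suc 0" "edge_from_cst ?x"] e i by (auto simp: ag coord_of_def arrow_def)
  have v: "z 0 (vertex_map ?i) (vx (Suc 0) q (edge_from_cst ?x)) = rop D 0 (Suc 0) (vertex_map q) (a, g)" if "q \<le> Suc 0" for q
    using cell_nat[of "vertex_map q" 0 "Suc 0" "edge_map ?i ?i" "edge_from_cst ?x"] e i that
    by (cases "q = 0") (auto simp: ag le_Suc_eq simp flip: vx_def)
  have "fst (z 0 (vertex_map ?i) (cst 0 (\<epsilon> ?x))) = sc (\<epsilon> ?x)"
  proof -
    have h: "z 0 (vertex_map ?i) \<in> ring_hom (lev P 0) (lev D 0)"
      using i by (intro cell_hom) simp
    have "fst \<circ> z 0 (vertex_map ?i) \<in> ring_hom (lev P 0) A"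
      by (rule ring_hom_memI)
        (use ring_hom_closed[OF h] ring_hom_add[OF h] ring_hom_mult[OF h] ring_hom_one[OF h] in
          \<open>auto simp: add_D mult_D one_D carrier_D mem_Times_iff\<close>)
    from ring_hom_int_mult[OF this] ring_hom_one[OF this] show ?thesis
      by (simp add: cring_axioms)
  qed
  then have a: "a = sc (\<epsilon> ?x)"
    using v[of 0] e ag' by (simp add: rop_D)
  have "fst (z m \<sigma> x) = fst (rop D 0 m (vertex_map 0) (z m \<sigma> x))"
    using cell_closed[OF assms] by (simp add: rop_D)
  also have "\<dots> = fst (z 0 (vertex_map ?i) ?x)"
    using cell_nat[of "vertex_map 0" 0 m \<sigma> x] assms by (simp add: vx_def)
  also have "\<dots> = a \<oplus> t \<otimes> g (Suc 0)"
    using v[of "Suc 0"] e by (simp add: rop_D)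
  finally show ?thesis
    using a ag' by simp
qed

text \<open>The augmentation of the integer \<open>N\<close> is 0, so there \<open>fst_cell\<close>
  reads \<open>N = 0 + t f\<close>.\<close>

lemma cell_value: "i \<le> K \<Longrightarrow> t \<otimes> coord_of z i (cst 0 N) = sc N"
proof -
  assume i: "i \<le> K"
  have h: "z 0 (vertex_map i) \<in> ring_hom (lev P 0) (lev D 0)"
    using i by (intro cell_hom) simp
  have "fst \<circ> z 0 (vertex_map i) \<in> ring_hom (lev P 0) A"
    by (rule ring_hom_memI)
      (use ring_hom_closed[OF h] ring_hom_add[OF h] ring_hom_mult[OF h] ring_hom_one[OF h] in
        \<open>auto simp: add_D mult_D one_D carrier_D mem_Times_iff\<close>)
  from ring_hom_int_mult[OF this] ring_hom_one[OF this]
  have "fst (z 0 (vertex_map i) (cst 0 N)) = sc N"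
    by (simp add: cring_axioms)
  moreover have "vx 0 0 x = x" if "x \<in> Pc 0" for x
    using simplicial that by (simp add: simplicial_cring_def vx_def flip: Did_0)
  ultimately show ?thesis
    using fst_cell[of "vertex_map i" 0 "cst 0 N"] i by simp
qed

text \<open>The sum of the chosen edges at \<open>x\<close> and \<open>y\<close> ends at the sum but
  starts at an integer that may exceed \<open>N\<close>. Hence \<open>arrow_eq\<close> subtracts the
  value of \<open>coord_of\<close> at this integer, which by \<open>coord_of_cst\<close> is the
  carry times \<open>f\<close>. Products behave alike; there the starting vertices of the two images
  enter, and they are the integers themselves since \<open>coord_of\<close> vanishes on reduced
  residues.\<close>

lemma coord_coord_of:
  assumes i: "i \<le> K"
  shows "coord (coord_of z i (cst 0 N)) (coord_of z i)"
  unfolding coord_def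
proof (intro conjI ballI)
  show "coord_of z i \<one>\<^bsub>lev P 0\<^esub> = \<zero>"
    using coord_of_cst_small[OF i, of 1] N_gt_1 by simp
  fix x y assume x: "x \<in> Pc 0" and y: "y \<in> Pc 0"
  show cx: "coord_of z i x \<in> carrier A"
    using i x by simp
  have cy: "coord_of z i y \<in> carrier A"
    using i y by simp
  let ?f = "coord_of z i (cst 0 N)"
  have f: "?f \<in> carrier A" using i by simp
  note ex = edge_from_cst[OF x] and ey = edge_from_cst[OF y]
  have pos: "0 \<le> \<epsilon> x + \<epsilon> y" "0 \<le> \<epsilon> x * \<epsilon> y"
    using eps_range x y by auto
  have "coord_of z i x \<oplus> coord_of z i y = arrow z i i (edge_from_cst x \<oplus>\<^bsub>lev P (Suc 0)\<^esub> edge_from_cst y)"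
    using ex ey i by (simp add: arrow_add coord_of_def)
  also have "\<dots> = coord_of z i (x \<oplus>\<^bsub>lev P 0\<^esub> y) \<ominus> coord_of z i (cst 0 (\<epsilon> x + \<epsilon> y))"
    using ex ey i by (simp add: arrow_eq del: One_nat_def flip: P.add.int_pow_mult)
  also have "coord_of z i (cst 0 (\<epsilon> x + \<epsilon> y)) = sc ((\<epsilon> x + \<epsilon> y) div N) \<otimes> ?f"
    by (rule coord_of_cst[OF i pos(1)])
  finally have "coord_of z i x \<oplus> coord_of z i y =
      coord_of z i (x \<oplus>\<^bsub>lev P 0\<^esub> y) \<ominus> sc ((\<epsilon> x + \<epsilon> y) div N) \<otimes> ?f" .
  then have "sc ((\<epsilon> x + \<epsilon> y) div N) \<otimes> ?f \<oplus> (coord_of z i x \<oplus> coord_of z i y) =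
      coord_of z i (x \<oplus>\<^bsub>lev P 0\<^esub> y)"
    by (subst (asm) minus_eq_iff) (use i x y f cx cy in auto)
  then show "coord_of z i (x \<oplus>\<^bsub>lev P 0\<^esub> y) =
      coord_of z i x \<oplus> coord_of z i y \<oplus> sc ((\<epsilon> x + \<epsilon> y) div N) \<otimes> ?f"
    using f cx cy by (subst a_comm) auto
  have h: "z (Suc 0) (edge_map i i) \<in> ring_hom (lev P (Suc 0)) (lev D (Suc 0))"
    using i by (intro cell_hom) simp
  have fe: "fst (z (Suc 0) (edge_map i i) (edge_from_cst w)) = sc (\<epsilon> w)" if "w \<in> Pc 0" for w
    using fst_cell[of "edge_map i i" "Suc 0" "edge_from_cst w"] edge_from_cst[OF that] i that
      coord_of_cst_small[OF i] eps_range[OF that] by simp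
  have "sc (\<epsilon> x) \<otimes> coord_of z i y \<oplus> sc (\<epsilon> y) \<otimes> coord_of z i x \<oplus> t \<otimes> (coord_of z i x \<otimes> coord_of z i y) =
      arrow z i i (edge_from_cst x \<otimes>\<^bsub>lev P (Suc 0)\<^esub> edge_from_cst y)"
    using ring_hom_mult[OF h ex(1) ey(1)] x y by (simp add: coord_of_def arrow_def mult_D fe del: One_nat_def)
  also have "\<dots> = coord_of z i (x \<otimes>\<^bsub>lev P 0\<^esub> y) \<ominus> coord_of z i (cst 0 (\<epsilon> x * \<epsilon> y))"
  proof -
    have "cst 0 (\<epsilon> x) \<otimes>\<^bsub>lev P 0\<^esub> cst 0 (\<epsilon> y) = cst 0 (\<epsilon> x * \<epsilon> y)"
      by (simp add: P.add_pow_ldistr_int P.add_pow_rdistr_int P.add.int_pow_pow mult.commute)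
    then show ?thesis
      using ex ey i by (simp add: arrow_eq del: One_nat_def)
  qed
  also have "coord_of z i (cst 0 (\<epsilon> x * \<epsilon> y)) = sc ((\<epsilon> x * \<epsilon> y) div N) \<otimes> ?f"
    by (rule coord_of_cst[OF i pos(2)])
  finally have "sc (\<epsilon> x) \<otimes> coord_of z i y \<oplus> sc (\<epsilon> y) \<otimes> coord_of z i x \<oplus> t \<otimes> (coord_of z i x \<otimes> coord_of z i y) =
      coord_of z i (x \<otimes>\<^bsub>lev P 0\<^esub> y) \<ominus> sc ((\<epsilon> x * \<epsilon> y) div N) \<otimes> ?f" .
  then have "sc ((\<epsilon> x * \<epsilon> y) div N) \<otimes> ?f \<oplus> (sc (\<epsilon> x) \<otimes> coord_of z i y \<oplus> sc (\<epsilon> y) \<otimes> coord_of z i x \<oplus>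
      t \<otimes> (coord_of z i x \<otimes> coord_of z i y)) = coord_of z i (x \<otimes>\<^bsub>lev P 0\<^esub> y)"
    by (subst (asm) minus_eq_iff) (use i x y f cx cy in auto)
  then show "coord_of z i (x \<otimes>\<^bsub>lev P 0\<^esub> y) = sc (\<epsilon> x) \<otimes> coord_of z i y \<oplus> sc (\<epsilon> y) \<otimes> coord_of z i x \<oplus>
      t \<otimes> (coord_of z i x \<otimes> coord_of z i y) \<oplus> sc ((\<epsilon> x * \<epsilon> y) div N) \<otimes> ?f"
    using f cx cy by (subst a_comm) auto
qed

text \<open>A simplex of the derived quotient is determined by its initial vertex and the arrows
  from there, and \<open>fst_cell\<close> and \<open>arrow_eq\<close> express both through
  \<open>coord_of\<close>.\<close>

lemma cell_eq_simplex: "z = simplex K (coord_of z)"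
proof (intro ext)
  fix m \<sigma> x
  show "z m \<sigma> x = simplex K (coord_of z) m \<sigma> x"
  proof (cases "\<sigma> \<in> Dmaps m K \<and> x \<in> Pc m")
    case False
    then show ?thesis
      using cell_ext(1)[of \<sigma> m] cell_ext(2)[of m] by (auto simp: simplex_def extensional_def restrict_def)
  next
    case True
    then have \<sigma>: "\<sigma> \<in> Dmaps m K" and x: "x \<in> Pc m" by auto
    obtain a g where ag: "z m \<sigma> x = (a, g)" by force
    have g: "g 0 = \<zero>" "\<And>j. j \<le> m \<Longrightarrow> g j \<in> carrier A" "g \<in> extensional {..m}"
      using cell_closed[OF \<sigma> x] by (auto simp: ag)
    have "g j = coord_of z (\<sigma> j) (vx m j x) \<ominus> coord_of z (\<sigma> 0) (vx m 0 x)" if j: "j \<le> m" for j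
    proof -
      have "arrow z (\<sigma> 0) (\<sigma> j) (rop P (Suc 0) m (edge_map 0 j) x) = g j \<ominus> g 0"
        using cell_nat[of "edge_map 0 j" "Suc 0" m \<sigma> x] \<sigma> x j by (simp add: arrow_def rop_D ag)
      then show ?thesis
        using arrow_eq[of "\<sigma> 0" "\<sigma> j" "rop P (Suc 0) m (edge_map 0 j) x"] \<sigma> x j g
          Dmaps_mono[of \<sigma> m K 0 j] Dmaps_le[of \<sigma> m K j]
        by (simp add: vx_rop minus_eq)
    qed
    then have "g = (\<lambda>i\<in>{..m}. coord_of z (\<sigma> i) (vx m i x) \<ominus> coord_of z (\<sigma> 0) (vx m 0 x))"
      using g(3) by (auto simp: fun_eq_iff extensional_def)
    then show ?thesis
      using fst_cell[OF \<sigma> x] \<sigma> x by (simp add: simplex_def spx_def ag)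
  qed
qed

end

end

context resolution
begin

text \<open>Since \<open>P\<close> is free in degree \<open>0\<close>, its augmentation lifts to the integers.\<close>

lemma integral_lift:
  obtains r :: "'b \<Rightarrow> int" where "r \<in> ring_hom (lev P 0) type_ring" "\<And>x. x \<in> Pc 0 \<Longrightarrow> r x mod N = \<epsilon> x"
proof -
  obtain X where X: "polynomial_ring_on (lev P 0) X"
    using res by (auto simp: free_resolution_def free_sring_def)
  define Q where "Q = {q :: 'b zpoly. \<forall>m \<in> keys q. keys m \<subseteq> X}"
  \<comment> \<open>The rules for \<open>zeval\<close> ask for a value in the carrier at every
    variable of the type, also outside \<open>X\<close>.\<close>
  define \<rho> where "\<rho> v = (if v \<in> Pc 0 then v else \<zero>\<^bsub>lev P 0\<^esub>)" for v
  have \<rho>: "\<rho> v \<in> Pc 0" for v by (simp add: \<rho>_def)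
  have XP: "X \<subseteq> Pc 0" and bij: "bij_betw (zeval (lev P 0) (\<lambda>x. x)) Q (Pc 0)"
    using X by (auto simp: polynomial_ring_on_def Q_def)
  have zQ: "zeval (lev P 0) (\<lambda>x. x) q = zeval (lev P 0) \<rho> q" if "q \<in> Q" for q
    using that XP by (intro P.zeval_cong) (auto simp: Q_def \<rho>_def)
  define g where "g = inv_into Q (zeval (lev P 0) (\<lambda>x. x))"
  have g: "g x \<in> Q" "zeval (lev P 0) \<rho> (g x) = x" if "x \<in> Pc 0" for x
    using bij that zQ[of "g x"] by (auto simp: g_def bij_betw_def inv_into_into f_inv_into_f)
  have g_eq: "q = g x" if "q \<in> Q" "zeval (lev P 0) \<rho> q = x" "x \<in> Pc 0" for q x
    using bij that zQ[OF that(1)] unfolding g_def bij_betw_def by (metis inv_into_f_f)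
  have Q1: "1 \<in> Q"
    by (auto simp: Q_def)
  have Q_add: "q + q' \<in> Q" if "q \<in> Q" "q' \<in> Q" for q q'
    using that keys_add[of q q'] by (auto simp: Q_def)
  have Q_mult: "q * q' \<in> Q" if "q \<in> Q" "q' \<in> Q" for q q'
  proof -
    have "keys (a + b) \<subseteq> X" if "a \<in> keys q" "b \<in> keys q'" for a b
      using that \<open>q \<in> Q\<close> \<open>q' \<in> Q\<close> keys_add[of a b] unfolding Q_def by blast
    then show ?thesis
      using keys_mult[of q q'] by (fastforce simp: Q_def)
  qed
  have g_add: "g (x \<oplus>\<^bsub>lev P 0\<^esub> y) = g x + g y" if "x \<in> Pc 0" "y \<in> Pc 0" for x y
    using that g by (intro g_eq[symmetric] Q_add) (auto simp: P.zeval_add[OF \<rho>])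
  have g_mult: "g (x \<otimes>\<^bsub>lev P 0\<^esub> y) = g x * g y" if "x \<in> Pc 0" "y \<in> Pc 0" for x y
    using that g by (intro g_eq[symmetric] Q_mult) (auto simp: P.zeval_mult[OF \<rho>])
  have g_one: "g \<one>\<^bsub>lev P 0\<^esub> = 1"
    by (intro g_eq[symmetric] Q1) (auto simp: P.zeval_1[OF \<rho>])
  \<comment> \<open>Each generator is sent to the representative of its augmentation between 0 and
    \<open>N - 1\<close>.\<close>
  define r where "r x = zev (\<lambda>v. \<epsilon> (\<rho> v)) (g x)" for x
  show thesis
  proof (rule that[of r])
    show "r \<in> ring_hom (lev P 0) type_ring"
      by (rule ring_hom_memI) (simp_all add: r_def g_add g_mult g_one)
    fix x assume x: "x \<in> Pc 0"
    have red: "(\<lambda>z. z mod N) \<in> ring_hom type_ring (residue_ring N)"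
      by (rule ring_hom_memI)
        (use N_gt_1 in \<open>auto simp: R.res_carrier_eq R.res_add_eq R.res_mult_eq R.res_one_eq mod_add_eq mod_mult_eq\<close>)
    have "r x mod N = zeval (residue_ring N) (\<lambda>v. \<epsilon> (\<rho> v) mod N) (g x)"
      using ring_hom_zeval[OF red cring_type_ring R.cring] by (simp add: r_def)
    also have "(\<lambda>v. \<epsilon> (\<rho> v) mod N) = (\<lambda>v. \<epsilon> (\<rho> v))"
      using eps_range[OF \<rho>] by (auto simp: fun_eq_iff)
    also have "zeval (residue_ring N) (\<lambda>v. \<epsilon> (\<rho> v)) (g x) = \<epsilon> (zeval (lev P 0) \<rho> (g x))"
      using ring_hom_zeval[OF eps_hom cring_P R.cring, of \<rho> "g x"] \<rho> by simp
    finally show "r x mod N = \<epsilon> x"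
      using g(2)[OF x] by simp
  qed
qed

end

section \<open>Existence of maps and discreteness of the mapping space\<close>

context quotient_mapping
begin

lemma coord_cst_small:
  assumes b: "coord f b" and f: "f \<in> carrier A" and c: "0 \<le> c" "c < N"
  shows "b (cst 0 c) = \<zero>"
proof -
  have nat: "int n < N \<Longrightarrow> b (cst 0 (int n)) = \<zero>" for n
  proof (induction n)
    case 0
    have "b \<zero>\<^bsub>lev P 0\<^esub> = b \<zero>\<^bsub>lev P 0\<^esub> \<oplus> b \<zero>\<^bsub>lev P 0\<^esub>"
      using coordD(1)[OF b, of "\<zero>\<^bsub>lev P 0\<^esub>" "\<zero>\<^bsub>lev P 0\<^esub>"] coord_closed[OF b, of "\<zero>\<^bsub>lev P 0\<^esub>"] eps_cst[of 0] f
      by simp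
    then show ?case
      using coord_closed[OF b, of "\<zero>\<^bsub>lev P 0\<^esub>"] by (simp add: add.l_cancel_one')
  next
    case (Suc n)
    have "cst 0 (int (Suc n)) = cst 0 (int n) \<oplus>\<^bsub>lev P 0\<^esub> \<one>\<^bsub>lev P 0\<^esub>"
      using P.add.int_pow_mult[of "\<one>\<^bsub>lev P 0\<^esub>" 0 "int n" 1] by (simp add: add.commute)
    moreover have "(\<epsilon> (cst 0 (int n)) + \<epsilon> \<one>\<^bsub>lev P 0\<^esub>) div N = 0"
      using Suc.prems by simp
    ultimately show ?case
      using coordD(1)[OF b, of "cst 0 (int n)" "\<one>\<^bsub>lev P 0\<^esub>"] Suc coord_one[OF b] f by simp
  qed
  show ?thesis
    using nat[of "nat c"] c by simp
qed

text \<open>Counting up from 0 in steps of 1 meets no carry before the step from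
  \<open>N - 1\<close> to \<open>N\<close>, and that carry contributes \<open>f\<close>.\<close>

lemma coord_N:
  assumes b: "coord f b" and f: "f \<in> carrier A"
  shows "b (cst 0 N) = f"
proof -
  have "cst 0 N = cst 0 (N - 1) \<oplus>\<^bsub>lev P 0\<^esub> \<one>\<^bsub>lev P 0\<^esub>"
    using P.add.int_pow_mult[of "\<one>\<^bsub>lev P 0\<^esub>" 0 "N - 1" 1] by simp
  moreover have "(N - 1) mod N = N - 1"
    using N_gt_1 by (intro mod_pos_pos_trivial) auto
  then have "\<epsilon> (cst 0 (N - 1)) + \<epsilon> \<one>\<^bsub>lev P 0\<^esub> = N"
    by (simp only: eps_cst eps_simps)
  ultimately show ?thesis
    using coordD(1)[OF b, of "cst 0 (N - 1)" "\<one>\<^bsub>lev P 0\<^esub>"] coord_cst_small[OF b f, of "N - 1"] coord_one[OF b]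
      N_gt_1 f by simp
qed

lemma coord_of_simplex:
  assumes b: "\<And>i. i \<le> K \<Longrightarrow> coord f (b i)" and f: "f \<in> carrier A" and i: "i \<le> K" and x: "x \<in> Pc 0"
  shows "coord_of (simplex K b) i x = b i x"
proof -
  note e = edge_from_cst[OF x]
  have "b i (cst 0 (\<epsilon> x)) = \<zero>"
    using coord_cst_small[OF b[OF i] f] eps_range[OF x] by simp
  then show ?thesis
    using e i coord_closed[OF b[OF i] x] by (simp add: coord_of_def arrow_def simplex_def spx_def)
qed

definition value_at_N :: "(nat \<Rightarrow> (nat \<Rightarrow> nat) \<Rightarrow> 'b \<Rightarrow> 'a \<times> (nat \<Rightarrow> 'a)) \<Rightarrow> 'a" where
  "value_at_N v = coord_of v 0 (cst 0 N)"

lemma coord_of_cell: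
  assumes "z \<in> cells M K" "i \<le> K"
  shows "coord (coord_of z 0 (cst 0 N)) (coord_of z i)"
  using coord_coord_of[OF assms] coord_of_N[OF assms(1), of 0 i] assms(2) by simp

text \<open>Write the integral lift of the augmentation as
  \<open>r x = \<epsilon> x + k x * N\<close>. Additivity and multiplicativity of \<open>r\<close>
  become carry rules for \<open>k\<close>, and \<open>k x\<close> times \<open>f\<close> is a
  solution: the quadratic term \<open>k x * k y * N\<close> takes the form required by
  \<open>coord\<close> because \<open>N = t f\<close>.\<close>

lemma coord_exists:
  assumes f: "f \<in> carrier A" "t \<otimes> f = sc N"
  shows "\<exists>b. coord f b"
proof -
  obtain r where r: "r \<in> ring_hom (lev P 0) type_ring" "\<And>x. x \<in> Pc 0 \<Longrightarrow> r x mod N = \<epsilon> x"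
    using integral_lift by blast
  define k where "k x = r x div N" for x
  have rk: "r x = \<epsilon> x + k x * N" if "x \<in> Pc 0" for x
    using div_mult_mod_eq[of "r x" N] r(2)[OF that] by (simp add: k_def)
  have Nz: "N \<noteq> 0" using N_gt_1 by simp
  have k_add: "k (x \<oplus>\<^bsub>lev P 0\<^esub> y) = k x + k y + (\<epsilon> x + \<epsilon> y) div N" if "x \<in> Pc 0" "y \<in> Pc 0" for x y
  proof -
    have "r (x \<oplus>\<^bsub>lev P 0\<^esub> y) = (\<epsilon> x + \<epsilon> y) + (k x + k y) * N"
      using ring_hom_add[OF r(1) that] rk that by (simp add: algebra_simps)
    then show ?thesis
      unfolding k_def[of "x \<oplus>\<^bsub>lev P 0\<^esub> y"] using Nz by simp
  qed
  have k_mult: "k (x \<otimes>\<^bsub>lev P 0\<^esub> y) = \<epsilon> x * k y + \<epsilon> y * k x + k x * k y * N + (\<epsilon> x * \<epsilon> y) div N"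
    if "x \<in> Pc 0" "y \<in> Pc 0" for x y
  proof -
    have "r (x \<otimes>\<^bsub>lev P 0\<^esub> y) = \<epsilon> x * \<epsilon> y + (\<epsilon> x * k y + \<epsilon> y * k x + k x * k y * N) * N"
      using ring_hom_mult[OF r(1) that] rk that by (simp add: algebra_simps)
    then show ?thesis
      unfolding k_def[of "x \<otimes>\<^bsub>lev P 0\<^esub> y"] using Nz by simp
  qed
  have k_one: "k \<one>\<^bsub>lev P 0\<^esub> = 0"
    using ring_hom_one[OF r(1)] N_gt_1 by (simp add: k_def)
  have "coord f (\<lambda>x. sc (k x) \<otimes> f)"
    unfolding coord_def
  proof (intro conjI ballI)
    fix x y assume xy: "x \<in> Pc 0" "y \<in> Pc 0"
    show "sc (k (x \<oplus>\<^bsub>lev P 0\<^esub> y)) \<otimes> f = sc (k x) \<otimes> f \<oplus> sc (k y) \<otimes> f \<oplus> sc ((\<epsilon> x + \<epsilon> y) div N) \<otimes> f"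
      using f(1) by (simp add: k_add[OF xy] sc_add l_distr)
    have id: "(a \<otimes> v \<oplus> b \<otimes> u \<oplus> u \<otimes> v \<otimes> (t \<otimes> f) \<oplus> d) \<otimes> f =
        a \<otimes> (v \<otimes> f) \<oplus> b \<otimes> (u \<otimes> f) \<oplus> t \<otimes> (u \<otimes> f \<otimes> (v \<otimes> f)) \<oplus> d \<otimes> f"
      if "a \<in> carrier A" "b \<in> carrier A" "d \<in> carrier A" "u \<in> carrier A" "v \<in> carrier A" for a b d u v
      using that f(1) t_closed by algebra
    have "sc (k x * k y * N) = sc (k x) \<otimes> sc (k y) \<otimes> (t \<otimes> f)"
      by (simp only: f sc_mult)
    then show "sc (k (x \<otimes>\<^bsub>lev P 0\<^esub> y)) \<otimes> f = sc (\<epsilon> x) \<otimes> (sc (k y) \<otimes> f) \<oplus> sc (\<epsilon> y) \<otimes> (sc (k x) \<otimes> f) \<oplus>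
        t \<otimes> (sc (k x) \<otimes> f \<otimes> (sc (k y) \<otimes> f)) \<oplus> sc ((\<epsilon> x * \<epsilon> y) div N) \<otimes> f"
      using id[of "sc (\<epsilon> x)" "sc (\<epsilon> y)" "sc ((\<epsilon> x * \<epsilon> y) div N)" "sc (k x)" "sc (k y)"]
      by (simp only: k_mult[OF xy] sc_add) (simp add: sc_mult)
  qed (use f k_one in auto)
  then show ?thesis by blast
qed

lemma sface_coord_of: "i \<le> Suc k \<Longrightarrow> l \<le> k \<Longrightarrow> coord_of (sface M k i z) l = coord_of z (coface k i l)"
  unfolding sface_def by (rule coord_of_sop) auto

lemma sop_cell:
  assumes "\<alpha> \<in> Dmaps j K" "z \<in> cells M K"
  shows "sop M j K \<alpha> z \<in> cells M j"
proof -
  have "sop M j K \<alpha> (simplex K (coord_of z)) \<in> cells M j"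
    unfolding sop_simplex[OF assms(1)]
    by (rule simplex_cell[where f = "coord_of z 0 (cst 0 N)"])
      (use assms cell_value[OF assms(2)] coord_of_cell Dmaps_le in auto)
  then show ?thesis
    using cell_eq_simplex[OF assms(2)] by simp
qed

lemma sface_simplex: "i \<le> Suc k \<Longrightarrow> sface M k i (simplex (Suc k) b) = simplex k (\<lambda>l. b (coface k i l))"
  unfolding sface_def by (rule sop_simplex) auto

text \<open>So a \<open>K\<close>-simplex of the mapping space is the same as a family of \<open>K + 1\<close> vertices with a common
  value at \<open>N\<close>.\<close>

theorem mapping_space_discrete:
  "discrete_equiv M {f \<in> carrier A. t \<otimes> f = sc N} value_at_N"
  unfolding discrete_equiv_def
proof (intro conjI ballI allI impI)
  fix x assume "x \<in> cells M 0"
  then show "value_at_N x \<in> {f \<in> carrier A. t \<otimes> f = sc N}"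
    using cell_value[of x 0 0] by (simp add: value_at_N_def)
next
  fix e assume e: "e \<in> cells M 1"
  then show "value_at_N (sface M 0 0 e) = value_at_N (sface M 0 1 e)"
    using coord_of_N[of e 1 0 1] by (simp add: value_at_N_def sface_coord_of coface_eqs)
next
  fix f assume "f \<in> {f \<in> carrier A. t \<otimes> f = sc N}"
  then have f: "f \<in> carrier A" "t \<otimes> f = sc N" by auto
  obtain b where b: "coord f b"
    using coord_exists[OF f] by blast
  show "\<exists>x\<in>cells M 0. value_at_N x = f"
  proof (rule bexI)
    show "simplex 0 (\<lambda>_. b) \<in> cells M 0"
      by (rule simplex_cell[OF f]) (rule b)
    show "value_at_N (simplex 0 (\<lambda>_. b)) = f"
      using coord_of_simplex[of 0 f "\<lambda>_. b" 0 "cst 0 N"] b f(1) coord_N[OF b f(1)] by (simp add: value_at_N_def)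
  qed
next
  fix x y assume xy: "x \<in> cells M 0" "y \<in> cells M 0" "value_at_N x = value_at_N y"
  let ?b = "\<lambda>i::nat. if i = 0 then coord_of x 0 else coord_of y 0"
  have "simplex 1 ?b \<in> cells M 1"
    by (rule simplex_cell[where f = "value_at_N x"])
      (use xy cell_value[of x 0 0] coord_of_cell[of x 0 0] coord_of_cell[of y 0 0] in \<open>auto simp: value_at_N_def\<close>)
  moreover have "sface M 0 1 (simplex 1 ?b) = x" "sface M 0 0 (simplex 1 ?b) = y"
    using sface_simplex[of 1 0 ?b] sface_simplex[of 0 0 ?b]
      cell_eq_simplex[OF xy(1)] cell_eq_simplex[OF xy(2)]
      simplex_cong[of 0 "\<lambda>l. ?b (coface 0 1 l)" "coord_of x"] simplex_cong[of 0 "\<lambda>l. ?b (coface 0 0 l)" "coord_of y"]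
    by (simp_all add: coface_eqs)
  ultimately show "\<exists>e\<in>cells M 1. sface M 0 1 e = x \<and> sface M 0 0 e = y"
    by blast
next
  fix k y
  assume "(\<forall>i \<le> Suc (Suc k). y i \<in> cells M (Suc k)) \<and>
      (\<forall>i j. i < j \<and> j \<le> Suc (Suc k) \<longrightarrow> sface M k i (y j) = sface M k (j - 1) (y i))"
  then have y: "\<And>i. i \<le> Suc (Suc k) \<Longrightarrow> y i \<in> cells M (Suc k)"
    and compat: "\<And>i j. \<lbrakk>i < j; j \<le> Suc (Suc k)\<rbrakk> \<Longrightarrow> sface M k i (y j) = sface M k (j - 1) (y i)"
    by auto
  have co: "coord_of (y j) (coface k i l) = coord_of (y i) (coface k (j - 1) l)"
    if "i < j" "j \<le> Suc (Suc k)" "l \<le> k" for i j l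
    using arg_cong[OF compat[OF that(1,2)], of "\<lambda>z. coord_of z l"] that
    by (simp add: sface_coord_of)
  \<comment> \<open>The vertices of the filler are dictated by the faces: face 0 contains all
    vertices but 0, and vertex 0 is the first vertex of face 1.\<close>
  let ?b = "\<lambda>l. if l = 0 then coord_of (y 1) 0 else coord_of (y 0) (l - 1)"
  have b: "coord_of (y i) l = ?b (coface (Suc k) i l)" if "i \<le> Suc (Suc k)" "l \<le> Suc k" for i l
  proof (cases "i = 0")
    case True
    then show ?thesis using that by (simp add: coface_def)
  next
    case False
    show ?thesis
    proof (cases l)
      case 0
      then show ?thesis
        using co[of 1 i 0] False that by (cases "i = 1") (auto simp: coface_def)
    next
      case (Suc l')
      then show ?thesis
        using co[of 0 i l'] False that by (auto simp: coface_def)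
    qed
  qed
  let ?f = "coord_of (y 0) 0 (cst 0 N)"
  have f: "?f \<in> carrier A" "t \<otimes> ?f = sc N"
    using y[of 0] cell_value[of "y 0" "Suc k" 0] by auto
  have "coord_of (y 1) 0 (cst 0 N) = ?f"
    using coord_of_N[OF y[of 1], of 0 1] b[of 1 1] b[of 0 0] coord_of_N[OF y[of 0], of 0 1]
    by (simp add: coface_def)
  then have cb: "coord ?f (?b l)" if "l \<le> Suc (Suc k)" for l
    using coord_of_cell[OF y[of 1], of 0] coord_of_cell[OF y[of 0], of "l - 1"] that by auto
  show "\<exists>z\<in>cells M (Suc (Suc k)). \<forall>i\<le>Suc (Suc k). sface M (Suc k) i z = y i"
  proof (intro bexI allI impI)
    show "simplex (Suc (Suc k)) ?b \<in> cells M (Suc (Suc k))"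
      by (rule simplex_cell[OF f cb])
    fix i assume i: "i \<le> Suc (Suc k)"
    have "simplex (Suc k) (\<lambda>l. ?b (coface (Suc k) i l)) = simplex (Suc k) (coord_of (y i))"
      using b[OF i] by (intro simplex_cong) metis
    then show "sface M (Suc k) i (simplex (Suc (Suc k)) ?b) = y i"
      using cell_eq_simplex[OF y[OF i]] i by (simp only: sface_simplex)
  qed
qed

end

section \<open>Functoriality of the mapping space in the target\<close>

definition simplicial_hom :: "'a sring \<Rightarrow> 'c sring \<Rightarrow> (nat \<Rightarrow> 'a \<Rightarrow> 'c) \<Rightarrow> bool" where
  "simplicial_hom B B' g \<longleftrightarrow> (\<forall>m. g m \<in> ring_hom (lev B m) (lev B' m)) \<and>
     (\<forall>l m. \<forall>\<theta>\<in>Dmaps l m. \<forall>x\<in>carrier (lev B m). g l (rop B l m \<theta> x) = rop B' l m \<theta> (g m x))"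

lemma (in resolution) postcomp_cell:
  assumes v: "v \<in> cells (mapping_space P B) 0" and g: "simplicial_hom B B' g"
  shows "postcomp P g v \<in> cells (mapping_space P B') 0"
proof -
  have vm: "v m \<sigma> \<in> ring_hom (lev P m) (lev B m)" if "\<sigma> \<in> Dmaps m 0" for m \<sigma>
    using v that by (auto simp: mapping_space_def rhom_def PiE_iff)
  have gm: "g m \<in> ring_hom (lev B m) (lev B' m)" for m
    using g by (simp add: simplicial_hom_def)
  have "(\<lambda>x. g m (v m \<sigma> x)) \<in> ring_hom (lev P m) (lev B' m)" if "\<sigma> \<in> Dmaps m 0" for m \<sigma>
    using ring_hom_trans[OF vm[OF that] gm] by (simp add: comp_def)
  then have "postcomp P g v m \<in> (\<Pi>\<^sub>E \<sigma> \<in> Dmaps m 0. rhom (lev P m) (lev B' m))" for m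
    by (auto simp: postcomp_def intro!: ring_hom_restrict)
  moreover have "postcomp P g v l (compose {..l} \<sigma> \<theta>) (rop P l m \<theta> x) = rop B' l m \<theta> (postcomp P g v m \<sigma> x)"
    if "\<theta> \<in> Dmaps l m" "\<sigma> \<in> Dmaps m 0" "x \<in> Pc m" for l m \<theta> \<sigma> x
    using v g that ring_hom_closed[OF vm[OF that(2)] that(3)]
    by (simp add: postcomp_def compose_Dmaps mapping_space_def simplicial_hom_def)
  ultimately show ?thesis
    by (simp add: mapping_space_def)
qed

lemma (in quotient_mapping) value_at_N_alt: "value_at_N v = snd (v (Suc 0) (edge_map 0 0) (edge_from_cst (cst 0 N))) (Suc 0)"
  by (simp add: value_at_N_def coord_of_def arrow_def)

section \<open>Isomorphisms of spaces with group action induce isomorphisms of quotient stacks\<close>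

lemma algebrasD: "(S, h) \<in> algebras p R \<Longrightarrow> p_nilpotent_ring p S" "(S, h) \<in> algebras p R \<Longrightarrow> h \<in> rhom R S"
  by (auto simp: algebras_def)

lemma rhom_closed: "\<lbrakk>h \<in> rhom R S; x \<in> carrier R\<rbrakk> \<Longrightarrow> h x \<in> carrier S"
  by (auto simp: rhom_def ring_hom_def)

lemma compose_rhom:
  assumes "cring R" "h \<in> rhom R S" "k \<in> rhom S S'"
  shows "compose (carrier R) k h \<in> rhom R S'"
proof -
  have "k \<circ> h \<in> ring_hom R S'"
    using assms ring_hom_trans by (auto simp: rhom_def)
  from ring_hom_restrict[OF assms(1) this] show ?thesis
    by (simp add: compose_def comp_def)
qed

lemma compose_algebras:
  "\<lbrakk>cring R; (S, h) \<in> algebras p R; (S', k) \<in> algebras p S\<rbrakk> \<Longrightarrow> (S', compose (carrier R) k h) \<in> algebras p R"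
  using compose_rhom by (auto simp: algebras_def)

lemma compose_rhom_assoc:
  "h \<in> rhom R S \<Longrightarrow> compose (carrier R) (compose (carrier S) l k) h = compose (carrier R) l (compose (carrier R) k h)"
  by (auto simp: compose_def fun_eq_iff rhom_closed)

lemma ball_pair_iff: "(\<forall>(a, b)\<in>X. Q a b) \<longleftrightarrow> (\<forall>a b. (a, b) \<in> X \<longrightarrow> Q a b)"
  by auto

lemma is_torsorI:
  assumes "is_functor p R T" "is_sheaf p R T"
    and "\<And>S h t. \<lbrakk>(S, h) \<in> algebras p R; t \<in> tob T S h\<rbrakk> \<Longrightarrow> tact T S h \<one>\<^bsub>grp Y S\<^esub> t = t"
    and "\<And>S h t g. \<lbrakk>(S, h) \<in> algebras p R; t \<in> tob T S h; g \<in> carrier (grp Y S)\<rbrakk> \<Longrightarrow> tact T S h g t \<in> tob T S h"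
    and "\<And>S h t g g'. \<lbrakk>(S, h) \<in> algebras p R; t \<in> tob T S h; g \<in> carrier (grp Y S); g' \<in> carrier (grp Y S)\<rbrakk> \<Longrightarrow>
      tact T S h (g' \<otimes>\<^bsub>grp Y S\<^esub> g) t = tact T S h g' (tact T S h g t)"
    and "\<And>S h t g S' k. \<lbrakk>(S, h) \<in> algebras p R; t \<in> tob T S h; g \<in> carrier (grp Y S); (S', k) \<in> algebras p S\<rbrakk> \<Longrightarrow>
      tmap T S h S' k (tact T S h g t) =
      tact T S' (compose (carrier R) k h) (gmap Y S S' k g) (tmap T S h S' k t)"
    and "\<And>S h t t'. \<lbrakk>(S, h) \<in> algebras p R; t \<in> tob T S h; t' \<in> tob T S h\<rbrakk> \<Longrightarrow>
      \<exists>!g. g \<in> carrier (grp Y S) \<and> tact T S h g t = t'"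
    and "\<forall>(S, h) \<in> algebras p R. \<exists>C. fpqc_cover p S C \<and>
      (\<forall>(S', k) \<in> C. tob T S' (compose (carrier R) k h) \<noteq> {})"
  shows "is_torsor p Y R T"
  unfolding is_torsor_def using assms(1,2,8)
  by (intro conjI) (simp_all only: ball_pair_iff, simp_all add: assms(3-7))

lemma quotient_obI:
  assumes "is_torsor p Y R T"
    and "\<And>S h t. \<lbrakk>(S, h) \<in> algebras p R; t \<in> tob T S h\<rbrakk> \<Longrightarrow> tpt T S h t \<in> pts Y S"
    and "\<And>S h t g. \<lbrakk>(S, h) \<in> algebras p R; t \<in> tob T S h; g \<in> carrier (grp Y S)\<rbrakk> \<Longrightarrow>
      tpt T S h (tact T S h g t) = pact Y S g (tpt T S h t)"
    and "\<And>S h t S' k. \<lbrakk>(S, h) \<in> algebras p R; t \<in> tob T S h; (S', k) \<in> algebras p S\<rbrakk> \<Longrightarrow>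
      tpt T S' (compose (carrier R) k h) (tmap T S h S' k t) = pmap Y S S' k (tpt T S h t)"
  shows "T \<in> quotient_ob p Y R"
  unfolding quotient_ob_def using assms by auto

lemma quotient_hom_iff:
  "\<phi> \<in> quotient_hom p Y R T T' \<longleftrightarrow>
     (\<forall>S h. (S, h) \<notin> algebras p R \<longrightarrow> \<phi> S h = undefined) \<and>
     (\<forall>S h. (S, h) \<in> algebras p R \<longrightarrow>
        \<phi> S h \<in> tob T S h \<rightarrow>\<^sub>E tob T' S h \<and>
        (\<forall>t\<in>tob T S h.
           (tpt T' S h (\<phi> S h t) = tpt T S h t \<and>
            (\<forall>g\<in>carrier (grp Y S). \<phi> S h (tact T S h g t) = tact T' S h g (\<phi> S h t))) \<and>
           (\<forall>S' k. (S', k) \<in> algebras p S \<longrightarrow>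
              \<phi> S' (compose (carrier R) k h) (tmap T S h S' k t) = tmap T' S h S' k (\<phi> S h t))))"
  unfolding quotient_hom_def mem_Collect_eq ball_pair_iff by (simp only: conj_assoc)

lemma quotient_ob_closed:
  assumes "T \<in> quotient_ob p Y R" "(S, h) \<in> algebras p R" "t \<in> tob T S h"
  shows "g \<in> carrier (grp Y S) \<Longrightarrow> tact T S h g t \<in> tob T S h"
    and "(S', k) \<in> algebras p S \<Longrightarrow> tmap T S h S' k t \<in> tob T S' (compose (carrier R) k h)"
    and "tpt T S h t \<in> pts Y S"
  using assms unfolding quotient_ob_def is_torsor_def is_functor_def by blast+

locale gspace_iso =
  fixes p :: nat and Y :: "('u, 'g, 'y, 'c) gspace" and Y' :: "('u, 'g1, 'y1, 'c) gspace"
    and \<theta> :: "'u ring \<Rightarrow> 'g \<Rightarrow> 'g1" and \<psi> :: "'u ring \<Rightarrow> 'y \<Rightarrow> 'y1"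
  assumes grp_bij: "p_nilpotent_ring p S \<Longrightarrow> bij_betw (\<theta> S) (carrier (grp Y S)) (carrier (grp Y' S))"
    and grp_one: "p_nilpotent_ring p S \<Longrightarrow> \<one>\<^bsub>grp Y S\<^esub> \<in> carrier (grp Y S) \<and> \<theta> S \<one>\<^bsub>grp Y S\<^esub> = \<one>\<^bsub>grp Y' S\<^esub>"
    and grp_mult: "\<lbrakk>p_nilpotent_ring p S; g \<in> carrier (grp Y S); g' \<in> carrier (grp Y S)\<rbrakk> \<Longrightarrow>
      g \<otimes>\<^bsub>grp Y S\<^esub> g' \<in> carrier (grp Y S) \<and> \<theta> S (g \<otimes>\<^bsub>grp Y S\<^esub> g') = \<theta> S g \<otimes>\<^bsub>grp Y' S\<^esub> \<theta> S g'"
    and grp_map: "\<lbrakk>p_nilpotent_ring p S; (S', k) \<in> algebras p S; g \<in> carrier (grp Y S)\<rbrakk> \<Longrightarrow>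
      gmap Y S S' k g \<in> carrier (grp Y S') \<and> \<theta> S' (gmap Y S S' k g) = gmap Y' S S' k (\<theta> S g)"
    and pts_bij: "p_nilpotent_ring p S \<Longrightarrow> bij_betw (\<psi> S) (pts Y S) (pts Y' S)"
    and pts_act: "\<lbrakk>p_nilpotent_ring p S; g \<in> carrier (grp Y S); y \<in> pts Y S\<rbrakk> \<Longrightarrow>
      pact Y S g y \<in> pts Y S \<and> \<psi> S (pact Y S g y) = pact Y' S (\<theta> S g) (\<psi> S y)"
    and pts_map: "\<lbrakk>p_nilpotent_ring p S; (S', k) \<in> algebras p S; y \<in> pts Y S\<rbrakk> \<Longrightarrow>
      pmap Y S S' k y \<in> pts Y S' \<and> \<psi> S' (pmap Y S S' k y) = pmap Y' S S' k (\<psi> S y)"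
    and pts_over: "\<lbrakk>p_nilpotent_ring p S; y \<in> pts Y S\<rbrakk> \<Longrightarrow> pover Y S y s \<longleftrightarrow> pover Y' S (\<psi> S y) s"
begin

definition inv_grp where "inv_grp S = inv_into (carrier (grp Y S)) (\<theta> S)"

definition inv_pts where "inv_pts S = inv_into (pts Y S) (\<psi> S)"

lemma inv_grp [simp]:
  assumes "p_nilpotent_ring p S"
  shows "g \<in> carrier (grp Y S) \<Longrightarrow> inv_grp S (\<theta> S g) = g"
    "g \<in> carrier (grp Y S) \<Longrightarrow> \<theta> S g \<in> carrier (grp Y' S)"
    "g' \<in> carrier (grp Y' S) \<Longrightarrow> \<theta> S (inv_grp S g') = g'"
    "g' \<in> carrier (grp Y' S) \<Longrightarrow> inv_grp S g' \<in> carrier (grp Y S)"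
  using grp_bij[OF assms] unfolding inv_grp_def
  by (auto simp: bij_betw_def inv_into_f_f f_inv_into_f inv_into_into)

lemma inv_pts [simp]:
  assumes "p_nilpotent_ring p S"
  shows "y \<in> pts Y S \<Longrightarrow> inv_pts S (\<psi> S y) = y"
    "y \<in> pts Y S \<Longrightarrow> \<psi> S y \<in> pts Y' S"
    "y' \<in> pts Y' S \<Longrightarrow> \<psi> S (inv_pts S y') = y'"
    "y' \<in> pts Y' S \<Longrightarrow> inv_pts S y' \<in> pts Y S"
  using pts_bij[OF assms] unfolding inv_pts_def
  by (auto simp: bij_betw_def inv_into_f_f f_inv_into_f inv_into_into)

lemma inv_grp_eqI: "\<lbrakk>p_nilpotent_ring p S; g \<in> carrier (grp Y S); \<theta> S g = g'\<rbrakk> \<Longrightarrow> inv_grp S g' = g"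
  by auto

lemma inv_grp_one: "p_nilpotent_ring p S \<Longrightarrow> inv_grp S \<one>\<^bsub>grp Y' S\<^esub> = \<one>\<^bsub>grp Y S\<^esub>"
  by (rule inv_grp_eqI) (auto simp: grp_one)

lemma inv_grp_mult: "\<lbrakk>p_nilpotent_ring p S; g \<in> carrier (grp Y' S); g' \<in> carrier (grp Y' S)\<rbrakk> \<Longrightarrow>
    inv_grp S (g \<otimes>\<^bsub>grp Y' S\<^esub> g') = inv_grp S g \<otimes>\<^bsub>grp Y S\<^esub> inv_grp S g'"
  by (rule inv_grp_eqI) (auto simp: grp_mult)

lemma inv_grp_map: "\<lbrakk>p_nilpotent_ring p S; (S', k) \<in> algebras p S; g \<in> carrier (grp Y' S)\<rbrakk> \<Longrightarrow>
    inv_grp S' (gmap Y' S S' k g) = gmap Y S S' k (inv_grp S g)"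
  by (rule inv_grp_eqI) (auto simp: grp_map dest: algebrasD)

lemma gspace_iso_inv: "gspace_iso p Y' Y inv_grp inv_pts"
proof
  fix S :: "'u ring" assume S: "p_nilpotent_ring p S"
  show "bij_betw (inv_grp S) (carrier (grp Y' S)) (carrier (grp Y S))"
    unfolding inv_grp_def using grp_bij[OF S] by (rule bij_betw_inv_into)
  show "bij_betw (inv_pts S) (pts Y' S) (pts Y S)"
    unfolding inv_pts_def using pts_bij[OF S] by (rule bij_betw_inv_into)
  show "\<one>\<^bsub>grp Y' S\<^esub> \<in> carrier (grp Y' S) \<and> inv_grp S \<one>\<^bsub>grp Y' S\<^esub> = \<one>\<^bsub>grp Y S\<^esub>"
    using grp_one[OF S] inv_grp_one[OF S] inv_grp(2)[OF S] by metis
  fix g assume g: "g \<in> carrier (grp Y' S)"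
  show "g \<otimes>\<^bsub>grp Y' S\<^esub> g' \<in> carrier (grp Y' S) \<and>
      inv_grp S (g \<otimes>\<^bsub>grp Y' S\<^esub> g') = inv_grp S g \<otimes>\<^bsub>grp Y S\<^esub> inv_grp S g'"
    if "g' \<in> carrier (grp Y' S)" for g'
    using grp_mult[OF S, of "inv_grp S g" "inv_grp S g'"] inv_grp_mult[OF S g that] S g that
    by (metis inv_grp(2-4))
  show "pact Y' S g y \<in> pts Y' S \<and> inv_pts S (pact Y' S g y) = pact Y S (inv_grp S g) (inv_pts S y)"
    if "y \<in> pts Y' S" for y
    using pts_act[OF S, of "inv_grp S g" "inv_pts S y"] S g that by (metis inv_grp(3,4) inv_pts)
  fix S' k assume k: "(S', k) \<in> algebras p S"
  then have S': "p_nilpotent_ring p S'" by (rule algebrasD)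
  show "gmap Y' S S' k g \<in> carrier (grp Y' S') \<and> inv_grp S' (gmap Y' S S' k g) = gmap Y S S' k (inv_grp S g)"
    using grp_map[OF S k, of "inv_grp S g"] inv_grp_map[OF S k g] S S' g by (metis inv_grp(2-4))
next
  fix S :: "'u ring" and S' k y
  assume S: "p_nilpotent_ring p S" and k: "(S', k) \<in> algebras p S" and y: "y \<in> pts Y' S"
  have S': "p_nilpotent_ring p S'" using k by (rule algebrasD)
  show "pmap Y' S S' k y \<in> pts Y' S' \<and> inv_pts S' (pmap Y' S S' k y) = pmap Y S S' k (inv_pts S y)"
    using pts_map[OF S k, of "inv_pts S y"] S S' y by (metis inv_pts)
next
  fix S :: "'u ring" and y s
  assume "p_nilpotent_ring p S" "y \<in> pts Y' S"
  then show "pover Y' S y s = pover Y S (inv_pts S y) s"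
    using pts_over[of S "inv_pts S y" s] by simp
qed

text \<open>The underlying sheaf is left alone; only the action and the map to the points are
  relabelled. Thus transport does nothing to morphisms and commutes strictly with base
  change.\<close>

definition transport :: "('u, 'g, 'y, 't) qobj \<Rightarrow> ('u, 'g1, 'y1, 't) qobj" where
  "transport T =
     \<lparr>tob = tob T, tmap = tmap T,
      tact = (\<lambda>S h g. tact T S h (inv_grp S g)),
      tpt = (\<lambda>S h t. \<psi> S (tpt T S h t))\<rparr>"

lemma transport_simps [simp]:
  "tob (transport T) = tob T" "tmap (transport T) = tmap T"
  "tact (transport T) S h g = tact T S h (inv_grp S g)"
  "tpt (transport T) S h t = \<psi> S (tpt T S h t)"
  by (simp_all add: transport_def)

lemma transport_torsor:
  assumes "is_torsor p Y R T"
  shows "is_torsor p Y' R (transport T)"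
proof -
  have fs: "is_functor p R T" "is_sheaf p R T"
    "\<forall>(S, h) \<in> algebras p R. \<exists>C. fpqc_cover p S C \<and> (\<forall>(S', k) \<in> C. tob T S' (compose (carrier R) k h) \<noteq> {})"
    using assms by (auto simp: is_torsor_def)
  have act: "tact T S h \<one>\<^bsub>grp Y S\<^esub> t = t"
    "\<And>g. g \<in> carrier (grp Y S) \<Longrightarrow> tact T S h g t \<in> tob T S h"
    "\<And>g g'. \<lbrakk>g \<in> carrier (grp Y S); g' \<in> carrier (grp Y S)\<rbrakk> \<Longrightarrow>
        tact T S h (g' \<otimes>\<^bsub>grp Y S\<^esub> g) t = tact T S h g' (tact T S h g t)"
    "\<And>g S' k. \<lbrakk>g \<in> carrier (grp Y S); (S', k) \<in> algebras p S\<rbrakk> \<Longrightarrow>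
        tmap T S h S' k (tact T S h g t) =
        tact T S' (compose (carrier R) k h) (gmap Y S S' k g) (tmap T S h S' k t)"
    "\<And>t'. t' \<in> tob T S h \<Longrightarrow> \<exists>!g. g \<in> carrier (grp Y S) \<and> tact T S h g t = t'"
    if "(S, h) \<in> algebras p R" "t \<in> tob T S h" for S h t
    using assms that unfolding is_torsor_def by blast+
  have "\<exists>!g. g \<in> carrier (grp Y' S) \<and> tact T S h (inv_grp S g) t = t'"
    if A: "(S, h) \<in> algebras p R" and t: "t \<in> tob T S h" "t' \<in> tob T S h" for S h t t'
  proof -
    have S: "p_nilpotent_ring p S" using A by (rule algebrasD)
    obtain g where g: "g \<in> carrier (grp Y S)" "tact T S h g t = t'"
      and u: "\<And>g'. \<lbrakk>g' \<in> carrier (grp Y S); tact T S h g' t = t'\<rbrakk> \<Longrightarrow> g' = g"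
      using act(5)[OF A t] by blast
    show ?thesis
    proof (rule ex1I[of _ "\<theta> S g"])
      show "\<theta> S g \<in> carrier (grp Y' S) \<and> tact T S h (inv_grp S (\<theta> S g)) t = t'"
        using g S by simp
      fix g' assume "g' \<in> carrier (grp Y' S) \<and> tact T S h (inv_grp S g') t = t'"
      then show "g' = \<theta> S g"
        using u[of "inv_grp S g'"] S by (metis inv_grp(3,4))
    qed
  qed
  moreover have "is_functor p R (transport T)" "is_sheaf p R (transport T)"
    using fs by (simp_all add: is_functor_def is_sheaf_def)
  ultimately show ?thesis
    using act(1-4) fs(3)
    by (intro is_torsorI) (simp_all add: inv_grp_one[OF algebrasD(1)] inv_grp_mult[OF algebrasD(1)]
      inv_grp_map[OF algebrasD(1)] inv_grp(4)[OF algebrasD(1)])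
qed

lemma transport_ob:
  assumes "T \<in> quotient_ob p Y R"
  shows "transport T \<in> quotient_ob p Y' R"
proof -
  have pt: "tpt T S h t \<in> pts Y S"
    "\<And>g. g \<in> carrier (grp Y S) \<Longrightarrow> tpt T S h (tact T S h g t) = pact Y S g (tpt T S h t)"
    "\<And>S' k. (S', k) \<in> algebras p S \<Longrightarrow>
        tpt T S' (compose (carrier R) k h) (tmap T S h S' k t) = pmap Y S S' k (tpt T S h t)"
    if "(S, h) \<in> algebras p R" "t \<in> tob T S h" for S h t
    using assms that unfolding quotient_ob_def by blast+
  have "is_torsor p Y' R (transport T)"
    using assms by (intro transport_torsor) (simp add: quotient_ob_def)
  then show ?thesis
    using pt
    by (intro quotient_obI) (simp_all add: pts_act[OF algebrasD(1)] pts_map[OF algebrasD(1)]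
      inv_grp(3,4)[OF algebrasD(1)] inv_pts(2)[OF algebrasD(1)])
qed

text \<open>Equivariance for all \<open>inv_grp S g\<close> is equivariance for all group elements,
  since \<open>inv_grp\<close> is onto, and compatibility with the points can be tested after the
  injective map \<psi>.\<close>

lemma quotient_hom_transport:
  assumes T: "T \<in> quotient_ob p Y R" and T': "T' \<in> quotient_ob p Y R"
  shows "quotient_hom p Y' R (transport T) (transport T') = quotient_hom p Y R T T'"
proof -
  have pt: "\<And>S h t. \<lbrakk>(S, h) \<in> algebras p R; t \<in> tob T S h\<rbrakk> \<Longrightarrow> tpt T S h t \<in> pts Y S"
    "\<And>S h t. \<lbrakk>(S, h) \<in> algebras p R; t \<in> tob T' S h\<rbrakk> \<Longrightarrow> tpt T' S h t \<in> pts Y S"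
    using assms unfolding quotient_ob_def by blast+
  have "(tpt (transport T') S h (\<phi> S h t) = tpt (transport T) S h t \<and>
      (\<forall>g\<in>carrier (grp Y' S). \<phi> S h (tact (transport T) S h g t) = tact (transport T') S h g (\<phi> S h t))) \<longleftrightarrow>
      (tpt T' S h (\<phi> S h t) = tpt T S h t \<and>
      (\<forall>g\<in>carrier (grp Y S). \<phi> S h (tact T S h g t) = tact T' S h g (\<phi> S h t)))"
    if A: "(S, h) \<in> algebras p R" and t: "t \<in> tob T S h" and \<phi>: "\<phi> S h \<in> tob T S h \<rightarrow>\<^sub>E tob T' S h" for S h t \<phi>
  proof -
    have S: "p_nilpotent_ring p S" using A by (rule algebrasD)
    have "\<phi> S h t \<in> tob T' S h" using \<phi> t by auto
    then have "tpt T' S h (\<phi> S h t) \<in> pts Y S" "tpt T S h t \<in> pts Y S"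
      using pt A t by auto
    then have "\<psi> S (tpt T' S h (\<phi> S h t)) = \<psi> S (tpt T S h t) \<longleftrightarrow> tpt T' S h (\<phi> S h t) = tpt T S h t"
      using S by (metis inv_pts(1))
    moreover have "(\<forall>g\<in>carrier (grp Y' S). \<phi> S h (tact T S h (inv_grp S g) t) = tact T' S h (inv_grp S g) (\<phi> S h t)) \<longleftrightarrow>
        (\<forall>g\<in>carrier (grp Y S). \<phi> S h (tact T S h g t) = tact T' S h g (\<phi> S h t))"
      using S by (metis inv_grp(1,2,4))
    ultimately show ?thesis by simp
  qed
  then show ?thesis
    unfolding set_eq_iff quotient_hom_iff transport_simps(1,2)
    by (simp cong: conj_cong del: transport_simps(3,4))
qed

end

lemma quotient_stack_simps [simp]:
  "sob (quotient_stack p A Y) = quotient_ob p Y"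
  "shom (quotient_stack p A Y) = quotient_hom p Y"
  by (simp_all add: quotient_stack_def)

lemma quotient_hom_id:
  assumes R: "cring R" and x: "x \<in> quotient_ob p Y R" and g: "(R', g) \<in> algebras p R"
  shows "sid (quotient_stack p A Y) R' (spull (quotient_stack p A Y) R R' g x)
    \<in> quotient_hom p Y R' (spull (quotient_stack p A Y) R R' g x) (spull (quotient_stack p A Y) R R' g x)"
proof -
  have gh: "g \<in> rhom R R'" using g by (rule algebrasD)
  have R': "cring R'" using g by (simp add: algebras_def p_nilpotent_ring_def)
  have alg: "(S, compose (carrier R) h g) \<in> algebras p R" if "(S, h) \<in> algebras p R'" for S h
    using compose_algebras[OF R g that] .
  show ?thesis
    unfolding quotient_hom_iff quotient_stack_def
    using quotient_ob_closed(1,2)[OF x alg] compose_algebras[OF R'] by (auto simp: compose_rhom_assoc[OF gh])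
qed

context gspace_iso
begin

lemma spull_transport:
  "transport (spull (quotient_stack p A Y) R R' g T) = spull (quotient_stack p A' Y') R R' g (transport T)"
  by (simp add: transport_def quotient_stack_def)

lemma sid_transport: "sid (quotient_stack p A' Y') R (transport T) = sid (quotient_stack p A Y) R T"
  by (simp add: quotient_stack_def fun_eq_iff)

text \<open>Transport on objects and the identity on morphisms; since base change commutes strictly
  with transport, the coherence maps are identities. Essential surjectivity comes from transport
  along the inverse isomorphism.\<close>

theorem stack_iso_quotient:
  "stack_iso p
     (quotient_stack p A Y :: ('u, ('u, 'g, 'y, 't) qobj, ('u, 't) qmor, 'c) stack)
     (quotient_stack p A Y' :: ('u, ('u, 'g1, 'y1, 't) qobj, ('u, 't) qmor, 'c) stack)"
    (is "stack_iso p ?X ?X'")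
proof -
  interpret inv: gspace_iso p Y' Y inv_grp inv_pts
    by (rule gspace_iso_inv)
  let ?F = "\<lambda>(R :: 'u ring) (x :: ('u, 'g, 'y, 't) qobj). transport x"
  let ?Fm = "\<lambda>(R :: 'u ring) (x :: ('u, 'g, 'y, 't) qobj) (x' :: ('u, 'g, 'y, 't) qobj) (\<phi> :: ('u, 't) qmor). \<phi>"
  let ?\<eta> = "\<lambda>R R' g (x :: ('u, 'g, 'y, 't) qobj). sid ?X R' (spull ?X R R' g x)"
  show ?thesis
    unfolding stack_iso_def
  proof (rule exI[of _ ?F], rule exI[of _ ?Fm], rule exI[of _ ?\<eta>], intro conjI allI impI ballI)
    fix R :: "'u ring" assume R: "p_nilpotent_ring p R"
    then have cR: "cring R" by (simp add: p_nilpotent_ring_def)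
    fix x assume "x \<in> sob ?X R"
    then have x: "x \<in> quotient_ob p Y R" by simp
    show "transport x \<in> sob ?X' R"
      using transport_ob[OF x] by simp
    show "sid ?X R x = sid ?X' R (transport x)"
      by (rule sid_transport[symmetric])
    have pt: "\<And>S h t. \<lbrakk>(S, h) \<in> algebras p R; t \<in> tob x S h\<rbrakk> \<Longrightarrow> tpt x S h t \<in> pts Y S"
      using x unfolding quotient_ob_def by blast
    show "sover ?X R x s = sover ?X' R (transport x) s" for s
      unfolding quotient_stack_def
      using pts_over pt by (auto simp: algebras_def)
    fix x' assume "x' \<in> sob ?X R"
    then have x': "x' \<in> quotient_ob p Y R" by simp
    show "bij_betw (\<lambda>\<phi>. \<phi>) (shom ?X R x x') (shom ?X' R (transport x) (transport x'))"
      using quotient_hom_transport[OF x x'] by (simp add: bij_betw_def)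
    fix x'' \<phi> \<psi>
    show "scomp ?X R x x' x'' \<psi> \<phi> = scomp ?X' R (transport x) (transport x') (transport x'') \<psi> \<phi>"
      by (simp add: quotient_stack_def fun_eq_iff)
  next
    fix R :: "'u ring" and y assume R: "p_nilpotent_ring p R" and "y \<in> sob ?X' R"
    then have y: "y \<in> quotient_ob p Y' R" by simp
    have cR: "cring R" using R by (simp add: p_nilpotent_ring_def)
    have x: "inv.transport y \<in> quotient_ob p Y R"
      by (rule inv.transport_ob[OF y])
    \<comment> \<open>Transport back and forth returns \<open>y\<close> only on actual group
      elements and points. The two records may differ elsewhere, so an isomorphism is given in place
      of an equality.\<close>
    have "sid ?X' R y \<in> quotient_hom p Y' R (transport (inv.transport y)) y"
      unfolding quotient_hom_iff quotient_stack_def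
      using quotient_ob_closed[OF y] compose_algebras[OF cR]
      by (auto simp: inv_pts(3)[OF algebrasD(1)] inv.inv_grp(1)[OF algebrasD(1)])
    then have "quotient_hom p Y' R (transport (inv.transport y)) y \<noteq> {}"
      by blast
    then show "\<exists>x\<in>sob ?X R. shom ?X' R (transport x) y \<noteq> {}"
      using x by auto
  next
    fix R :: "'u ring" assume R: "p_nilpotent_ring p R"
    then have cR: "cring R" by (simp add: p_nilpotent_ring_def)
    fix a assume "a \<in> algebras p R"
    then obtain R' g where a: "a = (R', g)" and g: "(R', g) \<in> algebras p R"
      by (cases a) auto
    show "case a of (R', g) \<Rightarrow> \<forall>x\<in>sob ?X R.
          ?\<eta> R R' g x \<in> shom ?X' R' (transport (spull ?X R R' g x)) (spull ?X' R R' g (transport x)) \<and>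
          (\<forall>x'\<in>sob ?X R. \<forall>\<phi>\<in>shom ?X R x x'.
             scomp ?X' R' (transport (spull ?X R R' g x)) (transport (spull ?X R R' g x'))
               (spull ?X' R R' g (transport x')) (?\<eta> R R' g x') (spullm ?X R R' g \<phi>) =
             scomp ?X' R' (transport (spull ?X R R' g x)) (spull ?X' R R' g (transport x))
               (spull ?X' R R' g (transport x')) (spullm ?X' R R' g \<phi>) (?\<eta> R R' g x)) \<and>
          (\<forall>(R'', g')\<in>algebras p R'.
             ?\<eta> R R'' (compose (carrier R) g' g) x =
             scomp ?X' R'' (transport (spull ?X R R'' (compose (carrier R) g' g) x))
               (spull ?X' R' R'' g' (transport (spull ?X R R' g x)))
               (spull ?X' R R'' (compose (carrier R) g' g) (transport x))
               (spullm ?X' R' R'' g' (?\<eta> R R' g x)) (?\<eta> R' R'' g' (spull ?X R R' g x)))"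
      unfolding a prod.case
    proof (intro ballI conjI)
      have gh: "g \<in> rhom R R'" using g by (rule algebrasD)
      fix x assume "x \<in> sob ?X R"
      then have x: "x \<in> quotient_ob p Y R" by simp
      show "?\<eta> R R' g x \<in> shom ?X' R' (transport (spull ?X R R' g x)) (spull ?X' R R' g (transport x))"
        using quotient_hom_id[OF cR transport_ob[OF x] g, of A]
        by (simp add: spull_transport[of A _ _ _ _ A] sid_transport[symmetric, of A _ _ A])
      show "scomp ?X' R' (transport (spull ?X R R' g x)) (transport (spull ?X R R' g x'))
               (spull ?X' R R' g (transport x')) (?\<eta> R R' g x') (spullm ?X R R' g \<phi>) =
             scomp ?X' R' (transport (spull ?X R R' g x)) (spull ?X' R R' g (transport x))
               (spull ?X' R R' g (transport x')) (spullm ?X' R R' g \<phi>) (?\<eta> R R' g x)"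
        if "x' \<in> sob ?X R" "\<phi> \<in> shom ?X R x x'" for x' \<phi>
      proof -
        have "\<phi> S (compose (carrier R) h g) t \<in> tob x' S (compose (carrier R) h g)"
          if "(S, h) \<in> algebras p R'" "t \<in> tob x S (compose (carrier R) h g)" for S h t
          using compose_algebras[OF cR g that(1)] that(2) \<open>\<phi> \<in> shom ?X R x x'\<close>
          by (force simp: quotient_hom_def)
        then show ?thesis
          by (auto simp: quotient_stack_def fun_eq_iff compose_def)
      qed
      fix b assume "b \<in> algebras p R'"
      then obtain R'' g' where b: "b = (R'', g')" and g': "(R'', g') \<in> algebras p R'"
        by (cases b) auto
      have alg: "(S, compose (carrier R') h g') \<in> algebras p R'" if "(S, h) \<in> algebras p R''" for S h
        using compose_algebras[OF _ g' that] g by (simp add: algebras_def p_nilpotent_ring_def)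
      show "case b of (R'', g') \<Rightarrow> ?\<eta> R R'' (compose (carrier R) g' g) x =
             scomp ?X' R'' (transport (spull ?X R R'' (compose (carrier R) g' g) x))
               (spull ?X' R' R'' g' (transport (spull ?X R R' g x)))
               (spull ?X' R R'' (compose (carrier R) g' g) (transport x))
               (spullm ?X' R' R'' g' (?\<eta> R R' g x)) (?\<eta> R' R'' g' (spull ?X R R' g x))"
        unfolding b prod.case
        by (auto simp: quotient_stack_def fun_eq_iff compose_rhom_assoc[OF gh] alg compose_def[of "tob _ _ _"])
    qed
  qed
qed

end

section \<open>Rational numbers integral at \<open>p\<close>\<close>

definition zp :: "nat \<Rightarrow> rat set" where
  "zp p = {of_int a / of_int b | a b. \<not> int p dvd b}"

definition zp_units :: "nat \<Rightarrow> rat set" where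
  "zp_units p = {q \<in> zp p. inverse q \<in> zp p \<and> q \<noteq> 0}"

lemma zpI: "\<not> int p dvd b \<Longrightarrow> of_int a / of_int b \<in> zp p"
  by (auto simp: zp_def)

lemma zpE:
  assumes "q \<in> zp p"
  obtains a b where "q = of_int a / of_int b" "\<not> int p dvd b" "b \<noteq> 0"
  using assms by (auto simp: zp_def)

lemma zp_units_in_zp: "q \<in> zp_units p \<Longrightarrow> q \<in> zp p"
  and zp_units_inverse: "q \<in> zp_units p \<Longrightarrow> inverse q \<in> zp_units p"
  and zp_units_nonzero: "q \<in> zp_units p \<Longrightarrow> q \<noteq> 0"
  by (auto simp: zp_units_def)

context
  fixes p :: nat
  assumes p: "Factorial_Ring.prime p"
begin

lemma prime_int: "Factorial_Ring.prime (int p)"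
  using p by simp

lemma zp_of_int [simp]: "of_int a \<in> zp p"
  using zpI[of p 1 a] prime_gt_1_nat[OF p] by simp

lemma zp_of_nat [simp]: "of_nat a \<in> zp p"
  using zp_of_int[of "int a"] by simp

lemma zp_0_1 [simp]: "0 \<in> zp p" "1 \<in> zp p"
  using zp_of_int[of 0] zp_of_int[of 1] by simp_all

lemma zp_add [simp]: "\<lbrakk>x \<in> zp p; y \<in> zp p\<rbrakk> \<Longrightarrow> x + y \<in> zp p"
proof (elim zpE)
  fix a b c d assume *: "x = of_int a / of_int b" "\<not> int p dvd b" "b \<noteq> 0"
    "y = of_int c / of_int d" "\<not> int p dvd d" "d \<noteq> 0"
  have "x + y = of_int (a * d + c * b) / of_int (b * d)"
    using * by (simp add: add_frac_eq)
  then show "x + y \<in> zp p"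
    using * prime_int by (metis prime_dvd_mult_iff zpI)
qed

lemma zp_mult [simp]: "\<lbrakk>x \<in> zp p; y \<in> zp p\<rbrakk> \<Longrightarrow> x * y \<in> zp p"
proof (elim zpE)
  fix a b c d assume *: "x = of_int a / of_int b" "\<not> int p dvd b" "b \<noteq> 0"
    "y = of_int c / of_int d" "\<not> int p dvd d" "d \<noteq> 0"
  have "x * y = of_int (a * c) / of_int (b * d)"
    using * by simp
  then show "x * y \<in> zp p"
    using * prime_int by (metis prime_dvd_mult_iff zpI)
qed

lemma zp_uminus [simp]: "x \<in> zp p \<Longrightarrow> - x \<in> zp p"
  using zp_mult[of "-1" x] zp_of_int[of "-1"] by simp

lemma zp_power [simp]: "x \<in> zp p \<Longrightarrow> x ^ n \<in> zp p"
  by (induction n) auto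

lemma zp_sum: "(\<And>i. i \<in> I \<Longrightarrow> f i \<in> zp p) \<Longrightarrow> sum f I \<in> zp p"
  by (induction I rule: infinite_finite_induct) auto

lemma zp_units_mult: "\<lbrakk>x \<in> zp_units p; y \<in> zp_units p\<rbrakk> \<Longrightarrow> x * y \<in> zp_units p"
  by (auto simp: zp_units_def)

lemma zp_units_power: "x \<in> zp_units p \<Longrightarrow> x ^ n \<in> zp_units p"
  by (auto simp: zp_units_def power_inverse[symmetric])

lemma zp_units_of_int: "\<not> int p dvd a \<Longrightarrow> of_int a \<in> zp_units p"
  using zpI[of p a 1] by (auto simp: zp_units_def inverse_eq_divide)

lemma zp_unitsI_cong:
  assumes "x - of_int a \<in> (*) (of_nat p) ` zp p" "\<not> int p dvd a"
  shows "x \<in> zp_units p"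
proof -
  obtain z where z: "z \<in> zp p" "x = of_int a + of_nat p * z"
    using assms(1) by (auto simp: algebra_simps)
  obtain b c where bc: "z = of_int b / of_int c" "\<not> int p dvd c" "c \<noteq> 0"
    using z(1) by (rule zpE)
  let ?n = "a * c + int p * b"
  have n: "\<not> int p dvd ?n"
    using assms(2) bc(2) prime_int by (simp add: prime_dvd_mult_iff dvd_add_left_iff)
  have "x = of_int ?n / of_int c"
    using bc z by (simp add: field_simps)
  then have "x \<in> zp p" "inverse x = of_int c / of_int ?n" "x \<noteq> 0"
    using bc(2,3) n by (auto intro: zpI simp del: of_int_add of_int_mult)
  then show ?thesis
    using n by (auto simp: zp_units_def simp del: of_int_add of_int_mult intro: zpI)
qed

text \<open>The sequence with ghost components \<open>(1, 0, 0, \<dots>)\<close>, whose entries have denominator \<open>(p\<^sup>k)!\<close> up to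
  units: \<open>W[F]\<close> is parametrized by the sequences \<open>c\<^sub>k x\<^bsup>p^k\<^esup>\<close>.\<close>

function wc :: "nat \<Rightarrow> rat" where
  "wc k = (if k = 0 then 1 else - (\<Sum>i<k. of_nat (p ^ i) * wc i ^ (p ^ (k - i))) / of_nat (p ^ k))"
  by auto
termination by (relation "measure id") auto

declare wc.simps [simp del]

lemma wc_0 [simp]: "wc 0 = 1"
  by (simp add: wc.simps)

lemma ghost_wc: "ghost p k wc = (if k = 0 then 1 else 0)"
proof (cases "k = 0")
  case False
  then have "of_nat (p ^ k) * wc k = - (\<Sum>i<k. of_nat (p ^ i) * wc i ^ (p ^ (k - i)))"
    using prime_gt_0_nat[OF p] by (subst wc.simps) simp
  then show ?thesis
    using False by (simp add: ghost_split)
qed simp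

text \<open>That this is a unit means that the \<open>p\<close>-adic valuation of
  \<open>wc (Suc k)\<close> is \<open>p\<close> times that of \<open>wc k\<close>, minus 1. The
  inverses of \<open>(p^k)!\<close> obey the same recursion.\<close>

definition wr :: "nat \<Rightarrow> rat" where
  "wr k = of_nat p * wc (Suc k) / wc k ^ p"

text \<open>Divide the vanishing ghost component \<open>Suc k\<close> of \<open>wc\<close> by
  \<open>p^k * wc k ^ p\<close>. The term \<open>i = k\<close> gives 1, and the term with
  \<open>d = k - i > 0\<close> is the \<open>p\<close>-th power of
  \<open>wc i ^ (p^d) / wc k\<close> over \<open>p^d\<close>. That quotient is divisible by
  \<open>p^d\<close>, so the term is divisible by \<open>p^(d(p-1))\<close>. Hence
  \<open>- wr k\<close> is congruent to 1 modulo \<open>p\<close>.\<close>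

lemma wr_unit_aux: "wc k \<noteq> 0 \<and> wr k \<in> zp_units p"
proof (induction k rule: less_induct)
  case (less k)
  have p0: "p > 0" "p \<ge> 2" using p prime_gt_0_nat prime_ge_2_nat by auto
  have nz: "wc j \<noteq> 0" if "j \<le> k" for j
  proof (cases j)
    case (Suc i)
    then have "wr i \<noteq> 0" using less[of i] that zp_units_nonzero by auto
    then show ?thesis by (auto simp: wr_def Suc)
  qed simp
  \<comment> \<open>Passing from \<open>wc j ^ p\<close> to \<open>wc (Suc j)\<close> costs
    \<open>p\<close> times a unit by the induction hypothesis for \<open>wr j\<close>;
    \<open>d\<close> such passages give \<open>p^d\<close>.\<close>
  have r: "wc i ^ (p ^ d) / wc (i + d) \<in> (*) (of_nat p ^ d) ` zp p" if "i + d \<le> k" for i d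
    using that
  proof (induction d)
    case 0
    then show ?case using nz[of i] by (auto intro!: image_eqI[of _ _ 1])
  next
    case (Suc d)
    then obtain z where z: "z \<in> zp p" "wc i ^ (p ^ d) / wc (i + d) = of_nat p ^ d * z"
      by auto
    have w: "wr (i + d) \<in> zp_units p" using less Suc by simp
    have e: "wc (i + d) ^ p = of_nat p * inverse (wr (i + d)) * wc (i + Suc d)"
      using nz[of "i + d"] nz[of "i + Suc d"] Suc.prems p0 by (simp add: wr_def field_simps)
    have "wc i ^ (p ^ d) = of_nat p ^ d * z * wc (i + d)"
      using z(2) nz[of "i + d"] Suc.prems by (simp add: field_simps)
    then have "wc i ^ (p ^ Suc d) = (of_nat p ^ d * z) ^ p * wc (i + d) ^ p"
      by (metis power_Suc2 power_mult power_mult_distrib)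
    then have "wc i ^ (p ^ Suc d) / wc (i + Suc d) = (of_nat p ^ d * z) ^ p * (of_nat p * inverse (wr (i + d)))"
      using nz[of "i + Suc d"] Suc.prems by (simp add: e)
    also have "\<dots> = of_nat p ^ Suc d * ((of_nat p ^ d) ^ (p - 1) * z ^ p * inverse (wr (i + d)))"
    proof -
      have "(of_nat p ^ d :: rat) ^ p = of_nat p ^ d * (of_nat p ^ d) ^ (p - 1)"
        using p0 by (metis power_eq_if not_gr_zero)
      then show ?thesis by (simp add: power_mult_distrib)
    qed
    finally show ?case
      using z(1) zp_units_in_zp[OF zp_units_inverse[OF w]]
      by (auto intro!: image_eqI zp_mult zp_power)
  qed
  have "- wr k - 1 \<in> (*) (of_nat p) ` zp p"
  proof -
    have "of_nat (p ^ Suc k) * wc (Suc k) = - (\<Sum>i<Suc k. of_nat (p ^ i) * wc i ^ (p ^ (Suc k - i)))"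
      using ghost_wc[of "Suc k"] by (simp add: ghost_split)
    then have "- wr k = (\<Sum>i<Suc k. of_nat (p ^ i) * wc i ^ (p ^ (Suc k - i))) / (of_nat (p ^ k) * wc k ^ p)"
      using nz[of k] p0 by (simp add: wr_def field_simps)
    also have "\<dots> = (\<Sum>i<k. of_nat (p ^ i) * wc i ^ (p ^ (Suc k - i)) / (of_nat (p ^ k) * wc k ^ p)) + 1"
      using nz[of k] p0 by (simp add: add_divide_distrib sum_divide_distrib)
    finally have eq: "- wr k - 1 = (\<Sum>i<k. of_nat (p ^ i) * wc i ^ (p ^ (Suc k - i)) / (of_nat (p ^ k) * wc k ^ p))"
      by simp
    have "\<exists>y\<in>zp p. of_nat (p ^ i) * wc i ^ (p ^ (Suc k - i)) / (of_nat (p ^ k) * wc k ^ p) = of_nat p * y"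
      if i: "i < k" for i
    proof -
      obtain d where d: "k = i + Suc d"
        using i less_iff_Suc_add by auto
      obtain z where z: "z \<in> zp p" "wc i ^ (p ^ Suc d) / wc k = of_nat p ^ Suc d * z"
        using r[of i "Suc d"] d by auto
      have "wc i ^ (p ^ (Suc k - i)) = (wc i ^ (p ^ Suc d)) ^ p"
        by (simp add: d mult.commute flip: power_mult)
      then have "of_nat (p ^ i) * wc i ^ (p ^ (Suc k - i)) / (of_nat (p ^ k) * wc k ^ p) =
          (wc i ^ (p ^ Suc d) / wc k) ^ p / of_nat p ^ Suc d"
        using p0 by (simp add: d power_divide power_add)
      also have "\<dots> = (of_nat p ^ Suc d) ^ p * z ^ p / of_nat p ^ Suc d"
        by (simp only: z(2) power_mult_distrib)
      also have "\<dots> = (of_nat p ^ Suc d) ^ (p - 1) * z ^ p"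
        using p0 by (simp add: power_eq_if[of _ p] del: power_Suc)
      also have "\<dots> = of_nat p * (of_nat p ^ (Suc d * (p - 1) - 1) * z ^ p)"
      proof -
        have "Suc d * (p - 1) > 0" using p0 by simp
        then have "(of_nat p :: rat) ^ (Suc d * (p - 1)) = of_nat p * of_nat p ^ (Suc d * (p - 1) - 1)"
          by (metis Suc_pred' power_Suc)
        then show ?thesis by (simp only: power_mult[symmetric] mult.assoc)
      qed
      finally show ?thesis
        using z(1) by (intro bexI[of _ "of_nat p ^ (Suc d * (p - 1) - 1) * z ^ p"]) (auto intro!: zp_mult zp_power)
    qed
    then obtain y where y: "\<And>i. i < k \<Longrightarrow> y i \<in> zp p"
      "\<And>i. i < k \<Longrightarrow> of_nat (p ^ i) * wc i ^ (p ^ (Suc k - i)) / (of_nat (p ^ k) * wc k ^ p) = of_nat p * y i"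
      by metis
    have "- wr k - 1 = of_nat p * (\<Sum>i<k. y i)"
      unfolding eq sum_distrib_left by (rule sum.cong[OF refl], rule y(2), simp)
    moreover have "(\<Sum>i<k. y i) \<in> zp p"
      by (rule zp_sum) (auto simp: y)
    ultimately show ?thesis by blast
  qed
  then have "- wr k - of_int 1 \<in> (*) (of_nat p) ` zp p"
    by simp
  then have "- wr k \<in> zp_units p"
    by (rule zp_unitsI_cong) (use p0 in auto)
  then show ?case
    using nz[of k] zp_units_mult[of "-1" "- wr k"] zp_units_of_int[of "-1"] p0
    by (auto simp: zp_units_def)
qed

lemma wc_nonzero [simp]: "wc k \<noteq> 0" and wr_unit: "wr k \<in> zp_units p"
  using wr_unit_aux by auto

text \<open>The constant in \<open>wc_power\<close>. The relation \<open>frob_rel\<close> imposes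
  the same constant on the components of a vector over \<open>R\<close>.\<close>

definition we :: "nat \<Rightarrow> rat" where
  "we k = of_nat p * inverse (wr k)"

lemma we_zp [simp]: "we k \<in> zp p"
  unfolding we_def using zp_units_in_zp[OF zp_units_inverse[OF wr_unit]] by simp

lemma wc_power: "wc k ^ p = we k * wc (Suc k)"
  using prime_gt_0_nat[OF p] by (simp add: we_def wr_def field_simps)

lemma we_nonzero: "we k \<noteq> 0"
  using zp_units_nonzero[OF wr_unit[of k]] prime_gt_0_nat[OF p] by (simp add: we_def)

text \<open>Only the multiples of \<open>p\<close> among the factors of \<open>w!\<close> are not
  units; together they give \<open>p^(w div p)\<close> times the factorial of
  \<open>w div p\<close>.\<close>

lemma fact_div_unit:
  "of_nat (fact w) / (of_nat p ^ (w div p) * of_nat (fact (w div p))) \<in> zp_units p"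
proof (induction w)
  case 0
  then show ?case using zp_units_of_int[of 1] prime_gt_1_nat[OF p] by simp
next
  case (Suc w)
  have p0: "p > 0" using p prime_gt_0_nat by auto
  show ?case
  proof (cases "p dvd Suc w")
    case True
    then obtain q where q: "Suc w = p * q" by (auto simp: dvd_def)
    then obtain q' where q': "q = Suc q'" by (cases q) auto
    have "w div p = q'"
      using q q' p0 by (intro div_nat_eqI) auto
    moreover have "Suc w div p = Suc q'" using q q' p0 by simp
    ultimately have "of_nat (fact (Suc w)) / (of_nat p ^ (Suc w div p) * of_nat (fact (Suc w div p))) =
        (of_nat (fact w) / (of_nat p ^ (w div p) * of_nat (fact (w div p))) :: rat)"
    proof -
      have "fact (Suc w) = p * Suc q' * (fact w :: nat)"
        using q q' by (metis fact_Suc of_nat_id)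
      then have "(of_nat (fact (Suc w)) :: rat) = of_nat p * of_nat (Suc q') * of_nat (fact w)"
        by (metis of_nat_mult)
      then show ?thesis
        using \<open>w div p = q'\<close> \<open>Suc w div p = Suc q'\<close> p0 by (simp add: field_simps del: of_nat_Suc fact_Suc) 
          (simp add: field_simps)
    qed
    then show ?thesis using Suc by simp
  next
    case False
    then have "Suc w div p = w div p"
      by (simp add: div_Suc dvd_eq_mod_eq_0)
    moreover have "of_nat (Suc w) \<in> zp_units p"
      using zp_units_of_int[of "int (Suc w)"] False by (simp del: of_nat_Suc)
    moreover have "(of_nat (fact (Suc w)) :: rat) = of_nat (Suc w) * of_nat (fact w)"
      by (metis fact_Suc of_nat_id of_nat_mult)
    ultimately show ?thesis
      using zp_units_mult[OF _ Suc, of "of_nat (Suc w)"] by (simp only: times_divide_eq_right)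
  qed
qed

end

section \<open>The kernel of Frobenius and divided powers\<close>

text \<open>The product of the \<open>a (j + i)\<close>, each raised to the \<open>i\<close>-th
  digit of \<open>w\<close> in base \<open>p\<close>. The case \<open>p < 2\<close> makes the
  recursion on \<open>w div p\<close> terminate.\<close>

fun digit_monomial :: "'a ring \<Rightarrow> nat \<Rightarrow> (nat \<Rightarrow> 'a) \<Rightarrow> nat \<Rightarrow> nat \<Rightarrow> 'a" where
  "digit_monomial R p a j w =
     (if w = 0 \<or> p < 2 then \<one>\<^bsub>R\<^esub>
      else a j [^]\<^bsub>R\<^esub> (w mod p) \<otimes>\<^bsub>R\<^esub> digit_monomial R p a (Suc j) (w div p))"

declare digit_monomial.simps [simp del]

section \<open>The action of p-integral rationals on a p-nilpotent ring\<close>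

locale witt_nilp = witt R p for R :: "'u ring" (structure) and p +
  assumes nilp: "\<exists>k::nat. [(p ^ k)] \<cdot> \<one> = \<zero>"
begin

abbreviation sc :: "int \<Rightarrow> 'u" where
  "sc z \<equiv> [z] \<cdot> \<one>"

lemma sc_add: "sc (x + y) = sc x \<oplus> sc y"
  by (rule add.int_pow_mult) simp

lemma sc_mult: "sc (x * y) = sc x \<otimes> sc y"
  by (simp add: add_pow_ldistr_int add_pow_rdistr_int add.int_pow_pow mult.commute)

text \<open>\<open>b\<close> is prime to \<open>p^k\<close>, so a Bezout relation in which
  \<open>p^k\<close> becomes zero exhibits the inverse.\<close>

lemma sc_unit:
  assumes "\<not> int p dvd b"
  shows "sc b \<in> Units R"
proof -
  obtain k :: nat where k: "[(p ^ k)] \<cdot> \<one> = \<zero>"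
    using nilp by blast
  have "coprime b (int p ^ k)"
    using prime_imp_coprime[of "int p" b] prime_p assms by (simp add: coprime_commute)
  then obtain u v where uv: "u * b + v * int p ^ k = 1"
    by (metis bezout_int coprime_iff_gcd_eq_1)
  have "sc (int p ^ k) = \<zero>"
    using k by (simp add: add_pow_int_ge nat_power_eq)
  then have "sc u \<otimes> sc b = \<one>"
    using arg_cong[OF uv, of sc] by (simp add: sc_add sc_mult)
  then show ?thesis
    by (auto simp: Units_def m_comm intro!: bexI[of _ "sc u"])
qed

definition scal :: "rat \<Rightarrow> 'u" where
  "scal q = (THE x. x \<in> carrier R \<and> (\<exists>a b. q = of_int a / of_int b \<and> \<not> int p dvd b \<and> x \<otimes> sc b = sc a))"

lemma unit_cancel: "\<lbrakk>u \<in> Units R; x \<in> carrier R; y \<in> carrier R; x \<otimes> u = y \<otimes> u\<rbrakk> \<Longrightarrow> x = y"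
  by (metis Units_closed Units_l_cancel m_comm)

text \<open>Different fractions for the same rational are compared by cross-multiplication, and the
  product of their denominators is a unit of \<open>R\<close>; so the description in
  \<open>scal\<close> is unique.\<close>

lemma scal_eqI:
  assumes x: "x \<in> carrier R" and b: "\<not> int p dvd b" and eq: "x \<otimes> sc b = sc a"
  shows "scal (of_int a / of_int b) = x"
  unfolding scal_def
proof (rule the_equality)
  show "x \<in> carrier R \<and> (\<exists>a' b'. of_int a / of_int b = (of_int a' / of_int b' :: rat) \<and> \<not> int p dvd b' \<and> x \<otimes> sc b' = sc a')"
    using assms by blast
  fix y assume "y \<in> carrier R \<and> (\<exists>a' b'. of_int a / of_int b = (of_int a' / of_int b' :: rat) \<and> \<not> int p dvd b' \<and> y \<otimes> sc b' = sc a')"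
  then obtain c d where y: "y \<in> carrier R" "of_int a / of_int b = (of_int c / of_int d :: rat)" "\<not> int p dvd d" "y \<otimes> sc d = sc c"
    by blast
  have "b \<noteq> 0" "d \<noteq> 0" using b y(3) by auto
  then have "of_int (a * d) = (of_int (c * b) :: rat)"
    using y(2) by (simp add: field_simps)
  then have "a * d = c * b"
    by (simp only: of_int_eq_iff)
  then have "sc a \<otimes> sc d = sc c \<otimes> sc b"
    by (metis sc_mult)
  then have "x \<otimes> (sc b \<otimes> sc d) = y \<otimes> (sc b \<otimes> sc d)"
    using x y(1) eq y(4) by (metis (no_types, lifting) add.int_pow_closed m_assoc m_comm one_closed)
  moreover have "sc b \<otimes> sc d \<in> Units R"
    using b y(3) by (simp add: sc_unit)
  ultimately show "y = x"
    using x y(1) by (metis unit_cancel)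
qed

lemma scal_frac:
  assumes "\<not> int p dvd b"
  shows "scal (of_int a / of_int b) \<in> carrier R" "scal (of_int a / of_int b) \<otimes> sc b = sc a"
proof -
  let ?x = "sc a \<otimes> inv (sc b)"
  have x: "?x \<in> carrier R" "?x \<otimes> sc b = sc a"
    using sc_unit[OF assms] by (simp_all add: m_assoc)
  then have "scal (of_int a / of_int b) = ?x"
    by (intro scal_eqI assms)
  then show "scal (of_int a / of_int b) \<in> carrier R" "scal (of_int a / of_int b) \<otimes> sc b = sc a"
    using x by simp_all
qed

lemma scal_closed [simp]: "q \<in> zp p \<Longrightarrow> scal q \<in> carrier R"
  by (elim zpE) (simp add: scal_frac)

lemma scal_of_int: "scal (of_int z) = sc z"
  using scal_eqI[of "sc z" 1 z] prime_gt_1_nat[OF prime_p] by simp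

lemma scal_of_nat: "scal (of_nat n) = [n] \<cdot> \<one>"
  using scal_of_int[of "int n"] by (simp add: add_pow_int_ge)

lemma scal_0 [simp]: "scal 0 = \<zero>" and scal_1 [simp]: "scal 1 = \<one>"
  using scal_of_int[of 0] scal_of_int[of 1] by (simp_all add: add_pow_int_ge)

lemma scal_add_mult:
  assumes "x \<in> zp p" "y \<in> zp p"
  shows "scal (x + y) = scal x \<oplus> scal y" "scal (x * y) = scal x \<otimes> scal y"
proof -
  obtain a b where ab: "x = of_int a / of_int b" "\<not> int p dvd b" "b \<noteq> 0"
    using assms(1) by (rule zpE)
  obtain c d where cd: "y = of_int c / of_int d" "\<not> int p dvd d" "d \<noteq> 0"
    using assms(2) by (rule zpE)
  have bd: "\<not> int p dvd b * d"
    using ab(2) cd(2) prime_p by (simp add: prime_dvd_mult_iff)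
  note cl = scal_closed[OF assms(1)] scal_closed[OF assms(2)]
  note b = scal_frac(2)[OF ab(2), of a, folded ab(1)] and d = scal_frac(2)[OF cd(2), of c, folded cd(1)]
  have sc_cl: "sc z \<in> carrier R" for z by simp
  have "(scal x \<oplus> scal y) \<otimes> sc (b * d) = (scal x \<otimes> sc b) \<otimes> sc d \<oplus> (scal y \<otimes> sc d) \<otimes> sc b"
    using cl sc_cl[of b] sc_cl[of d] unfolding sc_mult by algebra
  also have "\<dots> = sc (a * d + c * b)"
    unfolding b d by (simp add: sc_add sc_mult)
  finally have "scal (of_int (a * d + c * b) / of_int (b * d)) = scal x \<oplus> scal y"
    using cl bd by (intro scal_eqI) auto
  moreover have "of_int (a * d + c * b) / of_int (b * d) = x + y"
    using ab cd by (simp add: add_frac_eq)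
  ultimately show "scal (x + y) = scal x \<oplus> scal y" by simp
  have "(scal x \<otimes> scal y) \<otimes> sc (b * d) = (scal x \<otimes> sc b) \<otimes> (scal y \<otimes> sc d)"
    using cl sc_cl[of b] sc_cl[of d] unfolding sc_mult by algebra
  also have "\<dots> = sc (a * c)"
    unfolding b d by (simp add: sc_mult)
  finally have "scal (of_int (a * c) / of_int (b * d)) = scal x \<otimes> scal y"
    using cl bd by (intro scal_eqI) auto
  then show "scal (x * y) = scal x \<otimes> scal y"
    using ab cd by simp
qed

lemmas scal_add = scal_add_mult(1) and scal_mult = scal_add_mult(2)

lemma scal_power: "x \<in> zp p \<Longrightarrow> scal (x ^ n) = scal x [^] n"
  by (induction n) (simp_all add: scal_mult prime_p m_comm)

section \<open>Coefficients of digit monomials and factorials\<close>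

lemma p_ge_2: "p \<ge> 2"
  using prime_p by (rule prime_ge_2_nat)

declare zp_add[OF prime_p, simp] zp_mult[OF prime_p, simp] zp_power[OF prime_p, simp] zp_0_1[OF prime_p, simp]
  zp_uminus[OF prime_p, simp] zp_of_nat[OF prime_p, simp] zp_of_int[OF prime_p, simp] we_zp[OF prime_p, simp]
  wc_nonzero[OF prime_p, simp]

text \<open>The coefficient that arises for the model vector with components
  \<open>wc k * x^(p^k)\<close>: its digit monomial from place \<open>j\<close> is
  \<open>C j w\<close> times \<open>x^(w * p^j)\<close>.\<close>

abbreviation C :: "nat \<Rightarrow> nat \<Rightarrow> rat" where
  "C \<equiv> digit_monomial type_ring p (wc p)"

lemma C_rec: "s < p \<Longrightarrow> C j (s + p * w) = wc p j ^ s * C (Suc j) w"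
  using p_ge_2 by (subst digit_monomial.simps) (auto simp: digit_monomial.simps[of _ _ _ _ 0])

lemma C_0 [simp]: "C j 0 = 1"
  by (simp add: digit_monomial.simps)

lemma C_nonzero [simp]: "C j w \<noteq> 0"
proof (induction w arbitrary: j rule: less_induct)
  case (less w)
  show ?case
    using less[of "w div p" "Suc j"] p_ge_2 C_rec[of "w mod p" j "w div p"]
    by (cases "w = 0") simp_all
qed

text \<open>Split off the last digit, \<open>w = s + p w'\<close>. By \<open>wc_power\<close> the
  power \<open>wc j ^ w\<close> becomes one of \<open>wc (Suc j)\<close> times a power of
  \<open>we j\<close>, whose factors \<open>p\<close> are those lost in passing from
  \<open>w!\<close> to \<open>w'!\<close>. What remains are units and the same quotient for
  \<open>w'\<close>.\<close>

lemma C_unit: "of_nat (fact w) * C j w / wc p j ^ w \<in> zp_units p"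
proof (induction w arbitrary: j rule: less_induct)
  case (less w)
  show ?case
  proof (cases "w = 0")
    case True
    then show ?thesis
      using zp_units_of_int[OF prime_p, of 1] p_ge_2 by simp
  next
    case False
    define s w' where "s = w mod p" and "w' = w div p"
    have w: "w = s + p * w'" "s < p" "w' < w"
      using p_ge_2 False by (auto simp: s_def w'_def)
    have e: "we p j \<noteq> 0" "inverse (wr p j) \<in> zp_units p"
      using we_nonzero[OF prime_p] zp_units_inverse[OF wr_unit[OF prime_p]] by auto
    have "wc p j ^ w = wc p j ^ s * (we p j * wc p (Suc j)) ^ w'"
      by (simp add: w(1) power_add power_mult wc_power[OF prime_p])
    then have "of_nat (fact w) * C j w / wc p j ^ w =
        (of_nat (fact w) / (of_nat p ^ w' * of_nat (fact w'))) * wr p j ^ w' *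
        (of_nat (fact w') * C (Suc j) w' / wc p (Suc j) ^ w')"
      using w(2) e(1) p_ge_2 zp_units_nonzero[OF wr_unit[OF prime_p, of j]]
      by (simp add: C_rec we_def[OF prime_p] w(1) power_mult_distrib field_simps del: of_nat_fact)
    also have "\<dots> \<in> zp_units p"
      using fact_div_unit[OF prime_p, of w, folded w'_def] less[OF w(3), of "Suc j"] wr_unit[OF prime_p, of j]
      by (intro zp_units_mult[OF prime_p] zp_units_power[OF prime_p])
    finally show ?thesis .
  qed
qed

text \<open>Compares divided powers with digit monomials: in the model vector the digit monomial of
  \<open>m\<close> is \<open>U m\<close> times \<open>x^m / m!\<close>.\<close>

definition U :: "nat \<Rightarrow> rat" where
  "U m = of_nat (fact m) * C 0 m"

lemma U_unit: "U m \<in> zp_units p"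
  using C_unit[of m 0] by (simp add: U_def wc_0[OF prime_p])

lemma U_zp [simp]: "U m \<in> zp p" "inverse (U m) \<in> zp p" and U_nonzero [simp]: "U m \<noteq> 0"
  using U_unit[of m] zp_units_inverse[OF U_unit[of m]] by (auto simp: zp_units_def)

lemma C_power_p: "C j (p ^ k) = wc p (j + k)"
proof (induction k arbitrary: j)
  case 0
  show ?case using C_rec[of 1 j 0] p_ge_2 by simp
next
  case (Suc k)
  show ?case using C_rec[of 0 j "p ^ k"] Suc[of "Suc j"] p_ge_2 by simp
qed

section \<open>Digit monomials in the ring and the maps between divided powers and Witt
  vectors\<close>

lemma digit_monomial_closed [simp]: "(\<And>i. a i \<in> carrier R) \<Longrightarrow> digit_monomial R p a j w \<in> carrier R"
proof (induction w arbitrary: j rule: less_induct)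
  case (less w)
  have "w \<noteq> 0 \<Longrightarrow> digit_monomial R p a (Suc j) (w div p) \<in> carrier R" if "\<not> p < 2"
    using less that by (intro less.IH) auto
  then show ?case
    using less.prems by (subst digit_monomial.simps) auto
qed

lemma digit_monomial_rec:
  assumes "\<And>i. a i \<in> carrier R" "s < p"
  shows "digit_monomial R p a j (s + p * w) = a j [^] s \<otimes> digit_monomial R p a (Suc j) w"
  using p_ge_2 assms by (subst digit_monomial.simps) (auto simp: digit_monomial.simps[of _ _ _ _ 0])

lemma digit_monomial_power_p:
  assumes "\<And>i. a i \<in> carrier R"
  shows "digit_monomial R p a j (p ^ k) = a (j + k)"
proof (induction k arbitrary: j)
  case 0
  show ?case using digit_monomial_rec[of a, OF assms, of 1 j 0] assms p_ge_2 by (simp add: digit_monomial.simps[of _ _ _ _ 0])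
next
  case (Suc k)
  show ?case using digit_monomial_rec[of a, OF assms, of 0 j "p ^ k"] Suc[of "Suc j"] assms p_ge_2 by simp
qed

text \<open>The relation satisfied by the model components \<open>wc k * x^(p^k)\<close>. It is all
  that is needed for the digit monomials of \<open>a\<close> to multiply like those of the
  model.\<close>

definition frob_rel :: "(nat \<Rightarrow> 'u) \<Rightarrow> nat \<Rightarrow> bool" where
  "frob_rel a k \<longleftrightarrow> a k [^] p = scal (we p k) \<otimes> a (Suc k)"

text \<open>Addition of \<open>s\<close> and \<open>w\<close> in base \<open>p\<close>. Without a
  carry the digits add. With a carry, \<open>a j ^ p\<close> is traded for \<open>we j\<close> times
  \<open>a (Suc j)\<close>. The same trades take place for \<open>wc\<close>, so the scalar over
  \<open>R\<close> is the one computed over the rationals, and it is seen to be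
  \<open>p\<close>-integral on the way.\<close>

lemma digit_monomial_mult:
  assumes a: "\<And>i. a i \<in> carrier R" and rel: "\<And>k. frob_rel a k"
  shows "C j s * C j w / C j (s + w) \<in> zp p \<and>
    digit_monomial R p a j s \<otimes> digit_monomial R p a j w =
      scal (C j s * C j w / C j (s + w)) \<otimes> digit_monomial R p a j (s + w)"
proof (induction "s + w" arbitrary: s w j rule: less_induct)
  case less
  let ?A = "digit_monomial R p a"
  define s0 s1 w0 w1 where sw: "s0 = s mod p" "s1 = s div p" "w0 = w mod p" "w1 = w div p"
  have s: "s = s0 + p * s1" "s0 < p" and w: "w = w0 + p * w1" "w0 < p"
    using p_ge_2 by (auto simp: sw)
  have Acl: "?A j w \<in> carrier R" for j w using a by simp
  have split: "?A j s \<otimes> ?A j w = a j [^] (s0 + w0) \<otimes> (?A (Suc j) s1 \<otimes> ?A (Suc j) w1)"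
    using a Acl by (simp add: s w digit_monomial_rec[of a, OF a] m_ac flip: nat_pow_mult)
  have Csplit: "C j s * C j w = wc p j ^ (s0 + w0) * (C (Suc j) s1 * C (Suc j) w1)"
    by (simp add: s w C_rec power_add)
  show ?case
  proof (cases "s = 0 \<and> w = 0")
    case True
    then show ?thesis by (simp add: digit_monomial.simps)
  next
    case False
    have le: "s1 + w1 < s + w"
    proof -
      have "s1 \<le> s" "w1 \<le> w" by (simp_all add: sw)
      moreover have "s1 < s \<or> w1 < w" using False p_ge_2 by (auto simp: sw)
      ultimately show ?thesis by linarith
    qed
    from less(1)[OF le, of "Suc j"] obtain z where z: "z \<in> zp p" "C (Suc j) s1 * C (Suc j) w1 = z * C (Suc j) (s1 + w1)"
      "?A (Suc j) s1 \<otimes> ?A (Suc j) w1 = scal z \<otimes> ?A (Suc j) (s1 + w1)"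
      by (metis C_nonzero nonzero_eq_divide_eq)
    show ?thesis
    proof (cases "s0 + w0 < p")
      case True
      have sum: "s + w = (s0 + w0) + p * (s1 + w1)"
        by (simp add: s w algebra_simps)
      have "C j s * C j w / C j (s + w) = z"
        unfolding Csplit sum C_rec[OF True] z(2) by simp
      moreover have "?A j s \<otimes> ?A j w = scal z \<otimes> ?A j (s + w)"
        unfolding split sum digit_monomial_rec[of a, OF a True] z(3)
        using a Acl z(1) by (simp add: m_lcomm)
      ultimately show ?thesis using z(1) by simp
    next
      case False
      define d where "d = s0 + w0 - p"
      have d: "s0 + w0 = p + d" "d < p"
        using False s(2) w(2) by (auto simp: d_def)
      have sum: "s + w = d + p * (1 + (s1 + w1))"
        using d(1) by (simp add: s(1) w(1) algebra_simps)
      \<comment> \<open>The carry is added to the higher digits by a second recursive call, with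
        exponents \<open>1\<close> and \<open>s1 + w1\<close>, whose sum must be smaller than
        \<open>s + w\<close>.\<close>
      have le2: "1 + (s1 + w1) < s + w"
      proof -
        have "1 + (s1 + w1) < 2 * (1 + (s1 + w1))"
          by simp
        also have "\<dots> \<le> p * (1 + (s1 + w1))"
          using p_ge_2 by (rule mult_le_mono1)
        also have "\<dots> \<le> s + w"
          unfolding sum by simp
        finally show ?thesis .
      qed
      from less(1)[OF le2, of "Suc j"] obtain y where y: "y \<in> zp p" "C (Suc j) 1 * C (Suc j) (s1 + w1) = y * C (Suc j) (1 + (s1 + w1))"
        "?A (Suc j) 1 \<otimes> ?A (Suc j) (s1 + w1) = scal y \<otimes> ?A (Suc j) (1 + (s1 + w1))"
        by (metis C_nonzero nonzero_eq_divide_eq)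
      have one: "C (Suc j) 1 = wc p (Suc j)" "?A (Suc j) 1 = a (Suc j)"
        using C_power_p[of "Suc j" 0] digit_monomial_power_p[of a, OF a, of "Suc j" 0] by simp_all
      have "wc p j ^ (s0 + w0) = wc p j ^ d * (we p j * wc p (Suc j))"
        by (simp add: d power_add wc_power[OF prime_p])
      then have "C j s * C j w = wc p j ^ d * we p j * z * (C (Suc j) 1 * C (Suc j) (s1 + w1))"
        unfolding Csplit z(2) one by simp
      also have "\<dots> = (we p j * z * y) * (wc p j ^ d * C (Suc j) (1 + (s1 + w1)))"
        unfolding y(2) by simp
      also have "wc p j ^ d * C (Suc j) (1 + (s1 + w1)) = C j (s + w)"
        unfolding sum C_rec[OF d(2)] by simp
      finally have C: "C j s * C j w / C j (s + w) = we p j * z * y"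
        by simp
      have "a j [^] (s0 + w0) = a j [^] d \<otimes> (scal (we p j) \<otimes> a (Suc j))"
        using rel[of j] a by (simp add: d frob_rel_def m_comm flip: nat_pow_mult)
      then have "?A j s \<otimes> ?A j w = a j [^] d \<otimes> (scal (we p j) \<otimes> (scal z \<otimes> (?A (Suc j) 1 \<otimes> ?A (Suc j) (s1 + w1))))"
        unfolding split z(3) one using a Acl z(1) by (simp add: m_ac)
      also have "\<dots> = scal (we p j * z * y) \<otimes> (a j [^] d \<otimes> ?A (Suc j) (1 + (s1 + w1)))"
        unfolding y(3) using a Acl z(1) y(1) by (simp add: scal_mult m_ac)
      also have "a j [^] d \<otimes> ?A (Suc j) (1 + (s1 + w1)) = ?A j (s + w)"
        unfolding sum digit_monomial_rec[of a, OF a d(2)] by simp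
      finally show ?thesis
        using C z(1) y(1) by simp
    qed
  qed
qed

definition dp_of :: "(nat \<Rightarrow> 'u) \<Rightarrow> nat \<Rightarrow> 'u" where
  "dp_of a m = scal (inverse (U m)) \<otimes> digit_monomial R p a 0 m"

text \<open>Exponents \<open>p^k\<close> suffice to invert \<open>dp_of\<close>, since the digit
  monomial of \<open>p^k\<close> is the \<open>k\<close>-th component.\<close>

definition witt_of :: "(nat \<Rightarrow> 'u) \<Rightarrow> nat \<Rightarrow> 'u" where
  "witt_of \<gamma> k = scal (U (p ^ k)) \<otimes> \<gamma> (p ^ k)"

lemma nat_mult_eq_scal: "x \<in> carrier R \<Longrightarrow> [(n::nat)] \<cdot> x = scal (of_nat n) \<otimes> x"
  by (simp add: scal_of_nat add_pow_ldistr)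

text \<open>The factorials hidden in \<open>U\<close> convert the structure constants of digit
  monomials into binomial coefficients.\<close>

lemma dp_of_Ga_sharp:
  assumes a: "\<And>i. a i \<in> carrier R" and rel: "\<And>k. frob_rel a k"
  shows "dp_of a \<in> Ga_sharp R"
  unfolding Ga_sharp_def
proof (intro CollectI conjI allI)
  show "dp_of a k \<in> carrier R" for k
    using a by (simp add: dp_of_def)
  show "dp_of a 0 = \<one>"
    by (simp add: dp_of_def U_def digit_monomial.simps)
  fix i j
  let ?A = "digit_monomial R p a 0"
  define z where "z = C 0 i * C 0 j / C 0 (i + j)"
  have z: "z \<in> zp p" "?A i \<otimes> ?A j = scal z \<otimes> ?A (i + j)"
    using digit_monomial_mult[of a, OF a rel, of 0 i j] by (auto simp: z_def)
  have Acl: "?A w \<in> carrier R" for w using a by simp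
  have "(fact (i + j) :: rat) = of_nat ((i + j) choose i) * (fact i * fact j)"
    by (simp add: binomial_fact)
  then have "of_nat ((i + j) choose i) * inverse (U (i + j)) = inverse (U i) * inverse (U j) * z"
    by (simp add: U_def z_def field_simps)
  then have "[((i + j) choose i)] \<cdot> dp_of a (i + j) = scal (inverse (U i) * inverse (U j) * z) \<otimes> ?A (i + j)"
    using Acl by (simp add: dp_of_def nat_mult_eq_scal scal_mult m_assoc[symmetric] flip: scal_mult)
  also have "\<dots> = scal (inverse (U i)) \<otimes> scal (inverse (U j)) \<otimes> (?A i \<otimes> ?A j)"
    unfolding z(2) using Acl z(1) by (simp add: scal_mult m_assoc)
  also have "\<dots> = dp_of a i \<otimes> dp_of a j"
    using Acl by (simp add: dp_of_def m_ac)
  finally show "dp_of a i \<otimes> dp_of a j = [((i + j) choose i)] \<cdot> dp_of a (i + j)"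
    by simp
qed

lemma witt_of_dp_of:
  assumes a: "\<And>i. a i \<in> carrier R"
  shows "witt_of (dp_of a) = a"
proof
  fix k
  have "witt_of (dp_of a) k = scal (U (p ^ k) * inverse (U (p ^ k))) \<otimes> a k"
    using a digit_monomial_power_p[of a, OF a, of 0 k] by (simp add: witt_of_def dp_of_def scal_mult m_assoc del: right_inverse)
  then show "witt_of (dp_of a) k = a k"
    using a by simp
qed

end

section \<open>Evaluation of rational polynomials at divided powers\<close>

context poly_mapping_eval
begin

lemma eval_sum:
  assumes "finite I" "\<And>i. i \<in> I \<Longrightarrow> f i \<in> dom"
  shows "sum f I \<in> dom \<and> eval (sum f I) = (\<Oplus>i\<in>I. eval (f i))"
  using assms by (induction I rule: finite_induct) (auto simp: eval_add)

lemma eval_power: "q \<in> dom \<Longrightarrow> q ^ n \<in> dom \<and> eval (q ^ n) = eval q [^] n"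
  by (induction n) (auto simp: eval_mult m_comm)

lemma eval_of_nat: "of_nat n \<in> dom \<and> eval (of_nat n) = [n] \<cdot> \<one>"
  by (induction n) (auto simp: eval_add add.m_comm)

end

locale poly_mapping_eval_neg = poly_mapping_eval R C T + plain_cring R
  for R :: "'a ring" (structure) and C :: "'m::comm_monoid_add \<Rightarrow> 'k::comm_ring_1 set" and T +
  assumes C_uminus: "c \<in> C m \<Longrightarrow> - c \<in> C m"
begin

definition dom_ring :: "('m \<Rightarrow>\<^sub>0 'k) ring" where
  "dom_ring = \<lparr>carrier = dom, monoid.mult = (*), one = 1, zero = 0, add = (+)\<rparr>"

lemma dom_uminus: "q \<in> dom \<Longrightarrow> - q \<in> dom"
  by (simp add: dom_def C_uminus)

lemma cring_dom_ring: "cring dom_ring"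
proof (intro cringI abelian_groupI comm_monoidI)
  fix x assume "x \<in> carrier dom_ring"
  then show "\<exists>y\<in>carrier dom_ring. y \<oplus>\<^bsub>dom_ring\<^esub> x = \<zero>\<^bsub>dom_ring\<^esub>"
    by (intro bexI[of _ "-x"]) (auto simp: dom_ring_def dom_uminus)
qed (auto simp: dom_ring_def algebra_simps)

text \<open>The admissible polynomials form a ring with two homomorphisms, the inclusion into all
  rational polynomials and the evaluation in \<open>R\<close>. Both commute with integral
  polynomials, so Witt polynomials may be computed upstairs, where ghost components are
  faithful.\<close>

lemma eval_zev:
  assumes "\<And>v. \<rho> v \<in> dom"
  shows "eval (zev \<rho> q) = zeval R (\<lambda>v. eval (\<rho> v)) q"
proof -
  have incl: "(\<lambda>x. x) \<in> ring_hom dom_ring type_ring"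
    by (rule ring_hom_memI) (auto simp: dom_ring_def)
  have hom: "eval \<in> ring_hom dom_ring R"
    by (rule ring_hom_memI) (auto simp: dom_ring_def eval_add eval_mult)
  have "zeval dom_ring \<rho> q = zev \<rho> q"
    using ring_hom_zeval[OF incl cring_dom_ring cring_type_ring, of \<rho> q] assms by (simp add: dom_ring_def)
  then show ?thesis
    using ring_hom_zeval[OF hom cring_dom_ring cring_axioms, of \<rho> q] assms by (simp add: dom_ring_def)
qed

end

text \<open>The Witt vector with ghost components \<open>(a, 0, 0, \<dots>)\<close>.\<close>

definition ghost_vector :: "nat \<Rightarrow> ('m::comm_monoid_add \<Rightarrow>\<^sub>0 rat) \<Rightarrow> nat \<Rightarrow> ('m \<Rightarrow>\<^sub>0 rat)" where
  "ghost_vector p a k = Poly_Mapping.single 0 (wc p k) * a ^ (p ^ k)"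

lemma single_0_power: "Poly_Mapping.single 0 (c :: rat) ^ n = Poly_Mapping.single (0 :: 'm::comm_monoid_add) (c ^ n)"
  by (induction n) (auto simp: mult_single)

lemma single_0_of_nat: "of_nat n * Poly_Mapping.single (0 :: 'm::comm_monoid_add) (c :: rat) = Poly_Mapping.single 0 (of_nat n * c)"
  by (induction n) (auto simp: distrib_right single_add)

lemma single_0_sum: "(\<Sum>i\<in>I. Poly_Mapping.single (0 :: 'm::comm_monoid_add) (f i :: rat)) = Poly_Mapping.single 0 (sum f I)"
  by (induction I rule: infinite_finite_induct) (auto simp: single_add)

lemma ghost_ghost_vector:
  assumes "Factorial_Ring.prime p"
  shows "ghost p k (ghost_vector p a) = (if k = 0 then a else 0)"
proof -
  have "ghost p k (ghost_vector p a) = (\<Sum>i\<le>k. Poly_Mapping.single 0 (of_nat (p ^ i) * wc p i ^ (p ^ (k - i))) * a ^ (p ^ k))"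
    unfolding ghost_def ghost_vector_def
    by (intro sum.cong) (auto simp: power_mult_distrib single_0_power single_0_of_nat[symmetric] mult.assoc
        simp flip: power_mult power_add simp del: of_nat_power)
  also have "\<dots> = Poly_Mapping.single 0 (ghost p k (wc p)) * a ^ (p ^ k)"
    by (simp add: ghost_def single_0_sum flip: sum_distrib_right)
  finally show ?thesis
    by (simp add: ghost_wc[OF assms])
qed

context witt_nilp
begin

text \<open>\<open>c\<close> is admissible for the monomial \<open>x^i y^j\<close> if the term is a
  \<open>p\<close>-integral multiple of \<open>(x^i / i!) (y^j / j!)\<close>.\<close>

definition dp_coeffs :: "nat \<times> nat \<Rightarrow> rat set" where
  "dp_coeffs m = {c. c * fact (fst m) * fact (snd m) \<in> zp p}"

definition dp_term :: "(nat \<Rightarrow> 'u) \<Rightarrow> (nat \<Rightarrow> 'u) \<Rightarrow> nat \<times> nat \<Rightarrow> rat \<Rightarrow> 'u" where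
  "dp_term \<gamma> \<delta> m c = scal (c * fact (fst m) * fact (snd m)) \<otimes> (\<gamma> (fst m) \<otimes> \<delta> (snd m))"

lemma Ga_sharpD:
  assumes "\<gamma> \<in> Ga_sharp R"
  shows "\<gamma> k \<in> carrier R" "\<gamma> 0 = \<one>" "\<gamma> i \<otimes> \<gamma> j = scal (of_nat ((i + j) choose i)) \<otimes> \<gamma> (i + j)"
  using assms nat_mult_eq_scal[of "\<gamma> (i + j)" "(i + j) choose i"] by (auto simp: Ga_sharp_def)

lemma dp_eval_locale:
  assumes \<gamma>: "\<gamma> \<in> Ga_sharp R" and \<delta>: "\<delta> \<in> Ga_sharp R"
  shows "poly_mapping_eval_neg R dp_coeffs (dp_term \<gamma> \<delta>)"
proof unfold_locales
  fix c d :: rat and m m' :: "nat \<times> nat"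
  note [simp] = Ga_sharpD(1,2)[OF \<gamma>] Ga_sharpD(1,2)[OF \<delta>]
  obtain i j where m: "m = (i, j)" by force
  obtain i' j' where m': "m' = (i', j')" by force
  show "c \<in> dp_coeffs m \<Longrightarrow> dp_term \<gamma> \<delta> m c \<in> carrier R"
    by (simp add: dp_coeffs_def dp_term_def)
  show "0 \<in> dp_coeffs m" "1 \<in> dp_coeffs 0" "dp_term \<gamma> \<delta> m 0 = \<zero>" "dp_term \<gamma> \<delta> 0 1 = \<one>"
    by (simp_all add: dp_coeffs_def dp_term_def)
  show "c \<in> dp_coeffs m \<Longrightarrow> - c \<in> dp_coeffs m"
    using zp_uminus[OF prime_p, of "c * fact (fst m) * fact (snd m)"] by (simp add: dp_coeffs_def)
  assume c: "c \<in> dp_coeffs m"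
  show "c + d \<in> dp_coeffs m" "dp_term \<gamma> \<delta> m (c + d) = dp_term \<gamma> \<delta> m c \<oplus> dp_term \<gamma> \<delta> m d"
    if d: "d \<in> dp_coeffs m"
    using c d by (simp_all add: dp_coeffs_def dp_term_def distrib_right scal_add l_distr)
  assume d: "d \<in> dp_coeffs m'"
  let ?b = "of_nat ((i + i') choose i) :: rat" and ?b' = "of_nat ((j + j') choose j) :: rat"
  let ?C = "c * fact i * fact j" and ?D = "d * fact i' * fact j'"
  have CD: "?C \<in> zp p" "?D \<in> zp p"
    using c d by (simp_all add: dp_coeffs_def m m')
  have "fact (i + i') = ?b * (fact i * fact i')" "fact (j + j') = ?b' * (fact j * fact j')"
    by (simp_all add: binomial_fact)
  then have e: "c * d * fact (i + i') * fact (j + j') = ?C * ?D * (?b * ?b')"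
    by simp
  have "c * d * fact (i + i') * fact (j + j') \<in> zp p"
    unfolding e using CD by simp
  then show "c * d \<in> dp_coeffs (m + m')"
    by (simp add: dp_coeffs_def m m')
  have "dp_term \<gamma> \<delta> (m + m') (c * d) = scal ?C \<otimes> scal ?D \<otimes> ((scal ?b \<otimes> \<gamma> (i + i')) \<otimes> (scal ?b' \<otimes> \<delta> (j + j')))"
    using CD by (simp add: dp_term_def m m' e scal_mult m_ac)
  also have "\<dots> = dp_term \<gamma> \<delta> m c \<otimes> dp_term \<gamma> \<delta> m' d"
    unfolding Ga_sharpD(3)[OF \<gamma>, symmetric] Ga_sharpD(3)[OF \<delta>, symmetric]
    using CD by (simp add: dp_term_def m m' m_ac)
  finally show "dp_term \<gamma> \<delta> (m + m') (c * d) = dp_term \<gamma> \<delta> m c \<otimes> dp_term \<gamma> \<delta> m' d" .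
qed

lemma U_p_power: "U (p ^ k) = wc p k * fact (p ^ k)"
  using C_power_p[of 0 k] by (simp add: U_def)

text \<open>The divided powers of a sum, by the binomial theorem.\<close>

definition dp_conv :: "(nat \<Rightarrow> 'u) \<Rightarrow> (nat \<Rightarrow> 'u) \<Rightarrow> nat \<Rightarrow> 'u" where
  "dp_conv \<gamma> \<delta> n = (\<Oplus>i\<in>{..n}. \<gamma> i \<otimes> \<delta> (n - i))"

context
  fixes \<gamma> \<delta>
  assumes \<gamma>: "\<gamma> \<in> Ga_sharp R" and \<delta>: "\<delta> \<in> Ga_sharp R"
begin

interpretation E: poly_mapping_eval_neg R dp_coeffs "dp_term \<gamma> \<delta>"
  by (rule dp_eval_locale[OF \<gamma> \<delta>])

abbreviation "X \<equiv> Poly_Mapping.single (Suc 0, 0::nat) (1::rat)"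
abbreviation "Y \<equiv> Poly_Mapping.single (0::nat, Suc 0) (1::rat)"

lemma X_power: "X ^ n = Poly_Mapping.single (n, 0) 1" and Y_power: "Y ^ n = Poly_Mapping.single (0, n) 1"
  by (induction n; auto simp: mult_single simp flip: single_one zero_prod_def)+

lemma eval_powers:
  assumes c: "c * fact n \<in> zp p"
  shows "E.eval (Poly_Mapping.single 0 c * X ^ n) = scal (c * fact n) \<otimes> \<gamma> n"
    "Poly_Mapping.single 0 c * X ^ n \<in> E.dom"
    "E.eval (Poly_Mapping.single 0 c * Y ^ n) = scal (c * fact n) \<otimes> \<delta> n"
    "Poly_Mapping.single 0 c * Y ^ n \<in> E.dom"
    "E.eval (Poly_Mapping.single 0 c * (X + Y) ^ n) = scal (c * fact n) \<otimes> dp_conv \<gamma> \<delta> n"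
    "Poly_Mapping.single 0 c * (X + Y) ^ n \<in> E.dom"
proof -
  note [simp] = Ga_sharpD(1,2)[OF \<gamma>] Ga_sharpD(1,2)[OF \<delta>]
  have mem: "c \<in> dp_coeffs (n, 0)" "c \<in> dp_coeffs (0, n)"
    using c by (simp_all add: dp_coeffs_def)
  show "E.eval (Poly_Mapping.single 0 c * X ^ n) = scal (c * fact n) \<otimes> \<gamma> n"
    "Poly_Mapping.single 0 c * X ^ n \<in> E.dom"
    "E.eval (Poly_Mapping.single 0 c * Y ^ n) = scal (c * fact n) \<otimes> \<delta> n"
    "Poly_Mapping.single 0 c * Y ^ n \<in> E.dom"
    using mem by (simp_all add: X_power Y_power mult_single dp_term_def)
  have fact: "c * of_nat (n choose i) * fact i * fact (n - i) = c * fact n" if "i \<le> n" for i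
    using that by (simp add: binomial_fact)
  have eq: "Poly_Mapping.single 0 c * (X + Y) ^ n =
      (\<Sum>i\<le>n. Poly_Mapping.single (i, n - i) (c * of_nat (n choose i)))"
  proof -
    have "Poly_Mapping.single 0 c * (of_nat (n choose i) * X ^ i * Y ^ (n - i)) =
        Poly_Mapping.single (i, n - i) (c * of_nat (n choose i))" for i
    proof -
      have "(of_nat (n choose i) :: nat \<times> nat \<Rightarrow>\<^sub>0 rat) = Poly_Mapping.single 0 (of_nat (n choose i))"
        by simp
      then show ?thesis
        unfolding X_power Y_power by (simp only: mult_single) simp
    qed
    then show ?thesis
      by (simp add: binomial_ring sum_distrib_left)
  qed
  have m: "c * of_nat (n choose i) \<in> dp_coeffs (i, n - i)" if "i \<le> n" for i
    using c that by (simp add: dp_coeffs_def fact)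
  show "Poly_Mapping.single 0 c * (X + Y) ^ n \<in> E.dom"
    unfolding eq by (rule E.eval_sum[THEN conjunct1]) (use m in auto)
  have "E.eval (Poly_Mapping.single 0 c * (X + Y) ^ n) =
      (\<Oplus>i\<in>{..n}. E.eval (Poly_Mapping.single (i, n - i) (c * of_nat (n choose i))))"
    unfolding eq by (rule E.eval_sum[THEN conjunct2]) (use m in auto)
  also have "\<dots> = (\<Oplus>i\<in>{..n}. scal (c * fact n) \<otimes> (\<gamma> i \<otimes> \<delta> (n - i)))"
    using m c by (intro add.finprod_cong') (auto simp: dp_term_def fact)
  also have "\<dots> = scal (c * fact n) \<otimes> dp_conv \<gamma> \<delta> n"
    unfolding dp_conv_def by (rule finsum_rdistr[symmetric]) (use c in auto)
  finally show "E.eval (Poly_Mapping.single 0 c * (X + Y) ^ n) = scal (c * fact n) \<otimes> dp_conv \<gamma> \<delta> n" .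
qed

lemma eval_ghost_vector:
  "E.eval (ghost_vector p X k) = witt_of \<gamma> k" "ghost_vector p X k \<in> E.dom"
  "E.eval (ghost_vector p Y k) = witt_of \<delta> k" "ghost_vector p Y k \<in> E.dom"
  "E.eval (ghost_vector p (X + Y) k) = witt_of (dp_conv \<gamma> \<delta>) k" "ghost_vector p (X + Y) k \<in> E.dom"
  using U_zp(1)[of "p ^ k"] eval_powers[of "wc p k" "p ^ k"]
  unfolding ghost_vector_def witt_of_def U_p_power by blast+

text \<open>The ghost vector of \<open>X\<close> has ghost components \<open>(X, 0, 0, ...)\<close>,
  and Frobenius drops the first of them; so its Frobenius vanishes over the rational polynomials.
  Its entries are admissible because \<open>wc k * (p^k)!\<close> is a unit at \<open>p\<close>, and
  evaluating them gives \<open>witt_of \<gamma>\<close>.\<close>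

lemma frobenius_witt_of: "frobenius p R (witt_of \<gamma>) = \<zero>\<^bsub>W\<^esub>"
proof
  fix k
  have "frobenius p type_ring (ghost_vector p X) = (\<lambda>_. 0)"
    by (rule ghost_inj[OF torsion_free_poly_mapping prime_gt_0_nat[OF prime_p]])
      (simp add: ghosts ghost_ghost_vector[OF prime_p])
  then have "zev (ghost_vector p X) (witt_frob p k) = 0"
    by (metis frobenius_def)
  then have "zeval R (\<lambda>v. E.eval (ghost_vector p X v)) (witt_frob p k) = \<zero>"
    using E.eval_zev[of "ghost_vector p X" "witt_frob p k"] eval_ghost_vector(2) by simp
  then show "frobenius p R (witt_of \<gamma>) k = \<zero>\<^bsub>W\<^esub> k"
    by (simp add: frobenius_def eval_ghost_vector(1))
qed

text \<open>Ghost vectors add like their first ghost components, so the sum of those of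
  \<open>X\<close> and \<open>Y\<close> is the ghost vector of \<open>X + Y\<close>, which evaluates
  to the left side.\<close>

lemma witt_of_dp_conv: "witt_of (dp_conv \<gamma> \<delta>) = witt_of \<gamma> \<oplus>\<^bsub>W\<^esub> witt_of \<delta>"
proof
  fix k
  let ?\<rho> = "case_sum (ghost_vector p X) (ghost_vector p Y)"
  have "ghost_vector p X \<oplus>\<^bsub>type_witt p\<^esub> ghost_vector p Y = ghost_vector p (X + Y)"
    by (rule ghost_inj[OF torsion_free_poly_mapping prime_gt_0_nat[OF prime_p]])
      (simp add: ghosts ghost_ghost_vector[OF prime_p])
  then have "zev ?\<rho> (witt_sum p k) = ghost_vector p (X + Y) k"
    by (metis witt_add)
  moreover have "?\<rho> v \<in> E.dom" for v
    by (cases v) (simp_all add: eval_ghost_vector(2,4))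
  moreover have "(\<lambda>v. E.eval (?\<rho> v)) = case_sum (witt_of \<gamma>) (witt_of \<delta>)"
    by (auto simp: fun_eq_iff eval_ghost_vector(1,3) split: sum.split)
  ultimately show "witt_of (dp_conv \<gamma> \<delta>) k = (witt_of \<gamma> \<oplus>\<^bsub>W\<^esub> witt_of \<delta>) k"
    using E.eval_zev[of ?\<rho> "witt_sum p k"] eval_ghost_vector(5) by (simp add: witt_add)
qed

text \<open>Compute the digit monomials upstairs, where they are multiples of powers of
  \<open>X\<close>. The \<open>m\<close>-th is \<open>C 0 m * X^m\<close> and evaluates to
  \<open>U m\<close> times the \<open>m\<close>-th divided power; \<open>dp_of\<close> divides by
  \<open>U m\<close>.\<close>

lemma dp_of_witt_of: "dp_of (witt_of \<gamma>) = \<gamma>"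
proof
  fix m
  note [simp] = Ga_sharpD(1,2)[OF \<gamma>]
  have wcl: "witt_of \<gamma> i \<in> carrier R" for i
    by (simp add: witt_of_def)
  have main: "digit_monomial type_ring p (ghost_vector p X) j w = Poly_Mapping.single 0 (C j w) * X ^ (w * p ^ j) \<and>
      digit_monomial type_ring p (ghost_vector p X) j w \<in> E.dom \<and>
      E.eval (digit_monomial type_ring p (ghost_vector p X) j w) = digit_monomial R p (witt_of \<gamma>) j w" for j w
  proof (induction w arbitrary: j rule: less_induct)
    case (less w)
    show ?case
    proof (cases "w = 0")
      case True
      then show ?thesis by (simp add: digit_monomial.simps)
    next
      case False
      define s w' where "s = w mod p" and "w' = w div p"
      have w: "w = s + p * w'" "s < p" "w' < w"
        using p_ge_2 False by (auto simp: s_def w'_def)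
      have rec: "digit_monomial type_ring p (ghost_vector p X) j w =
          ghost_vector p X j ^ s * digit_monomial type_ring p (ghost_vector p X) (Suc j) w'"
        using False p_ge_2 by (subst digit_monomial.simps) (simp add: s_def w'_def)
      note IH = less[OF w(3), of "Suc j"]
      have eq: "digit_monomial type_ring p (ghost_vector p X) j w = Poly_Mapping.single 0 (C j w) * X ^ (w * p ^ j)"
      proof -
        have "ghost_vector p X j ^ s = Poly_Mapping.single 0 (wc p j ^ s) * X ^ (p ^ j * s)"
          by (simp add: ghost_vector_def power_mult_distrib single_0_power power_mult)
        then have "digit_monomial type_ring p (ghost_vector p X) j w =
            (Poly_Mapping.single 0 (wc p j ^ s) * Poly_Mapping.single 0 (C (Suc j) w')) * (X ^ (p ^ j * s) * X ^ (w' * p ^ Suc j))"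
          unfolding rec using IH by (simp only: mult_ac)
        also have "\<dots> = Poly_Mapping.single 0 (wc p j ^ s * C (Suc j) w') * X ^ (w * p ^ j)"
          unfolding power_add[symmetric] by (simp add: mult_single w(1) algebra_simps)
        also have "wc p j ^ s * C (Suc j) w' = C j w"
          using C_rec[OF w(2), of j w'] w(1) by simp
        finally show ?thesis .
      qed
      have "digit_monomial R p (witt_of \<gamma>) j w = witt_of \<gamma> j [^] s \<otimes> digit_monomial R p (witt_of \<gamma>) (Suc j) w'"
        using digit_monomial_rec[of "witt_of \<gamma>", OF wcl w(2), of j w'] w(1) by simp
      then have "digit_monomial type_ring p (ghost_vector p X) j w \<in> E.dom \<and>
          E.eval (digit_monomial type_ring p (ghost_vector p X) j w) = digit_monomial R p (witt_of \<gamma>) j w"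
        using IH[THEN conjunct2] E.eval_power[OF eval_ghost_vector(2)[of j], of s] eval_ghost_vector(1)[of j]
        unfolding rec by (simp add: E.eval_mult)
      with eq show ?thesis by (intro conjI) blast+
    qed
  qed
  have "digit_monomial R p (witt_of \<gamma>) 0 m = E.eval (Poly_Mapping.single 0 (C 0 m) * X ^ m)"
    using main[of 0 m] unfolding power_0 mult_1_right by metis
  also have "\<dots> = scal (U m) \<otimes> \<gamma> m"
    using U_zp(1)[of m] by (subst eval_powers(1)) (simp_all add: U_def mult.commute)
  finally have "dp_of (witt_of \<gamma>) m = scal (inverse (U m) * U m) \<otimes> \<gamma> m"
    by (simp add: dp_of_def scal_mult m_assoc del: left_inverse)
  then show "dp_of (witt_of \<gamma>) m = \<gamma> m"
    by simp
qed

text \<open>The polynomials \<open>(X + Y)^n / n!\<close> are admissible and satisfy the relations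
  of divided powers over the rationals; evaluation carries the relations to
  \<open>R\<close>.\<close>

lemma dp_conv_Ga_sharp: "dp_conv \<gamma> \<delta> \<in> Ga_sharp R"
  unfolding Ga_sharp_def
proof (intro CollectI conjI allI)
  note [simp] = Ga_sharpD(1,2)[OF \<gamma>] Ga_sharpD(1,2)[OF \<delta>]
  define Q where "Q n = Poly_Mapping.single 0 (inverse (fact n)) * (X + Y) ^ n" for n
  have Q: "E.eval (Q n) = dp_conv \<gamma> \<delta> n" "Q n \<in> E.dom" for n
    using eval_powers(5,6)[of "inverse (fact n)" n] by (simp_all add: Q_def dp_conv_def)
  show "dp_conv \<gamma> \<delta> k \<in> carrier R" for k
    by (simp add: dp_conv_def)
  show "dp_conv \<gamma> \<delta> 0 = \<one>"
    by (simp add: dp_conv_def)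
  fix i j
  have "(fact (i + j) :: rat) = of_nat ((i + j) choose i) * (fact i * fact j)"
    by (simp add: binomial_fact)
  then have "inverse (fact i) * inverse (fact j) = of_nat ((i + j) choose i) * (inverse (fact (i + j)) :: rat)"
    by (simp add: field_simps)
  then have eq: "Poly_Mapping.single (0 :: nat \<times> nat) (inverse (fact i) * inverse (fact j) :: rat) =
      of_nat ((i + j) choose i) * Poly_Mapping.single 0 (inverse (fact (i + j)))"
    by (simp only: single_0_of_nat)
  have "Q i * Q j = (Poly_Mapping.single 0 (inverse (fact i)) * Poly_Mapping.single 0 (inverse (fact j))) *
      ((X + Y) ^ i * (X + Y) ^ j)"
    by (simp only: Q_def mult_ac)
  also have "\<dots> = of_nat ((i + j) choose i) * Q (i + j)"
    unfolding mult_single power_add[symmetric] add_0_left eq Q_def by (simp only: mult.assoc)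
  finally have "Q i * Q j = of_nat ((i + j) choose i) * Q (i + j)" .
  then have "E.eval (Q i * Q j) = E.eval (of_nat ((i + j) choose i) * Q (i + j))"
    by simp
  then have "dp_conv \<gamma> \<delta> i \<otimes> dp_conv \<gamma> \<delta> j = [((i + j) choose i)] \<cdot> \<one> \<otimes> dp_conv \<gamma> \<delta> (i + j)"
    using E.eval_of_nat[of "(i + j) choose i"] by (simp add: E.eval_mult Q)
  moreover have "dp_conv \<gamma> \<delta> (i + j) \<in> carrier R"
    by (simp add: dp_conv_def)
  ultimately show "dp_conv \<gamma> \<delta> i \<otimes> dp_conv \<gamma> \<delta> j = [((i + j) choose i)] \<cdot> dp_conv \<gamma> \<delta> (i + j)"
    by (simp add: add_pow_ldistr)
qed

end

end

section \<open>Weights of the Frobenius polynomials\<close>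

definition weight :: "nat \<Rightarrow> (nat \<Rightarrow>\<^sub>0 nat) \<Rightarrow> nat" where
  "weight p m = (\<Sum>v\<in>keys m. lookup m v * p ^ v)"

definition isobaric :: "nat \<Rightarrow> nat \<Rightarrow> nat zpoly \<Rightarrow> bool" where
  "isobaric p d q \<longleftrightarrow> (\<forall>m. lookup q m \<noteq> 0 \<longrightarrow> weight p m = d)"

lemma weight_superset: "\<lbrakk>finite A; keys m \<subseteq> A\<rbrakk> \<Longrightarrow> weight p m = (\<Sum>v\<in>A. lookup m v * p ^ v)"
  unfolding weight_def by (rule sum.mono_neutral_left) (auto simp: in_keys_iff)

lemma weight_add: "weight p (m + m') = weight p m + weight p m'"
  using keys_add[of m m'] weight_superset[of "keys m \<union> keys m'" m p] weight_superset[of "keys m \<union> keys m'" m' p]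
  by (subst weight_superset[of "keys m \<union> keys m'"]) (auto simp: lookup_add add_mult_distrib sum.distrib)

lemma isobaric_add: "\<lbrakk>isobaric p d q; isobaric p d q'\<rbrakk> \<Longrightarrow> isobaric p d (q + q')"
  unfolding isobaric_def lookup_add by (metis add_0)

lemma isobaric_diff: "\<lbrakk>isobaric p d q; isobaric p d q'\<rbrakk> \<Longrightarrow> isobaric p d (q - q')"
  unfolding isobaric_def lookup_minus by (metis diff_self)

lemma isobaric_0: "isobaric p d 0"
  by (simp add: isobaric_def)

lemma isobaric_mult: "\<lbrakk>isobaric p d q; isobaric p d' q'\<rbrakk> \<Longrightarrow> isobaric p (d + d') (q * q')"
  using keys_mult[of q q'] by (fastforce simp: isobaric_def weight_add simp flip: in_keys_iff)

lemma isobaric_power: "isobaric p d q \<Longrightarrow> isobaric p (n * d) (q ^ n)"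
proof (induction n)
  case 0
  then show ?case
    by (auto simp: isobaric_def lookup_one when_def weight_def)
next
  case (Suc n)
  then show ?case using isobaric_mult[of p d q] by simp
qed

lemma isobaric_of_nat_mult: "isobaric p d q \<Longrightarrow> isobaric p d (of_nat n * q)"
  and isobaric_of_nat_mult_cancel: "n > 0 \<Longrightarrow> isobaric p d (of_nat n * q) \<Longrightarrow> isobaric p d q"
  by (auto simp: isobaric_def lookup_of_nat_mult)

lemma isobaric_sum: "(\<And>i. i \<in> I \<Longrightarrow> isobaric p d (f i)) \<Longrightarrow> isobaric p d (sum f I)"
  by (induction I rule: infinite_finite_induct) (auto intro: isobaric_add isobaric_0)

lemma isobaric_zvar: "isobaric p (p ^ i) (zvar i)"
  by (auto simp: isobaric_def zvar_def lookup_single when_def weight_def)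

text \<open>With weight \<open>p^i\<close> for variable \<open>i\<close>, ghost component
  \<open>Suc k\<close> of the variables is isobaric of weight \<open>p^(k+1)\<close>. The recursion
  for \<open>witt_frob\<close> subtracts powers of earlier polynomials of that same total weight and
  divides by an integer.\<close>

lemma isobaric_witt_frob:
  assumes p: "Factorial_Ring.prime p"
  shows "isobaric p (p ^ Suc k) (witt_frob p k)"
proof (induction k rule: less_induct)
  case (less k)
  have p0: "p > 0" using p prime_gt_0_nat by blast
  have gh: "isobaric p (p ^ Suc k) (ghost p (Suc k) zvar)"
    unfolding ghost_def
  proof (rule isobaric_sum, rule isobaric_of_nat_mult)
    fix i assume "i \<in> {..Suc k}"
    then have "p ^ (Suc k - i) * p ^ i = p ^ Suc k"
      by (simp flip: power_add)
    then show "isobaric p (p ^ Suc k) (zvar i ^ (p ^ (Suc k - i)))"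
      using isobaric_power[OF isobaric_zvar[of p i], of "p ^ (Suc k - i)"] by metis
  qed
  have lo: "isobaric p (p ^ Suc k) (\<Sum>i<k. of_nat (p ^ i) * witt_frob p i ^ (p ^ (k - i)))"
  proof (rule isobaric_sum, rule isobaric_of_nat_mult)
    fix i assume i: "i \<in> {..<k}"
    then have "p ^ (k - i) * p ^ Suc i = p ^ Suc k"
      by (simp flip: power_add power_Suc)
    then show "isobaric p (p ^ Suc k) (witt_frob p i ^ (p ^ (k - i)))"
      using isobaric_power[OF less.IH[of i], of "p ^ (k - i)"] i by (metis lessThan_iff)
  qed
  have "of_nat (p ^ k) * witt_frob p k = ghost p (Suc k) zvar - (\<Sum>i<k. of_nat (p ^ i) * witt_frob p i ^ (p ^ (k - i)))"
    using ghost_witt_frob[OF p, of k] by (simp add: ghost_split[of p k] eq_diff_eq add.commute)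
  then have "isobaric p (p ^ Suc k) (of_nat (p ^ k) * witt_frob p k)"
    using isobaric_diff[OF gh lo] by metis
  then show ?case
    by (rule isobaric_of_nat_mult_cancel[rotated]) (use p0 in simp)
qed

text \<open>Exponents as a list beginning at variable \<open>j\<close>, so that an induction can
  remove the lowest variable. In \<open>list_weight\<close> the weights are taken relative to that
  variable, in Horner form.\<close>

fun list_monomial :: "('a, 'x) ring_scheme \<Rightarrow> (nat \<Rightarrow> 'a) \<Rightarrow> nat \<Rightarrow> nat list \<Rightarrow> 'a" where
  "list_monomial R a j [] = \<one>\<^bsub>R\<^esub>"
| "list_monomial R a j (n # ns) = a j [^]\<^bsub>R\<^esub> n \<otimes>\<^bsub>R\<^esub> list_monomial R a (Suc j) ns"

fun list_weight :: "nat \<Rightarrow> nat list \<Rightarrow> nat" where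
  "list_weight p [] = 0"
| "list_weight p (n # ns) = n + p * list_weight p ns"

lemma (in cring) list_monomial_closed [simp]:
  "(\<And>i. a i \<in> carrier R) \<Longrightarrow> list_monomial R a j ns \<in> carrier R"
  by (induction ns arbitrary: j) auto

lemma (in cring) list_monomial_upt:
  assumes "\<And>i. a i \<in> carrier R"
  shows "list_monomial R a j (map f [j..<j + l]) = (\<Otimes>i\<in>{j..<j + l}. a i [^] (f i :: nat))"
proof (induction l arbitrary: j)
  case (Suc l)
  have "{j..<j + Suc l} = insert j {Suc j..<Suc j + l}" by auto
  moreover have "[j..<j + Suc l] = j # [Suc j..<Suc j + l]" by (simp add: upt_conv_Cons)
  ultimately show ?case
    using Suc[of "Suc j"] assms by (simp del: upt_Suc)
qed simp

lemma list_weight_upt: "list_weight p (map f [j..<j + l]) * p ^ j = (\<Sum>i\<in>{j..<j + l}. f i * p ^ i)"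
proof (induction l arbitrary: j)
  case (Suc l)
  have "{j..<j + Suc l} = insert j {Suc j..<Suc j + l}" by auto
  moreover have "[j..<j + Suc l] = j # [Suc j..<Suc j + l]" by (simp add: upt_conv_Cons)
  ultimately show ?case
    using Suc[of "Suc j"] by (simp add: algebra_simps del: upt_Suc)
qed simp

context witt_nilp
begin

text \<open>All exponents but the first enter the weight with a factor \<open>p\<close>, and the
  weight is a power of \<open>p\<close>; so the lowest exponent is \<open>p q\<close>. The relation
  turns \<open>a j ^ (p q)\<close> into a scalar times \<open>a (Suc j) ^ q\<close>, and the
  shortened list satisfies the hypotheses again. At the end \<open>a k ^ p\<close> is left. The
  components of \<open>wc\<close> go through the same rewriting with the same scalars.\<close>

lemma list_monomial_top:
  assumes a: "\<And>i. a i \<in> carrier R" and rel: "\<And>j. j < k \<Longrightarrow> frob_rel a j"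
    and "ns \<noteq> []" "j + length ns = Suc k" "list_weight p ns = p ^ length ns"
  shows "\<exists>z\<in>zp p. list_monomial type_ring (wc p) j ns = z * wc p k ^ p \<and>
    list_monomial R a j ns = scal z \<otimes> a k [^] p"
  using assms(3-5)
proof (induction "length ns" arbitrary: ns j)
  case 0
  then show ?case by simp
next
  case (Suc len)
  then obtain n ns1 where ns: "ns = n # ns1" by (cases ns) auto
  show ?case
  proof (cases ns1)
    case Nil
    then have "n = p" "j = k" using Suc.prems by (auto simp: ns)
    then show ?thesis
      using a by (intro bexI[of _ 1]) (simp_all add: ns Nil)
  next
    case (Cons n2 ns2)
    have "n + p * (n2 + p * list_weight p ns2) = p * (p * p ^ length ns2)"
      using Suc.prems by (simp add: ns Cons)
    then have "p dvd n"
      by (metis dvd_add_left_iff dvd_triv_left)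
    then obtain q where n: "n = p * q" by (auto simp: dvd_def)
    have "p * (q + (n2 + p * list_weight p ns2)) = p * (p * p ^ length ns2)"
      using Suc.prems by (simp add: ns Cons n algebra_simps)
    then have wt: "list_weight p ((q + n2) # ns2) = p ^ length ((q + n2) # ns2)"
      using p_ge_2 by (simp add: add.assoc)
    have jk: "j < k" using Suc.prems by (simp add: ns Cons)
    obtain z where z: "z \<in> zp p" "list_monomial type_ring (wc p) (Suc j) ((q + n2) # ns2) = z * wc p k ^ p"
      "list_monomial R a (Suc j) ((q + n2) # ns2) = scal z \<otimes> a k [^] p"
      using Suc.hyps(1)[of "(q + n2) # ns2" "Suc j"] Suc.hyps(2) Suc.prems wt by (auto simp: ns Cons)
    have "list_monomial type_ring (wc p) j ns = we p j ^ q * list_monomial type_ring (wc p) (Suc j) ((q + n2) # ns2)"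
      by (simp add: ns Cons n power_mult wc_power[OF prime_p] power_mult_distrib power_add)
    then have "list_monomial type_ring (wc p) j ns = (we p j ^ q * z) * wc p k ^ p"
      using z(2) by simp
    moreover have "list_monomial R a j ns = scal (we p j ^ q) \<otimes> list_monomial R a (Suc j) ((q + n2) # ns2)"
    proof -
      have "a j [^] n = (a j [^] p) [^] q"
        using a by (simp add: n nat_pow_pow)
      also have "\<dots> = scal (we p j ^ q) \<otimes> a (Suc j) [^] q"
        using rel[OF jk] a by (simp add: frob_rel_def nat_pow_distrib scal_power)
      finally show ?thesis
        using a by (simp add: ns Cons m_assoc flip: nat_pow_mult)
    qed
    then have "list_monomial R a j ns = scal (we p j ^ q * z) \<otimes> a k [^] p"
      using z(1,3) a by (simp add: scal_mult m_assoc)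
    ultimately show ?thesis
      using z(1) by (intro bexI[of _ "we p j ^ q * z"]) auto
  qed
qed

definition low_monomial :: "nat \<Rightarrow> (nat \<Rightarrow>\<^sub>0 nat) \<Rightarrow> bool" where
  "low_monomial k m \<longleftrightarrow> keys m \<subseteq> {..k} \<and> weight p m = p ^ Suc k"

text \<open>One occurrence of variable \<open>Suc k\<close> exhausts the weight
  \<open>p^(k+1)\<close>, and later variables are too heavy.\<close>

lemma isobaric_cases:
  assumes "weight p m = p ^ Suc k"
  shows "m = Poly_Mapping.single (Suc k) 1 \<or> low_monomial k m"
proof -
  have wt: "lookup m v * p ^ v \<le> p ^ Suc k" for v
  proof (cases "v \<in> keys m")
    case True
    then show ?thesis
      unfolding assms[symmetric] weight_def by (intro member_le_sum) auto
  qed (simp add: in_keys_iff)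
  have le: "v \<le> Suc k" if "v \<in> keys m" for v
  proof -
    have "1 \<le> lookup m v" using that by (simp add: in_keys_iff Suc_le_eq)
    then have "p ^ v \<le> p ^ Suc k" using wt[of v] by (metis le_trans mult_1 mult_le_mono1)
    then show ?thesis using p_ge_2 by (simp add: power_increasing_iff del: power_Suc)
  qed
  show ?thesis
  proof (cases "Suc k \<in> keys m")
    case False
    then show ?thesis
      using le assms by (auto simp: low_monomial_def) (metis le_SucE)
  next
    case True
    have ge: "1 \<le> lookup m (Suc k)" using True by (simp add: in_keys_iff Suc_le_eq)
    have "lookup m (Suc k) * p ^ Suc k \<le> 1 * p ^ Suc k" using wt[of "Suc k"] by simp
    then have one: "lookup m (Suc k) = 1"
      using ge p_ge_2 by (metis le_antisym mult_le_cancel2 not_numeral_le_zero zero_less_power le_zero_eq neq0_conv)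
    have "weight p m = lookup m (Suc k) * p ^ Suc k + (\<Sum>v\<in>keys m - {Suc k}. lookup m v * p ^ v)"
      unfolding weight_def by (rule sum.remove) (use True in auto)
    then have zero: "(\<Sum>v\<in>keys m - {Suc k}. lookup m v * p ^ v) = 0"
      using assms one by simp
    have "lookup m v = 0" if "v \<noteq> Suc k" for v
    proof (rule ccontr)
      assume "lookup m v \<noteq> 0"
      then have "v \<in> keys m - {Suc k}" using that by (simp add: in_keys_iff)
      then have "lookup m v * p ^ v = 0" using zero by simp
      then show False using \<open>lookup m v \<noteq> 0\<close> p_ge_2 by simp
    qed
    then have "m = Poly_Mapping.single (Suc k) 1"
      using one by (intro poly_mapping_eqI) (auto simp: lookup_single when_def)
    then show ?thesis ..
  qed
qed

lemma low_monomial_value: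
  assumes m: "low_monomial k m" and a: "\<And>i. a i \<in> carrier R" and rel: "\<And>j. j < k \<Longrightarrow> frob_rel a j"
  shows "\<exists>z\<in>zp p. monomial_value type_ring (wc p) m = z * wc p k ^ p \<and>
    monomial_value R a m = scal z \<otimes> a k [^] p"
proof -
  let ?ns = "map (lookup m) [0..<0 + Suc k]"
  have keys: "keys m \<subseteq> {0..<0 + Suc k}"
    using m by (auto simp: low_monomial_def)
  have "list_weight p ?ns = p ^ Suc k"
    using list_weight_upt[of p "lookup m" 0 "Suc k"] weight_superset[OF _ keys] m
    by (simp add: low_monomial_def del: upt_Suc)
  then have "\<exists>z\<in>zp p. list_monomial type_ring (wc p) 0 ?ns = z * wc p k ^ p \<and>
      list_monomial R a 0 ?ns = scal z \<otimes> a k [^] p"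
    by (intro list_monomial_top a rel) auto
  moreover have "list_monomial type_ring (wc p) 0 ?ns = monomial_value type_ring (wc p) m"
    using type_ring.list_monomial_upt[of "wc p" 0 "lookup m" "Suc k"]
      type_ring.monomial_value_superset[OF _ _ keys, of "wc p"] by simp
  moreover have "list_monomial R a 0 ?ns = monomial_value R a m"
    using list_monomial_upt[of a, OF a, of 0 "lookup m" "Suc k"]
      monomial_value_superset[OF a _ keys] by simp
  ultimately show ?thesis by simp
qed

text \<open>At the vector with a single 1 in place \<open>Suc k\<close>, the image under Frobenius
  has ghost components 0 below \<open>k\<close> and \<open>p^(k+1)\<close> at \<open>k\<close>. So
  its components below \<open>k\<close> vanish, and division by \<open>p^k\<close> leaves
  \<open>p\<close>.\<close>

lemma witt_frob_top_coeff:
  fixes k :: nat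
  defines "\<rho> \<equiv> \<lambda>v. if v = Suc k then 1 else (0 :: int)"
  shows "zev \<rho> (witt_frob p k) = int p"
proof -
  define b where "b = frobenius p type_ring \<rho>"
  have gh: "ghost p i b = (if i = k then int (p ^ Suc k) else 0)" if "i \<le> k" for i
  proof -
    have "ghost p i b = ghost p (Suc i) \<rho>"
      unfolding b_def by (rule ghost_frobenius[OF prime_p])
    also have "\<dots> = (\<Sum>l\<le>Suc i. if l = Suc k then int (p ^ Suc k) else 0)"
      unfolding ghost_def
      by (intro sum.cong) (use p_ge_2 that in \<open>auto simp: \<rho>_def power_0_left\<close>)
    finally show ?thesis using that by simp
  qed
  have z: "b i = 0" if "i < k" for i
    using that
  proof (induction i rule: less_induct)
    case (less i)
    have "(\<Sum>l<i. of_nat (p ^ l) * b l ^ (p ^ (i - l))) = 0"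
      using less p_ge_2 by (intro sum.neutral) (auto simp: power_0_left)
    then show ?case
      using gh[of i] less.prems p_ge_2 by (simp add: ghost_split)
  qed
  have "(\<Sum>l<k. of_nat (p ^ l) * b l ^ (p ^ (k - l))) = 0"
    using z p_ge_2 by (intro sum.neutral) (auto simp: power_0_left)
  then have "int (p ^ k) * b k = int (p ^ Suc k)"
    using gh[of k] by (simp add: ghost_split)
  then have "b k = int p"
    using p_ge_2 by simp
  then show ?thesis
    by (simp add: b_def frobenius_def)
qed

text \<open>By weights, component \<open>k\<close> of \<open>F a\<close> is
  \<open>G + p * a (Suc k)\<close>, where \<open>G\<close> involves only \<open>a 0\<close> to
  \<open>a k\<close>. The relations already known below \<open>k\<close> collapse \<open>G\<close>
  to a scalar \<open>z\<close> times \<open>a k ^ p\<close>, and for \<open>wc\<close> to the same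
  \<open>z\<close> times \<open>wc k ^ p\<close>. Since \<open>wc\<close> is killed by Frobenius as
  well, \<open>z = - wr k\<close>, a unit at \<open>p\<close>; dividing by it gives the
  relation.\<close>

lemma frobenius_zero_rel:
  assumes a: "\<And>i. a i \<in> carrier R" and F: "F a = \<zero>\<^bsub>W\<^esub>"
  shows "frob_rel a k"
proof (induction k rule: less_induct)
  case (less k)
  define q where "q = witt_frob p k"
  define m0 where "m0 = Poly_Mapping.single (Suc k) (1::nat)"
  define G where "G = q - Poly_Mapping.single m0 (lookup q m0)"
  let ?\<rho> = "\<lambda>v. if v = Suc k then 1 else (0 :: int)"
  have low: "low_monomial k m" if "lookup G m \<noteq> 0" for m
  proof -
    have "m \<noteq> m0" "lookup q m \<noteq> 0"
      using that by (auto simp: G_def lookup_minus lookup_single when_def split: if_splits)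
    then show ?thesis
      using isobaric_witt_frob[OF prime_p, of k] isobaric_cases[of m k] by (auto simp: isobaric_def q_def m0_def)
  qed
  \<comment> \<open>One induction produces a common \<open>z\<close> for \<open>wc\<close> and
    \<open>a\<close>. The last conjunct records that \<open>G\<close> vanishes at the vector
    supported in place \<open>Suc k\<close>, as none of its monomials is constant or contains that
    variable; it isolates the coefficient of \<open>m0\<close> below.\<close>
  have "(\<exists>z\<in>zp p. zev (wc p) G = z * wc p k ^ p \<and> zeval R a G = scal z \<otimes> a k [^] p) \<and> zev ?\<rho> G = 0"
  proof (rule poly_mapping_additive_induct[where C = "\<lambda>m. if low_monomial k m then UNIV else {0}"])
    show "lookup G m \<in> (if low_monomial k m then UNIV else {0})" for m
      using low[of m] by auto
    show "(\<exists>z\<in>zp p. zev (wc p) 0 = z * wc p k ^ p \<and> zeval R a 0 = scal z \<otimes> a k [^] p) \<and> zev ?\<rho> 0 = 0"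
      using a by (auto simp: zeval_alt intro!: bexI[of _ 0])
    fix m and c :: int
    assume "c \<in> (if low_monomial k m then UNIV else {0})"
    then show "(\<exists>z\<in>zp p. zev (wc p) (Poly_Mapping.single m c) = z * wc p k ^ p \<and>
        zeval R a (Poly_Mapping.single m c) = scal z \<otimes> a k [^] p) \<and> zev ?\<rho> (Poly_Mapping.single m c) = 0"
    proof (cases "low_monomial k m")
      case False
      then have "c = 0" using \<open>c \<in> _\<close> by simp
      then show ?thesis
        using a by (auto simp: zeval_alt intro!: bexI[of _ 0])
    next
      case True
      obtain z where z: "z \<in> zp p" "monomial_value type_ring (wc p) m = z * wc p k ^ p"
        "monomial_value R a m = scal z \<otimes> a k [^] p"
        using low_monomial_value[OF True a less] by blast
      have "keys m \<noteq> {}"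
        using True p_ge_2 by (auto simp: low_monomial_def weight_def)
      then obtain v where v: "v \<in> keys m"
        by blast
      then have "v \<noteq> Suc k"
        using True by (auto simp: low_monomial_def)
      have "monomial_value type_ring ?\<rho> m = 0"
        unfolding monomial_value_def type_ring_finprod
        by (rule prod_zero) (use v \<open>v \<noteq> Suc k\<close> in \<open>auto simp: in_keys_iff power_0_left intro!: bexI[of _ v]\<close>)
      moreover have "[c] \<cdot> (scal z \<otimes> a k [^] p) = scal (of_int c * z) \<otimes> a k [^] p"
        using z(1) a by (simp add: scal_mult scal_of_int m_assoc add_pow_ldistr_int)
      ultimately show ?thesis
        using a z by (auto simp: zeval_single type_ring.zeval_single intro!: bexI[of _ "of_int c * z"])
    qed
  next
    fix q q'
    assume "(\<exists>z\<in>zp p. zev (wc p) q = z * wc p k ^ p \<and> zeval R a q = scal z \<otimes> a k [^] p) \<and> zev ?\<rho> q = 0"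
      and "(\<exists>z\<in>zp p. zev (wc p) q' = z * wc p k ^ p \<and> zeval R a q' = scal z \<otimes> a k [^] p) \<and> zev ?\<rho> q' = 0"
    then show "(\<exists>z\<in>zp p. zev (wc p) (q + q') = z * wc p k ^ p \<and>
        zeval R a (q + q') = scal z \<otimes> a k [^] p) \<and> zev ?\<rho> (q + q') = 0"
      using a by (auto simp: zeval_add scal_add l_distr distrib_right intro!: bexI[of _ "_ + _"])
  qed auto
  then obtain z where z: "z \<in> zp p" "zev (wc p) G = z * wc p k ^ p" "zeval R a G = scal z \<otimes> a k [^] p"
    "zev ?\<rho> G = 0"
    by blast
  have q: "q = G + Poly_Mapping.single m0 (lookup q m0)"
    by (simp add: G_def)
  have "zev ?\<rho> q = lookup q m0"
    using z(4) by (subst q) (simp add: type_ring.zeval_single monomial_value_def m0_def)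
  then have lam: "lookup q m0 = int p"
    using witt_frob_top_coeff[of k] by (simp add: q_def)
  have mv: "monomial_value R a m0 = a (Suc k)" "monomial_value type_ring (wc p) m0 = wc p (Suc k)"
    using a by (simp_all add: monomial_value_def m0_def)
  \<comment> \<open>The rational vector is used to determine \<open>z\<close>, which depends on the
    polynomial but has no closed form from the induction.\<close>
  have "frobenius p type_ring (wc p) = (\<lambda>_. 0)"
    by (rule ghost_inj[OF torsion_free_char_0 prime_gt_0_nat[OF prime_p]])
      (simp add: ghosts ghost_wc[OF prime_p])
  then have "zev (wc p) q = 0"
    by (simp add: frobenius_def q_def fun_eq_iff)
  moreover have "zev (wc p) q = z * wc p k ^ p + of_nat p * wc p (Suc k)"
    using z(2) by (subst q) (simp add: type_ring.zeval_single mv lam)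
  ultimately have "z = - wr p k"
    by (simp add: wr_def[OF prime_p] field_simps eq_neg_iff_add_eq_0)
  have wr: "wr p k \<in> zp p" "inverse (wr p k) \<in> zp p" "wr p k \<noteq> 0"
    using wr_unit[OF prime_p, of k] by (auto simp: zp_units_def)
  have "zeval R a q = \<zero>"
    using fun_cong[OF F, of k] by (simp add: frobenius_def q_def)
  moreover have "zeval R a q = scal z \<otimes> a k [^] p \<oplus> scal (of_nat p) \<otimes> a (Suc k)"
    using z(3) a by (subst q) (simp add: zeval_add zeval_single mv lam nat_mult_eq_scal[symmetric] add_pow_int_ge)
  ultimately have 1: "scal z \<otimes> a k [^] p \<oplus> scal (of_nat p) \<otimes> a (Suc k) = \<zero>"
    by simp
  have 2: "scal (wr p k) \<otimes> a k [^] p \<oplus> scal z \<otimes> a k [^] p = \<zero>"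
    using a wr(1) z(1) \<open>z = - wr p k\<close> by (simp flip: l_distr scal_add)
  have "scal (wr p k) \<otimes> a k [^] p =
      scal (wr p k) \<otimes> a k [^] p \<oplus> (scal z \<otimes> a k [^] p \<oplus> scal (of_nat p) \<otimes> a (Suc k))"
    unfolding 1 using a wr(1) by simp
  also have "\<dots> = (scal (wr p k) \<otimes> a k [^] p \<oplus> scal z \<otimes> a k [^] p) \<oplus> scal (of_nat p) \<otimes> a (Suc k)"
    using a wr(1) z(1) by (simp only: a_assoc m_closed nat_pow_closed scal_closed zp_of_nat[OF prime_p])
  also have "\<dots> = scal (of_nat p) \<otimes> a (Suc k)"
    unfolding 2 using a by simp
  finally have "scal (wr p k) \<otimes> a k [^] p = scal (of_nat p) \<otimes> a (Suc k)" .
  then have "scal (inverse (wr p k)) \<otimes> (scal (wr p k) \<otimes> a k [^] p) =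
      scal (inverse (wr p k)) \<otimes> (scal (of_nat p) \<otimes> a (Suc k))"
    by simp
  then have "scal (inverse (wr p k) * wr p k) \<otimes> a k [^] p = scal (inverse (wr p k) * of_nat p) \<otimes> a (Suc k)"
    using a wr by (simp add: scal_mult m_assoc del: left_inverse)
  then show ?case
    using a wr(3) by (simp add: frob_rel_def we_def[OF prime_p] mult.commute)
qed

end

section \<open>The kernel of Frobenius as a module over the Witt vectors\<close>

context witt_nilp
begin

definition frobenius_kernel :: "(nat \<Rightarrow> 'u) set" where
  "frobenius_kernel = {a \<in> carrier W. F a = \<zero>\<^bsub>W\<^esub>}"

lemma frobenius_kernelD:
  assumes "a \<in> frobenius_kernel"
  shows "a \<in> carrier W" "a i \<in> carrier R" "F a = \<zero>\<^bsub>W\<^esub>"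
  using assms by (auto simp: frobenius_kernel_def)

lemma F_simps [simp]:
  "\<lbrakk>a \<in> carrier W; b \<in> carrier W\<rbrakk> \<Longrightarrow> F (a \<oplus>\<^bsub>W\<^esub> b) = F a \<oplus>\<^bsub>W\<^esub> F b"
  "\<lbrakk>a \<in> carrier W; b \<in> carrier W\<rbrakk> \<Longrightarrow> F (a \<otimes>\<^bsub>W\<^esub> b) = F a \<otimes>\<^bsub>W\<^esub> F b"
  "F \<one>\<^bsub>W\<^esub> = \<one>\<^bsub>W\<^esub>" "F \<zero>\<^bsub>W\<^esub> = \<zero>\<^bsub>W\<^esub>"
  using ring_hom_add[OF F_ring_hom] ring_hom_mult[OF F_ring_hom] ring_hom_one[OF F_ring_hom]
    ring_hom_zero'[OF F_ring_hom cring_W cring_W] by blast+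

lemma F_closed_W [simp]: "a \<in> carrier W \<Longrightarrow> F a \<in> carrier W"
  using ring_hom_closed[OF F_ring_hom] .

lemma V_closed_W [simp]: "a \<in> carrier W \<Longrightarrow> V a \<in> carrier W"
  by simp

lemma F_minus [simp]: "\<lbrakk>a \<in> carrier W; b \<in> carrier W\<rbrakk> \<Longrightarrow> F (a \<ominus>\<^bsub>W\<^esub> b) = F a \<ominus>\<^bsub>W\<^esub> F b"
  by (metis F_closed_W F_simps(1) W.minus_eq_iff W.add_minus_cancel W.minus_closed)

lemma V_zero: "V \<zero>\<^bsub>W\<^esub> = \<zero>\<^bsub>W\<^esub>"
  by (auto simp: verschiebung_def fun_eq_iff split: nat.split)

lemma frobenius_kernel_mult:
  "\<lbrakk>a \<in> carrier W; b \<in> frobenius_kernel\<rbrakk> \<Longrightarrow> a \<otimes>\<^bsub>W\<^esub> b \<in> frobenius_kernel"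
  unfolding frobenius_kernel_def by (simp del: witt_ring_simps)

lemma V_frobenius_kernel:
  assumes "b \<in> carrier W" "a \<in> frobenius_kernel"
  shows "V b \<otimes>\<^bsub>W\<^esub> a = \<zero>\<^bsub>W\<^esub>"
  using assms frobenius_kernelD[OF assms(2)] V_mult[of b a] by (simp del: witt_ring_simps add: V_zero)

lemma teichmuller_closed [simp]: "c \<in> carrier R \<Longrightarrow> teichmuller R c \<in> carrier W"
  by (simp add: teichmuller_def)

text \<open>\<open>W[F]\<close> is killed by \<open>V W\<close>, so a Witt vector acts on it through its Teichmueller part.\<close>

lemma frobenius_kernel_scale:
  assumes u: "u \<in> carrier W" and b: "b \<in> frobenius_kernel"
  shows "u \<otimes>\<^bsub>W\<^esub> b = teichmuller R (u 0) \<otimes>\<^bsub>W\<^esub> b"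
proof -
  have s: "(\<lambda>i. u (Suc i)) \<in> carrier W" and u0: "u 0 \<in> carrier R"
    using u by simp_all
  note bW = frobenius_kernelD(1)[OF b]
  have "u \<otimes>\<^bsub>W\<^esub> b = (teichmuller R (u 0) \<oplus>\<^bsub>W\<^esub> V (\<lambda>i. u (Suc i))) \<otimes>\<^bsub>W\<^esub> b"
    using witt_decomp[OF u] by simp
  also have "\<dots> = teichmuller R (u 0) \<otimes>\<^bsub>W\<^esub> b \<oplus>\<^bsub>W\<^esub> V (\<lambda>i. u (Suc i)) \<otimes>\<^bsub>W\<^esub> b"
    by (rule W.l_distr) (use s u0 bW in \<open>simp_all del: witt_ring_simps\<close>)
  also have "V (\<lambda>i. u (Suc i)) \<otimes>\<^bsub>W\<^esub> b = \<zero>\<^bsub>W\<^esub>"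
    by (rule V_frobenius_kernel[OF s b])
  finally show ?thesis
    using bW u0 by (simp del: witt_ring_simps)
qed

lemma witt_of_frobenius_kernel: "\<gamma> \<in> Ga_sharp R \<Longrightarrow> witt_of \<gamma> \<in> frobenius_kernel"
  using frobenius_witt_of[of \<gamma> \<gamma>] Ga_sharpD(1)[of \<gamma>] by (auto simp: frobenius_kernel_def witt_of_def)

lemma dp_of_frobenius_kernel: "a \<in> frobenius_kernel \<Longrightarrow> dp_of a \<in> Ga_sharp R"
  using frobenius_kernelD by (intro dp_of_Ga_sharp frobenius_zero_rel) auto

lemma witt_of_inverse: "a \<in> frobenius_kernel \<Longrightarrow> witt_of (dp_of a) = a"
  using frobenius_kernelD by (intro witt_of_dp_of) auto

lemma dp_of_inverse: "\<gamma> \<in> Ga_sharp R \<Longrightarrow> dp_of (witt_of \<gamma>) = \<gamma>"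
  using dp_of_witt_of[of \<gamma> \<gamma>] by simp

lemma dp_of_bij: "bij_betw dp_of frobenius_kernel (Ga_sharp R)"
  by (rule bij_betw_byWitness[where f' = witt_of])
    (auto simp: witt_of_inverse dp_of_inverse witt_of_frobenius_kernel dp_of_frobenius_kernel)

lemma dp_of_add:
  assumes "a \<in> frobenius_kernel" "b \<in> frobenius_kernel"
  shows "dp_of (a \<oplus>\<^bsub>W\<^esub> b) = dp_conv (dp_of a) (dp_of b)"
proof -
  note ab = dp_of_frobenius_kernel[OF assms(1)] dp_of_frobenius_kernel[OF assms(2)]
  have "witt_of (dp_conv (dp_of a) (dp_of b)) = a \<oplus>\<^bsub>W\<^esub> b"
    using witt_of_dp_conv[OF ab] assms by (simp add: witt_of_inverse)
  then show ?thesis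
    using dp_of_inverse[OF dp_conv_Ga_sharp[OF ab]] by simp
qed

lemma U_1: "U (Suc 0) = 1"
  using C_power_p[of 0 0] wc_0[OF prime_p] by (simp add: U_def)

lemma dp_of_1: "a \<in> frobenius_kernel \<Longrightarrow> dp_of a (Suc 0) = a 0"
  using digit_monomial_power_p[of a 0 0] frobenius_kernelD[of a] by (simp add: dp_of_def U_1)

lemma dp_scaling_Ga_sharp:
  assumes "\<delta> 1 \<in> carrier R" "\<gamma> \<in> Ga_sharp R"
  shows "dp_scaling R \<delta> \<gamma> \<in> Ga_sharp R"
proof -
  have u: "unit_part R \<delta> \<in> carrier R" using assms(1) by (simp add: unit_part_def)
  note g = Ga_sharpD(1,2)[OF assms(2)]
  have "unit_part R \<delta> [^] i \<otimes> \<gamma> i \<otimes> (unit_part R \<delta> [^] j \<otimes> \<gamma> j) =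
      [((i + j) choose i)] \<cdot> (unit_part R \<delta> [^] (i + j) \<otimes> \<gamma> (i + j))" for i j
  proof -
    have "unit_part R \<delta> [^] i \<otimes> \<gamma> i \<otimes> (unit_part R \<delta> [^] j \<otimes> \<gamma> j) =
        unit_part R \<delta> [^] (i + j) \<otimes> (\<gamma> i \<otimes> \<gamma> j)"
      using u g by (simp add: nat_pow_mult[symmetric] m_ac)
    also have "\<gamma> i \<otimes> \<gamma> j = [((i + j) choose i)] \<cdot> \<gamma> (i + j)"
      using assms(2) by (simp add: Ga_sharp_def)
    finally show ?thesis
      using u g by (simp add: add_pow_rdistr)
  qed
  then show ?thesis
    using u g by (simp add: Ga_sharp_def dp_scaling_def)
qed

text \<open>The factor acts through the Teichmueller representative of its component 0, which
  multiplies component \<open>k\<close> by the \<open>p^k\<close>-th power of the unit. Under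
  \<open>witt_of\<close> component \<open>k\<close> is a multiple of the divided power of exponent
  \<open>p^k\<close>, which \<open>dp_scaling\<close> multiplies alike.\<close>

lemma dp_of_scale:
  assumes a: "a \<in> frobenius_kernel" and b: "b \<in> frobenius_kernel"
  shows "dp_of ((\<one>\<^bsub>W\<^esub> \<oplus>\<^bsub>W\<^esub> a) \<otimes>\<^bsub>W\<^esub> b) = dp_scaling R (dp_of a) (dp_of b)"
proof -
  note aW = frobenius_kernelD(1)[OF a] and bW = frobenius_kernelD(1)[OF b]
  note ab = dp_of_frobenius_kernel[OF a] dp_of_frobenius_kernel[OF b]
  note g = Ga_sharpD(1)[OF ab(1)] Ga_sharpD(1)[OF ab(2)]
  have u0: "(\<one>\<^bsub>W\<^esub> \<oplus>\<^bsub>W\<^esub> a) 0 = unit_part R (dp_of a)"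
    using component_0(1)[OF W.one_closed aW] dp_of_1[OF a] by (simp add: unit_part_def)
  have uc: "unit_part R (dp_of a) \<in> carrier R"
    using g by (simp add: unit_part_def)
  have "(\<one>\<^bsub>W\<^esub> \<oplus>\<^bsub>W\<^esub> a) \<otimes>\<^bsub>W\<^esub> b = teichmuller R (unit_part R (dp_of a)) \<otimes>\<^bsub>W\<^esub> b"
    using frobenius_kernel_scale[OF _ b, of "\<one>\<^bsub>W\<^esub> \<oplus>\<^bsub>W\<^esub> a"] aW u0 by (simp del: witt_ring_simps)
  also have "\<dots> = (\<lambda>k. unit_part R (dp_of a) [^] (p ^ k) \<otimes> witt_of (dp_of b) k)"
    using teichmuller_mult[OF bW uc] witt_of_inverse[OF b] by simp
  also have "\<dots> = witt_of (dp_scaling R (dp_of a) (dp_of b))"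
    using uc g by (auto simp: witt_of_def dp_scaling_def m_lcomm fun_eq_iff)
  finally show ?thesis
    using dp_of_inverse[OF dp_scaling_Ga_sharp[OF g(1) ab(2)]] by simp
qed

lemma dp_translated_scaling_eq: "dp_translated_scaling R \<delta> \<gamma> = dp_conv (dp_scaling R \<delta> \<gamma>) \<delta>"
  by (simp add: dp_translated_scaling_def dp_conv_def dp_scaling_def fun_eq_iff)

lemma dp_of_zero: "dp_of \<zero>\<^bsub>W\<^esub> = (\<lambda>k. if k = 0 then \<one> else \<zero>)"
proof -
  let ?e = "\<lambda>k::nat. if k = 0 then \<one> else \<zero>"
  have "?e i \<otimes> ?e j = [((i + j) choose i)] \<cdot> ?e (i + j)" for i j
    by (cases "i = 0"; cases "j = 0") auto
  then have e: "?e \<in> Ga_sharp R"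
    by (simp add: Ga_sharp_def)
  have "witt_of ?e = \<zero>\<^bsub>W\<^esub>"
    using p_ge_2 by (auto simp: witt_of_def fun_eq_iff)
  then show ?thesis
    using dp_of_inverse[OF e] by simp
qed

lemma unit_witt:
  assumes a: "a \<in> frobenius_kernel"
  shows "\<one>\<^bsub>W\<^esub> \<oplus>\<^bsub>W\<^esub> a \<in> Units W \<longleftrightarrow> \<one> \<oplus> a 0 \<in> Units R"
proof
  note aW = frobenius_kernelD(1)[OF a]
  let ?u = "\<one>\<^bsub>W\<^esub> \<oplus>\<^bsub>W\<^esub> a"
  have uW: "?u \<in> carrier W" using aW by (simp del: witt_ring_simps)
  have u0: "?u 0 = \<one> \<oplus> a 0"
    using component_0(1)[OF W.one_closed aW] by simp
  show "\<one> \<oplus> a 0 \<in> Units R" if "?u \<in> Units W"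
  proof -
    have v: "inv\<^bsub>W\<^esub> ?u \<in> carrier W" "?u \<otimes>\<^bsub>W\<^esub> inv\<^bsub>W\<^esub> ?u = \<one>\<^bsub>W\<^esub>"
      using W.Units_inv_closed[OF that] W.Units_r_inv[OF that] by blast+
    have "?u 0 \<otimes> (inv\<^bsub>W\<^esub> ?u) 0 = \<one>"
      using component_0(2)[OF uW v(1)] v(2) by simp
    moreover have "?u 0 \<in> carrier R" "(inv\<^bsub>W\<^esub> ?u) 0 \<in> carrier R"
      using uW v(1) by simp_all
    ultimately have "?u 0 \<in> Units R"
      by (auto simp: Units_def m_comm simp del: witt_ring_simps intro!: bexI[of _ "(inv\<^bsub>W\<^esub> ?u) 0"])
    then show ?thesis by (simp only: u0)
  qed
  show "?u \<in> Units W" if "\<one> \<oplus> a 0 \<in> Units R"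
  proof -
    define w where "w = inv (\<one> \<oplus> a 0)"
    have w: "w \<in> carrier R" "(\<one> \<oplus> a 0) \<otimes> w = \<one>" "\<one> \<oplus> a 0 \<in> carrier R"
      using that Units_closed[OF that] by (simp_all only: w_def Units_inv_closed Units_r_inv)
    \<comment> \<open>The inverse is sought as \<open>1 + a'\<close> with \<open>a'\<close> in the
      kernel of Frobenius. There \<open>1 + a\<close> acts as the Teichmueller representative of
      \<open>1 + a 0\<close>, so the equation \<open>(1 + a) a' = - a\<close> is solved with the
      representative of \<open>w\<close>.\<close>
    define a' where "a' = teichmuller R w \<otimes>\<^bsub>W\<^esub> (\<ominus>\<^bsub>W\<^esub> a)"
    have na: "\<ominus>\<^bsub>W\<^esub> a \<in> frobenius_kernel"
      using F_minus[OF W.zero_closed aW] aW frobenius_kernelD(3)[OF a]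
      by (simp add: frobenius_kernel_def W.minus_eq del: witt_ring_simps)
    have a': "a' \<in> frobenius_kernel"
      using frobenius_kernel_mult[OF teichmuller_closed[OF w(1)] na] by (simp only: a'_def)
    note a'W = frobenius_kernelD(1)[OF a'] and naW = frobenius_kernelD(1)[OF na]
    have t: "teichmuller R (\<one> \<oplus> a 0) \<otimes>\<^bsub>W\<^esub> teichmuller R w = \<one>\<^bsub>W\<^esub>"
      using w p_ge_2 teichmuller_mult[OF teichmuller_closed[OF w(1)] w(3)]
      by (auto simp: teichmuller_def fun_eq_iff)
    have "?u \<otimes>\<^bsub>W\<^esub> a' = teichmuller R (\<one> \<oplus> a 0) \<otimes>\<^bsub>W\<^esub> (teichmuller R w \<otimes>\<^bsub>W\<^esub> (\<ominus>\<^bsub>W\<^esub> a))"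
      using frobenius_kernel_scale[OF uW a'] by (simp only: u0 a'_def)
    also have "\<dots> = \<ominus>\<^bsub>W\<^esub> a"
      using w naW t by (simp add: W.m_assoc[symmetric] del: witt_ring_simps)
    finally have "?u \<otimes>\<^bsub>W\<^esub> (\<one>\<^bsub>W\<^esub> \<oplus>\<^bsub>W\<^esub> a') = ?u \<oplus>\<^bsub>W\<^esub> \<ominus>\<^bsub>W\<^esub> a"
      using uW a'W by (simp add: W.r_distr del: witt_ring_simps)
    also have "\<dots> = \<one>\<^bsub>W\<^esub>"
      using aW by (simp add: W.a_assoc W.r_neg del: witt_ring_simps)
    finally show ?thesis
      using uW a'W by (auto simp: Units_def W.m_comm simp del: witt_ring_simps intro!: bexI[of _ "\<one>\<^bsub>W\<^esub> \<oplus>\<^bsub>W\<^esub> a'"])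
  qed
qed

section \<open>Units with trivial Frobenius and the divided power hull of the multiplicative
  group\<close>

definition unit_dp :: "(nat \<Rightarrow> 'u) \<Rightarrow> (nat \<Rightarrow> 'u)" where
  "unit_dp u = dp_of (u \<ominus>\<^bsub>W\<^esub> \<one>\<^bsub>W\<^esub>)"

lemma witt_units_F_carrier: "u \<in> carrier (witt_units_F p R) \<longleftrightarrow> u \<in> Units W \<and> F u = \<one>\<^bsub>W\<^esub>"
  by (simp add: witt_units_F_def)

lemma witt_units_F_kernel:
  assumes "u \<in> carrier (witt_units_F p R)"
  shows "u \<ominus>\<^bsub>W\<^esub> \<one>\<^bsub>W\<^esub> \<in> frobenius_kernel" "\<one>\<^bsub>W\<^esub> \<oplus>\<^bsub>W\<^esub> (u \<ominus>\<^bsub>W\<^esub> \<one>\<^bsub>W\<^esub>) = u" "u \<in> carrier W"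
proof -
  have u: "u \<in> carrier W" "F u = \<one>\<^bsub>W\<^esub>"
    using assms W.Units_closed by (auto simp: witt_units_F_carrier simp del: witt_ring_simps)
  then show "u \<ominus>\<^bsub>W\<^esub> \<one>\<^bsub>W\<^esub> \<in> frobenius_kernel" "\<one>\<^bsub>W\<^esub> \<oplus>\<^bsub>W\<^esub> (u \<ominus>\<^bsub>W\<^esub> \<one>\<^bsub>W\<^esub>) = u" "u \<in> carrier W"
    using F_minus[OF u(1) W.one_closed] by (simp_all add: frobenius_kernel_def del: witt_ring_simps)
qed

lemma unit_dp_bij: "bij_betw unit_dp (carrier (witt_units_F p R)) (carrier (Gm_sharp R))"
proof (rule bij_betw_byWitness[where f' = "\<lambda>\<gamma>. \<one>\<^bsub>W\<^esub> \<oplus>\<^bsub>W\<^esub> witt_of \<gamma>"])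
  show "\<forall>u\<in>carrier (witt_units_F p R). \<one>\<^bsub>W\<^esub> \<oplus>\<^bsub>W\<^esub> witt_of (unit_dp u) = u"
    using witt_units_F_kernel by (simp add: unit_dp_def witt_of_inverse del: witt_ring_simps)
  show "unit_dp ` carrier (witt_units_F p R) \<subseteq> carrier (Gm_sharp R)"
  proof safe
    fix u assume u: "u \<in> carrier (witt_units_F p R)"
    note k = witt_units_F_kernel[OF u]
    have "\<one> \<oplus> (u \<ominus>\<^bsub>W\<^esub> \<one>\<^bsub>W\<^esub>) 0 \<in> Units R"
      using unit_witt[OF k(1)] k(2) u by (simp only: witt_units_F_carrier)
    then show "unit_dp u \<in> carrier (Gm_sharp R)"
      using dp_of_frobenius_kernel[OF k(1)] dp_of_1[OF k(1)]
      by (simp add: unit_dp_def Gm_sharp_def unit_part_def del: witt_ring_simps)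
  qed
  show "\<forall>\<gamma>\<in>carrier (Gm_sharp R). unit_dp (\<one>\<^bsub>W\<^esub> \<oplus>\<^bsub>W\<^esub> witt_of \<gamma>) = \<gamma>"
  proof
    fix \<gamma> assume "\<gamma> \<in> carrier (Gm_sharp R)"
    then have g: "\<gamma> \<in> Ga_sharp R" by (simp add: Gm_sharp_def)
    note k = frobenius_kernelD(1)[OF witt_of_frobenius_kernel[OF g]]
    have "witt_of \<gamma> = (\<one>\<^bsub>W\<^esub> \<oplus>\<^bsub>W\<^esub> witt_of \<gamma>) \<ominus>\<^bsub>W\<^esub> \<one>\<^bsub>W\<^esub>"
      using k by (subst W.minus_eq_iff) (simp_all del: witt_ring_simps)
    then show "unit_dp (\<one>\<^bsub>W\<^esub> \<oplus>\<^bsub>W\<^esub> witt_of \<gamma>) = \<gamma>"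
      using dp_of_inverse[OF g] by (simp add: unit_dp_def del: witt_ring_simps)
  qed
  show "(\<lambda>\<gamma>. \<one>\<^bsub>W\<^esub> \<oplus>\<^bsub>W\<^esub> witt_of \<gamma>) ` carrier (Gm_sharp R) \<subseteq> carrier (witt_units_F p R)"
  proof safe
    fix \<gamma> assume "\<gamma> \<in> carrier (Gm_sharp R)"
    then have g: "\<gamma> \<in> Ga_sharp R" and u: "\<one> \<oplus> \<gamma> 1 \<in> Units R" by (auto simp: Gm_sharp_def unit_part_def)
    note k = witt_of_frobenius_kernel[OF g]
    have "witt_of \<gamma> 0 = \<gamma> 1"
      using dp_of_1[OF k] dp_of_inverse[OF g] by simp
    then have "\<one>\<^bsub>W\<^esub> \<oplus>\<^bsub>W\<^esub> witt_of \<gamma> \<in> Units W"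
      using unit_witt[OF k] u by simp
    then show "\<one>\<^bsub>W\<^esub> \<oplus>\<^bsub>W\<^esub> witt_of \<gamma> \<in> carrier (witt_units_F p R)"
      using frobenius_kernelD[OF k] by (simp add: witt_units_F_carrier del: witt_ring_simps)
  qed
qed

lemma witt_units_F_mult:
  assumes "u \<in> carrier (witt_units_F p R)" "v \<in> carrier (witt_units_F p R)"
  shows "u \<otimes>\<^bsub>W\<^esub> v \<in> carrier (witt_units_F p R)"
  using assms witt_units_F_kernel(3) by (simp add: witt_units_F_carrier del: witt_ring_simps)

text \<open>On \<open>1 + W[F]\<close> multiplication by \<open>u\<close> is \<open>u (1 + b) - 1 = u b + (u - 1)\<close>.\<close>

lemma dp_of_translated:
  assumes u: "u \<in> carrier (witt_units_F p R)" and b: "b \<in> frobenius_kernel"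
  shows "dp_of (u \<otimes>\<^bsub>W\<^esub> b \<oplus>\<^bsub>W\<^esub> (u \<ominus>\<^bsub>W\<^esub> \<one>\<^bsub>W\<^esub>)) = dp_translated_scaling R (unit_dp u) (dp_of b)"
    and "dp_of (u \<otimes>\<^bsub>W\<^esub> b) = dp_scaling R (unit_dp u) (dp_of b)"
proof -
  note k = witt_units_F_kernel[OF u]
  show *: "dp_of (u \<otimes>\<^bsub>W\<^esub> b) = dp_scaling R (unit_dp u) (dp_of b)"
    using dp_of_scale[OF k(1) b] by (simp only: k(2) unit_dp_def)
  show "dp_of (u \<otimes>\<^bsub>W\<^esub> b \<oplus>\<^bsub>W\<^esub> (u \<ominus>\<^bsub>W\<^esub> \<one>\<^bsub>W\<^esub>)) = dp_translated_scaling R (unit_dp u) (dp_of b)"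
    using dp_of_add[OF frobenius_kernel_mult[OF k(3) b] k(1)]
    by (simp only: * dp_translated_scaling_eq unit_dp_def)
qed

lemma unit_dp_mult:
  assumes u: "u \<in> carrier (witt_units_F p R)" and v: "v \<in> carrier (witt_units_F p R)"
  shows "unit_dp (u \<otimes>\<^bsub>W\<^esub> v) = dp_translated_scaling R (unit_dp u) (unit_dp v)"
proof -
  note k = witt_units_F_kernel[OF u] and l = witt_units_F_kernel[OF v]
  have lW: "v \<ominus>\<^bsub>W\<^esub> \<one>\<^bsub>W\<^esub> \<in> carrier W" by (rule frobenius_kernelD[OF l(1)])
  have "u \<otimes>\<^bsub>W\<^esub> v \<ominus>\<^bsub>W\<^esub> \<one>\<^bsub>W\<^esub> = u \<otimes>\<^bsub>W\<^esub> (v \<ominus>\<^bsub>W\<^esub> \<one>\<^bsub>W\<^esub>) \<oplus>\<^bsub>W\<^esub> (u \<ominus>\<^bsub>W\<^esub> \<one>\<^bsub>W\<^esub>)"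
    using k(3) l(3) W.one_closed by algebra
  then show ?thesis
    using dp_of_translated(1)[OF u l(1)] by (simp only: unit_dp_def)
qed

lemma unit_dp_one: "unit_dp \<one>\<^bsub>W\<^esub> = (\<lambda>k. if k = 0 then \<one> else \<zero>)"
proof -
  have "\<one>\<^bsub>W\<^esub> \<ominus>\<^bsub>W\<^esub> \<one>\<^bsub>W\<^esub> = \<zero>\<^bsub>W\<^esub>"
    by (simp add: W.minus_eq W.r_neg del: witt_ring_simps)
  then show ?thesis
    using dp_of_zero by (simp only: unit_dp_def)
qed

end

lemma witt_nilp_iff: "witt_nilp R p \<longleftrightarrow> p_nilpotent_ring p R \<and> Factorial_Ring.prime p"
  by (auto simp: witt_nilp_def witt_def witt_axioms_def witt_nilp_axioms_def plain_cring_def p_nilpotent_ring_def)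

lemma dp_of_natural:
  assumes R: "witt_nilp R p" and S: "witt_nilp S p" and h: "h \<in> ring_hom R S"
    and a: "\<And>i. a i \<in> carrier R"
  shows "h \<circ> witt_nilp.dp_of R p a = witt_nilp.dp_of S p (h \<circ> a)"
proof -
  interpret R: witt_nilp R p by (rule R)
  interpret S: witt_nilp S p by (rule S)
  note homs = h R.cring_axioms S.cring_axioms
  have scal: "h (R.scal q) = S.scal q" if "q \<in> zp p" for q
    using that
  proof (elim zpE)
    fix x y assume q: "q = of_int x / of_int y" and y: "\<not> int p dvd y"
    have "h (R.scal q) \<otimes>\<^bsub>S\<^esub> S.sc y = h (R.scal q \<otimes>\<^bsub>R\<^esub> R.sc y)"
      using ring_hom_mult[OF h] ring_hom_int_mult[OF homs] ring_hom_one[OF h] R.scal_closed[OF that] by simp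
    also have "\<dots> = S.sc x"
      using R.scal_frac(2)[OF y, of x] ring_hom_int_mult[OF homs] ring_hom_one[OF h] q by simp
    finally show ?thesis
      unfolding q using S.scal_eqI[OF _ y] ring_hom_closed[OF h R.scal_closed[OF that]] q by simp
  qed
  have pow: "h (x [^]\<^bsub>R\<^esub> (n::nat)) = h x [^]\<^bsub>S\<^esub> n" if "x \<in> carrier R" for x n
    using that ring_hom_mult[OF h] ring_hom_one[OF h] by (induction n) auto
  have "h (digit_monomial R p a j w) = digit_monomial S p (h \<circ> a) j w" for j w
  proof (induction w arbitrary: j rule: less_induct)
    case (less w)
    show ?case
    proof (cases "w = 0 \<or> p < 2")
      case True
      then show ?thesis
        using ring_hom_one[OF h] by (subst (1 2) digit_monomial.simps) simp
    next
      case False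
      have "h (digit_monomial R p a (Suc j) (w div p)) = digit_monomial S p (h \<circ> a) (Suc j) (w div p)"
        using False by (intro less) auto
      then show ?thesis
        using False a ring_hom_mult[OF h, of "a j [^]\<^bsub>R\<^esub> (w mod p)" "digit_monomial R p a (Suc j) (w div p)"]
        by (subst (1 2) digit_monomial.simps) (simp add: pow)
    qed
  qed
  then show ?thesis
    using a ring_hom_mult[OF h] by (simp add: fun_eq_iff R.dp_of_def S.dp_of_def scal)
qed

section \<open>The diffracted Hodge stack of \<open>\<int>/p\<^sup>n\<close>\<close>

lemma discrete_equiv_cong_bij:
  assumes e: "discrete_equiv K T \<phi>" and g: "bij_betw g T T'"
    and \<phi>': "\<And>x. x \<in> cells K 0 \<Longrightarrow> \<phi>' x = g (\<phi> x)"
    and faces: "\<And>e i. \<lbrakk>e \<in> cells K 1; i \<le> 1\<rbrakk> \<Longrightarrow> sface K 0 i e \<in> cells K 0"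
  shows "discrete_equiv K T' \<phi>'"
proof -
  have mem: "\<And>x. x \<in> cells K 0 \<Longrightarrow> \<phi> x \<in> T"
    and edge: "\<And>e. e \<in> cells K 1 \<Longrightarrow> \<phi> (sface K 0 0 e) = \<phi> (sface K 0 1 e)"
    and surj: "\<And>t. t \<in> T \<Longrightarrow> \<exists>x\<in>cells K 0. \<phi> x = t"
    and path: "\<And>x y. \<lbrakk>x \<in> cells K 0; y \<in> cells K 0; \<phi> x = \<phi> y\<rbrakk> \<Longrightarrow>
        \<exists>e\<in>cells K 1. sface K 0 1 e = x \<and> sface K 0 0 e = y"
    and fill: "\<forall>k y. (\<forall>i \<le> Suc (Suc k). y i \<in> cells K (Suc k)) \<and>
            (\<forall>i j. i < j \<and> j \<le> Suc (Suc k) \<longrightarrow>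
                sface K k i (y j) = sface K k (j - 1) (y i)) \<longrightarrow>
        (\<exists>z \<in> cells K (Suc (Suc k)). \<forall>i \<le> Suc (Suc k). sface K (Suc k) i z = y i)"
    using e unfolding discrete_equiv_def by blast+
  have inj: "\<And>x y. \<lbrakk>x \<in> T; y \<in> T; g x = g y\<rbrakk> \<Longrightarrow> x = y" and im: "g ` T = T'"
    using g by (auto simp: bij_betw_def inj_on_def)
  show ?thesis
    unfolding discrete_equiv_def
  proof (intro conjI)
    show "\<forall>x\<in>cells K 0. \<phi>' x \<in> T'"
      using mem im \<phi>' by auto
    show "\<forall>e\<in>cells K 1. \<phi>' (sface K 0 0 e) = \<phi>' (sface K 0 1 e)"
      using faces edge \<phi>' by simp
    show "\<forall>t\<in>T'. \<exists>x\<in>cells K 0. \<phi>' x = t"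
      using surj im \<phi>' by (metis imageE)
    show "\<forall>x\<in>cells K 0. \<forall>y\<in>cells K 0. \<phi>' x = \<phi>' y \<longrightarrow> (\<exists>e\<in>cells K 1. sface K 0 1 e = x \<and> sface K 0 0 e = y)"
      using path inj mem \<phi>' by metis
  qed (rule fill)
qed

lemma pi0_class_eq:
  assumes e: "discrete_equiv K T \<phi>" and x: "x \<in> cells K 0"
    and faces: "\<And>e i. \<lbrakk>e \<in> cells K 1; i \<le> 1\<rbrakk> \<Longrightarrow> sface K 0 i e \<in> cells K 0"
  shows "pi0_class K x = {y \<in> cells K 0. \<phi> y = \<phi> x}"
proof -
  let ?r = "(\<lambda>e. (sface K 0 1 e, sface K 0 0 e)) ` cells K 1 \<union> (\<lambda>e. (sface K 0 0 e, sface K 0 1 e)) ` cells K 1"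
  have edge: "\<And>e. e \<in> cells K 1 \<Longrightarrow> \<phi> (sface K 0 0 e) = \<phi> (sface K 0 1 e)"
    and path: "\<And>x y. \<lbrakk>x \<in> cells K 0; y \<in> cells K 0; \<phi> x = \<phi> y\<rbrakk> \<Longrightarrow>
        \<exists>e\<in>cells K 1. sface K 0 1 e = x \<and> sface K 0 0 e = y"
    using e unfolding discrete_equiv_def by blast+
  have 1: "y \<in> cells K 0 \<and> \<phi> y = \<phi> x" if "(x, y) \<in> ?r\<^sup>*" for y
    using that
  proof (induction rule: rtrancl_induct)
    case base
    show ?case using x by simp
  next
    case (step y z)
    then show ?case using faces edge by auto
  qed
  have 2: "(x, y) \<in> ?r\<^sup>*" if "y \<in> cells K 0" "\<phi> y = \<phi> x" for y
    using path[OF x that(1)] that(2) by (intro r_into_rtrancl) (auto simp: image_iff)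
  show ?thesis
    unfolding pi0_class_def using 1 2 by blast
qed

text \<open>The value of \<open>m f\<close> depends through \<open>G\<close> only on the value of
  \<open>f\<close>, so all members of the class contribute the same component. This evaluates the
  unions in \<open>pmap\<close> and \<open>pact\<close>.\<close>

lemma pi0_class_UN:
  assumes e: "discrete_equiv K T \<phi>" and x: "x \<in> cells K 0"
    and faces: "\<And>e i. \<lbrakk>e \<in> cells K 1; i \<le> 1\<rbrakk> \<Longrightarrow> sface K 0 i e \<in> cells K 0"
    and e': "discrete_equiv K' T' \<phi>'"
    and faces': "\<And>e i. \<lbrakk>e \<in> cells K' 1; i \<le> 1\<rbrakk> \<Longrightarrow> sface K' 0 i e \<in> cells K' 0"
    and m: "\<And>f. f \<in> cells K 0 \<Longrightarrow> m f \<in> cells K' 0" "\<And>f. f \<in> cells K 0 \<Longrightarrow> \<phi>' (m f) = G (\<phi> f)"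
  shows "(\<Union>f\<in>pi0_class K x. pi0_class K' (m f)) = pi0_class K' (m x)"
proof -
  have cl: "pi0_class K x = {y \<in> cells K 0. \<phi> y = \<phi> x}"
    by (rule pi0_class_eq[OF e x faces])
  have cl': "pi0_class K' y = {z \<in> cells K' 0. \<phi>' z = \<phi>' y}" if "y \<in> cells K' 0" for y
    by (rule pi0_class_eq[OF e' that faces'])
  have "pi0_class K' (m f) = pi0_class K' (m x)" if "f \<in> pi0_class K x" for f
    using that m x cl'[of "m f"] cl'[of "m x"] by (simp add: cl)
  moreover have "x \<in> pi0_class K x"
    using x by (simp add: cl)
  ultimately show ?thesis by blast
qed

lemma pi0_bij:
  assumes e: "discrete_equiv K T \<phi>"
    and faces: "\<And>e i. \<lbrakk>e \<in> cells K 1; i \<le> 1\<rbrakk> \<Longrightarrow> sface K 0 i e \<in> cells K 0"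
  shows "x \<in> cells K 0 \<Longrightarrow> \<phi> (SOME f. f \<in> pi0_class K x) = \<phi> x"
    and "bij_betw (\<lambda>c. \<phi> (SOME f. f \<in> c)) (pi0 K) T"
proof -
  have cl: "pi0_class K x = {y \<in> cells K 0. \<phi> y = \<phi> x}" if "x \<in> cells K 0" for x
    by (rule pi0_class_eq[OF e that faces])
  show some: "\<phi> (SOME f. f \<in> pi0_class K x) = \<phi> x" if "x \<in> cells K 0" for x
  proof -
    have "x \<in> pi0_class K x" using cl[OF that] that by simp
    then have "(SOME f. f \<in> pi0_class K x) \<in> pi0_class K x" by (rule someI)
    then show ?thesis using cl[OF that] by simp
  qed
  have T: "\<phi> ` cells K 0 = T"
    using e unfolding discrete_equiv_def by auto
  show "bij_betw (\<lambda>c. \<phi> (SOME f. f \<in> c)) (pi0 K) T"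
    unfolding bij_betw_def
  proof
    show "inj_on (\<lambda>c. \<phi> (SOME f. f \<in> c)) (pi0 K)"
    proof (rule inj_onI)
      fix c d assume "c \<in> pi0 K" "d \<in> pi0 K" and eq: "\<phi> (SOME f. f \<in> c) = \<phi> (SOME f. f \<in> d)"
      then obtain x y where xy: "c = pi0_class K x" "x \<in> cells K 0" "d = pi0_class K y" "y \<in> cells K 0"
        by (auto simp: pi0_def)
      then have "\<phi> x = \<phi> y"
        using eq some by metis
      then show "c = d"
        using xy cl by simp
    qed
    show "(\<lambda>c. \<phi> (SOME f. f \<in> c)) ` pi0 K = T"
      unfolding T[symmetric] pi0_def image_image using some by (rule image_cong[OF refl])
  qed
qed

section \<open>Homomorphisms of derived quotients\<close>

lemma simplicial_hom_map:
  assumes h: "h \<in> ring_hom A B" "cring A" "cring B" and t: "t \<in> carrier A" "h t = t'"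
  shows "simplicial_hom (derived_quotient A t) (derived_quotient B t') (derived_quotient_map h)"
proof -
  interpret A: cring_with_element A t
    using assms by (simp add: cring_with_element_def cring_with_element_axioms_def plain_cring_def)
  interpret B: cring_with_element B t'
    using assms ring_hom_closed[OF h(1) t(1)] by (simp add: cring_with_element_def cring_with_element_axioms_def plain_cring_def)
  note hs = ring_hom_closed[OF h(1)] ring_hom_add[OF h(1)] ring_hom_mult[OF h(1)] ring_hom_one[OF h(1)] ring_hom_zero'[OF h]
  have hm: "h (a \<ominus>\<^bsub>A\<^esub> b) = h a \<ominus>\<^bsub>B\<^esub> h b" if "a \<in> carrier A" "b \<in> carrier A" for a b
    using that hs A.add_minus_cancel[of a b] by (metis A.minus_closed B.minus_eq_iff)
  show ?thesis
    unfolding simplicial_hom_def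
  proof (intro conjI allI ballI)
    fix m
    show "derived_quotient_map h m \<in> ring_hom (lev A.D m) (lev B.D m)"
    proof (rule ring_hom_memI)
      fix x assume x: "x \<in> carrier (lev A.D m)"
      then show "derived_quotient_map h m x \<in> carrier (lev B.D m)"
        by (auto simp: derived_quotient_map_def A.carrier_D B.carrier_D hs case_prod_beta PiE_iff)
      fix y assume y: "y \<in> carrier (lev A.D m)"
      have x': "fst x \<in> carrier A" "\<And>i. i \<le> m \<Longrightarrow> snd x i \<in> carrier A"
        and y': "fst y \<in> carrier A" "\<And>i. i \<le> m \<Longrightarrow> snd y i \<in> carrier A"
        using x y by (auto simp: A.carrier_D)
      show "derived_quotient_map h m (x \<otimes>\<^bsub>lev A.D m\<^esub> y) = derived_quotient_map h m x \<otimes>\<^bsub>lev B.D m\<^esub> derived_quotient_map h m y"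
        "derived_quotient_map h m (x \<oplus>\<^bsub>lev A.D m\<^esub> y) = derived_quotient_map h m x \<oplus>\<^bsub>lev B.D m\<^esub> derived_quotient_map h m y"
        using x' y' t by (auto simp: derived_quotient_map_def A.add_D B.add_D A.mult_D B.mult_D hs case_prod_beta)
    qed (auto simp: derived_quotient_map_def A.one_D B.one_D hs)
  next
    fix l m \<theta> x assume \<theta>: "\<theta> \<in> Dmaps l m" and x: "x \<in> carrier (lev A.D m)"
    have x': "fst x \<in> carrier A" "\<And>i. i \<le> m \<Longrightarrow> snd x i \<in> carrier A"
      using x by (auto simp: A.carrier_D)
    have "\<theta> i \<le> m" if "i \<le> l" for i
      using Dmaps_le[OF \<theta> that] .
    then show "derived_quotient_map h l (rop A.D l m \<theta> x) = rop B.D l m \<theta> (derived_quotient_map h m x)"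
      using x' t by (auto simp: derived_quotient_map_def A.rop_D B.rop_D hs hm case_prod_beta)
  qed
qed

text \<open>The product of two arrows has the quadratic term \<open>t f g\<close>, which would pick
  up \<open>u\<close> twice; \<open>u t = t\<close> absorbs the surplus factor. The same identity
  keeps all vertices \<open>a + t f\<close> in place.\<close>

lemma (in cring_with_element) simplicial_hom_scale:
  assumes u: "u \<in> carrier A" "u \<otimes> t = t"
  shows "simplicial_hom D D (derived_quotient_scale A u)"
  unfolding simplicial_hom_def
proof (intro conjI allI ballI)
  fix m
  show "derived_quotient_scale A u m \<in> ring_hom (lev D m) (lev D m)"
  proof (rule ring_hom_memI)
    fix x assume x: "x \<in> carrier (lev D m)"
    then show "derived_quotient_scale A u m x \<in> carrier (lev D m)"
      using u by (auto simp: derived_quotient_scale_def carrier_D PiE_iff)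
    fix y assume y: "y \<in> carrier (lev D m)"
    have x': "fst x \<in> carrier A" "\<And>i. i \<le> m \<Longrightarrow> snd x i \<in> carrier A"
      and y': "fst y \<in> carrier A" "\<And>i. i \<le> m \<Longrightarrow> snd y i \<in> carrier A"
      using x y by (auto simp: carrier_D)
    have "u \<otimes> (a \<otimes> g \<oplus> b \<otimes> f \<oplus> t \<otimes> (f \<otimes> g)) = a \<otimes> (u \<otimes> g) \<oplus> b \<otimes> (u \<otimes> f) \<oplus> t \<otimes> (u \<otimes> f \<otimes> (u \<otimes> g))"
      if "a \<in> carrier A" "b \<in> carrier A" "f \<in> carrier A" "g \<in> carrier A" for a b f g
    proof -
      have "t \<otimes> (u \<otimes> f \<otimes> (u \<otimes> g)) = (u \<otimes> t) \<otimes> (u \<otimes> (f \<otimes> g))"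
        using that u(1) t_closed by algebra
      then have "t \<otimes> (u \<otimes> f \<otimes> (u \<otimes> g)) = t \<otimes> (u \<otimes> (f \<otimes> g))"
        by (simp only: u(2))
      then show ?thesis
        using that u(1) t_closed by (simp add: r_distr m_lcomm)
    qed
    then show "derived_quotient_scale A u m (x \<otimes>\<^bsub>lev D m\<^esub> y) = derived_quotient_scale A u m x \<otimes>\<^bsub>lev D m\<^esub> derived_quotient_scale A u m y"
      using x' y' by (auto simp: derived_quotient_scale_def mult_D case_prod_beta)
    show "derived_quotient_scale A u m (x \<oplus>\<^bsub>lev D m\<^esub> y) = derived_quotient_scale A u m x \<oplus>\<^bsub>lev D m\<^esub> derived_quotient_scale A u m y"
      using x' y' u by (auto simp: derived_quotient_scale_def add_D case_prod_beta r_distr)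
  qed (use u in \<open>auto simp: derived_quotient_scale_def one_D\<close>)
next
  fix l m \<theta> x assume \<theta>: "\<theta> \<in> Dmaps l m" and x: "x \<in> carrier (lev D m)"
  have x': "fst x \<in> carrier A" "\<And>i. i \<le> m \<Longrightarrow> snd x i \<in> carrier A"
    using x by (auto simp: carrier_D)
  have le: "\<theta> i \<le> m" if "i \<le> l" for i
    using Dmaps_le[OF \<theta> that] .
  have "t \<otimes> (u \<otimes> f) = t \<otimes> f" if "f \<in> carrier A" for f
    using that u by (metis m_assoc m_comm t_closed)
  moreover have "u \<otimes> (f \<ominus> g) = u \<otimes> f \<ominus> u \<otimes> g" if "f \<in> carrier A" "g \<in> carrier A" for f g
    using that u(1) by algebra
  ultimately show "derived_quotient_scale A u l (rop D l m \<theta> x) = rop D l m \<theta> (derived_quotient_scale A u m x)"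
    using x' le by (auto simp: derived_quotient_scale_def rop_D case_prod_beta)
qed

section \<open>Null-homotopies as solutions of an equation in Witt vectors\<close>

context witt_nilp
begin

definition base_point :: "nat \<Rightarrow> nat \<Rightarrow> 'u" where
  "base_point n = (if n = 1 then \<one>\<^bsub>W\<^esub> else V ([(p ^ (n - 2))] \<cdot>\<^bsub>W\<^esub> \<one>\<^bsub>W\<^esub>))"

lemma base_point_closed: "base_point n \<in> carrier W"
  unfolding base_point_def by (simp del: witt_ring_simps)

text \<open>For \<open>n > 1\<close> the relation \<open>F V = p\<close> supplies the missing factor
  \<open>p\<close>.\<close>

lemma F_base_point:
  assumes "n \<ge> 1"
  shows "F (base_point n) = [(p ^ (n - 1))] \<cdot>\<^bsub>W\<^esub> \<one>\<^bsub>W\<^esub>"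
proof (cases "n = 1")
  case True
  then show ?thesis by (simp add: base_point_def del: witt_ring_simps)
next
  case False
  then obtain k where k: "n = Suc (Suc k)"
    using assms le_Suc_ex[of 2 n] by auto
  show ?thesis
    by (simp add: base_point_def k F_V W.add.nat_pow_pow mult.commute del: witt_ring_simps)
qed

lemma V_one_mult: "f \<in> carrier W \<Longrightarrow> V \<one>\<^bsub>W\<^esub> \<otimes>\<^bsub>W\<^esub> f = V (F f)"
  using V_mult[OF W.one_closed] by (simp del: witt_ring_simps)

lemma W_int_mult: "[(int p ^ n)] \<cdot>\<^bsub>W\<^esub> \<one>\<^bsub>W\<^esub> = [(p ^ n)] \<cdot>\<^bsub>W\<^esub> \<one>\<^bsub>W\<^esub>"
  by (simp add: add_pow_int_ge nat_power_eq del: witt_ring_simps)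

definition solutions :: "nat \<Rightarrow> (nat \<Rightarrow> 'u) set" where
  "solutions n = {f \<in> carrier W. V \<one>\<^bsub>W\<^esub> \<otimes>\<^bsub>W\<^esub> f = [(int p ^ n)] \<cdot>\<^bsub>W\<^esub> \<one>\<^bsub>W\<^esub>}"

lemma solutions_imp_zero:
  assumes "f \<in> solutions n"
  shows "[(p ^ n)] \<cdot> \<one> = \<zero>"
proof -
  have f: "f \<in> carrier W" "V (F f) = [(p ^ n)] \<cdot>\<^bsub>W\<^esub> \<one>\<^bsub>W\<^esub>"
    using assms V_one_mult[of f] by (auto simp only: solutions_def W_int_mult mem_Collect_eq)
  have "([(p ^ n)] \<cdot>\<^bsub>W\<^esub> \<one>\<^bsub>W\<^esub>) 0 = [(p ^ n)] \<cdot> (\<one>\<^bsub>W\<^esub> 0)"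
    by (rule ring_hom_nat_mult[OF component_0_hom cring_W cring_axioms W.one_closed])
  moreover have "V (F f) 0 = \<zero>"
    by (simp add: verschiebung_def)
  ultimately show ?thesis
    using f(2) by simp
qed

lemma solutions_iff:
  assumes n: "n \<ge> 1" and zero: "[(p ^ n)] \<cdot> \<one> = \<zero>" and f: "f \<in> carrier W"
  shows "f \<in> solutions n \<longleftrightarrow> f \<ominus>\<^bsub>W\<^esub> base_point n \<in> frobenius_kernel"
proof -
  have "f \<in> solutions n \<longleftrightarrow> V (F f) = V (F (base_point n))"
    using f by (simp only: solutions_def mem_Collect_eq V_one_mult W_int_mult p_power_eq_V[OF n zero] F_base_point[OF n] simp_thms)
  also have "\<dots> \<longleftrightarrow> F f = F (base_point n)"
    by (auto dest: V_inj)
  also have "\<dots> \<longleftrightarrow> F (f \<ominus>\<^bsub>W\<^esub> base_point n) = \<zero>\<^bsub>W\<^esub>"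
    using f base_point_closed[of n] by (simp del: witt_ring_simps)
  also have "\<dots> \<longleftrightarrow> f \<ominus>\<^bsub>W\<^esub> base_point n \<in> frobenius_kernel"
    using f base_point_closed[of n] by (simp add: frobenius_kernel_def del: witt_ring_simps)
  finally show ?thesis .
qed

lemma solutions_bij:
  assumes n: "n \<ge> 1" and zero: "[(p ^ n)] \<cdot> \<one> = \<zero>"
  shows "bij_betw (\<lambda>f. dp_of (f \<ominus>\<^bsub>W\<^esub> base_point n)) (solutions n) (Ga_sharp R)"
proof -
  note b = base_point_closed[of n]
  have "bij_betw (\<lambda>f. f \<ominus>\<^bsub>W\<^esub> base_point n) (solutions n) frobenius_kernel"
  proof (rule bij_betw_byWitness[where f' = "\<lambda>a. base_point n \<oplus>\<^bsub>W\<^esub> a"])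
    have s: "f \<in> carrier W" if "f \<in> solutions n" for f
      using that by (simp add: solutions_def)
    show "\<forall>f\<in>solutions n. base_point n \<oplus>\<^bsub>W\<^esub> (f \<ominus>\<^bsub>W\<^esub> base_point n) = f"
      using s b by (simp del: witt_ring_simps)
    have c: "(base_point n \<oplus>\<^bsub>W\<^esub> a) \<ominus>\<^bsub>W\<^esub> base_point n = a" if "a \<in> carrier W" for a
      using that b W.minus_eq_iff[of "base_point n \<oplus>\<^bsub>W\<^esub> a" "base_point n" a] by (simp del: witt_ring_simps)
    then show "\<forall>a\<in>frobenius_kernel. (base_point n \<oplus>\<^bsub>W\<^esub> a) \<ominus>\<^bsub>W\<^esub> base_point n = a"
      using frobenius_kernelD(1) by blast
    show "(\<lambda>f. f \<ominus>\<^bsub>W\<^esub> base_point n) ` solutions n \<subseteq> frobenius_kernel"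
      using s solutions_iff[OF n zero] by blast
    show "(\<lambda>a. base_point n \<oplus>\<^bsub>W\<^esub> a) ` frobenius_kernel \<subseteq> solutions n"
    proof safe
      fix a assume a: "a \<in> frobenius_kernel"
      note aW = frobenius_kernelD(1)[OF a]
      show "base_point n \<oplus>\<^bsub>W\<^esub> a \<in> solutions n"
        using solutions_iff[OF n zero W.a_closed[OF b aW]] a c[OF aW] by simp
    qed
  qed
  from bij_betw_trans[OF this dp_of_bij] show ?thesis
    by (simp add: comp_def)
qed

text \<open>For \<open>n \<ge> 2\<close> the base point lies in \<open>V W\<close>, hence it is fixed by the units in the kernel of
  Frobenius, and the action is linear.\<close>

lemma solutions_act:
  assumes n: "n \<ge> 1" and u: "u \<in> carrier (witt_units_F p R)" and f: "f \<in> solutions n"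
  shows "dp_of (u \<otimes>\<^bsub>W\<^esub> f \<ominus>\<^bsub>W\<^esub> base_point n) =
    (if n = 1 then dp_translated_scaling else dp_scaling) R (unit_dp u) (dp_of (f \<ominus>\<^bsub>W\<^esub> base_point n))"
proof -
  note b = base_point_closed[of n]
  note k = witt_units_F_kernel[OF u]
  have fW: "f \<in> carrier W" using f by (simp add: solutions_def)
  have a: "f \<ominus>\<^bsub>W\<^esub> base_point n \<in> frobenius_kernel"
    using solutions_iff[OF n solutions_imp_zero[OF f] fW] f by blast
  note aW = frobenius_kernelD(1)[OF a] and kW = frobenius_kernelD(1)[OF k(1)]
  \<comment> \<open>The difference between the action on \<open>f\<close> and that on its coordinate
    is the base point times \<open>u - 1\<close>: this is \<open>u - 1\<close> itself for
    \<open>n = 1\<close>, and it vanishes when the base point lies in the image of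
    \<open>V\<close>.\<close>
  have eq: "u \<otimes>\<^bsub>W\<^esub> f \<ominus>\<^bsub>W\<^esub> base_point n =
      u \<otimes>\<^bsub>W\<^esub> (f \<ominus>\<^bsub>W\<^esub> base_point n) \<oplus>\<^bsub>W\<^esub> base_point n \<otimes>\<^bsub>W\<^esub> (u \<ominus>\<^bsub>W\<^esub> \<one>\<^bsub>W\<^esub>)"
    using k(3) fW b W.one_closed by algebra
  show ?thesis
  proof (cases "n = 1")
    case True
    then show ?thesis
      unfolding eq using dp_of_translated(1)[OF u a] kW
      by (simp add: base_point_def del: witt_ring_simps)
  next
    case False
    then have "base_point n \<otimes>\<^bsub>W\<^esub> (u \<ominus>\<^bsub>W\<^esub> \<one>\<^bsub>W\<^esub>) = \<zero>\<^bsub>W\<^esub>"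
      using V_frobenius_kernel[OF _ k(1)] by (simp add: base_point_def del: witt_ring_simps)
    then show ?thesis
      unfolding eq using dp_of_translated(2)[OF u a] False k(3) aW by (simp del: witt_ring_simps)
  qed
qed

end

lemma base_point_natural:
  assumes R: "witt_nilp R p" and S: "witt_nilp S p" and h: "h \<in> ring_hom R S"
  shows "h \<circ> witt_nilp.base_point R p n = witt_nilp.base_point S p n"
proof -
  interpret R: witt_nilp R p by (rule R)
  interpret S: witt_nilp S p by (rule S)
  note homs = h R.cring_axioms S.cring_axioms
  have Wh: "(\<circ>) h \<in> ring_hom R.W S.W"
    by (rule witt_hom[OF homs R.prime_p])
  show ?thesis
    using ring_hom_nat_mult[OF Wh R.cring_W S.cring_W R.W.one_closed] ring_hom_one[OF Wh]
    unfolding R.base_point_def S.base_point_def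
    by (simp add: ring_hom_verschiebung[OF homs] del: witt_ring_simps)
qed

definition unit_map :: "int \<Rightarrow> 'u ring \<Rightarrow> int \<Rightarrow> 'u" where
  "unit_map N R = (\<lambda>i\<in>carrier (residue_ring N). [i] \<cdot>\<^bsub>R\<^esub> \<one>\<^bsub>R\<^esub>)"

text \<open>Every residue is a multiple of 1, which forces the homomorphism, and it is well defined
  exactly if \<open>N\<close> vanishes in \<open>R\<close>. So the factor \<open>Spec A\<close>
  records only whether \<open>R\<close> is an algebra over the residue ring.\<close>

lemma rhom_residue_ring:
  assumes N: "N > 1" and R: "cring R"
  shows "rhom (residue_ring N) R = (if [N] \<cdot>\<^bsub>R\<^esub> \<one>\<^bsub>R\<^esub> = \<zero>\<^bsub>R\<^esub> then {unit_map N R} else {})"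
proof -
  interpret A: residues N "residue_ring N" using N by unfold_locales auto
  interpret R: plain_cring R using R by (simp add: plain_cring_def)
  have red: "(\<lambda>z. z mod N) \<in> ring_hom type_ring (residue_ring N)"
    by (rule ring_hom_memI)
      (use N in \<open>auto simp: A.res_carrier_eq A.res_add_eq A.res_mult_eq A.res_one_eq mod_add_eq mod_mult_eq\<close>)
  have cst: "[z] \<cdot>\<^bsub>residue_ring N\<^esub> \<one>\<^bsub>residue_ring N\<^esub> = z mod N" for z :: int
    using ring_hom_int_mult[OF red cring_type_ring A.cring, of 1 z] N by (simp add: A.res_one_eq)
  have val: "s (z mod N) = [z] \<cdot>\<^bsub>R\<^esub> \<one>\<^bsub>R\<^esub>" if s: "s \<in> rhom (residue_ring N) R" for s and z :: int
  proof -
    have s': "s \<in> ring_hom (residue_ring N) R" using s by (simp add: rhom_def)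
    show ?thesis
      using ring_hom_int_mult[OF s' A.cring R, of "\<one>\<^bsub>residue_ring N\<^esub>" z] ring_hom_one[OF s'] A.one_closed
      by (simp add: cst)
  qed
  have eq: "s = unit_map N R" "[N] \<cdot>\<^bsub>R\<^esub> \<one>\<^bsub>R\<^esub> = \<zero>\<^bsub>R\<^esub>" if s: "s \<in> rhom (residue_ring N) R" for s
  proof -
    have "s i = unit_map N R i" for i
    proof (cases "i \<in> carrier (residue_ring N)")
      case True
      then show ?thesis
        using val[OF s, of i] by (simp add: unit_map_def A.res_carrier_eq)
    next
      case False
      then show ?thesis using s by (simp add: unit_map_def rhom_def extensional_def)
    qed
    then show "s = unit_map N R" by blast
    show "[N] \<cdot>\<^bsub>R\<^esub> \<one>\<^bsub>R\<^esub> = \<zero>\<^bsub>R\<^esub>"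
      using val[OF s, of N] val[OF s, of 0] by simp
  qed
  have "unit_map N R \<in> rhom (residue_ring N) R" if zero: "[N] \<cdot>\<^bsub>R\<^esub> \<one>\<^bsub>R\<^esub> = \<zero>\<^bsub>R\<^esub>"
    unfolding unit_map_def
  proof (rule ring_hom_restrict[OF A.cring], rule ring_hom_memI)
    have m: "[(z mod N)] \<cdot>\<^bsub>R\<^esub> \<one>\<^bsub>R\<^esub> = [z] \<cdot>\<^bsub>R\<^esub> \<one>\<^bsub>R\<^esub>" for z :: int
    proof -
      have "[z] \<cdot>\<^bsub>R\<^esub> \<one>\<^bsub>R\<^esub> = [(N * (z div N) + z mod N)] \<cdot>\<^bsub>R\<^esub> \<one>\<^bsub>R\<^esub>"
        by simp
      also have "\<dots> = [(N * (z div N))] \<cdot>\<^bsub>R\<^esub> \<one>\<^bsub>R\<^esub> \<oplus>\<^bsub>R\<^esub> [(z mod N)] \<cdot>\<^bsub>R\<^esub> \<one>\<^bsub>R\<^esub>"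
        by (rule R.add.int_pow_mult) simp
      also have "[(N * (z div N))] \<cdot>\<^bsub>R\<^esub> \<one>\<^bsub>R\<^esub> = [(z div N)] \<cdot>\<^bsub>R\<^esub> ([N] \<cdot>\<^bsub>R\<^esub> \<one>\<^bsub>R\<^esub>)"
        by (simp add: R.add.int_pow_pow mult.commute)
      also have "\<dots> = \<zero>\<^bsub>R\<^esub>"
        by (simp add: zero)
      finally show ?thesis by simp
    qed
    fix x y assume "x \<in> carrier (residue_ring N)" "y \<in> carrier (residue_ring N)"
    show "[(x \<otimes>\<^bsub>residue_ring N\<^esub> y)] \<cdot>\<^bsub>R\<^esub> \<one>\<^bsub>R\<^esub> = [x] \<cdot>\<^bsub>R\<^esub> \<one>\<^bsub>R\<^esub> \<otimes>\<^bsub>R\<^esub> [y] \<cdot>\<^bsub>R\<^esub> \<one>\<^bsub>R\<^esub>"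
      by (simp add: A.res_mult_eq m R.add_pow_ldistr_int R.add_pow_rdistr_int R.add.int_pow_pow mult.commute)
    show "[(x \<oplus>\<^bsub>residue_ring N\<^esub> y)] \<cdot>\<^bsub>R\<^esub> \<one>\<^bsub>R\<^esub> = [x] \<cdot>\<^bsub>R\<^esub> \<one>\<^bsub>R\<^esub> \<oplus>\<^bsub>R\<^esub> [y] \<cdot>\<^bsub>R\<^esub> \<one>\<^bsub>R\<^esub>"
      by (simp add: A.res_add_eq m R.add.int_pow_mult)
  qed (simp_all add: A.res_one_eq)
  then show ?thesis
    using eq by auto
qed

lemma (in resolution) vx_0_0: "x \<in> Pc 0 \<Longrightarrow> vx 0 0 x = x"
  using simplicial by (simp add: simplicial_cring_def vx_def flip: Did_0)

section \<open>Coordinates on the diffracted Hodge stack and their naturality\<close>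

locale diffracted_residue = resolution P \<epsilon> "int p ^ n" for P :: "'b sring" and \<epsilon> and p n :: nat +
  assumes prime: "Factorial_Ring.prime p" and n: "n \<ge> 1"
begin

abbreviation "N \<equiv> int p ^ n"

text \<open>\<open>value_at_N\<close> without reference to a fixed target ring, so that points over
  different rings can be compared.\<close>

definition arrow_at_N :: "('u, 'b) diffracted_point \<Rightarrow> nat \<Rightarrow> 'u" where
  "arrow_at_N v = snd (v (Suc 0) (edge_map 0 0) (edge_from_cst (cst 0 N))) (Suc 0)"

definition coordinates :: "'u ring \<Rightarrow> ('u, 'b) diffracted_point \<Rightarrow> (nat \<Rightarrow> 'u) \<times> (int \<Rightarrow> 'u)" where
  "coordinates R v =
     (witt_nilp.dp_of R p (arrow_at_N v \<ominus>\<^bsub>witt_ring p R\<^esub> witt_nilp.base_point R p n), unit_map N R)"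

lemma witt_nilp: "p_nilpotent_ring p R \<Longrightarrow> witt_nilp R p"
  using prime by (simp add: witt_nilp_iff)

context
  fixes R :: "'u ring"
  assumes R: "p_nilpotent_ring p R"
begin

interpretation X: witt_nilp R p
  by (rule witt_nilp[OF R])

interpretation Q: quotient_mapping X.W "X.V \<one>\<^bsub>X.W\<^esub>" P \<epsilon> N
  by (simp add: quotient_mapping_def cring_with_element_def cring_with_element_axioms_def X.W.plain_cring_axioms
      resolution_axioms del: witt_ring_simps)

lemma diffracted_eq: "diffracted p P R = Q.M"
  by (simp only: diffracted_def witt_mod_V1_def)

lemma value_at_N_eq: "Q.value_at_N v = arrow_at_N v"
  by (simp only: Q.value_at_N_alt arrow_at_N_def)

lemma diffracted_solutions: "discrete_equiv (diffracted p P R) (X.solutions n) arrow_at_N"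
proof -
  have "Q.value_at_N = arrow_at_N"
    by (rule ext) (rule value_at_N_eq)
  then show ?thesis
    using Q.mapping_space_discrete by (simp only: diffracted_eq X.solutions_def)
qed

lemma diffracted_faces: "\<lbrakk>e \<in> cells (diffracted p P R) 1; i \<le> 1\<rbrakk> \<Longrightarrow> sface (diffracted p P R) 0 i e \<in> cells (diffracted p P R) 0"
  unfolding diffracted_eq sface_def by (rule Q.sop_cell) auto

lemma arrow_at_N_solution: "f \<in> cells (diffracted p P R) 0 \<Longrightarrow> arrow_at_N f \<in> X.solutions n"
  using diffracted_solutions by (simp add: discrete_equiv_def)

lemma N_mult: "[N] \<cdot>\<^bsub>R\<^esub> \<one>\<^bsub>R\<^esub> = [(p ^ n)] \<cdot>\<^bsub>R\<^esub> \<one>\<^bsub>R\<^esub>"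
  by (simp add: add_pow_int_ge nat_power_eq)

text \<open>If \<open>p^n\<close> is nonzero in \<open>R\<close>, there are neither solutions nor
  homomorphisms from the residue ring; otherwise the second factor is a single point.\<close>

lemma coordinates_bij:
  "bij_betw (\<lambda>f. (X.dp_of (f \<ominus>\<^bsub>X.W\<^esub> X.base_point n), unit_map N R)) (X.solutions n)
     (Ga_sharp R \<times> rhom (residue_ring N) R)"
proof (cases "[(p ^ n)] \<cdot>\<^bsub>R\<^esub> \<one>\<^bsub>R\<^esub> = \<zero>\<^bsub>R\<^esub>")
  case True
  then have "rhom (residue_ring N) R = {unit_map N R}"
    using rhom_residue_ring[OF N_gt_1 X.cring_axioms] by (simp add: N_mult)
  then show ?thesis
    using X.solutions_bij[OF n True] by (auto simp: bij_betw_def inj_on_def)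
next
  case False
  then have "rhom (residue_ring N) R = {}"
    using rhom_residue_ring[OF N_gt_1 X.cring_axioms] by (simp add: N_mult)
  moreover have "X.solutions n = {}"
    using X.solutions_imp_zero False by blast
  ultimately show ?thesis by (simp add: bij_betw_def)
qed

lemma coordinates_equiv:
  "discrete_equiv (diffracted p P R) (Ga_sharp R \<times> rhom (residue_ring N) R) (coordinates R)"
  by (rule discrete_equiv_cong_bij[OF diffracted_solutions coordinates_bij])
    (simp_all only: coordinates_def diffracted_faces)

text \<open>By \<open>fst_cell\<close> the image of \<open>x\<close> is the integer \<epsilon> x
  plus a multiple of \<open>V(1)\<close>. That multiple lies in the image of \<open>V\<close>, so
  its component 0 vanishes.\<close>

lemma coordinates_over:
  assumes f: "f \<in> cells (diffracted p P R) 0"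
  shows "diffracted_over P \<epsilon> (residue_ring N) R f s \<longleftrightarrow> s = snd (coordinates R f)"
proof -
  have z: "[(p ^ n)] \<cdot>\<^bsub>R\<^esub> \<one>\<^bsub>R\<^esub> = \<zero>\<^bsub>R\<^esub>"
    using X.solutions_imp_zero[OF arrow_at_N_solution[OF f]] .
  then have rh: "rhom (residue_ring N) R = {unit_map N R}"
    using rhom_residue_ring[OF N_gt_1 X.cring_axioms] by (simp add: N_mult)
  have "unit_map N R (\<epsilon> x) = fst (f 0 (Did 0) x) 0" if x: "x \<in> Pc 0" for x
  proof -
    have fQ: "f \<in> cells Q.M 0" using f by (simp only: diffracted_eq)
    let ?b = "Q.coord_of f (vertex_map 0 0) x"
    have b: "?b \<in> carrier X.W"
      using Q.coord_of_closed[OF fQ _ x] by simp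
    have "fst (f 0 (Did 0) x) = Q.sc (\<epsilon> x) \<oplus>\<^bsub>X.W\<^esub> X.V \<one>\<^bsub>X.W\<^esub> \<otimes>\<^bsub>X.W\<^esub> ?b"
      using Q.fst_cell[OF fQ, of "vertex_map 0" 0 x] x by (simp only: Did_0 vx_0_0 vertex_map_Dmaps le_refl)
    also have "\<dots> = Q.sc (\<epsilon> x) \<oplus>\<^bsub>X.W\<^esub> X.V (X.F ?b)"
      using X.V_one_mult[OF b] by simp
    finally have "fst (f 0 (Did 0) x) 0 = Q.sc (\<epsilon> x) 0 \<oplus>\<^bsub>R\<^esub> X.V (X.F ?b) 0"
      using X.component_0(1)[of "Q.sc (\<epsilon> x)" "X.V (X.F ?b)"] b by (simp del: witt_ring_simps)
    also have "X.V (X.F ?b) 0 = \<zero>\<^bsub>R\<^esub>"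
      by (simp add: verschiebung_def)
    also have "Q.sc (\<epsilon> x) 0 = [(\<epsilon> x)] \<cdot>\<^bsub>R\<^esub> \<one>\<^bsub>R\<^esub>"
      using ring_hom_int_mult[OF X.component_0_hom X.cring_W X.cring_axioms X.W.one_closed] by simp
    finally show ?thesis
      using eps_range[OF x] by (simp add: unit_map_def R.res_carrier_eq)
  qed
  then show ?thesis
    by (auto simp: diffracted_over_def rh coordinates_def)
qed

text \<open>A unit \<open>u\<close> with \<open>F u = 1\<close> fixes \<open>V(1)\<close>, as
  \<open>V(1) u = V(F u)\<close>. It therefore acts on the derived quotient, multiplying arrows, in
  particular the arrow at \<open>N\<close>, by \<open>u\<close>.\<close>

lemma act_cell:
  assumes u: "u \<in> carrier (witt_units_F p R)" and f: "f \<in> cells (diffracted p P R) 0"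
  shows "postcomp P (derived_quotient_scale X.W u) f \<in> cells (diffracted p P R) 0"
    and "arrow_at_N (postcomp P (derived_quotient_scale X.W u) f) = u \<otimes>\<^bsub>X.W\<^esub> arrow_at_N f"
proof -
  note k = X.witt_units_F_kernel[OF u]
  have "u \<otimes>\<^bsub>X.W\<^esub> X.V \<one>\<^bsub>X.W\<^esub> = X.V \<one>\<^bsub>X.W\<^esub>"
    using X.V_one_mult[OF k(3)] k(3) u X.W.m_comm[OF k(3), of "X.V \<one>\<^bsub>X.W\<^esub>"]
    by (simp add: X.witt_units_F_carrier del: witt_ring_simps)
  then have "simplicial_hom Q.D Q.D (derived_quotient_scale X.W u)"
    by (rule Q.simplicial_hom_scale[OF k(3)])
  then show "postcomp P (derived_quotient_scale X.W u) f \<in> cells (diffracted p P R) 0"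
    using f unfolding diffracted_eq by (intro postcomp_cell)
  show "arrow_at_N (postcomp P (derived_quotient_scale X.W u) f) = u \<otimes>\<^bsub>X.W\<^esub> arrow_at_N f"
    using edge_from_cst(1)[of "cst 0 N"]
    by (simp add: arrow_at_N_def postcomp_def derived_quotient_scale_def case_prod_beta)
qed

lemma coordinates_act:
  assumes u: "u \<in> carrier (witt_units_F p R)" and f: "f \<in> cells (diffracted p P R) 0"
  shows "coordinates R (postcomp P (derived_quotient_scale X.W u) f) =
    ((if n = 1 then dp_translated_scaling else dp_scaling) R (X.unit_dp u) (fst (coordinates R f)), snd (coordinates R f))"
  using X.solutions_act[OF n u arrow_at_N_solution[OF f]] by (simp only: coordinates_def act_cell(2)[OF u f] fst_conv snd_conv)

end

lemma diffracted_map_natural: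
  assumes R: "p_nilpotent_ring p R" and S: "(S, h) \<in> algebras p R" and f: "f \<in> cells (diffracted p P R) 0"
  shows "diffracted_map P h f \<in> cells (diffracted p P S) 0"
    and "coordinates S (diffracted_map P h f) =
      (h \<circ> fst (coordinates R f), compose (carrier (residue_ring N)) h (snd (coordinates R f)))"
proof -
  have S': "p_nilpotent_ring p S" and hh: "h \<in> ring_hom R S"
    using S by (auto simp: algebras_def rhom_def)
  interpret X: witt_nilp R p by (rule witt_nilp[OF R])
  interpret S: witt_nilp S p by (rule witt_nilp[OF S'])
  note homs = hh X.cring_axioms S.cring_axioms
  have Wh: "(\<circ>) h \<in> ring_hom X.W S.W"
    by (rule witt_hom[OF homs prime])
  have "h \<circ> X.V \<one>\<^bsub>X.W\<^esub> = S.V \<one>\<^bsub>S.W\<^esub>"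
    using ring_hom_verschiebung[OF homs] ring_hom_one[OF Wh] by simp
  then have "simplicial_hom (witt_mod_V1 p R) (witt_mod_V1 p S) (derived_quotient_map (\<lambda>a. h \<circ> a))"
    unfolding witt_mod_V1_def
    by (intro simplicial_hom_map Wh X.cring_W S.cring_W) (simp_all del: witt_ring_simps)
  then show "diffracted_map P h f \<in> cells (diffracted p P S) 0"
    using f unfolding diffracted_def diffracted_map_def by (intro postcomp_cell)
  have ar: "arrow_at_N (diffracted_map P h f) = h \<circ> arrow_at_N f"
    using edge_from_cst(1)[of "cst 0 N"]
    by (simp add: diffracted_map_def arrow_at_N_def postcomp_def derived_quotient_map_def case_prod_beta)
  have sol: "arrow_at_N f \<in> carrier X.W"
    using arrow_at_N_solution[OF R f] by (simp add: X.solutions_def)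
  have minus: "h \<circ> (a \<ominus>\<^bsub>X.W\<^esub> b) = (h \<circ> a) \<ominus>\<^bsub>S.W\<^esub> (h \<circ> b)" if "a \<in> carrier X.W" "b \<in> carrier X.W" for a b
  proof -
    have "(h \<circ> b) \<oplus>\<^bsub>S.W\<^esub> (h \<circ> (a \<ominus>\<^bsub>X.W\<^esub> b)) = h \<circ> a"
      using ring_hom_add[OF Wh that(2) X.W.minus_closed[OF that]] that by (simp del: witt_ring_simps)
    then show ?thesis
      using that ring_hom_closed[OF Wh] X.W.minus_closed[OF that] by (simp only: S.W.minus_eq_iff)
  qed
  have "h \<circ> X.dp_of (arrow_at_N f \<ominus>\<^bsub>X.W\<^esub> X.base_point n) =
      S.dp_of (arrow_at_N (diffracted_map P h f) \<ominus>\<^bsub>S.W\<^esub> S.base_point n)"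
    using dp_of_natural[OF X.witt_nilp_axioms S.witt_nilp_axioms hh, of "arrow_at_N f \<ominus>\<^bsub>X.W\<^esub> X.base_point n"]
      X.W.minus_closed[OF sol X.base_point_closed[of n]]
      minus[OF sol X.base_point_closed[of n]] base_point_natural[OF X.witt_nilp_axioms S.witt_nilp_axioms hh, of n]
    by (simp add: ar)
  moreover have "unit_map N S = compose (carrier (residue_ring N)) h (unit_map N R)"
    using ring_hom_int_mult[OF homs X.one_closed] ring_hom_one[OF hh]
    by (auto simp: unit_map_def compose_def restrict_def fun_eq_iff)
  ultimately show "coordinates S (diffracted_map P h f) =
      (h \<circ> fst (coordinates R f), compose (carrier (residue_ring N)) h (snd (coordinates R f)))"
    by (simp only: coordinates_def fst_conv snd_conv)
qed

lemma diffracted_iso: "diffracted_iso_Ga_sharp TYPE('u) p P \<epsilon> (residue_ring N)"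
  unfolding diffracted_iso_Ga_sharp_def
proof (rule exI[of _ coordinates], intro allI impI conjI ballI)
  fix R :: "'u ring" assume R: "p_nilpotent_ring p R"
  show "discrete_equiv (diffracted p P R) (Ga_sharp R \<times> rhom (residue_ring N) R) (coordinates R)"
    by (rule coordinates_equiv[OF R])
  fix f assume f: "f \<in> cells (diffracted p P R) 0"
  show "diffracted_over P \<epsilon> (residue_ring N) R f (snd (coordinates R f))"
    using coordinates_over[OF R f] by simp
  fix Sh assume "Sh \<in> algebras p R"
  then show "case Sh of (S, h) \<Rightarrow> coordinates S (diffracted_map P h f) =
      (h \<circ> fst (coordinates R f), compose (carrier (residue_ring N)) h (snd (coordinates R f)))"
    using diffracted_map_natural(2)[OF R _ f] by (cases Sh) simp
qed

text \<open>Any representative will do, since the coordinates are constant on connected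
  components.\<close>

definition pi0_coordinates :: "'u ring \<Rightarrow> ('u, 'b) diffracted_point set \<Rightarrow> (nat \<Rightarrow> 'u) \<times> (int \<Rightarrow> 'u)" where
  "pi0_coordinates R c = coordinates R (SOME f. f \<in> c)"

text \<open>The actions are matched by \<open>solutions_act\<close>, whence the case distinction on
  \<open>n\<close> in the target. Compatibility with change of rings reduces to the naturality of
  \<open>dp_of\<close> and of the base point.\<close>

lemma gspace_iso_diffracted:
  "gspace_iso p
     (diffracted_gspace p P \<epsilon> (residue_ring N) ::
        ('u, nat \<Rightarrow> 'u, ('u, 'b) diffracted_point set, int) gspace)
     (Ga_sharp_gspace (if n = 1 then dp_translated_scaling else dp_scaling) (residue_ring N))
     (\<lambda>R. witt_nilp.unit_dp R p) pi0_coordinates"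
proof
  fix S :: "'u ring" assume S: "p_nilpotent_ring p S"
  interpret S: witt_nilp S p by (rule witt_nilp[OF S])
  let ?Y = "diffracted_gspace p P \<epsilon> (residue_ring N) ::
        ('u, nat \<Rightarrow> 'u, ('u, 'b) diffracted_point set, int) gspace"
  let ?act = "if n = 1 then dp_translated_scaling else dp_scaling :: 'u ring \<Rightarrow> (nat \<Rightarrow> 'u) \<Rightarrow> (nat \<Rightarrow> 'u) \<Rightarrow> (nat \<Rightarrow> 'u)"
  let ?Y' = "Ga_sharp_gspace ?act (residue_ring N)"
  let ?D = "\<lambda>S :: 'u ring. diffracted p P S"
  have Y: "grp ?Y = witt_units_F p" "gmap ?Y = (\<lambda>R S h u. h \<circ> u)" "pts ?Y T = pi0 (?D T)"
    "grp ?Y' = Gm_sharp" "gmap ?Y' = (\<lambda>R S h u. h \<circ> u)" "pts ?Y' T = Ga_sharp T \<times> rhom (residue_ring N) T" for T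
    by (simp_all add: diffracted_gspace_def Ga_sharp_gspace_def)
  note eq = coordinates_equiv[OF S] and faces = diffracted_faces[OF S]
  have pc: "pi0_coordinates S (pi0_class (?D S) x) = coordinates S x" if "x \<in> cells (?D S) 0" for x
    unfolding pi0_coordinates_def by (rule pi0_bij(1)[OF eq faces that])
  show "bij_betw (S.unit_dp) (carrier (grp ?Y S)) (carrier (grp ?Y' S))"
    unfolding Y by (rule S.unit_dp_bij)
  have one: "\<one>\<^bsub>S.W\<^esub> \<in> Units S.W" "S.F \<one>\<^bsub>S.W\<^esub> = \<one>\<^bsub>S.W\<^esub>"
    by (simp_all del: witt_ring_simps)
  have w1: "\<one>\<^bsub>witt_units_F p S\<^esub> = \<one>\<^bsub>S.W\<^esub>"
    by (simp add: witt_units_F_def)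
  show "\<one>\<^bsub>grp ?Y S\<^esub> \<in> carrier (grp ?Y S) \<and> S.unit_dp \<one>\<^bsub>grp ?Y S\<^esub> = \<one>\<^bsub>grp ?Y' S\<^esub>"
    unfolding Y w1 S.witt_units_F_carrier S.unit_dp_one using one by (simp add: Gm_sharp_def)
  show "g \<otimes>\<^bsub>grp ?Y S\<^esub> g' \<in> carrier (grp ?Y S) \<and>
      S.unit_dp (g \<otimes>\<^bsub>grp ?Y S\<^esub> g') = S.unit_dp g \<otimes>\<^bsub>grp ?Y' S\<^esub> S.unit_dp g'"
    if "g \<in> carrier (grp ?Y S)" "g' \<in> carrier (grp ?Y S)" for g g'
  proof -
    have "g \<otimes>\<^bsub>witt_units_F p S\<^esub> g' = g \<otimes>\<^bsub>S.W\<^esub> g'"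
      by (simp add: witt_units_F_def)
    then show ?thesis
      using S.witt_units_F_mult[of g g'] S.unit_dp_mult[of g g'] that unfolding Y by (simp add: Gm_sharp_def)
  qed
  show "bij_betw (pi0_coordinates S) (pts ?Y S) (pts ?Y' S)"
    unfolding Y pi0_coordinates_def[abs_def] by (rule pi0_bij(2)[OF eq faces])
  show "pact ?Y S g y \<in> pts ?Y S \<and> pi0_coordinates S (pact ?Y S g y) = pact ?Y' S (S.unit_dp g) (pi0_coordinates S y)"
    if g: "g \<in> carrier (grp ?Y S)" and y: "y \<in> pts ?Y S" for g y
  proof -
    have g': "g \<in> carrier (witt_units_F p S)" using g by (simp only: Y)
    obtain f where f: "f \<in> cells (?D S) 0" "y = pi0_class (?D S) f"
      using y unfolding Y pi0_def by blast
    let ?m = "postcomp P (derived_quotient_scale S.W g)"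
    have m: "?m f \<in> cells (?D S) 0" if "f \<in> cells (?D S) 0" for f
      by (rule act_cell(1)[OF S g' that])
    have "pact ?Y S g y = pi0_class (?D S) (?m f)"
      unfolding diffracted_gspace_def gspace.simps f(2)
      by (rule pi0_class_UN[OF eq f(1) faces eq faces m, where G = "\<lambda>(a, s). (?act S (S.unit_dp g) a, s)"])
        (simp_all add: coordinates_act[OF S g'] case_prod_beta)
    moreover have "pact ?Y' S (S.unit_dp g) z = (?act S (S.unit_dp g) (fst z), snd z)" for z
      by (simp only: Ga_sharp_gspace_def gspace.simps case_prod_beta)
    ultimately show ?thesis
      using m[OF f(1)] by (simp only: Y f(2) pc[OF f(1)] pc[OF m[OF f(1)]] coordinates_act[OF S g' f(1)] pi0_def)
        blast
  qed
  show "pover ?Y S y s \<longleftrightarrow> pover ?Y' S (pi0_coordinates S y) s" if y: "y \<in> pts ?Y S" for y s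
  proof -
    obtain f where f: "f \<in> cells (?D S) 0" "y = pi0_class (?D S) f"
      using y unfolding Y pi0_def by blast
    have "y = {f' \<in> cells (?D S) 0. coordinates S f' = coordinates S f}"
      unfolding f(2) by (rule pi0_class_eq[OF eq f(1) faces])
    then have "(\<forall>f'\<in>y. diffracted_over P \<epsilon> (residue_ring N) S f' s) \<longleftrightarrow> s = snd (coordinates S f)"
      using coordinates_over[OF S, of _ s] f(1) by auto
    then show ?thesis
      using f by (auto simp: diffracted_gspace_def Ga_sharp_gspace_def pc case_prod_beta)
  qed
  fix S' k assume k: "(S', k) \<in> algebras p S"
  then have S': "p_nilpotent_ring p S'" and kh: "k \<in> ring_hom S S'"
    by (auto simp: algebras_def rhom_def)
  interpret S': witt_nilp S' p by (rule witt_nilp[OF S'])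
  note homs = kh S.cring_axioms S'.cring_axioms
  have Wh: "(\<circ>) k \<in> ring_hom S.W S'.W"
    by (rule witt_hom[OF homs prime])
  show "gmap ?Y S S' k g \<in> carrier (grp ?Y S') \<and> S'.unit_dp (gmap ?Y S S' k g) = gmap ?Y' S S' k (S.unit_dp g)"
    if "g \<in> carrier (grp ?Y S)" for g
  proof -
    have g: "g \<in> carrier (witt_units_F p S)" using that by (simp only: Y)
    note kk = S.witt_units_F_kernel[OF g]
    have u: "g \<in> Units S.W" "S.F g = \<one>\<^bsub>S.W\<^esub>" using g by (simp_all only: S.witt_units_F_carrier)
    have gi: "inv\<^bsub>S.W\<^esub> g \<in> carrier S.W" "g \<otimes>\<^bsub>S.W\<^esub> inv\<^bsub>S.W\<^esub> g = \<one>\<^bsub>S.W\<^esub>"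
      using u(1) by (simp_all del: witt_ring_simps)
    have "(k \<circ> g) \<otimes>\<^bsub>S'.W\<^esub> (k \<circ> inv\<^bsub>S.W\<^esub> g) = \<one>\<^bsub>S'.W\<^esub>"
      using ring_hom_mult[OF Wh kk(3) gi(1)] ring_hom_one[OF Wh] gi(2) by simp
    then have "k \<circ> g \<in> Units S'.W"
      using ring_hom_closed[OF Wh kk(3)] ring_hom_closed[OF Wh gi(1)]
      by (auto simp: Units_def S'.W.m_comm simp del: witt_ring_simps intro!: bexI[of _ "k \<circ> inv\<^bsub>S.W\<^esub> g"])
    moreover have "S'.F (k \<circ> g) = \<one>\<^bsub>S'.W\<^esub>"
      using ring_hom_frobenius[OF homs, of g p] kk(3) u(2) ring_hom_one[OF Wh] by simp
    ultimately have mem: "k \<circ> g \<in> carrier (witt_units_F p S')"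
      by (simp only: S'.witt_units_F_carrier)
    have "(k \<circ> g) \<ominus>\<^bsub>S'.W\<^esub> \<one>\<^bsub>S'.W\<^esub> = k \<circ> (g \<ominus>\<^bsub>S.W\<^esub> \<one>\<^bsub>S.W\<^esub>)"
    proof -
      have "\<one>\<^bsub>S'.W\<^esub> \<oplus>\<^bsub>S'.W\<^esub> (k \<circ> (g \<ominus>\<^bsub>S.W\<^esub> \<one>\<^bsub>S.W\<^esub>)) = k \<circ> g"
        using ring_hom_add[OF Wh S.W.one_closed S.frobenius_kernelD(1)[OF kk(1)]] ring_hom_one[OF Wh] kk(2) by simp
      then show ?thesis
        using ring_hom_closed[OF Wh kk(3)] ring_hom_closed[OF Wh S.frobenius_kernelD(1)[OF kk(1)]]
          S'.W.minus_eq_iff[of "k \<circ> g" "\<one>\<^bsub>S'.W\<^esub>" "k \<circ> (g \<ominus>\<^bsub>S.W\<^esub> \<one>\<^bsub>S.W\<^esub>)"]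
        by (simp del: witt_ring_simps)
    qed
    then have "S'.unit_dp (k \<circ> g) = k \<circ> S.unit_dp g"
      using dp_of_natural[OF S.witt_nilp_axioms S'.witt_nilp_axioms kh, of "g \<ominus>\<^bsub>S.W\<^esub> \<one>\<^bsub>S.W\<^esub>"]
        S.frobenius_kernelD(2)[OF kk(1)]
      by (simp add: S.unit_dp_def S'.unit_dp_def del: witt_ring_simps)
    then show ?thesis
      using mem by (simp only: Y)
  qed
  show "pmap ?Y S S' k y \<in> pts ?Y S' \<and> pi0_coordinates S' (pmap ?Y S S' k y) = pmap ?Y' S S' k (pi0_coordinates S y)"
    if y: "y \<in> pts ?Y S" for y
  proof -
    note eq' = coordinates_equiv[OF S'] and faces' = diffracted_faces[OF S']
    obtain f where f: "f \<in> cells (?D S) 0" "y = pi0_class (?D S) f"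
      using y unfolding Y pi0_def by blast
    have m: "diffracted_map P k f \<in> cells (?D S') 0" if "f \<in> cells (?D S) 0" for f
      by (rule diffracted_map_natural(1)[OF S k that])
    have "pmap ?Y S S' k y = pi0_class (?D S') (diffracted_map P k f)"
      unfolding diffracted_gspace_def gspace.simps f(2)
      by (rule pi0_class_UN[OF eq f(1) faces eq' faces' m,
            where G = "\<lambda>(a, s). (k \<circ> a, compose (carrier (residue_ring N)) k s)"])
        (simp_all add: diffracted_map_natural(2)[OF S k] case_prod_beta)
    moreover have "pi0_coordinates S' (pi0_class (?D S') x) = coordinates S' x" if "x \<in> cells (?D S') 0" for x
      unfolding pi0_coordinates_def by (rule pi0_bij(1)[OF eq' faces' that])
    moreover have "pmap ?Y' S S' k z = (k \<circ> fst z, compose (carrier (residue_ring N)) k (snd z))" for z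
      by (simp only: Ga_sharp_gspace_def gspace.simps case_prod_beta)
    ultimately show ?thesis
      using m[OF f(1)] by (simp only: Y f(2) pc[OF f(1)] diffracted_map_natural(2)[OF S k f(1)] pi0_def) blast
  qed
qed

end

theorem corollary3p2p15:
  fixes p n :: nat and P :: "'b sring" and \<epsilon> :: "'b \<Rightarrow> int"
  assumes "Factorial_Ring.prime p" and "n \<ge> 1"
    and "free_resolution P \<epsilon> (residue_ring (int p ^ n))"
  shows "diffracted_iso_Ga_sharp TYPE('u) p P \<epsilon> (residue_ring (int p ^ n)) \<and>
    (n \<ge> 2 \<longrightarrow>
       stack_iso p
         (WCart_HT p P \<epsilon> (residue_ring (int p ^ n)) ::
            ('u, ('u, nat \<Rightarrow> 'u, ('u, 'b) diffracted_point set, 't) qobj, ('u, 't) qmor, int) stack)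
         (quotient_stack p (residue_ring (int p ^ n))
            (Ga_sharp_gspace dp_scaling (residue_ring (int p ^ n))) ::
            ('u, ('u, nat \<Rightarrow> 'u, (nat \<Rightarrow> 'u) \<times> (int \<Rightarrow> 'u), 't) qobj, ('u, 't) qmor, int) stack)) \<and>
    (n = 1 \<longrightarrow>
       stack_iso p
         (WCart_HT p P \<epsilon> (residue_ring (int p ^ n)) ::
            ('u, ('u, nat \<Rightarrow> 'u, ('u, 'b) diffracted_point set, 't) qobj, ('u, 't) qmor, int) stack)
         (quotient_stack p (residue_ring (int p ^ n))
            (Ga_sharp_gspace dp_translated_scaling (residue_ring (int p ^ n))) ::
            ('u, ('u, nat \<Rightarrow> 'u, (nat \<Rightarrow> 'u) \<times> (int \<Rightarrow> 'u), 't) qobj, ('u, 't) qmor, int) stack))"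
proof -
  have "int p ^ n > 1"
    using assms(1,2) prime_gt_1_nat by (simp add: one_less_power)
  then interpret diffracted_residue P \<epsilon> p n
    using assms by unfold_locales
  show ?thesis
    using diffracted_iso gspace_iso.stack_iso_quotient[OF gspace_iso_diffracted]
    unfolding WCart_HT_def by (cases "n = 1") auto
qed

end
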